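(* Let $(A,\{\Delta(\lambda)\}_{\lambda\in\Lambda})$ and $(A',\{\Delta'(\gamma)\}_{\gamma\in\Gamma})$ be two split quasi-hereditary algebras over a commutative Noetherian ring $R$. Then any exact equivalence $\Phi\colon \mathcal{F}(\tilde{\Delta})\to\mathcal{F}(\tilde{\Delta}')$ lifts to a Morita equivalence $F\colon A\text{-mod}\to A'\text{-mod}$, i.e. there is an equivalence of categories $F\colon A\text{-mod}\to A'\text{-mod}$ such that $F\circ \iota\cong \iota'\circ\Phi$, where $\iota\colon\mathcal{F}(\tilde{\Delta})\hookrightarrow A\text{-mod}$ and $\iota'\colon\mathcal{F}(\tilde{\Delta}')\hookrightarrow A'\text{-mod}$ are the inclusions. Moreover, $F$ is an equivalence of (split) highest weight categories.
   Context: Let $R$ be a commutative Noetherian ring with identity. A projective Noetherian $R$-algebra is an $R$-algebra that is finitely generated and projective as an $R$-module. $A\text{-mod}$ denotes finitely generated left $A$-modules, $A\text{-proj}$ (resp. $R\text{-proj}$) the finitely generated projective ones, $\operatorname{add}_A M$ the full subcategory of direct summands of finite direct sums of copies of $M$, and $\operatorname{Pic}(R)$ the group of invertible $R$-modules. For a set $\theta$ of $A$-modules, $\mathcal{F}(\theta)$ is the full subcategory of $A\text{-mod}$ of modules admitting a finite filtration with successive quotients (isomorphic to modules) in $\theta$. Split quasi-hereditary: a projective Noetherian $R$-algebra $A$ with a collection $\{\Delta(\lambda)\colon\lambda\in\Lambda\}$ of modules in $A\text{-mod}$ indexed by a finite poset $\Lambda$ is a split quasi-hereditary $R$-algebra,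 written $(A,\{\Delta(\lambda)\}_{\lambda\in\Lambda})$ (and $(A\text{-mod},\{\Delta(\lambda)\})$ is a split highest weight category), if: (i) each $\Delta(\lambda)$ is projective over $R$; (ii) $\operatorname{Hom}_A(\Delta(\lambda),\Delta(\mu))\neq0$ implies $\lambda\le\mu$; (iii) $\operatorname{End}_A(\Delta(\lambda))\simeq R$; (iv) for each $\lambda$ there is $P(\lambda)\in A\text{-proj}$ and an exact sequence $0\to C(\lambda)\to P(\lambda)\to\Delta(\lambda)\to0$ such that $C(\lambda)$ has a finite filtration by modules $\Delta(\mu)\otimes_R U_\mu$ with $U_\mu\in R\text{-proj}$, $\mu>\lambda$; (v) $\operatorname{add}_A(\bigoplus_{\lambda}P(\lambda))=A\text{-proj}$. The $\Delta(\lambda)$ are the standard modules, and $\tilde{\Delta}=\{\Delta(\lambda)\otimes_R U\colon\lambda\in\Lambda,\ U\in R\text{-proj}\}$; likewise $\tilde\Delta'$. An exact equivalence between such subcategories is an equivalence which, together with its quasi-inverse, is exact (preserves short exact sequences of modules all of whose terms lie in the subcategory). An equivalence $F\colon A\text{-mod}\to A'\text{-mod}$ is an equivalence of split highest weight categories (in the sense of Rouquier) if there are a bijection $\phi\colon\Lambda\to\Gamma$ and $U_\lambda\in\operatorname{Pic}(R)$ such that $F\Delta(\lambda)\simeq\Delta'(\phi(\lambda))\otimes_R U_\lambda$ for all $\lambda\in\Lambda$.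
   Formalization: The final claim, that F is an equivalence of split highest weight categories, is stated only for connected R (nonzero, no idempotents except 0 and 1); it fails e.g. over R = k×k. The existence of the lift F is stated for every commutative Noetherian R. *)

theory Defs
  imports "HOL-Algebra.Module" "HOL-Algebra.Ring_Divisibility" "HOL-Algebra.Generated_Groups"
    "HOL-Algebra.Free_Abelian_Groups"
begin

section \<open>Left modules\<close>

text \<open>
  Modules are the records of HOL-Algebra. The \<open>mult\<close> and \<open>one\<close> components of a module record
  carry no information: no notion below except the algebra structure of \<open>A\<close> itself looks at them.
\<close>

locale left_module = A?: ring A + M?: abelian_group M
  for A :: "('a, 'k) ring_scheme" (structure) and M :: "('a, 'm, 'j) module_scheme" (structure) +
  assumes smult_closed:
      "\<lbrakk> a \<in> carrier A; x \<in> carrier M \<rbrakk> \<Longrightarrow> a \<odot>\<^bsub>M\<^esub> x \<in> carrier M"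
    and smult_l_distr:
      "\<lbrakk> a \<in> carrier A; b \<in> carrier A; x \<in> carrier M \<rbrakk> \<Longrightarrow>
        (a \<oplus> b) \<odot>\<^bsub>M\<^esub> x = a \<odot>\<^bsub>M\<^esub> x \<oplus>\<^bsub>M\<^esub> b \<odot>\<^bsub>M\<^esub> x"
    and smult_r_distr:
      "\<lbrakk> a \<in> carrier A; x \<in> carrier M; y \<in> carrier M \<rbrakk> \<Longrightarrow>
        a \<odot>\<^bsub>M\<^esub> (x \<oplus>\<^bsub>M\<^esub> y) = a \<odot>\<^bsub>M\<^esub> x \<oplus>\<^bsub>M\<^esub> a \<odot>\<^bsub>M\<^esub> y"
    and smult_assoc1:
      "\<lbrakk> a \<in> carrier A; b \<in> carrier A; x \<in> carrier M \<rbrakk> \<Longrightarrow>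
        (a \<otimes> b) \<odot>\<^bsub>M\<^esub> x = a \<odot>\<^bsub>M\<^esub> (b \<odot>\<^bsub>M\<^esub> x)"
    and smult_one:
      "x \<in> carrier M \<Longrightarrow> \<one> \<odot>\<^bsub>M\<^esub> x = x"

lemma left_module_iff_module: "cring R \<Longrightarrow> left_module R M \<longleftrightarrow> module R M"
  by (auto simp: left_module_def module_def left_module_axioms_def module_axioms_def cring_def)

text \<open>Homomorphisms are extensional, so that equality of functions is equality of morphisms.\<close>

definition Hom ::
  "('a, 'k) ring_scheme \<Rightarrow> ('a, 'm) module \<Rightarrow> ('a, 'n) module \<Rightarrow> ('m \<Rightarrow> 'n) set" where
  "Hom A M N = {f \<in> carrier M \<rightarrow>\<^sub>E carrier N.
     (\<forall>x\<in>carrier M. \<forall>y\<in>carrier M. f (x \<oplus>\<^bsub>M\<^esub> y) = f x \<oplus>\<^bsub>N\<^esub> f y) \<and>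
     (\<forall>a\<in>carrier A. \<forall>x\<in>carrier M. f (a \<odot>\<^bsub>M\<^esub> x) = a \<odot>\<^bsub>N\<^esub> f x)}"

definition Iso ::
  "('a, 'k) ring_scheme \<Rightarrow> ('a, 'm) module \<Rightarrow> ('a, 'n) module \<Rightarrow> ('m \<Rightarrow> 'n) set" where
  "Iso A M N = {f \<in> Hom A M N. bij_betw f (carrier M) (carrier N)}"

definition isomorphic ::
  "('a, 'k) ring_scheme \<Rightarrow> ('a, 'm) module \<Rightarrow> ('a, 'n) module \<Rightarrow> bool" where
  "isomorphic A M N \<longleftrightarrow> Iso A M N \<noteq> {}"

definition short_exact ::
  "('a, 'k) ring_scheme \<Rightarrow> ('a, 'l) module \<Rightarrow> ('l \<Rightarrow> 'm) \<Rightarrow> ('a, 'm) module \<Rightarrow> ('m \<Rightarrow> 'n)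
    \<Rightarrow> ('a, 'n) module \<Rightarrow> bool" where
  "short_exact A L f M g N \<longleftrightarrow> f \<in> Hom A L M \<and> g \<in> Hom A M N \<and>
     inj_on f (carrier L) \<and> f ` carrier L = a_kernel M N g \<and> g ` carrier M = carrier N"

definition finitely_generated :: "('a, 'k) ring_scheme \<Rightarrow> ('a, 'm) module \<Rightarrow> bool" where
  "finitely_generated A M \<longleftrightarrow> (\<exists>S. finite S \<and> S \<subseteq> carrier M \<and>
     carrier M = {\<Oplus>\<^bsub>M\<^esub>s\<in>S. c s \<odot>\<^bsub>M\<^esub> s | c. c \<in> S \<rightarrow> carrier A})"

text \<open>
  The lifting property against epimorphisms. HOL cannot quantify over types, so the types of the
  test modules are fixed. They lose nothing: \<open>L = P\<close> is admissible, and the free module on the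
  set \<open>carrier P\<close> lives on the finitely supported functions in \<open>'m \<Rightarrow> 'a\<close>.
\<close>

definition projective :: "('a, 'k) ring_scheme \<Rightarrow> ('a, 'm) module \<Rightarrow> bool" where
  "projective A P \<longleftrightarrow> left_module A P \<and>
     (\<forall>(N :: ('a, 'm \<Rightarrow> 'a) module) (L :: ('a, 'm) module).
        left_module A N \<and> left_module A L \<longrightarrow>
        (\<forall>g\<in>Hom A N L. \<forall>f\<in>Hom A P L. g ` carrier N = carrier L \<longrightarrow>
           (\<exists>h\<in>Hom A P N. compose (carrier P) g h = f)))"

definition fg_modules :: "('a, 'k) ring_scheme \<Rightarrow> ('a, 'm) module set" where
  "fg_modules A = {M. left_module A M \<and> finitely_generated A M}"

definition fg_projectives :: "('a, 'k) ring_scheme \<Rightarrow> ('a, 'm) module set" where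
  "fg_projectives A = {M \<in> fg_modules A. projective A M}"

definition dsum :: "'i set \<Rightarrow> ('i \<Rightarrow> ('a, 'm) module) \<Rightarrow> ('a, 'i \<Rightarrow> 'm) module" where
  "dsum I M = \<lparr>carrier = (\<Pi>\<^sub>E i\<in>I. carrier (M i)), monoid.mult = undefined, monoid.one = undefined,
     ring.zero = (\<lambda>i\<in>I. \<zero>\<^bsub>M i\<^esub>), ring.add = (\<lambda>x y. \<lambda>i\<in>I. x i \<oplus>\<^bsub>M i\<^esub> y i),
     smult = (\<lambda>a x. \<lambda>i\<in>I. a \<odot>\<^bsub>M i\<^esub> x i)\<rparr>"

definition direct_summand ::
  "('a, 'k) ring_scheme \<Rightarrow> ('a, 'n) module \<Rightarrow> ('a, 'm) module \<Rightarrow> bool" where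
  "direct_summand A N M \<longleftrightarrow> (\<exists>H K. submodule H A M \<and> submodule K A M \<and>
     H <+>\<^bsub>M\<^esub> K = carrier M \<and> H \<inter> K = {\<zero>\<^bsub>M\<^esub>} \<and> isomorphic A N (M\<lparr>carrier := H\<rparr>))"

definition add_closure ::
  "('a, 'k) ring_scheme \<Rightarrow> ('a, 'x) module \<Rightarrow> ('a, 'm) module set" where
  "add_closure A L =
     {N \<in> fg_modules A. \<exists>n::nat. direct_summand A N (dsum {..<n} (\<lambda>_. L))}"

definition quot :: "('a, 'm) module \<Rightarrow> 'm set \<Rightarrow> ('a, 'm set) module" where
  "quot M H = \<lparr>carrier = a_rcosets\<^bsub>M\<^esub> H, monoid.mult = undefined, monoid.one = undefined,
     ring.zero = H, ring.add = set_add M, smult = (\<lambda>a C. \<Union>x\<in>C. H +>\<^bsub>M\<^esub> (a \<odot>\<^bsub>M\<^esub> x))\<rparr>"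

text \<open>\<open>\<F>(\<theta>)\<close>\<close>

definition filtered ::
  "('a, 'k) ring_scheme \<Rightarrow> ('a, 't) module set \<Rightarrow> ('a, 'm) module \<Rightarrow> bool" where
  "filtered A \<theta> M \<longleftrightarrow> (\<exists>(n::nat) H.
     H 0 = {\<zero>\<^bsub>M\<^esub>} \<and> H n = carrier M \<and> (\<forall>i\<le>n. submodule (H i) A M) \<and>
     (\<forall>i<n. H i \<subseteq> H (Suc i) \<and>
        (\<exists>L\<in>\<theta>. isomorphic A (quot (M\<lparr>carrier := H (Suc i)\<rparr>) (H i)) L)))"

definition Filt ::
  "('a, 'k) ring_scheme \<Rightarrow> ('a, 't) module set \<Rightarrow> ('a, 'm) module set" where
  "Filt A \<theta> = {M \<in> fg_modules A. filtered A \<theta> M}"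


section \<open>Algebras over a commutative ring\<close>

text \<open>The locale \<open>algebra\<close> of HOL-Algebra is about commutative algebras only.\<close>

locale assoc_algebra = ring A + module R A
  for R :: "('r, 'k) ring_scheme" and A :: "('r, 'a, 'j) module_scheme" +
  assumes smult_mult_l:
      "\<lbrakk> r \<in> carrier R; x \<in> carrier A; y \<in> carrier A \<rbrakk> \<Longrightarrow>
        (r \<odot>\<^bsub>A\<^esub> x) \<otimes>\<^bsub>A\<^esub> y = r \<odot>\<^bsub>A\<^esub> (x \<otimes>\<^bsub>A\<^esub> y)"
    and smult_mult_r:
      "\<lbrakk> r \<in> carrier R; x \<in> carrier A; y \<in> carrier A \<rbrakk> \<Longrightarrow>
        x \<otimes>\<^bsub>A\<^esub> (r \<odot>\<^bsub>A\<^esub> y) = r \<odot>\<^bsub>A\<^esub> (x \<otimes>\<^bsub>A\<^esub> y)"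

definition projective_Noetherian_algebra ::
  "('r, 'k) ring_scheme \<Rightarrow> ('r, 'a) module \<Rightarrow> bool" where
  "projective_Noetherian_algebra R A \<longleftrightarrow>
     assoc_algebra R A \<and> finitely_generated R A \<and> projective R A"

definition self_algebra :: "('r, 'k) ring_scheme \<Rightarrow> ('r, 'r) module" where
  "self_algebra R = \<lparr>carrier = carrier R, monoid.mult = monoid.mult R, monoid.one = monoid.one R,
     ring.zero = ring.zero R, ring.add = ring.add R, smult = monoid.mult R\<rparr>"

definition algebra_isomorphic ::
  "('r, 'k) ring_scheme \<Rightarrow> ('r, 'a) module \<Rightarrow> ('r, 'b) module \<Rightarrow> bool" where
  "algebra_isomorphic R A B \<longleftrightarrow> (\<exists>h\<in>ring_iso A B.
     \<forall>r\<in>carrier R. \<forall>x\<in>carrier A. h (r \<odot>\<^bsub>A\<^esub> x) = r \<odot>\<^bsub>B\<^esub> h x)"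

definition restrict_scalars ::
  "('r, 'a) module \<Rightarrow> ('a, 'm) module \<Rightarrow> ('r, 'm) module" where
  "restrict_scalars A M = \<lparr>carrier = carrier M, monoid.mult = monoid.mult M, monoid.one = monoid.one M,
     ring.zero = ring.zero M, ring.add = ring.add M, smult = (\<lambda>r x. (r \<odot>\<^bsub>A\<^esub> \<one>\<^bsub>A\<^esub>) \<odot>\<^bsub>M\<^esub> x)\<rparr>"

definition End_algebra :: "('r, 'a) module \<Rightarrow> ('a, 'm) module \<Rightarrow> ('r, 'm \<Rightarrow> 'm) module" where
  "End_algebra A M = \<lparr>carrier = Hom A M M,
     monoid.mult = compose (carrier M), monoid.one = (\<lambda>x\<in>carrier M. x),
     ring.zero = (\<lambda>x\<in>carrier M. \<zero>\<^bsub>M\<^esub>), ring.add = (\<lambda>f g. \<lambda>x\<in>carrier M. f x \<oplus>\<^bsub>M\<^esub> g x),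
     smult = (\<lambda>r f. \<lambda>x\<in>carrier M. r \<odot>\<^bsub>restrict_scalars A M\<^esub> f x)\<rparr>"

text \<open>
  \<open>M \<otimes>\<^sub>R U\<close> for an \<open>A\<close>-module \<open>M\<close> and an \<open>R\<close>-module \<open>U\<close>: the free abelian group on
  \<open>carrier M \<times> carrier U\<close>, on which \<open>a\<close> acts by \<open>(m, u) \<mapsto> (a m, u)\<close>, modulo the
  biadditivity and \<open>R\<close>-balancedness relations. The group before passing to the quotient is not
  yet a module, only a record of the right shape for \<open>quot\<close>.
\<close>

definition pre_tensor ::
  "('a, 'm) module \<Rightarrow> ('r, 'u) module \<Rightarrow> ('a, ('m \<times> 'u) \<Rightarrow>\<^sub>0 int) module" where
  "pre_tensor M U = \<lparr>carrier = carrier (free_Abelian_group (carrier M \<times> carrier U)),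
     monoid.mult = undefined, monoid.one = undefined, ring.zero = 0, ring.add = (+),
     smult = (\<lambda>a. frag_extend (\<lambda>(m, u). frag_of (a \<odot>\<^bsub>M\<^esub> m, u)))\<rparr>"

definition tensor_relations ::
  "('r, 'k) ring_scheme \<Rightarrow> ('r, 'a) module \<Rightarrow> ('a, 'm) module \<Rightarrow> ('r, 'u) module
    \<Rightarrow> (('m \<times> 'u) \<Rightarrow>\<^sub>0 int) set" where
  "tensor_relations R A M U =
     {frag_of (m \<oplus>\<^bsub>M\<^esub> m', u) - frag_of (m, u) - frag_of (m', u) | m m' u.
        m \<in> carrier M \<and> m' \<in> carrier M \<and> u \<in> carrier U} \<union>
     {frag_of (m, u \<oplus>\<^bsub>U\<^esub> u') - frag_of (m, u) - frag_of (m, u') | m u u'.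
        m \<in> carrier M \<and> u \<in> carrier U \<and> u' \<in> carrier U} \<union>
     {frag_of (r \<odot>\<^bsub>restrict_scalars A M\<^esub> m, u) - frag_of (m, r \<odot>\<^bsub>U\<^esub> u) | r m u.
        r \<in> carrier R \<and> m \<in> carrier M \<and> u \<in> carrier U}"

definition tensor ::
  "('r, 'k) ring_scheme \<Rightarrow> ('r, 'a) module \<Rightarrow> ('a, 'm) module \<Rightarrow> ('r, 'u) module
    \<Rightarrow> ('a, (('m \<times> 'u) \<Rightarrow>\<^sub>0 int) set) module" where
  "tensor R A M U = quot (pre_tensor M U)
     (generate (free_Abelian_group (carrier M \<times> carrier U)) (tensor_relations R A M U))"

text \<open>
  \<open>R-proj\<close> and \<open>Pic(R)\<close> enter only up to isomorphism. A finitely generated projective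
  \<open>R\<close>-module is isomorphic to a submodule of some \<open>R\<^sup>n\<close>, so the type \<open>nat \<Rightarrow> 'r\<close> is large
  enough to hold a representative of every isomorphism class.
\<close>

definition R_proj :: "('r, 'k) ring_scheme \<Rightarrow> ('r, nat \<Rightarrow> 'r) module set" where
  "R_proj R = fg_projectives R"

definition Pic :: "('r, 'k) ring_scheme \<Rightarrow> ('r, nat \<Rightarrow> 'r) module set" where
  "Pic R = {U. left_module R U \<and>
     (\<exists>V :: ('r, nat \<Rightarrow> 'r) module. left_module R V \<and>
        isomorphic R (tensor R (self_algebra R) U V) (self_algebra R))}"

text \<open>
  Without connectedness an exact equivalence need not preserve standard modules up to \<open>Pic(R)\<close>.
  Take \<open>R = k \<times> k\<close> for a field \<open>k\<close>, \<open>A = R \<times> R\<close> and the two factors as standard modules, indexed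
  by an antichain. Interchanging the two blocks of \<open>A\<close> over the second factor of \<open>R\<close> only is an exact
  (even \<open>R\<close>-linear) autoequivalence, and it sends \<open>\<Delta>(1)\<close> to no \<open>\<Delta>(i) \<otimes>\<^sub>R U\<close>. Over the zero ring
  all standard modules vanish and the index sets need not even be in bijection.
\<close>

definition connected_ring :: "('r, 'k) ring_scheme \<Rightarrow> bool" where
  "connected_ring R \<longleftrightarrow> \<one>\<^bsub>R\<^esub> \<noteq> \<zero>\<^bsub>R\<^esub> \<and>
     (\<forall>e\<in>carrier R. e \<otimes>\<^bsub>R\<^esub> e = e \<longrightarrow> e = \<zero>\<^bsub>R\<^esub> \<or> e = \<one>\<^bsub>R\<^esub>)"


section \<open>Split quasi-hereditary algebras\<close>

definition Delta_tilde ::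
  "('r, 'k) ring_scheme \<Rightarrow> ('r, 'a) module \<Rightarrow> 'l set \<Rightarrow> ('l \<Rightarrow> ('a, 'm) module)
    \<Rightarrow> ('a, (('m \<times> (nat \<Rightarrow> 'r)) \<Rightarrow>\<^sub>0 int) set) module set" where
  "Delta_tilde R A \<Lambda> \<Delta> = {tensor R A (\<Delta> l) U | l U. l \<in> \<Lambda> \<and> U \<in> R_proj R}"

definition split_quasi_hereditary ::
  "('r, 'k) ring_scheme \<Rightarrow> ('r, 'a) module \<Rightarrow> ('l::order) set \<Rightarrow> ('l \<Rightarrow> ('a, 'm) module) \<Rightarrow> bool"
  where
  "split_quasi_hereditary R A \<Lambda> \<Delta> \<longleftrightarrow>
     projective_Noetherian_algebra R A \<and> finite \<Lambda> \<and> (\<forall>l\<in>\<Lambda>. \<Delta> l \<in> fg_modules A) \<and>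
     (\<forall>l\<in>\<Lambda>. projective R (restrict_scalars A (\<Delta> l))) \<and>
     (\<forall>l\<in>\<Lambda>. \<forall>m\<in>\<Lambda>. Hom A (\<Delta> l) (\<Delta> m) \<noteq> {\<lambda>x\<in>carrier (\<Delta> l). \<zero>\<^bsub>\<Delta> m\<^esub>} \<longrightarrow> l \<le> m) \<and>
     (\<forall>l\<in>\<Lambda>. algebra_isomorphic R (End_algebra A (\<Delta> l)) (self_algebra R)) \<and>
     (\<exists>P :: 'l \<Rightarrow> ('a, 'm) module.
        (\<forall>l\<in>\<Lambda>. P l \<in> fg_projectives A \<and>
           (\<exists>(C :: ('a, 'm) module) f g. C \<in> fg_modules A \<and> short_exact A C f (P l) g (\<Delta> l) \<and>
              filtered A (Delta_tilde R A {m \<in> \<Lambda>. l < m} \<Delta>) C)) \<and>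
        add_closure A (dsum \<Lambda> P) = (fg_projectives A :: ('a, 'm) module set))"


section \<open>Functors between full subcategories of module categories\<close>

text \<open>
  A full subcategory is given by its set of objects. A functor acts on objects and, for each pair
  \<open>M\<close>, \<open>N\<close> of objects, on the morphisms from \<open>M\<close> to \<open>N\<close>; its values elsewhere are irrelevant.
\<close>

record ('a, 'm, 'b, 'n) mod_functor =
  fobj :: "('a, 'm) module \<Rightarrow> ('b, 'n) module"
  farr :: "('a, 'm) module \<Rightarrow> ('a, 'm) module \<Rightarrow> ('m \<Rightarrow> 'm) \<Rightarrow> ('n \<Rightarrow> 'n)"

definition is_functor ::
  "('a, 'k) ring_scheme \<Rightarrow> ('a, 'm) module set \<Rightarrow> ('b, 'j) ring_scheme \<Rightarrow> ('b, 'n) module set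
    \<Rightarrow> ('a, 'm, 'b, 'n) mod_functor \<Rightarrow> bool" where
  "is_functor A \<C> B \<D> F \<longleftrightarrow>
     (\<forall>M\<in>\<C>. fobj F M \<in> \<D>) \<and>
     (\<forall>M\<in>\<C>. \<forall>N\<in>\<C>. \<forall>f\<in>Hom A M N. farr F M N f \<in> Hom B (fobj F M) (fobj F N)) \<and>
     (\<forall>M\<in>\<C>. farr F M M (\<lambda>x\<in>carrier M. x) = (\<lambda>x\<in>carrier (fobj F M). x)) \<and>
     (\<forall>L\<in>\<C>. \<forall>M\<in>\<C>. \<forall>N\<in>\<C>. \<forall>f\<in>Hom A L M. \<forall>g\<in>Hom A M N.
        farr F L N (compose (carrier L) g f) =
        compose (carrier (fobj F L)) (farr F M N g) (farr F L M f))"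

definition incl :: "('a, 'm, 'a, 'm) mod_functor" where
  "incl = \<lparr>fobj = (\<lambda>M. M), farr = (\<lambda>M N f. f)\<rparr>"

definition functor_comp ::
  "('b, 'n, 'c, 'p) mod_functor \<Rightarrow> ('a, 'm, 'b, 'n) mod_functor \<Rightarrow> ('a, 'm, 'c, 'p) mod_functor"
  where
  "functor_comp G F = \<lparr>fobj = (\<lambda>M. fobj G (fobj F M)),
     farr = (\<lambda>M N f. farr G (fobj F M) (fobj F N) (farr F M N f))\<rparr>"

definition naturally_isomorphic ::
  "('a, 'k) ring_scheme \<Rightarrow> ('a, 'm) module set \<Rightarrow> ('b, 'j) ring_scheme
    \<Rightarrow> ('a, 'm, 'b, 'n) mod_functor \<Rightarrow> ('a, 'm, 'b, 'n) mod_functor \<Rightarrow> bool" where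
  "naturally_isomorphic A \<C> B F G \<longleftrightarrow> (\<exists>\<eta>.
     (\<forall>M\<in>\<C>. \<eta> M \<in> Iso B (fobj F M) (fobj G M)) \<and>
     (\<forall>M\<in>\<C>. \<forall>N\<in>\<C>. \<forall>f\<in>Hom A M N.
        compose (carrier (fobj F M)) (\<eta> N) (farr F M N f) =
        compose (carrier (fobj F M)) (farr G M N f) (\<eta> M)))"

text \<open>\<open>incl\<close> plays the role of the identity functor of \<open>\<C>\<close> and of \<open>\<D>\<close>.\<close>

definition quasi_inverse ::
  "('a, 'k) ring_scheme \<Rightarrow> ('a, 'm) module set \<Rightarrow> ('b, 'j) ring_scheme \<Rightarrow> ('b, 'n) module set
    \<Rightarrow> ('a, 'm, 'b, 'n) mod_functor \<Rightarrow> ('b, 'n, 'a, 'm) mod_functor \<Rightarrow> bool" where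
  "quasi_inverse A \<C> B \<D> F G \<longleftrightarrow> is_functor A \<C> B \<D> F \<and> is_functor B \<D> A \<C> G \<and>
     naturally_isomorphic A \<C> A (functor_comp G F) incl \<and> naturally_isomorphic B \<D> B (functor_comp F G) incl"

definition category_equivalence ::
  "('a, 'k) ring_scheme \<Rightarrow> ('a, 'm) module set \<Rightarrow> ('b, 'j) ring_scheme \<Rightarrow> ('b, 'n) module set
    \<Rightarrow> ('a, 'm, 'b, 'n) mod_functor \<Rightarrow> bool" where
  "category_equivalence A \<C> B \<D> F \<longleftrightarrow> (\<exists>G. quasi_inverse A \<C> B \<D> F G)"

definition exact_functor ::
  "('a, 'k) ring_scheme \<Rightarrow> ('a, 'm) module set \<Rightarrow> ('b, 'j) ring_scheme
    \<Rightarrow> ('a, 'm, 'b, 'n) mod_functor \<Rightarrow> bool" where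
  "exact_functor A \<C> B F \<longleftrightarrow> (\<forall>L\<in>\<C>. \<forall>M\<in>\<C>. \<forall>N\<in>\<C>. \<forall>f g. short_exact A L f M g N \<longrightarrow>
     short_exact B (fobj F L) (farr F L M f) (fobj F M) (farr F M N g) (fobj F N))"

definition exact_equivalence ::
  "('a, 'k) ring_scheme \<Rightarrow> ('a, 'm) module set \<Rightarrow> ('b, 'j) ring_scheme \<Rightarrow> ('b, 'n) module set
    \<Rightarrow> ('a, 'm, 'b, 'n) mod_functor \<Rightarrow> bool" where
  "exact_equivalence A \<C> B \<D> F \<longleftrightarrow>
     (\<exists>G. quasi_inverse A \<C> B \<D> F G \<and> exact_functor A \<C> B F \<and> exact_functor B \<D> A G)"

definition highest_weight_equivalence ::
  "('r, 'k) ring_scheme \<Rightarrow> ('r, 'a) module \<Rightarrow> 'l set \<Rightarrow> ('l \<Rightarrow> ('a, 'm) module)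
    \<Rightarrow> ('r, 'b) module \<Rightarrow> 'g set \<Rightarrow> ('g \<Rightarrow> ('b, 'n) module)
    \<Rightarrow> ('a, 'm, 'b, 'n) mod_functor \<Rightarrow> bool" where
  "highest_weight_equivalence R A \<Lambda> \<Delta> B \<Gamma> \<Delta>' F \<longleftrightarrow>
     category_equivalence A (fg_modules A) B (fg_modules B) F \<and>
     (\<exists>\<phi> U. bij_betw \<phi> \<Lambda> \<Gamma> \<and>
        (\<forall>l\<in>\<Lambda>. U l \<in> Pic R \<and> isomorphic B (fobj F (\<Delta> l)) (tensor R B (\<Delta>' (\<phi> l)) (U l))))"

text \<open>
  The type \<open>'m\<close> is a universe in which all finitely generated modules over a ring with elements in
  \<open>'a\<close> can be realised up to isomorphism: such a module is a quotient of some \<open>A\<^sup>n\<close>, and so has a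
  copy whose elements are cosets, i.e. sets of functions \<open>nat \<Rightarrow> 'a\<close>. Without such a condition
  \<open>fg_modules A :: ('a, 'm) module set\<close> could miss isomorphism classes.
\<close>

definition module_universe :: "'a itself \<Rightarrow> 'm itself \<Rightarrow> bool" where
  "module_universe (_ :: 'a itself) (_ :: 'm itself) \<longleftrightarrow>
     (\<exists>e :: (nat \<Rightarrow> 'a) set \<Rightarrow> 'm. inj e)"

end

theory Submission
  imports Defs
begin

text \<open>
  An exact equivalence sees only the exact category \<F>(\<Delta>~) of filtered modules. The proof recovers
  the module category from it because this exact category knows the projective modules: the axioms
  give a filtered projective generator (\<open>filtered_generator\<close>), and every filtered module has a cover
  by a filtered projective module with filtered kernel (\<open>filtered_cover\<close>, a horseshoe argument along
  the filtration). So an exact equivalence \<open>\<Phi>\<close> and its inverse \<open>\<Psi>\<close> preserve projectivity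
  (\<open>preserves_fgp\<close>).

  Take a filtered projective generator \<open>T\<close> of \<open>A'\<close>. It has the regular module as a retract, and the
  right multiplications of \<open>A'\<close> act on the corresponding summand \<open>X\<close> of \<open>\<Psi> T\<close>. This summand is a
  projective \<open>A\<close>-module with endomorphism ring \<open>A'\<close> (\<open>X_full\<close>, \<open>X_faithful\<close>), and it is a generator since
  \<open>\<Phi>\<close> preserves the projectivity of a filtered projective generator of \<open>A\<close> (\<open>X_generator\<close>). Hence
  \<open>Hom A X\<close> is a Morita equivalence (\<open>progenerator_context\<close>, \<open>represents_equivalence\<close>). For a filtered
  module \<open>M\<close>, homomorphisms from \<open>X\<close> to \<open>M\<close> correspond under \<open>\<Phi>\<close> to homomorphisms from the regular
  module to \<open>\<Phi> M\<close>, that is, to elements of \<open>\<Phi> M\<close> (\<open>extends_functor\<close>).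

  Now let \<open>R\<close> be connected. Since \<open>End(\<Delta>(l)) = R\<close> has no idempotents besides \<open>0\<close> and \<open>1\<close>, each nonzero
  epimorphism from \<open>\<Delta>(l)\<close> to a filtered module is injective (\<open>standard_quotient_injective\<close>). Applied to
  the image under \<open>\<Psi>\<close> of the top factor of \<open>\<Phi>(\<Delta>(l))\<close>, this shows that \<open>\<Phi>(\<Delta>(l))\<close> has only one factor,
  \<open>\<Delta>'(\<gamma>) \<otimes> U\<close> (\<open>standard_image\<close>). Its endomorphism ring is commutative, so \<open>U\<close> has rank one and is
  invertible (\<open>rank_one_Pic\<close>). The same holds for \<open>\<Psi>\<close>, and the order axioms make the two assignments of
  indices inverse to each other (\<open>standard_round_trip\<close>).

  Finitely generated projective \<open>R\<close>-modules \<open>U\<close> are handled through idempotent matrices \<open>E\<close>, which turn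
  \<open>\<Delta> \<otimes> U\<close> into the module \<open>Fix\<close> of the vectors over \<open>\<Delta>\<close> that \<open>E\<close> fixes (\<open>tensor_iso_Fix\<close>).
\<close>

section \<open>Modules, submodules and homomorphisms\<close>

text \<open>
  Sums over an initial segment of the naturals, by recursion on the length. In contrast to
  \<open>finsum\<close> no summand has to be known to lie in the carrier before the sum unfolds, and the sum
  does not depend on the carrier at all, so it is literally the same in a module and a submodule.
\<close>

fun msum :: "('m, 'k) ring_scheme \<Rightarrow> (nat \<Rightarrow> 'm) \<Rightarrow> nat \<Rightarrow> 'm" where
  "msum M f 0 = \<zero>\<^bsub>M\<^esub>"
| "msum M f (Suc n) = msum M f n \<oplus>\<^bsub>M\<^esub> f n"

lemma msum_cong: "(\<And>k. k < n \<Longrightarrow> f k = g k) \<Longrightarrow> msum M f n = msum M g n"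
  by (induction n) auto

context abelian_group begin

lemma msum_closed [intro, simp]:
  "(\<And>k. k < n \<Longrightarrow> f k \<in> carrier G) \<Longrightarrow> msum G f n \<in> carrier G"
  by (induction n) auto

lemma msum_zero: "(\<And>k. k < n \<Longrightarrow> f k = \<zero>) \<Longrightarrow> msum G f n = \<zero>"
  by (induction n) auto

lemma msum_add:
  "(\<And>k. k < n \<Longrightarrow> f k \<in> carrier G) \<Longrightarrow> (\<And>k. k < n \<Longrightarrow> g k \<in> carrier G) \<Longrightarrow>
     msum G (\<lambda>k. f k \<oplus> g k) n = msum G f n \<oplus> msum G g n"
  by (induction n) (auto simp: a_ac)

lemma msum_swap:
  assumes "\<And>i j. i < n \<Longrightarrow> j < m \<Longrightarrow> f i j \<in> carrier G"
  shows "msum G (\<lambda>i. msum G (f i) m) n = msum G (\<lambda>j. msum G (\<lambda>i. f i j) n) m"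
  using assms
proof (induction n)
  case 0
  then show ?case by (simp add: msum_zero)
next
  case (Suc n)
  then show ?case by (simp add: msum_add)
qed

lemma msum_append:
  assumes "\<And>k. k < n \<Longrightarrow> f k \<in> carrier G" "\<And>k. k < m \<Longrightarrow> g k \<in> carrier G"
  shows "msum G (\<lambda>k. if k < n then f k else g (k - n)) (n + m) = msum G f n \<oplus> msum G g m"
  using assms(2)
proof (induction m)
  case 0
  have "msum G (\<lambda>k. if k < n then f k else g (k - n)) n = msum G f n"
    by (rule msum_cong) auto
  then show ?case using assms(1) by simp
next
  case (Suc m)
  then show ?case using assms(1) by (simp add: a_assoc)
qed

lemma msum_delta:
  assumes "k < n" "x \<in> carrier G"
  shows "msum G (\<lambda>i. if i = k then x else \<zero>) n = x"
  using assms(1)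
proof (induction n)
  case 0
  then show ?case by simp
next
  case (Suc n)
  show ?case
  proof (cases "k = n")
    case True
    then have "msum G (\<lambda>i. if i = k then x else \<zero>) n = \<zero>" by (auto intro: msum_zero)
    then show ?thesis using True assms by simp
  next
    case False
    then show ?thesis using Suc assms by simp
  qed
qed

end

lemma finsum_eq_msum:
  assumes G: "abelian_group G" and s: "bij_betw s {..<n::nat} S"
    and f: "\<And>x. x \<in> S \<Longrightarrow> f x \<in> carrier G"
  shows "finsum G f S = msum G (\<lambda>k. f (s k)) n"
proof -
  interpret abelian_group G by fact
  have *: "s k \<in> S" if "k < n" for k using s that by (auto simp: bij_betw_def)
  have "finsum G f S = finsum G (\<lambda>k. f (s k)) {..<n}"
    using s f finsum_reindex[of f s "{..<n}"] by (auto simp: bij_betw_def)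
  also have "m \<le> n \<Longrightarrow> finsum G (\<lambda>k. f (s k)) {..<m} = msum G (\<lambda>k. f (s k)) m" for m
  proof (induction m)
    case 0 then show ?case by simp
  next
    case (Suc m)
    have "{..<Suc m} = insert m {..<m}" by auto
    moreover have "finsum G (\<lambda>k. f (s k)) (insert m {..<m}) =
        f (s m) \<oplus>\<^bsub>G\<^esub> finsum G (\<lambda>k. f (s k)) {..<m}"
      using Suc(2) * f by (intro finsum_insert) auto
    ultimately show ?case using Suc * f by (simp add: a_comm)
  qed
  finally show ?thesis by simp
qed

lemma additive_zero:
  assumes "abelian_group G" "abelian_group H" "\<And>x. x \<in> carrier G \<Longrightarrow> h x \<in> carrier H"
    "\<And>x y. x \<in> carrier G \<Longrightarrow> y \<in> carrier G \<Longrightarrow> h (x \<oplus>\<^bsub>G\<^esub> y) = h x \<oplus>\<^bsub>H\<^esub> h y"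
  shows "h \<zero>\<^bsub>G\<^esub> = \<zero>\<^bsub>H\<^esub>"
proof -
  interpret G: abelian_group G by fact
  interpret H: abelian_group H by fact
  have "h \<zero>\<^bsub>G\<^esub> \<oplus>\<^bsub>H\<^esub> h \<zero>\<^bsub>G\<^esub> = h \<zero>\<^bsub>G\<^esub> \<oplus>\<^bsub>H\<^esub> \<zero>\<^bsub>H\<^esub>"
    using assms(4)[of "\<zero>\<^bsub>G\<^esub>" "\<zero>\<^bsub>G\<^esub>"] assms(3) by simp
  then show ?thesis using assms(3) by (metis G.zero_closed H.add.l_cancel H.zero_closed)
qed

lemma additive_msum:
  assumes "abelian_group G" "abelian_group H" "\<And>x. x \<in> carrier G \<Longrightarrow> h x \<in> carrier H"
    "\<And>x y. x \<in> carrier G \<Longrightarrow> y \<in> carrier G \<Longrightarrow> h (x \<oplus>\<^bsub>G\<^esub> y) = h x \<oplus>\<^bsub>H\<^esub> h y"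
    "\<And>k. k < n \<Longrightarrow> f k \<in> carrier G"
  shows "h (msum G f n) = msum H (\<lambda>k. h (f k)) n"
proof -
  interpret G: abelian_group G by fact
  show ?thesis using assms(5)
    by (induction n) (simp_all add: additive_zero[OF assms(1-4)] assms(4))
qed

context left_module begin

lemma smult_zero_r [simp]: "a \<in> carrier A \<Longrightarrow> a \<odot>\<^bsub>M\<^esub> \<zero>\<^bsub>M\<^esub> = \<zero>\<^bsub>M\<^esub>"
  by (rule additive_zero[OF M.abelian_group_axioms M.abelian_group_axioms])
    (auto simp: smult_closed smult_r_distr)

lemma smult_zero_l [simp]: "x \<in> carrier M \<Longrightarrow> \<zero> \<odot>\<^bsub>M\<^esub> x = \<zero>\<^bsub>M\<^esub>"
  by (rule additive_zero[OF A.abelian_group_axioms M.abelian_group_axioms, of "\<lambda>a. a \<odot>\<^bsub>M\<^esub> x"])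
    (auto simp: smult_closed smult_l_distr)

lemma smult_minus_one: "x \<in> carrier M \<Longrightarrow> (\<ominus> \<one>) \<odot>\<^bsub>M\<^esub> x = \<ominus>\<^bsub>M\<^esub> x"
  using smult_l_distr[of "\<ominus> \<one>" \<one> x] A.l_neg[of \<one>]
  by (intro M.minus_equality[symmetric]) (auto simp: smult_closed smult_one)

lemma smult_minus_r: "a \<in> carrier A \<Longrightarrow> x \<in> carrier M \<Longrightarrow> a \<odot>\<^bsub>M\<^esub> (\<ominus>\<^bsub>M\<^esub> x) = \<ominus>\<^bsub>M\<^esub> (a \<odot>\<^bsub>M\<^esub> x)"
  by (rule M.minus_equality[symmetric]) (auto simp: smult_closed smult_r_distr[symmetric] M.l_neg)

lemma smult_msum_r:
  "a \<in> carrier A \<Longrightarrow> (\<And>k. k < n \<Longrightarrow> f k \<in> carrier M) \<Longrightarrow>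
     a \<odot>\<^bsub>M\<^esub> msum M f n = msum M (\<lambda>k. a \<odot>\<^bsub>M\<^esub> f k) n"
  by (rule additive_msum[OF M.abelian_group_axioms M.abelian_group_axioms])
    (auto simp: smult_closed smult_r_distr)

lemma smult_msum_l:
  "x \<in> carrier M \<Longrightarrow> (\<And>k. k < n \<Longrightarrow> f k \<in> carrier A) \<Longrightarrow>
     msum A f n \<odot>\<^bsub>M\<^esub> x = msum M (\<lambda>k. f k \<odot>\<^bsub>M\<^esub> x) n"
  by (rule additive_msum[OF A.abelian_group_axioms M.abelian_group_axioms, of "\<lambda>a. a \<odot>\<^bsub>M\<^esub> x"])
    (auto simp: smult_closed smult_l_distr)

lemma submodule_minus:
  assumes "H \<subseteq> carrier M" "\<zero>\<^bsub>M\<^esub> \<in> H" "\<And>x y. x \<in> H \<Longrightarrow> y \<in> H \<Longrightarrow> x \<oplus>\<^bsub>M\<^esub> y \<in> H"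
    "\<And>a x. a \<in> carrier A \<Longrightarrow> x \<in> H \<Longrightarrow> a \<odot>\<^bsub>M\<^esub> x \<in> H"
  shows "submodule H A M"
proof (intro submodule.intro subgroup.intro submodule_axioms.intro)
  fix x assume "x \<in> H"
  then have "(\<ominus> \<one>) \<odot>\<^bsub>M\<^esub> x \<in> H" using assms(4) by auto
  then show "inv\<^bsub>add_monoid M\<^esub> x \<in> H"
    using smult_minus_one[of x] assms(1) \<open>x \<in> H\<close> by (auto simp: a_inv_def)
qed (use assms in auto)

end

lemmas submoduleI = left_module.submodule_minus

lemma submoduleD:
  assumes "submodule H A M"
  shows "H \<subseteq> carrier M" "\<zero>\<^bsub>M\<^esub> \<in> H" "\<And>x y. x \<in> H \<Longrightarrow> y \<in> H \<Longrightarrow> x \<oplus>\<^bsub>M\<^esub> y \<in> H"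
    "\<And>a x. a \<in> carrier A \<Longrightarrow> x \<in> H \<Longrightarrow> a \<odot>\<^bsub>M\<^esub> x \<in> H" "\<And>x. x \<in> H \<Longrightarrow> \<ominus>\<^bsub>M\<^esub> x \<in> H"
proof -
  interpret submodule H A M by fact
  show "H \<subseteq> carrier M" "\<zero>\<^bsub>M\<^esub> \<in> H" "\<And>x y. x \<in> H \<Longrightarrow> y \<in> H \<Longrightarrow> x \<oplus>\<^bsub>M\<^esub> y \<in> H"
    "\<And>a x. a \<in> carrier A \<Longrightarrow> x \<in> H \<Longrightarrow> a \<odot>\<^bsub>M\<^esub> x \<in> H" "\<And>x. x \<in> H \<Longrightarrow> \<ominus>\<^bsub>M\<^esub> x \<in> H"
    using subset one_closed m_closed smult_closed m_inv_closed by (auto simp: a_inv_def)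
qed

lemma abelian_groupI':
  assumes "\<And>x y. x \<in> carrier M \<Longrightarrow> y \<in> carrier M \<Longrightarrow> x \<oplus>\<^bsub>M\<^esub> y \<in> carrier M"
    and "\<zero>\<^bsub>M\<^esub> \<in> carrier M"
    and "\<And>x y z. x \<in> carrier M \<Longrightarrow> y \<in> carrier M \<Longrightarrow> z \<in> carrier M \<Longrightarrow>
          (x \<oplus>\<^bsub>M\<^esub> y) \<oplus>\<^bsub>M\<^esub> z = x \<oplus>\<^bsub>M\<^esub> (y \<oplus>\<^bsub>M\<^esub> z)"
    and "\<And>x y. x \<in> carrier M \<Longrightarrow> y \<in> carrier M \<Longrightarrow> x \<oplus>\<^bsub>M\<^esub> y = y \<oplus>\<^bsub>M\<^esub> x"
    and "\<And>x. x \<in> carrier M \<Longrightarrow> \<zero>\<^bsub>M\<^esub> \<oplus>\<^bsub>M\<^esub> x = x"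
    and "\<And>x. x \<in> carrier M \<Longrightarrow> \<exists>y\<in>carrier M. y \<oplus>\<^bsub>M\<^esub> x = \<zero>\<^bsub>M\<^esub>"
  shows "abelian_group M"
  by (rule abelian_groupI) (use assms in auto)

text \<open>All that changes for a submodule is the carrier, so only closure has to be checked.\<close>

lemma left_module_submodule:
  assumes "left_module A M" "submodule H A M"
  shows "left_module A (M\<lparr>carrier := H\<rparr>)"
proof -
  interpret left_module A M by fact
  note H = submoduleD[OF assms(2)]
  have "abelian_group (M\<lparr>carrier := H\<rparr>)"
  proof (rule abelian_groupI')
    fix x assume "x \<in> carrier (M\<lparr>carrier := H\<rparr>)"
    then show "\<exists>y\<in>carrier (M\<lparr>carrier := H\<rparr>). y \<oplus>\<^bsub>M\<lparr>carrier := H\<rparr>\<^esub> x = \<zero>\<^bsub>M\<lparr>carrier := H\<rparr>\<^esub>"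
      using H by (intro bexI[of _ "\<ominus>\<^bsub>M\<^esub> x"]) (auto simp: M.l_neg subset_iff)
  qed (use H in \<open>auto simp: M.a_ac subset_iff\<close>)
  then show ?thesis
    using H smult_l_distr smult_r_distr smult_assoc1 smult_one
    by (auto simp: left_module_def left_module_axioms_def A.ring_axioms subset_iff)
qed

lemma submodule_of_submodule:
  assumes "left_module A M" "submodule H A M" "submodule K A (M\<lparr>carrier := H\<rparr>)"
  shows "submodule K A M"
  using submoduleD[OF assms(2)] submoduleD[OF assms(3)]
  by (intro submoduleI[OF assms(1)]) (auto simp: subset_iff)

lemma submodule_carrier: "left_module A M \<Longrightarrow> submodule (carrier M) A M"
proof -
  assume "left_module A M"
  then interpret left_module A M by simp
  show ?thesis by (rule submodule_minus) (auto simp: smult_closed)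
qed

lemma left_moduleD:
  assumes "left_module A M" shows "ring A" "abelian_group M"
  using assms by (auto simp: left_module_def)

lemma fg_modulesD: "M \<in> fg_modules A \<Longrightarrow> left_module A M" "M \<in> fg_modules A \<Longrightarrow> finitely_generated A M"
  by (auto simp: fg_modules_def)

lemma Hom_closed: "f \<in> Hom A M N \<Longrightarrow> x \<in> carrier M \<Longrightarrow> f x \<in> carrier N"
  by (auto simp: Hom_def)

lemma Hom_add: "f \<in> Hom A M N \<Longrightarrow> x \<in> carrier M \<Longrightarrow> y \<in> carrier M \<Longrightarrow> f (x \<oplus>\<^bsub>M\<^esub> y) = f x \<oplus>\<^bsub>N\<^esub> f y"
  by (auto simp: Hom_def)

lemma Hom_smult: "f \<in> Hom A M N \<Longrightarrow> a \<in> carrier A \<Longrightarrow> x \<in> carrier M \<Longrightarrow> f (a \<odot>\<^bsub>M\<^esub> x) = a \<odot>\<^bsub>N\<^esub> f x"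
  by (auto simp: Hom_def)

lemma Hom_extensional: "f \<in> Hom A M N \<Longrightarrow> f \<in> extensional (carrier M)"
  by (auto simp: Hom_def PiE_def)

lemma Hom_eqI:
  "f \<in> Hom A M N \<Longrightarrow> g \<in> Hom A M N' \<Longrightarrow> (\<And>x. x \<in> carrier M \<Longrightarrow> f x = g x) \<Longrightarrow> f = g"
  by (blast intro: extensionalityI Hom_extensional)

lemma Hom_restrictI:
  assumes "left_module A M" "\<And>x. x \<in> carrier M \<Longrightarrow> f x \<in> carrier N"
    "\<And>x y. x \<in> carrier M \<Longrightarrow> y \<in> carrier M \<Longrightarrow> f (x \<oplus>\<^bsub>M\<^esub> y) = f x \<oplus>\<^bsub>N\<^esub> f y"
    "\<And>a x. a \<in> carrier A \<Longrightarrow> x \<in> carrier M \<Longrightarrow> f (a \<odot>\<^bsub>M\<^esub> x) = a \<odot>\<^bsub>N\<^esub> f x"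
  shows "(\<lambda>x\<in>carrier M. f x) \<in> Hom A M N"
proof -
  interpret left_module A M by fact
  show ?thesis using assms(2-) by (auto simp: Hom_def smult_closed)
qed

lemma Hom_id: "left_module A M \<Longrightarrow> (\<lambda>x\<in>carrier M. x) \<in> Hom A M M"
  by (rule Hom_restrictI) auto

lemma Hom_incl:
  "left_module A M \<Longrightarrow> submodule H A M \<Longrightarrow> (\<lambda>x\<in>H. x) \<in> Hom A (M\<lparr>carrier := H\<rparr>) M"
  using Hom_restrictI[OF left_module_submodule, of A M H "\<lambda>x. x" M] submoduleD(1)[of H A M] by auto

lemma Hom_compose:
  assumes "left_module A L" "f \<in> Hom A L M" "g \<in> Hom A M N"
  shows "compose (carrier L) g f \<in> Hom A L N"
  unfolding compose_def
  by (rule Hom_restrictI[OF assms(1)])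
    (auto simp: Hom_closed[OF assms(2)] Hom_closed[OF assms(3)] Hom_add[OF assms(2)]
      Hom_add[OF assms(3)] Hom_smult[OF assms(2)] Hom_smult[OF assms(3)])

lemma compose_apply [simp]: "x \<in> C \<Longrightarrow> compose C g f x = g (f x)"
  by (simp add: compose_def)

lemma Hom_zero:
  assumes "left_module A M" "left_module A N" "f \<in> Hom A M N"
  shows "f \<zero>\<^bsub>M\<^esub> = \<zero>\<^bsub>N\<^esub>"
  using additive_zero[of M N f] left_moduleD[OF assms(1)] left_moduleD[OF assms(2)] assms(3)
  by (auto simp: Hom_closed Hom_add)

lemma Hom_msum:
  assumes "left_module A M" "left_module A N" "f \<in> Hom A M N" "\<And>k. k < n \<Longrightarrow> g k \<in> carrier M"
  shows "f (msum M g n) = msum N (\<lambda>k. f (g k)) n"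
  using additive_msum[of M N f n g] left_moduleD[OF assms(1)] left_moduleD[OF assms(2)] assms(3,4)
  by (auto simp: Hom_closed Hom_add)

lemma Hom_minus:
  assumes "left_module A M" "left_module A N" "f \<in> Hom A M N" "x \<in> carrier M"
  shows "f (\<ominus>\<^bsub>M\<^esub> x) = \<ominus>\<^bsub>N\<^esub> f x"
proof -
  interpret M: left_module A M by fact
  interpret N: left_module A N by fact
  have "f (\<ominus>\<^bsub>M\<^esub> x) \<oplus>\<^bsub>N\<^esub> f x = \<zero>\<^bsub>N\<^esub>"
    using assms(4) Hom_add[OF assms(3), of "\<ominus>\<^bsub>M\<^esub> x" x] Hom_zero[OF assms(1-3)] by (simp add: M.M.l_neg)
  then show ?thesis
    using assms(3,4) by (intro N.M.minus_equality[symmetric]) (auto intro: Hom_closed)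
qed

lemma Hom_diff_eq_zero:
  assumes "left_module A M" "left_module A N" "f \<in> Hom A M N" "x \<in> carrier M" "y \<in> carrier M"
  shows "f (x \<ominus>\<^bsub>M\<^esub> y) = f x \<ominus>\<^bsub>N\<^esub> f y"
proof -
  interpret M: left_module A M by fact
  show ?thesis using assms Hom_minus[OF assms(1-3)] by (simp add: a_minus_def Hom_add)
qed

lemma (in abelian_group) minus_eq_zero_iff:
  "x \<in> carrier G \<Longrightarrow> y \<in> carrier G \<Longrightarrow> x \<ominus> y = \<zero> \<longleftrightarrow> x = y"
  by (metis a_minus_def add.inv_closed minus_equality minus_minus r_neg)

lemma a_kernel_iff [simp]: "x \<in> a_kernel M N f \<longleftrightarrow> x \<in> carrier M \<and> f x = \<zero>\<^bsub>N\<^esub>"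
  by (simp add: a_kernel_def kernel_def)

lemma inj_on_iff_kernel:
  assumes "left_module A M" "left_module A N" "f \<in> Hom A M N"
  shows "inj_on f (carrier M) \<longleftrightarrow> (\<forall>x\<in>carrier M. f x = \<zero>\<^bsub>N\<^esub> \<longrightarrow> x = \<zero>\<^bsub>M\<^esub>)"
proof -
  interpret M: left_module A M by fact
  interpret N: left_module A N by fact
  show ?thesis
  proof safe
    fix x assume "inj_on f (carrier M)" "x \<in> carrier M" "f x = \<zero>\<^bsub>N\<^esub>"
    then show "x = \<zero>\<^bsub>M\<^esub>" using Hom_zero[OF assms] by (metis inj_onD M.M.zero_closed)
  next
    assume *: "\<forall>x\<in>carrier M. f x = \<zero>\<^bsub>N\<^esub> \<longrightarrow> x = \<zero>\<^bsub>M\<^esub>"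
    show "inj_on f (carrier M)"
    proof (rule inj_onI)
      fix x y assume xy: "x \<in> carrier M" "y \<in> carrier M" "f x = f y"
      then have "f (x \<ominus>\<^bsub>M\<^esub> y) = \<zero>\<^bsub>N\<^esub>"
        using Hom_diff_eq_zero[OF assms] N.M.minus_eq_zero_iff Hom_closed[OF assms(3)] by simp
      then show "x = y" using bspec[OF *, of "x \<ominus>\<^bsub>M\<^esub> y"] xy M.M.minus_eq_zero_iff[of x y] by simp
    qed
  qed
qed

lemma submodule_preimage:
  assumes "left_module A M" "left_module A N" "f \<in> Hom A M N" "submodule H A N"
  shows "submodule {x \<in> carrier M. f x \<in> H} A M"
proof -
  interpret M: left_module A M by fact
  show ?thesis
    using submoduleD[OF assms(4)] Hom_zero[OF assms(1-3)] assms(3)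
    by (intro M.submodule_minus) (auto simp: Hom_add Hom_smult M.smult_closed)
qed

lemma submodule_zero: "left_module A N \<Longrightarrow> submodule {\<zero>\<^bsub>N\<^esub>} A N"
proof -
  assume "left_module A N"
  then interpret left_module A N by simp
  show ?thesis by (rule submodule_minus) auto
qed

lemma submodule_kernel:
  assumes "left_module A M" "left_module A N" "f \<in> Hom A M N"
  shows "submodule (a_kernel M N f) A M"
proof -
  have "a_kernel M N f = {x \<in> carrier M. f x \<in> {\<zero>\<^bsub>N\<^esub>}}" by auto
  then show ?thesis using submodule_preimage[OF assms submodule_zero[OF assms(2)]] by simp
qed

lemma submodule_image:
  assumes "left_module A M" "left_module A N" "f \<in> Hom A M N" "submodule H A M"
  shows "submodule (f ` H) A N"
proof -
  interpret M: left_module A M by fact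
  interpret N: left_module A N by fact
  note H = submoduleD[OF assms(4)]
  show ?thesis
  proof (rule N.submodule_minus)
    show "f ` H \<subseteq> carrier N" using H assms(3) by (auto intro: Hom_closed)
    show "\<zero>\<^bsub>N\<^esub> \<in> f ` H" using Hom_zero[OF assms(1-3)] H by force
    show "x \<oplus>\<^bsub>N\<^esub> y \<in> f ` H" if "x \<in> f ` H" "y \<in> f ` H" for x y
      using that H(1,3) Hom_add[OF assms(3)] by (auto simp: subset_iff) (metis image_eqI)
    show "a \<odot>\<^bsub>N\<^esub> x \<in> f ` H" if "a \<in> carrier A" "x \<in> f ` H" for a x
      using that H(1,4) Hom_smult[OF assms(3)] by (auto simp: subset_iff) (metis image_eqI)
  qed
qed

lemma Hom_into_sub:
  assumes "left_module A M" "f \<in> Hom A M N" "\<And>x. x \<in> carrier M \<Longrightarrow> f x \<in> H"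
  shows "f \<in> Hom A M (N\<lparr>carrier := H\<rparr>)"
  using assms by (auto simp: Hom_def)

lemma Hom_from_sub_iff:
  "f \<in> Hom A M (N\<lparr>carrier := H\<rparr>) \<Longrightarrow> H \<subseteq> carrier N \<Longrightarrow> f \<in> Hom A M N"
  by (auto simp: Hom_def PiE_def)

lemma Hom_restrict_sub:
  assumes "left_module A M" "submodule H A M" "f \<in> Hom A M N"
  shows "restrict f H \<in> Hom A (M\<lparr>carrier := H\<rparr>) N"
  using Hom_restrictI[OF left_module_submodule[OF assms(1,2)], of f N] submoduleD(1)[OF assms(2)] assms(3)
  by (auto simp: Hom_closed Hom_add Hom_smult subset_iff)

lemma Hom_factor:
  assumes "left_module A M" "left_module A N" "left_module A L" "g \<in> Hom A M N" "h \<in> Hom A M L"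
    and surj: "g ` carrier M = carrier N"
    and ker: "\<And>x. x \<in> carrier M \<Longrightarrow> g x = \<zero>\<^bsub>N\<^esub> \<Longrightarrow> h x = \<zero>\<^bsub>L\<^esub>"
  obtains k where "k \<in> Hom A N L" "\<And>x. x \<in> carrier M \<Longrightarrow> k (g x) = h x"
proof -
  interpret M: left_module A M by fact
  interpret N: left_module A N by fact
  interpret L: left_module A L by fact
  define s where "s y = (SOME x. x \<in> carrier M \<and> g x = y)" for y
  have s: "s y \<in> carrier M" "g (s y) = y" if "y \<in> carrier N" for y
  proof -
    have "\<exists>x. x \<in> carrier M \<and> g x = y" using that surj by (metis imageE)
    from someI_ex[OF this] show "s y \<in> carrier M" "g (s y) = y" by (auto simp: s_def)
  qed
  have *: "h x = h x'" if "x \<in> carrier M" "x' \<in> carrier M" "g x = g x'" for x x'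
  proof -
    have "g (x \<ominus>\<^bsub>M\<^esub> x') = \<zero>\<^bsub>N\<^esub>"
      using that Hom_diff_eq_zero[OF assms(1,2,4)] N.M.minus_eq_zero_iff Hom_closed[OF assms(4)] by simp
    then have "h (x \<ominus>\<^bsub>M\<^esub> x') = \<zero>\<^bsub>L\<^esub>" using ker that by simp
    then show ?thesis
      using that Hom_diff_eq_zero[OF assms(1,3,5)] L.M.minus_eq_zero_iff Hom_closed[OF assms(5)] by simp
  qed
  have k: "(\<lambda>y\<in>carrier N. h (s y)) \<in> Hom A N L"
  proof (rule Hom_restrictI[OF assms(2)])
    fix x y assume xy: "x \<in> carrier N" "y \<in> carrier N"
    have "h (s (x \<oplus>\<^bsub>N\<^esub> y)) = h (s x \<oplus>\<^bsub>M\<^esub> s y)"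
      using xy s by (intro *) (auto simp: Hom_add[OF assms(4)])
    then show "h (s (x \<oplus>\<^bsub>N\<^esub> y)) = h (s x) \<oplus>\<^bsub>L\<^esub> h (s y)" using s xy by (simp add: Hom_add[OF assms(5)])
  next
    fix a x assume ax: "a \<in> carrier A" "x \<in> carrier N"
    have "h (s (a \<odot>\<^bsub>N\<^esub> x)) = h (a \<odot>\<^bsub>M\<^esub> s x)"
      using ax s by (intro *) (auto simp: Hom_smult[OF assms(4)] N.smult_closed M.smult_closed)
    then show "h (s (a \<odot>\<^bsub>N\<^esub> x)) = a \<odot>\<^bsub>L\<^esub> h (s x)" using s ax by (simp add: Hom_smult[OF assms(5)])
  qed (use s assms(5) in \<open>auto intro: Hom_closed\<close>)
  show thesis
    by (rule that[OF k]) (use s surj assms(4) in \<open>auto intro!: * simp: Hom_closed\<close>)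
qed

lemma IsoD:
  assumes "f \<in> Iso A M N"
  shows "f \<in> Hom A M N" "inj_on f (carrier M)" "f ` carrier M = carrier N"
  using assms by (auto simp: Iso_def bij_betw_def)

lemma IsoI: "f \<in> Hom A M N \<Longrightarrow> inj_on f (carrier M) \<Longrightarrow> f ` carrier M = carrier N \<Longrightarrow> f \<in> Iso A M N"
  by (auto simp: Iso_def bij_betw_def)

lemma Iso_inverse:
  assumes M: "left_module A M" and f: "f \<in> Iso A M N"
  obtains g where "g \<in> Iso A N M" "\<And>x. x \<in> carrier M \<Longrightarrow> g (f x) = x"
    "\<And>y. y \<in> carrier N \<Longrightarrow> f (g y) = y"
proof -
  interpret M: left_module A M by fact
  note f = IsoD[OF f]
  define g where "g = (\<lambda>y\<in>carrier N. the_inv_into (carrier M) f y)"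
  have gf: "g (f x) = x" if "x \<in> carrier M" for x
    using that f by (auto simp: g_def the_inv_into_f_f Hom_closed)
  have gc: "g y \<in> carrier M" and fg: "f (g y) = y" if y: "y \<in> carrier N" for y
  proof -
    obtain x where "x \<in> carrier M" "y = f x" using y f(3) by blast
    then show "g y \<in> carrier M" "f (g y) = y" using gf by simp_all
  qed
  have "g \<in> Hom A N M"
  proof -
    have "g (x \<oplus>\<^bsub>N\<^esub> y) = g x \<oplus>\<^bsub>M\<^esub> g y" if "x \<in> carrier N" "y \<in> carrier N" for x y
    proof -
      have "f (g x \<oplus>\<^bsub>M\<^esub> g y) = x \<oplus>\<^bsub>N\<^esub> y" using that by (simp add: Hom_add[OF f(1)] gc fg)
      then show ?thesis using gf[of "g x \<oplus>\<^bsub>M\<^esub> g y"] gc that by simp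
    qed
    moreover have "g (a \<odot>\<^bsub>N\<^esub> x) = a \<odot>\<^bsub>M\<^esub> g x" if "a \<in> carrier A" "x \<in> carrier N" for a x
    proof -
      have "f (a \<odot>\<^bsub>M\<^esub> g x) = a \<odot>\<^bsub>N\<^esub> x" using that by (simp add: Hom_smult[OF f(1)] gc fg)
      then show ?thesis using gf[of "a \<odot>\<^bsub>M\<^esub> g x"] gc that by (simp add: M.smult_closed)
    qed
    ultimately show ?thesis using gc by (auto simp: Hom_def g_def)
  qed
  moreover have "inj_on g (carrier N)" using fg by (metis inj_onI)
  moreover have "g ` carrier N = carrier M" using gf gc f(1) Hom_closed by (force simp: image_iff)
  ultimately have "g \<in> Iso A N M" by (rule IsoI)
  then show thesis by (rule that[OF _ gf fg])
qed

lemma Iso_inverse_ex: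
  assumes "left_module A M" "f \<in> Iso A M N"
  shows "\<exists>g. g \<in> Iso A N M \<and> (\<forall>x\<in>carrier M. g (f x) = x) \<and> (\<forall>y\<in>carrier N. f (g y) = y)"
  by (rule Iso_inverse[OF assms]) auto

lemma Iso_compose:
  assumes "left_module A L" "f \<in> Iso A L M" "g \<in> Iso A M N"
  shows "compose (carrier L) g f \<in> Iso A L N"
proof (rule IsoI)
  note f = IsoD[OF assms(2)] and g = IsoD[OF assms(3)]
  show "compose (carrier L) g f \<in> Hom A L N" using Hom_compose assms f g by blast
  show "inj_on (compose (carrier L) g f) (carrier L)"
    using f g by (auto simp: inj_on_def Hom_closed)
  show "compose (carrier L) g f ` carrier L = carrier N" using f g by (auto simp: image_image[symmetric] cong: image_cong)
qed

lemma isomorphic_sym: "left_module A M \<Longrightarrow> isomorphic A M N \<Longrightarrow> isomorphic A N M"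
  unfolding isomorphic_def by (metis Iso_inverse empty_iff equals0I)

lemma isomorphic_trans:
  "left_module A L \<Longrightarrow> isomorphic A L M \<Longrightarrow> isomorphic A M N \<Longrightarrow> isomorphic A L N"
  using Iso_compose by (fastforce simp: isomorphic_def)

text \<open>
  For images and extensions it is convenient that finite generation speaks of submodules instead
  of linear combinations.
\<close>

lemma finitely_generated_iff:
  fixes A (structure)
  assumes "left_module A M"
  shows "finitely_generated A M \<longleftrightarrow>
    (\<exists>S. finite S \<and> S \<subseteq> carrier M \<and> (\<forall>H. submodule H A M \<and> S \<subseteq> H \<longrightarrow> H = carrier M))"
proof -
  interpret left_module A M by fact
  have span: "{\<Oplus>\<^bsub>M\<^esub>s\<in>S. c s \<odot>\<^bsub>M\<^esub> s | c. c \<in> S \<rightarrow> carrier A} \<subseteq> H"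
    if "finite S" "submodule H A M" "S \<subseteq> H" for S H
  proof clarify
    fix c assume c: "c \<in> S \<rightarrow> carrier A"
    note H = submoduleD[OF that(2)]
    have "T \<subseteq> S \<Longrightarrow> (\<Oplus>\<^bsub>M\<^esub>s\<in>T. c s \<odot>\<^bsub>M\<^esub> s) \<in> H" if "finite T" for T
      using that
    proof (induction T rule: finite_induct)
      case empty then show ?case using H by simp
    next
      case (insert x T)
      have "(\<Oplus>\<^bsub>M\<^esub>s\<in>insert x T. c s \<odot>\<^bsub>M\<^esub> s) = c x \<odot>\<^bsub>M\<^esub> x \<oplus>\<^bsub>M\<^esub> (\<Oplus>\<^bsub>M\<^esub>s\<in>T. c s \<odot>\<^bsub>M\<^esub> s)"
        using insert H(1) \<open>S \<subseteq> H\<close> c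
        by (intro M.finsum_insert) (auto intro!: smult_closed simp: subset_iff Pi_iff)
      moreover have "c x \<odot>\<^bsub>M\<^esub> x \<in> H" using insert \<open>S \<subseteq> H\<close> c by (intro H(4)) auto
      ultimately show ?case using insert H(3) by auto
    qed
    then show "(\<Oplus>\<^bsub>M\<^esub>s\<in>S. c s \<odot>\<^bsub>M\<^esub> s) \<in> H" using that by blast
  qed
  define Sp where "Sp S = {\<Oplus>\<^bsub>M\<^esub>s\<in>S. c s \<odot>\<^bsub>M\<^esub> s | c. c \<in> S \<rightarrow> carrier A}" for S
  have sub: "submodule (Sp S) A M" and mem: "S \<subseteq> Sp S"
    if S: "finite S" "S \<subseteq> carrier M" for S
  proof -
    have cl: "c s \<odot>\<^bsub>M\<^esub> s \<in> carrier M" if "c \<in> S \<rightarrow> carrier A" "s \<in> S" for c s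
      using that S by (auto intro!: smult_closed)
    obtain s where s: "bij_betw s {..<card S} S" using ex_bij_betw_nat_finite[OF S(1)] by (auto simp: atLeast0LessThan)
    then have sS: "s k \<in> S" if "k < card S" for k using that by (auto simp: bij_betw_def)
    have eq: "(\<Oplus>\<^bsub>M\<^esub>s\<in>S. c s \<odot>\<^bsub>M\<^esub> s) = msum M (\<lambda>k. c (s k) \<odot>\<^bsub>M\<^esub> s k) (card S)" if "c \<in> S \<rightarrow> carrier A" for c
      using finsum_eq_msum[OF M.abelian_group_axioms s, of "\<lambda>x. c x \<odot>\<^bsub>M\<^esub> x"] cl that by auto
    let ?H = "{\<Oplus>\<^bsub>M\<^esub>s\<in>S. c s \<odot>\<^bsub>M\<^esub> s | c. c \<in> S \<rightarrow> carrier A}"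
    show "submodule (Sp S) A M" unfolding Sp_def
    proof (rule submodule_minus)
      show "?H \<subseteq> carrier M" using cl by (auto intro!: M.finsum_closed)
      have "(\<Oplus>\<^bsub>M\<^esub>s\<in>S. \<zero> \<odot>\<^bsub>M\<^esub> s) = (\<Oplus>\<^bsub>M\<^esub>s\<in>S. \<zero>\<^bsub>M\<^esub>)"
        using S(2) by (intro M.finsum_cong') (auto simp: subset_iff)
      then have "(\<Oplus>\<^bsub>M\<^esub>s\<in>S. \<zero> \<odot>\<^bsub>M\<^esub> s) = \<zero>\<^bsub>M\<^esub>" by simp
      then show "\<zero>\<^bsub>M\<^esub> \<in> ?H" by (intro CollectI exI[of _ "\<lambda>_. \<zero>"]) auto
    next
      fix x y assume "x \<in> ?H" "y \<in> ?H"
      then obtain c d where cd: "c \<in> S \<rightarrow> carrier A" "d \<in> S \<rightarrow> carrier A"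
        "x = (\<Oplus>\<^bsub>M\<^esub>s\<in>S. c s \<odot>\<^bsub>M\<^esub> s)" "y = (\<Oplus>\<^bsub>M\<^esub>s\<in>S. d s \<odot>\<^bsub>M\<^esub> s)" by blast
      have cd': "(\<lambda>s. c s \<oplus> d s) \<in> S \<rightarrow> carrier A" using cd by auto
      have "x \<oplus>\<^bsub>M\<^esub> y = (\<Oplus>\<^bsub>M\<^esub>s\<in>S. (c s \<oplus> d s) \<odot>\<^bsub>M\<^esub> s)"
        unfolding cd(3,4) eq[OF cd(1)] eq[OF cd(2)] eq[OF cd']
        using cd(1,2) sS S(2) cl
        by (subst M.msum_add[symmetric])
          (auto intro!: msum_cong smult_l_distr[symmetric] simp: Pi_iff subset_iff)
      then show "x \<oplus>\<^bsub>M\<^esub> y \<in> ?H" using cd' by (intro CollectI exI[of _ "\<lambda>s. c s \<oplus> d s"]) auto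
    next
      fix a x assume a: "a \<in> carrier A" and "x \<in> ?H"
      then obtain c where c: "c \<in> S \<rightarrow> carrier A" "x = (\<Oplus>\<^bsub>M\<^esub>s\<in>S. c s \<odot>\<^bsub>M\<^esub> s)" by blast
      have c': "(\<lambda>s. a \<otimes> c s) \<in> S \<rightarrow> carrier A" using c a by auto
      have "a \<odot>\<^bsub>M\<^esub> x = (\<Oplus>\<^bsub>M\<^esub>s\<in>S. (a \<otimes> c s) \<odot>\<^bsub>M\<^esub> s)"
        unfolding c(2) eq[OF c(1)] eq[OF c']
        using c(1) sS S(2) cl a
        by (subst smult_msum_r) (auto intro!: msum_cong smult_assoc1[symmetric] simp: Pi_iff subset_iff)
      then show "a \<odot>\<^bsub>M\<^esub> x \<in> ?H" using c' by (intro CollectI exI[of _ "\<lambda>s. a \<otimes> c s"]) auto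
    qed
    show "S \<subseteq> Sp S" unfolding Sp_def
    proof
      fix x assume x: "x \<in> S"
      have "(\<Oplus>\<^bsub>M\<^esub>s\<in>S. (if x = s then \<one> else \<zero>) \<odot>\<^bsub>M\<^esub> s) = (\<Oplus>\<^bsub>M\<^esub>s\<in>S. if x = s then s else \<zero>\<^bsub>M\<^esub>)"
        using S(2) by (intro M.finsum_cong') (auto simp: smult_one subset_iff)
      also have "\<dots> = x"
        using M.finsum_singleton[OF x S(1), of "\<lambda>s. s"] S(2) by auto
      finally show "x \<in> ?H" by (intro CollectI exI[of _ "\<lambda>s. if x = s then \<one> else \<zero>"]) auto
    qed
  qed
  show ?thesis
  proof
    assume "finitely_generated A M"
    then obtain S where S: "finite S" "S \<subseteq> carrier M"
      "carrier M = {\<Oplus>\<^bsub>M\<^esub>s\<in>S. c s \<odot>\<^bsub>M\<^esub> s | c. c \<in> S \<rightarrow> carrier A}"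
      unfolding finitely_generated_def by blast
    show "\<exists>S. finite S \<and> S \<subseteq> carrier M \<and> (\<forall>H. submodule H A M \<and> S \<subseteq> H \<longrightarrow> H = carrier M)"
    proof (intro exI[of _ S] conjI S(1,2) allI impI)
      fix H assume H: "submodule H A M \<and> S \<subseteq> H"
      then have "carrier M \<subseteq> H" using span[of S H] S(1) unfolding S(3) by simp
      then show "H = carrier M" using submoduleD(1) H by blast
    qed
  next
    assume "\<exists>S. finite S \<and> S \<subseteq> carrier M \<and> (\<forall>H. submodule H A M \<and> S \<subseteq> H \<longrightarrow> H = carrier M)"
    then obtain S where S: "finite S" "S \<subseteq> carrier M" "\<And>H. submodule H A M \<Longrightarrow> S \<subseteq> H \<Longrightarrow> H = carrier M" by auto
    have "Sp S = carrier M" by (rule S(3)[OF sub[OF S(1,2)] mem[OF S(1,2)]])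
    then have "finite S \<and> S \<subseteq> carrier M \<and> carrier M = Sp S" using S by simp
    then show "finitely_generated A M" unfolding finitely_generated_def Sp_def by (rule exI)
  qed
qed

lemma finitely_generated_extension:
  assumes M: "left_module A M" and N: "left_module A N" and f: "f \<in> Hom A M N"
    and surj: "f ` carrier M = carrier N"
    and fgN: "finitely_generated A N" and fgK: "finitely_generated A (M\<lparr>carrier := a_kernel M N f\<rparr>)"
  shows "finitely_generated A M"
proof -
  interpret M: left_module A M by fact
  interpret N: left_module A N by fact
  let ?K = "M\<lparr>carrier := a_kernel M N f\<rparr>"
  have K: "left_module A ?K" by (rule left_module_submodule[OF M submodule_kernel[OF M N f]])
  obtain S where S: "finite S" "S \<subseteq> carrier N" "\<And>H. submodule H A N \<Longrightarrow> S \<subseteq> H \<Longrightarrow> H = carrier N"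
    using fgN finitely_generated_iff[OF N] by blast
  obtain T where T: "finite T" "T \<subseteq> a_kernel M N f" "\<And>H. submodule H A ?K \<Longrightarrow> T \<subseteq> H \<Longrightarrow> H = a_kernel M N f"
    using fgK finitely_generated_iff[OF K] by auto
  obtain S' where S': "finite S'" "S' \<subseteq> carrier M" "S = f ` S'"
    using S(1,2) surj by (metis finite_subset_image)
  show ?thesis unfolding finitely_generated_iff[OF M]
  proof (intro exI[of _ "S' \<union> T"] conjI allI impI)
    fix H assume "submodule H A M \<and> S' \<union> T \<subseteq> H"
    then have H: "submodule H A M" "S' \<subseteq> H" "T \<subseteq> H" by auto
    note H' = submoduleD[OF H(1)]
    have fH: "f ` H = carrier N" using S(3)[OF submodule_image[OF M N f H(1)]] S'(3) H(2) by auto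
    have "submodule (H \<inter> a_kernel M N f) A ?K"
      by (rule submoduleI[OF K]) (use submoduleD[OF H(1)] submoduleD[OF submodule_kernel[OF M N f]] in auto)
    then have "H \<inter> a_kernel M N f = a_kernel M N f" using T(2,3) H(3) by blast
    then have KH: "a_kernel M N f \<subseteq> H" by blast
    have "x \<in> H" if x: "x \<in> carrier M" for x
    proof -
      obtain h where h: "h \<in> H" "f h = f x" using fH x Hom_closed[OF f] by (metis image_iff)
      then have hM: "h \<in> carrier M" using H' by auto
      then have "f (x \<ominus>\<^bsub>M\<^esub> h) = \<zero>\<^bsub>N\<^esub>"
        using x h Hom_diff_eq_zero[OF M N f] N.M.minus_eq_zero_iff Hom_closed[OF f] by simp
      then have "x \<ominus>\<^bsub>M\<^esub> h \<in> H" using KH x hM by auto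
      then have "(x \<ominus>\<^bsub>M\<^esub> h) \<oplus>\<^bsub>M\<^esub> h \<in> H" using H' h by blast
      then show ?thesis using x hM by (simp add: a_minus_def M.M.a_assoc M.M.l_neg)
    qed
    then show "H = carrier M" using H' by blast
  qed (use S' T in auto)
qed

lemma finitely_generated_image:
  assumes M: "left_module A M" and N: "left_module A N" and f: "f \<in> Hom A M N"
    and surj: "f ` carrier M = carrier N" and fg: "finitely_generated A M"
  shows "finitely_generated A N"
proof -
  obtain S where S: "finite S" "S \<subseteq> carrier M" "\<And>H. submodule H A M \<Longrightarrow> S \<subseteq> H \<Longrightarrow> H = carrier M"
    using fg finitely_generated_iff[OF M] by blast
  show ?thesis unfolding finitely_generated_iff[OF N]
  proof (intro exI[of _ "f ` S"] conjI allI impI)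
    fix H assume H: "submodule H A N \<and> f ` S \<subseteq> H"
    then have "{x \<in> carrier M. f x \<in> H} = carrier M"
      using S(2) by (intro S(3) submodule_preimage[OF M N f]) auto
    then have "\<And>x. x \<in> carrier M \<Longrightarrow> f x \<in> H" by auto
    then have "carrier N \<subseteq> H" unfolding surj[symmetric] by (rule image_subsetI)
    moreover have "H \<subseteq> carrier N" using H submoduleD(1) by auto
    ultimately show "H = carrier N" by simp
  qed (use S f in \<open>auto intro: Hom_closed\<close>)
qed

section \<open>Transport of structure and direct sums\<close>

definition transport :: "('m \<Rightarrow> 'n) \<Rightarrow> ('a, 'm) module \<Rightarrow> ('a, 'n) module" where
  "transport h M = \<lparr>carrier = h ` carrier M, monoid.mult = undefined, monoid.one = undefined,
     ring.zero = h \<zero>\<^bsub>M\<^esub>,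
     ring.add = (\<lambda>x y. h (inv_into (carrier M) h x \<oplus>\<^bsub>M\<^esub> inv_into (carrier M) h y)),
     smult = (\<lambda>a x. h (a \<odot>\<^bsub>M\<^esub> inv_into (carrier M) h x))\<rparr>"

lemma transport_module:
  assumes M: "left_module A M" and h: "inj_on h (carrier M)"
  shows "left_module A (transport h M)" and "restrict h (carrier M) \<in> Iso A M (transport h M)"
proof -
  interpret left_module A M by fact
  have inv: "inv_into (carrier M) h (h x) = x" if "x \<in> carrier M" for x
    using inv_into_f_f[OF h that] .
  have ab: "abelian_group (transport h M)"
  proof (rule abelian_groupI')
    fix x assume "x \<in> carrier (transport h M)"
    then obtain z where z: "z \<in> carrier M" "x = h z" by (auto simp: transport_def)
    then show "\<exists>y\<in>carrier (transport h M). y \<oplus>\<^bsub>transport h M\<^esub> x = \<zero>\<^bsub>transport h M\<^esub>"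
      by (intro bexI[of _ "h (\<ominus>\<^bsub>M\<^esub> z)"]) (auto simp: transport_def inv M.l_neg)
  qed (auto simp: transport_def inv M.a_ac)
  show "left_module A (transport h M)"
    using ab unfolding left_module_def left_module_axioms_def
    by (auto simp: A.ring_axioms transport_def inv smult_closed smult_l_distr smult_r_distr smult_assoc1 smult_one)
  show "restrict h (carrier M) \<in> Iso A M (transport h M)"
    using h by (intro IsoI Hom_restrictI[OF M]) (auto simp: transport_def inv)
qed

lemma finitely_generated_coefficients:
  assumes M: "left_module A M" and fg: "finitely_generated A M"
  obtains S s n where "finite S" "S \<subseteq> carrier M" "bij_betw s {..<n::nat} S"
    "\<And>k. k < n \<Longrightarrow> s k \<in> carrier M"
    "\<And>x. x \<in> carrier M \<Longrightarrow> \<exists>c \<in> S \<rightarrow>\<^sub>E carrier A. x = msum M (\<lambda>k. c (s k) \<odot>\<^bsub>M\<^esub> s k) n"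
proof -
  interpret left_module A M by fact
  obtain S where S: "finite S" "S \<subseteq> carrier M"
    "carrier M = {\<Oplus>\<^bsub>M\<^esub>s\<in>S. c s \<odot>\<^bsub>M\<^esub> s | c. c \<in> S \<rightarrow> carrier A}"
    using fg unfolding finitely_generated_def by auto
  obtain s where s: "bij_betw s {..<card S} S"
    using ex_bij_betw_nat_finite[OF S(1)] by (auto simp: atLeast0LessThan)
  then have sS: "s k \<in> S" if "k < card S" for k using that by (auto simp: bij_betw_def)
  have "\<exists>c \<in> S \<rightarrow>\<^sub>E carrier A. x = msum M (\<lambda>k. c (s k) \<odot>\<^bsub>M\<^esub> s k) (card S)" if x: "x \<in> carrier M" for x
  proof -
    obtain c where c: "c \<in> S \<rightarrow> carrier A" "x = (\<Oplus>\<^bsub>M\<^esub>s\<in>S. c s \<odot>\<^bsub>M\<^esub> s)" using x S(3) by auto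
    have "c y \<odot>\<^bsub>M\<^esub> y \<in> carrier M" if "y \<in> S" for y using that c(1) S(2) by (auto intro!: smult_closed)
    then have "x = msum M (\<lambda>k. c (s k) \<odot>\<^bsub>M\<^esub> s k) (card S)"
      using finsum_eq_msum[OF M.abelian_group_axioms s, of "\<lambda>x. c x \<odot>\<^bsub>M\<^esub> x"] c(2) by simp
    also have "\<dots> = msum M (\<lambda>k. restrict c S (s k) \<odot>\<^bsub>M\<^esub> s k) (card S)"
      using sS by (intro msum_cong) auto
    finally show ?thesis using c(1) by (intro bexI[of _ "restrict c S"]) auto
  qed
  moreover have "s k \<in> carrier M" if "k < card S" for k using sS[OF that] S(2) by auto
  ultimately show thesis using that[OF S(1,2) s] by simp
qed

text \<open>
  An element of a finitely generated module is determined by the set of all coefficient vectors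
  that express it in the generators, so such a module has a copy in any universe that contains
  these sets.
\<close>

lemma universe_copy:
  fixes M :: "('a, 'x) module"
  assumes U: "module_universe TYPE('a) TYPE('m)" and M: "left_module A M" and fg: "finitely_generated A M"
  obtains N :: "('a, 'm) module" and i where "N \<in> fg_modules A" "i \<in> Iso A M N"
proof -
  obtain S s n where s: "finite S" "S \<subseteq> carrier M" "bij_betw s {..<n::nat} S" "\<And>k. k < n \<Longrightarrow> s k \<in> carrier M"
    "\<And>x. x \<in> carrier M \<Longrightarrow> \<exists>c \<in> S \<rightarrow>\<^sub>E carrier A. x = msum M (\<lambda>k. c (s k) \<odot>\<^bsub>M\<^esub> s k) n"
    using finitely_generated_coefficients[OF M fg] by blast
  obtain e :: "(nat \<Rightarrow> 'a) set \<Rightarrow> 'm" where e: "inj e" using U unfolding module_universe_def by auto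
  define C where "C x = {d. msum M (\<lambda>k. d k \<odot>\<^bsub>M\<^esub> s k) n = x}" for x
  have "inj_on (\<lambda>x. e (C x)) (carrier M)"
  proof (rule inj_onI)
    fix x y assume x: "x \<in> carrier M" and "e (C x) = e (C y)"
    then have xy: "C x = C y" using e by (auto dest: injD)
    obtain c where "x = msum M (\<lambda>k. c (s k) \<odot>\<^bsub>M\<^esub> s k) n" using s(5)[OF x] by auto
    then have "(\<lambda>k. c (s k)) \<in> C x" by (simp add: C_def)
    then show "x = y" unfolding xy using \<open>(\<lambda>k. c (s k)) \<in> C x\<close> by (simp add: C_def)
  qed
  note t = transport_module[OF M this]
  have "finitely_generated A (transport (\<lambda>x. e (C x)) M)"
    using finitely_generated_image[OF M t(1) IsoD(1)[OF t(2)] IsoD(3)[OF t(2)] fg] .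
  then show thesis using that t by (auto simp: fg_modules_def)
qed

lemma dsum_simps [simp]:
  "carrier (dsum I M) = (\<Pi>\<^sub>E i\<in>I. carrier (M i))"
  "\<zero>\<^bsub>dsum I M\<^esub> = (\<lambda>i\<in>I. \<zero>\<^bsub>M i\<^esub>)"
  "x \<oplus>\<^bsub>dsum I M\<^esub> y = (\<lambda>i\<in>I. x i \<oplus>\<^bsub>M i\<^esub> y i)"
  "a \<odot>\<^bsub>dsum I M\<^esub> x = (\<lambda>i\<in>I. a \<odot>\<^bsub>M i\<^esub> x i)"
  by (simp_all add: dsum_def)

lemma dsum_eqI:
  "x \<in> (\<Pi>\<^sub>E i\<in>I. B i) \<Longrightarrow> y \<in> (\<Pi>\<^sub>E i\<in>I. C i) \<Longrightarrow> (\<And>i. i \<in> I \<Longrightarrow> x i = y i) \<Longrightarrow> x = y"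
  by (rule PiE_ext[of x I B]) (auto simp: PiE_iff)

lemma left_module_dsum:
  assumes A: "ring A" and M: "\<And>i. i \<in> I \<Longrightarrow> left_module A (M i)"
  shows "left_module A (dsum I M)"
proof -
  have ab: "abelian_group (M i)" if "i \<in> I" for i using left_moduleD(2)[OF M[OF that]] .
  note g = abelian_group.axioms(1)[OF ab]
  interpret A: ring A by fact
  have "abelian_group (dsum I M)"
  proof (rule abelian_groupI')
    fix x assume x: "x \<in> carrier (dsum I M)"
    have "(\<ominus>\<^bsub>M i\<^esub> x i) \<oplus>\<^bsub>M i\<^esub> x i = \<zero>\<^bsub>M i\<^esub>" if "i \<in> I" for i
      using abelian_group.l_neg[OF ab[OF that]] x that by auto
    moreover have "\<ominus>\<^bsub>M i\<^esub> x i \<in> carrier (M i)" if "i \<in> I" for i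
      using abelian_group.a_inv_closed[OF ab[OF that]] x that by auto
    ultimately show "\<exists>y\<in>carrier (dsum I M). y \<oplus>\<^bsub>dsum I M\<^esub> x = \<zero>\<^bsub>dsum I M\<^esub>"
      by (intro bexI[of _ "\<lambda>i\<in>I. \<ominus>\<^bsub>M i\<^esub> x i"]) (auto intro!: restrict_ext)
  next
    fix x y z assume "x \<in> carrier (dsum I M)" "y \<in> carrier (dsum I M)" "z \<in> carrier (dsum I M)"
    then show "x \<oplus>\<^bsub>dsum I M\<^esub> y \<oplus>\<^bsub>dsum I M\<^esub> z = x \<oplus>\<^bsub>dsum I M\<^esub> (y \<oplus>\<^bsub>dsum I M\<^esub> z)"
      by (auto intro!: restrict_ext abelian_monoid.a_assoc[OF g] simp: PiE_iff)
  next
    fix x y assume "x \<in> carrier (dsum I M)" "y \<in> carrier (dsum I M)"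
    then show "x \<oplus>\<^bsub>dsum I M\<^esub> y = y \<oplus>\<^bsub>dsum I M\<^esub> x"
      by (auto intro!: restrict_ext abelian_monoid.a_comm[OF g] simp: PiE_iff)
  next
    fix x assume "x \<in> carrier (dsum I M)"
    then show "\<zero>\<^bsub>dsum I M\<^esub> \<oplus>\<^bsub>dsum I M\<^esub> x = x"
      by (intro dsum_eqI[of _ I "\<lambda>i. carrier (M i)" _ "\<lambda>i. carrier (M i)"])
        (auto simp: abelian_monoid.l_zero[OF g] abelian_monoid.zero_closed[OF g] PiE_iff)
  qed (auto simp: abelian_monoid.zero_closed[OF g] PiE_iff intro!: abelian_monoid.a_closed[OF g])
  moreover have "left_module_axioms A (dsum I M)"
  proof
    fix x assume "x \<in> carrier (dsum I M)"
    then show "\<one>\<^bsub>A\<^esub> \<odot>\<^bsub>dsum I M\<^esub> x = x"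
      by (intro dsum_eqI[of _ I "\<lambda>i. carrier (M i)" _ "\<lambda>i. carrier (M i)"])
        (auto simp: left_module.smult_one[OF M] PiE_iff)
  qed (auto intro!: restrict_ext left_module.smult_closed[OF M] left_module.smult_l_distr[OF M]
       left_module.smult_r_distr[OF M] left_module.smult_assoc1[OF M] simp: PiE_iff)
  ultimately show ?thesis by (simp add: left_module_def A)
qed

lemma dsum_proj:
  assumes "left_module A (dsum I M)" "i \<in> I"
  shows "(\<lambda>x\<in>carrier (dsum I M). x i) \<in> Hom A (dsum I M) (M i)"
  by (rule Hom_restrictI[OF assms(1)]) (use assms(2) in auto)

lemma dsum_tuple:
  assumes "left_module A L" "\<And>i. i \<in> I \<Longrightarrow> f i \<in> Hom A L (M i)"
  shows "(\<lambda>x\<in>carrier L. \<lambda>i\<in>I. f i x) \<in> Hom A L (dsum I M)"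
  by (rule Hom_restrictI[OF assms(1)])
    (auto intro!: restrict_ext Hom_closed[OF assms(2)] Hom_add[OF assms(2)] Hom_smult[OF assms(2)])

lemma dsum_inj:
  assumes "left_module A (M i)" "\<And>j. j \<in> I \<Longrightarrow> left_module A (M j)" "i \<in> I"
  shows "(\<lambda>x\<in>carrier (M i). \<lambda>j\<in>I. if j = i then x else \<zero>\<^bsub>M j\<^esub>) \<in> Hom A (M i) (dsum I M)"
proof -
  have "\<zero>\<^bsub>M j\<^esub> \<in> carrier (M j)" "\<zero>\<^bsub>M j\<^esub> \<oplus>\<^bsub>M j\<^esub> \<zero>\<^bsub>M j\<^esub> = \<zero>\<^bsub>M j\<^esub>" if "j \<in> I" for j
  proof -
    interpret left_module A "M j" using assms that by auto
    show "\<zero>\<^bsub>M j\<^esub> \<in> carrier (M j)" "\<zero>\<^bsub>M j\<^esub> \<oplus>\<^bsub>M j\<^esub> \<zero>\<^bsub>M j\<^esub> = \<zero>\<^bsub>M j\<^esub>" by auto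
  qed
  moreover have "a \<odot>\<^bsub>M j\<^esub> \<zero>\<^bsub>M j\<^esub> = \<zero>\<^bsub>M j\<^esub>" if "j \<in> I" "a \<in> carrier A" for a j
    by (rule left_module.smult_zero_r[OF assms(2)[OF that(1)] that(2)])
  ultimately show ?thesis
    using assms(3) by (intro Hom_restrictI[OF assms(1)]) (auto intro!: restrict_ext)
qed

lemma dsum_sub_family:
  "dsum I (\<lambda>i. M i\<lparr>carrier := H i\<rparr>) = (dsum I M)\<lparr>carrier := (\<Pi>\<^sub>E i\<in>I. H i)\<rparr>"
  by (simp add: dsum_def)

section \<open>Dual bases and finitely generated projective modules\<close>

lemma left_module_self: "ring A \<Longrightarrow> left_module A (self_algebra A)"
proof -
  assume "ring A"
  then interpret ring A .
  have "abelian_group (self_algebra A)"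
    by (rule abelian_groupI') (auto simp: self_algebra_def a_ac intro: l_neg bexI[OF _ a_inv_closed])
  then show ?thesis
    by (auto simp: left_module_def left_module_axioms_def ring_axioms self_algebra_def l_distr r_distr m_assoc)
qed

lemma self_algebra_simps [simp]:
  "carrier (self_algebra A) = carrier A" "\<zero>\<^bsub>self_algebra A\<^esub> = \<zero>\<^bsub>A\<^esub>" "\<one>\<^bsub>self_algebra A\<^esub> = \<one>\<^bsub>A\<^esub>"
  "x \<oplus>\<^bsub>self_algebra A\<^esub> y = x \<oplus>\<^bsub>A\<^esub> y" "x \<odot>\<^bsub>self_algebra A\<^esub> y = x \<otimes>\<^bsub>A\<^esub> y"
  "x \<otimes>\<^bsub>self_algebra A\<^esub> y = x \<otimes>\<^bsub>A\<^esub> y"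
  by (simp_all add: self_algebra_def)

text \<open>
  The dual basis criterion makes projectivity independent of the types of test modules, and it
  passes to retracts and direct sums by explicit formulas.
\<close>

definition dual_basis ::
  "('a, 'k) ring_scheme \<Rightarrow> ('a, 'm) module \<Rightarrow> nat \<Rightarrow> (nat \<Rightarrow> 'm) \<Rightarrow> (nat \<Rightarrow> 'm \<Rightarrow> 'a) \<Rightarrow> bool" where
  "dual_basis A P n u t \<longleftrightarrow> (\<forall>k<n. u k \<in> carrier P) \<and> (\<forall>k<n. t k \<in> Hom A P (self_algebra A)) \<and>
     (\<forall>x\<in>carrier P. msum P (\<lambda>k. t k x \<odot>\<^bsub>P\<^esub> u k) n = x)"

definition fgp :: "('a, 'k) ring_scheme \<Rightarrow> ('a, 'm) module \<Rightarrow> bool" where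
  "fgp A P \<longleftrightarrow> left_module A P \<and> (\<exists>n u t. dual_basis A P n u t)"

lemma dual_basisD:
  assumes "dual_basis A P n u t"
  shows "\<And>k. k < n \<Longrightarrow> u k \<in> carrier P" "\<And>k. k < n \<Longrightarrow> t k \<in> Hom A P (self_algebra A)"
    "\<And>x. x \<in> carrier P \<Longrightarrow> msum P (\<lambda>k. t k x \<odot>\<^bsub>P\<^esub> u k) n = x"
    "\<And>k x. k < n \<Longrightarrow> x \<in> carrier P \<Longrightarrow> t k x \<in> carrier A"
  using assms Hom_closed[of _ A P "self_algebra A"] by (auto simp: dual_basis_def)

lemma fgpE:
  assumes "fgp A P" obtains n u t where "left_module A P" "dual_basis A P n u t"
  using assms by (auto simp: fgp_def)

lemma Hom_combination:
  assumes P: "left_module A P" and N: "left_module A N"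
    and t: "\<And>k. k < n \<Longrightarrow> t k \<in> Hom A P (self_algebra A)" and v: "\<And>k. k < n \<Longrightarrow> v k \<in> carrier N"
  shows "(\<lambda>x\<in>carrier P. msum N (\<lambda>k. t k x \<odot>\<^bsub>N\<^esub> v k) n) \<in> Hom A P N"
proof (rule Hom_restrictI[OF P])
  interpret N: left_module A N by fact
  have tc: "t k x \<in> carrier A" if "k < n" "x \<in> carrier P" for k x
    using Hom_closed[OF t[OF that(1)] that(2)] by simp
  fix x assume x: "x \<in> carrier P"
  show "msum N (\<lambda>k. t k x \<odot>\<^bsub>N\<^esub> v k) n \<in> carrier N"
    using x tc v by (auto intro!: N.smult_closed)
  show "msum N (\<lambda>k. t k (x \<oplus>\<^bsub>P\<^esub> y) \<odot>\<^bsub>N\<^esub> v k) n =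
      msum N (\<lambda>k. t k x \<odot>\<^bsub>N\<^esub> v k) n \<oplus>\<^bsub>N\<^esub> msum N (\<lambda>k. t k y \<odot>\<^bsub>N\<^esub> v k) n" if y: "y \<in> carrier P" for y
    using x y tc v
    by (subst N.M.msum_add[symmetric])
      (auto intro!: msum_cong N.smult_closed simp: Hom_add[OF t] N.smult_l_distr)
  show "msum N (\<lambda>k. t k (a \<odot>\<^bsub>P\<^esub> x) \<odot>\<^bsub>N\<^esub> v k) n = a \<odot>\<^bsub>N\<^esub> msum N (\<lambda>k. t k x \<odot>\<^bsub>N\<^esub> v k) n"
    if a: "a \<in> carrier A" for a
    using x a tc v
    by (subst N.smult_msum_r)
      (auto intro!: msum_cong N.smult_closed simp: Hom_smult[OF t] N.smult_assoc1)
qed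

lemma Hom_dual_basis:
  assumes "left_module A P" "left_module A N" "dual_basis A P n u t" "f \<in> Hom A P N" "x \<in> carrier P"
  shows "f x = msum N (\<lambda>k. t k x \<odot>\<^bsub>N\<^esub> f (u k)) n"
proof -
  interpret P: left_module A P by fact
  note d = dual_basisD[OF assms(3)]
  have "f x = f (msum P (\<lambda>k. t k x \<odot>\<^bsub>P\<^esub> u k) n)" using d(3)[OF assms(5)] by simp
  also have "\<dots> = msum N (\<lambda>k. f (t k x \<odot>\<^bsub>P\<^esub> u k)) n"
    using d assms(5) by (intro Hom_msum[OF assms(1,2,4)]) (auto intro: P.smult_closed)
  also have "\<dots> = msum N (\<lambda>k. t k x \<odot>\<^bsub>N\<^esub> f (u k)) n"
    using d assms(5) by (intro msum_cong) (auto simp: Hom_smult[OF assms(4)])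
  finally show ?thesis .
qed

lemma fgp_lift:
  assumes P: "fgp A P" and N: "left_module A N" and L: "left_module A L"
    and g: "g \<in> Hom A N L" and surj: "g ` carrier N = carrier L" and f: "f \<in> Hom A P L"
  obtains h where "h \<in> Hom A P N" "\<And>x. x \<in> carrier P \<Longrightarrow> g (h x) = f x"
proof -
  interpret N: left_module A N by fact
  obtain n u t where P': "left_module A P" and d: "dual_basis A P n u t" using P by (rule fgpE)
  note d' = dual_basisD[OF d]
  have "\<forall>k. \<exists>y. k < n \<longrightarrow> y \<in> carrier N \<and> g y = f (u k)"
  proof
    fix k
    show "\<exists>y. k < n \<longrightarrow> y \<in> carrier N \<and> g y = f (u k)"
      using Hom_closed[OF f, of "u k"] d'(1)[of k] surj by (metis imageE)
  qed
  then obtain v where v: "\<And>k. k < n \<Longrightarrow> v k \<in> carrier N" "\<And>k. k < n \<Longrightarrow> g (v k) = f (u k)" by metis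
  let ?h = "\<lambda>x\<in>carrier P. msum N (\<lambda>k. t k x \<odot>\<^bsub>N\<^esub> v k) n"
  have h: "?h \<in> Hom A P N" by (rule Hom_combination[OF P' N]) (use d'(2) v in auto)
  have "g (?h x) = f x" if x: "x \<in> carrier P" for x
  proof -
    have "g (?h x) = msum L (\<lambda>k. g (t k x \<odot>\<^bsub>N\<^esub> v k)) n"
      using x v d' by (simp add: Hom_msum[OF N L g] N.smult_closed)
    also have "\<dots> = msum L (\<lambda>k. t k x \<odot>\<^bsub>L\<^esub> f (u k)) n"
      using x v d' by (intro msum_cong) (simp add: Hom_smult[OF g])
    also have "\<dots> = f x" using Hom_dual_basis[OF P' L d f x] by simp
    finally show ?thesis .
  qed
  then show thesis using that[OF h] by simp
qed

lemma fgp_retract: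
  assumes P: "fgp A P" and Q: "left_module A Q" and p: "p \<in> Hom A P Q" and i: "i \<in> Hom A Q P"
    and pi: "\<And>x. x \<in> carrier Q \<Longrightarrow> p (i x) = x"
  shows "fgp A Q"
proof -
  obtain n u t where P': "left_module A P" and d: "dual_basis A P n u t" using P by (rule fgpE)
  note d' = dual_basisD[OF d]
  have "dual_basis A Q n (\<lambda>k. p (u k)) (\<lambda>k. compose (carrier Q) (t k) i)"
    unfolding dual_basis_def
  proof (intro conjI allI impI ballI)
    fix x assume x: "x \<in> carrier Q"
    have "x = msum Q (\<lambda>k. t k (i x) \<odot>\<^bsub>Q\<^esub> p (u k)) n"
      using Hom_dual_basis[OF P' Q d p Hom_closed[OF i x]] pi[OF x] by simp
    then show "msum Q (\<lambda>k. compose (carrier Q) (t k) i x \<odot>\<^bsub>Q\<^esub> p (u k)) n = x" using x by simp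
  qed (use d' p i Q in \<open>auto intro: Hom_closed Hom_compose\<close>)
  then show ?thesis using Q by (auto simp: fgp_def)
qed

lemma fgp_iso:
  assumes P: "fgp A P" and Q: "left_module A Q" and f: "f \<in> Iso A P Q"
  shows "fgp A Q"
proof -
  have P': "left_module A P" using P by (auto simp: fgp_def)
  obtain g where g: "g \<in> Iso A Q P" "\<And>x. x \<in> carrier P \<Longrightarrow> g (f x) = x" "\<And>y. y \<in> carrier Q \<Longrightarrow> f (g y) = y"
    using Iso_inverse[OF P' f] by blast
  show ?thesis using fgp_retract[OF P Q IsoD(1)[OF f] IsoD(1)[OF g(1)] g(3)] .
qed

lemma fgp_biproduct:
  assumes M: "left_module A M" and P: "fgp A P" and Q: "fgp A Q"
    and p: "p \<in> Hom A M P" and i: "i \<in> Hom A P M" and q: "q \<in> Hom A M Q" and j: "j \<in> Hom A Q M"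
    and sum: "\<And>x. x \<in> carrier M \<Longrightarrow> i (p x) \<oplus>\<^bsub>M\<^esub> j (q x) = x"
  shows "fgp A M"
proof -
  interpret M: left_module A M by fact
  obtain n u t where P': "left_module A P" and d: "dual_basis A P n u t" using P by (rule fgpE)
  obtain m v s where Q': "left_module A Q" and e: "dual_basis A Q m v s" using Q by (rule fgpE)
  note d' = dual_basisD[OF d] and e' = dual_basisD[OF e]
  define u' where "u' k = (if k < n then i (u k) else j (v (k - n)))" for k
  define t' where "t' k = (if k < n then compose (carrier M) (t k) p else compose (carrier M) (s (k - n)) q)" for k
  have "dual_basis A M (n + m) u' t'"
    unfolding dual_basis_def
  proof (intro conjI allI impI ballI)
    show "u' k \<in> carrier M" if "k < n + m" for k
      using that d'(1) e'(1) by (auto simp: u'_def intro!: Hom_closed[OF i] Hom_closed[OF j])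
    show "t' k \<in> Hom A M (self_algebra A)" if "k < n + m" for k
      using that d'(2) e'(2) by (auto simp: t'_def intro!: Hom_compose[OF M p] Hom_compose[OF M q])
    fix x assume x: "x \<in> carrier M"
    have "msum M (\<lambda>k. t' k x \<odot>\<^bsub>M\<^esub> u' k) (n + m) =
      msum M (\<lambda>k. if k < n then t k (p x) \<odot>\<^bsub>M\<^esub> i (u k) else s (k - n) (q x) \<odot>\<^bsub>M\<^esub> j (v (k - n))) (n + m)"
      by (rule msum_cong) (simp add: t'_def u'_def x)
    also have "\<dots> = msum M (\<lambda>k. t k (p x) \<odot>\<^bsub>M\<^esub> i (u k)) n \<oplus>\<^bsub>M\<^esub> msum M (\<lambda>k. s k (q x) \<odot>\<^bsub>M\<^esub> j (v k)) m"
      by (rule M.M.msum_append[where g="\<lambda>k. s k (q x) \<odot>\<^bsub>M\<^esub> j (v k)"])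
        (auto intro!: M.smult_closed Hom_closed[OF i] Hom_closed[OF j] Hom_closed[OF p] Hom_closed[OF q] d'(1,4) e'(1,4) x)
    also have "\<dots> = x"
      using Hom_dual_basis[OF P' M d i Hom_closed[OF p x]] Hom_dual_basis[OF Q' M e j Hom_closed[OF q x]] sum[OF x]
      by simp
    finally show "msum M (\<lambda>k. t' k x \<odot>\<^bsub>M\<^esub> u' k) (n + m) = x" .
  qed
  then show ?thesis using M by (auto simp: fgp_def)
qed

text \<open>The split extension by which induction over the index set of a finite direct sum proceeds.\<close>

lemma dsum_insert_maps:
  assumes A: "ring A" and M': "\<forall>j\<in>insert i I. left_module A (M j)" and i: "i \<notin> I"
  defines "D \<equiv> dsum (insert i I) M"
  defines "p \<equiv> \<lambda>x\<in>carrier D. x i" and "q \<equiv> \<lambda>x\<in>carrier D. restrict x I"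
    and "h \<equiv> \<lambda>x\<in>carrier (M i). \<lambda>j\<in>insert i I. if j = i then x else \<zero>\<^bsub>M j\<^esub>"
    and "k \<equiv> \<lambda>x\<in>carrier (dsum I M). \<lambda>j\<in>insert i I. if j = i then \<zero>\<^bsub>M i\<^esub> else x j"
  shows "p \<in> Hom A D (M i)" "q \<in> Hom A D (dsum I M)" "h \<in> Hom A (M i) D" "k \<in> Hom A (dsum I M) D"
    "\<And>x. x \<in> carrier D \<Longrightarrow> h (p x) \<oplus>\<^bsub>D\<^esub> k (q x) = x"
    "\<And>x. x \<in> carrier (M i) \<Longrightarrow> p (h x) = x" "\<And>x. x \<in> carrier (M i) \<Longrightarrow> q (h x) = \<zero>\<^bsub>dsum I M\<^esub>"
    "\<And>x. x \<in> carrier (dsum I M) \<Longrightarrow> q (k x) = x"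
    "\<And>x. x \<in> carrier (dsum I M) \<Longrightarrow> p (k x) = \<zero>\<^bsub>M i\<^esub>"
proof -
  note M = bspec[OF M']
  have D: "left_module A D" unfolding D_def by (rule left_module_dsum[OF A M])
  have I: "left_module A (dsum I M)" by (rule left_module_dsum[OF A]) (use M in auto)
  have g: "abelian_group (M j)" if "j \<in> insert i I" for j using left_moduleD(2)[OF M[OF that]] .
  note z = abelian_monoid.l_zero[OF abelian_group.axioms(1)[OF g]] abelian_monoid.r_zero[OF abelian_group.axioms(1)[OF g]]
    abelian_monoid.zero_closed[OF abelian_group.axioms(1)[OF g]]
  have zs: "a \<odot>\<^bsub>M i\<^esub> \<zero>\<^bsub>M i\<^esub> = \<zero>\<^bsub>M i\<^esub>" if "a \<in> carrier A" for a
    using left_module.smult_zero_r[OF M that, of i] by simp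
  show p: "p \<in> Hom A D (M i)" unfolding p_def D_def by (rule dsum_proj) (use D D_def in auto)
  show q: "q \<in> Hom A D (dsum I M)" unfolding q_def
    by (rule Hom_restrictI[OF D]) (auto simp: D_def PiE_iff fun_eq_iff)
  show h: "h \<in> Hom A (M i) D" unfolding h_def D_def by (rule dsum_inj) (use M in auto)
  show k: "k \<in> Hom A (dsum I M) D" unfolding k_def
    using i by (intro Hom_restrictI[OF I]) (auto simp: D_def PiE_iff fun_eq_iff z zs)
  show "h (p x) \<oplus>\<^bsub>D\<^esub> k (q x) = x" if x: "x \<in> carrier D" for x
  proof -
    have "p x = x i" "p x \<in> carrier (M i)" "q x = restrict x I" "q x \<in> carrier (dsum I M)"
      using x by (auto simp: p_def q_def D_def PiE_iff)
    then have "h (p x) \<oplus>\<^bsub>D\<^esub> k (q x) = (\<lambda>j\<in>insert i I. x j)"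
      using x i by (intro ext) (simp add: h_def k_def D_def PiE_iff z restrict_def)
    also have "\<dots> = x" using x by (auto simp: D_def PiE_iff extensional_restrict)
    finally show ?thesis .
  qed
  show "p (h x) = x" if x: "x \<in> carrier (M i)" for x
    using Hom_closed[OF h x] x by (simp add: p_def h_def)
  show "q (h x) = \<zero>\<^bsub>dsum I M\<^esub>" if x: "x \<in> carrier (M i)" for x
    using Hom_closed[OF h x] x i by (auto simp: q_def h_def fun_eq_iff)
  show "q (k x) = x" if x: "x \<in> carrier (dsum I M)" for x
  proof -
    have "q (k x) = (\<lambda>j\<in>I. x j)"
      using Hom_closed[OF k x] x i by (auto simp: q_def k_def fun_eq_iff)
    then show ?thesis using x by (auto simp: PiE_iff extensional_restrict)
  qed
  show "p (k x) = \<zero>\<^bsub>M i\<^esub>" if x: "x \<in> carrier (dsum I M)" for x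
    using Hom_closed[OF k x] x by (simp add: p_def k_def)
qed

lemma fgp_zero:
  assumes "left_module A M" "carrier M = {\<zero>\<^bsub>M\<^esub>}" shows "fgp A M"
proof -
  have "dual_basis A M 0 (\<lambda>_. \<zero>\<^bsub>M\<^esub>) (\<lambda>_. undefined)" using assms(2) by (simp add: dual_basis_def)
  then show ?thesis using assms(1) unfolding fgp_def by blast
qed

lemma fgp_dsum:
  assumes A: "ring A" and "finite I" and M: "\<And>i. i \<in> I \<Longrightarrow> fgp A (M i)"
  shows "fgp A (dsum I M)"
  using \<open>finite I\<close> M
proof (induction I rule: finite_induct)
  case empty
  then show ?case using left_module_dsum[OF A, of "{}" M] by (intro fgp_zero) auto
next
  case (insert i I)
  have lm: "left_module A (M j)" if "j \<in> insert i I" for j using insert(4)[OF that] by (simp add: fgp_def)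
  have "\<forall>j\<in>insert i I. left_module A (M j)" using lm by blast
  note m = dsum_insert_maps[OF A this insert(2)]
  have D: "left_module A (dsum (insert i I) M)" by (rule left_module_dsum[OF A lm])
  have 1: "fgp A (M i)" and 2: "fgp A (dsum I M)" using insert by auto
  show ?case by (rule fgp_biproduct[OF D 1 2 m(1) m(3) m(2) m(4)]) (rule m(5))
qed

lemma fgp_self: assumes "ring A" shows "fgp A (self_algebra A)"
proof -
  interpret ring A by fact
  have L: "left_module A (self_algebra A)" using left_module_self[OF assms] .
  have "dual_basis A (self_algebra A) 1 (\<lambda>_. \<one>\<^bsub>A\<^esub>) (\<lambda>_. \<lambda>x\<in>carrier A. x)"
    using Hom_id[OF L] by (auto simp: dual_basis_def)
  then show ?thesis using L unfolding fgp_def by blast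
qed

lemma fgp_finitely_generated: assumes "fgp A P" shows "finitely_generated A P"
proof -
  obtain n u t where P': "left_module A P" and d: "dual_basis A P n u t" using assms by (rule fgpE)
  note d' = dual_basisD[OF d]
  show ?thesis unfolding finitely_generated_iff[OF P']
  proof (intro exI[of _ "u ` {..<n}"] conjI allI impI)
    fix H assume H: "submodule H A P \<and> u ` {..<n} \<subseteq> H"
    note H' = submoduleD[OF conjunct1[OF H]]
    have "x \<in> H" if x: "x \<in> carrier P" for x
    proof -
      have "m \<le> n \<Longrightarrow> msum P (\<lambda>k. t k x \<odot>\<^bsub>P\<^esub> u k) m \<in> H" for m
      proof (induction m)
        case 0 then show ?case using H' by simp
      next
        case (Suc m)
        then have "t m x \<odot>\<^bsub>P\<^esub> u m \<in> H" using H d' x by (intro H'(4)) auto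
        then show ?case using Suc H' by simp
      qed
      from this[of n] show "x \<in> H" using d'(3)[OF x] by simp
    qed
    then show "H = carrier P" using H' by auto
  qed (use d' in auto)
qed

lemma fgp_projective:
  fixes P :: "('a, 'm) module"
  assumes "fgp A P" shows "projective A P"
  unfolding projective_def
proof (intro conjI allI impI ballI)
  show P: "left_module A P" using assms by (simp add: fgp_def)
  fix N :: "('a, 'm \<Rightarrow> 'a) module" and L :: "('a, 'm) module" and g f
  assume *: "left_module A N \<and> left_module A L" "g \<in> Hom A N L" "f \<in> Hom A P L" "g ` carrier N = carrier L"
  obtain h where h: "h \<in> Hom A P N" "\<And>x. x \<in> carrier P \<Longrightarrow> g (h x) = f x"
    using fgp_lift[OF assms conjunct1[OF *(1)] conjunct2[OF *(1)] *(2,4,3)] by blast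
  have "compose (carrier P) g h = f"
    by (rule Hom_eqI[OF Hom_compose[OF P h(1) *(2)] *(3)]) (use h in simp)
  then show "\<exists>h\<in>Hom A P N. compose (carrier P) g h = f" using h by auto
qed

text \<open>
  The free module on a finite set of generators is an admissible test module. A section of its map
  onto \<open>P\<close> provides the coordinate functions.
\<close>

lemma projective_imp_fgp:
  fixes P :: "('a, 'm) module"
  assumes proj: "projective A P" and fg: "finitely_generated A P"
  shows "fgp A P"
proof -
  have P: "left_module A P" using proj by (simp add: projective_def)
  interpret P: left_module A P by fact
  obtain S s n where s: "finite S" "S \<subseteq> carrier P" "bij_betw s {..<n::nat} S" "\<And>k. k < n \<Longrightarrow> s k \<in> carrier P"
    "\<And>x. x \<in> carrier P \<Longrightarrow> \<exists>c \<in> S \<rightarrow>\<^sub>E carrier A. x = msum P (\<lambda>k. c (s k) \<odot>\<^bsub>P\<^esub> s k) n"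
    using finitely_generated_coefficients[OF P fg] by blast
  have sS: "s k \<in> S" if "k < n" for k using s(3) that by (auto simp: bij_betw_def)
  define N where "N = (dsum S (\<lambda>_. self_algebra A) :: ('a, 'm \<Rightarrow> 'a) module)"
  have N: "left_module A N" unfolding N_def
    by (rule left_module_dsum[OF P.A.ring_axioms]) (rule left_module_self[OF P.A.ring_axioms])
  define \<pi> where "\<pi> k = (\<lambda>x\<in>carrier N. x (s k))" for k
  have \<pi>: "\<pi> k \<in> Hom A N (self_algebra A)" if "k < n" for k
    unfolding \<pi>_def N_def using dsum_proj[of A S "\<lambda>_. self_algebra A" "s k"] N sS[OF that] by (simp add: N_def)
  define g where "g = (\<lambda>x\<in>carrier N. msum P (\<lambda>k. \<pi> k x \<odot>\<^bsub>P\<^esub> s k) n)"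
  have g: "g \<in> Hom A N P" unfolding g_def by (rule Hom_combination[OF N P]) (use \<pi> s in auto)
  have "x \<in> g ` carrier N" if x: "x \<in> carrier P" for x
  proof -
    obtain c where c: "c \<in> S \<rightarrow>\<^sub>E carrier A" "x = msum P (\<lambda>k. c (s k) \<odot>\<^bsub>P\<^esub> s k) n" using s(5)[OF x] by auto
    then have "c \<in> carrier N" by (simp add: N_def)
    moreover have "x = g c" using \<open>c \<in> carrier N\<close> c(2) by (simp add: g_def \<pi>_def)
    ultimately show ?thesis by auto
  qed
  then have surj: "g ` carrier N = carrier P" using Hom_closed[OF g] by auto
  have "left_module A N \<and> left_module A P" using N P by simp
  then have "\<exists>h\<in>Hom A P N. compose (carrier P) g h = (\<lambda>x\<in>carrier P. x)"
    using conjunct2[OF proj[unfolded projective_def], rule_format, OF _ g Hom_id[OF P] surj] by simp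
  then obtain h where h: "h \<in> Hom A P N" "compose (carrier P) g h = (\<lambda>x\<in>carrier P. x)" by auto
  have gh: "g (h x) = x" if "x \<in> carrier P" for x
    using fun_cong[OF h(2), of x] that by simp
  have "dual_basis A P n s (\<lambda>k. compose (carrier P) (\<pi> k) h)"
    unfolding dual_basis_def
  proof (intro conjI allI impI ballI)
    fix x assume x: "x \<in> carrier P"
    then show "msum P (\<lambda>k. compose (carrier P) (\<pi> k) h x \<odot>\<^bsub>P\<^esub> s k) n = x"
      using gh[OF x] Hom_closed[OF h(1) x] by (simp add: g_def)
  qed (use s(4) in \<open>auto intro!: Hom_compose[OF P h(1) \<pi>]\<close>)
  then show ?thesis using P unfolding fgp_def by blast
qed

lemma fg_projectives_iff: "P \<in> fg_projectives A \<longleftrightarrow> fgp A P"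
proof
  assume "P \<in> fg_projectives A"
  then show "fgp A P" by (intro projective_imp_fgp) (auto simp: fg_projectives_def fg_modules_def)
next
  assume P: "fgp A P"
  then have "left_module A P" by (simp add: fgp_def)
  then show "P \<in> fg_projectives A"
    using fgp_projective[OF P] fgp_finitely_generated[OF P] by (simp add: fg_projectives_def fg_modules_def)
qed

section \<open>Idempotent matrices over the ground ring and the tensor product\<close>

text \<open>
  The action of \<open>R\<close> through its structure map \<open>r \<mapsto> r \<cdot> 1\<close> into \<open>A\<close>.
\<close>

definition scal :: "('r, 'a) module \<Rightarrow> ('a, 'm) module \<Rightarrow> 'r \<Rightarrow> 'm \<Rightarrow> 'm" where
  "scal A M r x = (r \<odot>\<^bsub>A\<^esub> \<one>\<^bsub>A\<^esub>) \<odot>\<^bsub>M\<^esub> x"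

lemma restrict_scalars_simps [simp]:
  "carrier (restrict_scalars A M) = carrier M" "\<zero>\<^bsub>restrict_scalars A M\<^esub> = \<zero>\<^bsub>M\<^esub>"
  "x \<oplus>\<^bsub>restrict_scalars A M\<^esub> y = x \<oplus>\<^bsub>M\<^esub> y" "r \<odot>\<^bsub>restrict_scalars A M\<^esub> x = scal A M r x"
  by (simp_all add: restrict_scalars_def scal_def)

lemma msum_restrict_scalars [simp]: "msum (restrict_scalars A M) f n = msum M f n"
  by (induction n) auto

text \<open>
  An idempotent matrix \<open>E\<close> over \<open>R\<close> stands for the finitely generated projective module
  \<open>U = E R\<^sup>n\<close>. Then \<open>Fix A M n E\<close>, the vectors over \<open>M\<close> that \<open>E\<close> fixes, is \<open>M \<otimes> U\<close> without
  a quotient construction.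
\<close>

definition idem_matrix :: "('r, 'k) ring_scheme \<Rightarrow> nat \<Rightarrow> (nat \<Rightarrow> nat \<Rightarrow> 'r) \<Rightarrow> bool" where
  "idem_matrix R n E \<longleftrightarrow> (\<forall>l<n. \<forall>k<n. E l k \<in> carrier R) \<and>
     (\<forall>l<n. \<forall>k<n. msum R (\<lambda>j. E l j \<otimes>\<^bsub>R\<^esub> E j k) n = E l k)"

definition mact :: "('r, 'a) module \<Rightarrow> ('a, 'm) module \<Rightarrow> nat \<Rightarrow> (nat \<Rightarrow> nat \<Rightarrow> 'r) \<Rightarrow> (nat \<Rightarrow> 'm) \<Rightarrow> (nat \<Rightarrow> 'm)" where
  "mact A M n E x = (\<lambda>l\<in>{..<n}. msum M (\<lambda>k. scal A M (E l k) (x k)) n)"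

definition pow_module :: "('a, 'm) module \<Rightarrow> nat \<Rightarrow> ('a, nat \<Rightarrow> 'm) module" where
  "pow_module M n = dsum {..<n} (\<lambda>_. M)"

definition Fix :: "('r, 'a) module \<Rightarrow> ('a, 'm) module \<Rightarrow> nat \<Rightarrow> (nat \<Rightarrow> nat \<Rightarrow> 'r) \<Rightarrow> ('a, nat \<Rightarrow> 'm) module" where
  "Fix A M n E = (pow_module M n)\<lparr>carrier := {x \<in> carrier (pow_module M n). mact A M n E x = x}\<rparr>"

lemma pow_module_simps [simp]:
  "carrier (pow_module M n) = {..<n} \<rightarrow>\<^sub>E carrier M"
  "\<zero>\<^bsub>pow_module M n\<^esub> = (\<lambda>i\<in>{..<n}. \<zero>\<^bsub>M\<^esub>)"
  "x \<oplus>\<^bsub>pow_module M n\<^esub> y = (\<lambda>i\<in>{..<n}. x i \<oplus>\<^bsub>M\<^esub> y i)"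
  "a \<odot>\<^bsub>pow_module M n\<^esub> x = (\<lambda>i\<in>{..<n}. a \<odot>\<^bsub>M\<^esub> x i)"
  by (simp_all add: pow_module_def)

lemma left_module_pow: "left_module A M \<Longrightarrow> left_module A (pow_module M n)"
  unfolding pow_module_def by (rule left_module_dsum) (auto dest: left_moduleD)

lemma pow_proj: "left_module A M \<Longrightarrow> k < n \<Longrightarrow> (\<lambda>x\<in>carrier (pow_module M n). x k) \<in> Hom A (pow_module M n) M"
  using dsum_proj[of A "{..<n}" "\<lambda>_. M" k] left_module_pow[of A M n] unfolding pow_module_def by simp

lemma powI: "(\<And>k. k < n \<Longrightarrow> f k \<in> carrier M) \<Longrightarrow> (\<lambda>k\<in>{..<n}. f k) \<in> carrier (pow_module M n)"
  by auto

lemma powD: "x \<in> carrier (pow_module M n) \<Longrightarrow> k < n \<Longrightarrow> x k \<in> carrier M"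
  by auto

lemma pow_eqI:
  "x \<in> carrier (pow_module M n) \<Longrightarrow> y \<in> carrier (pow_module M' n) \<Longrightarrow> (\<And>k. k < n \<Longrightarrow> x k = y k) \<Longrightarrow> x = y"
  by (rule PiE_ext[of x "{..<n}" "\<lambda>_. carrier M"]) (auto simp: PiE_iff)

context assoc_algebra begin

lemma unit_closed: "r \<in> carrier R \<Longrightarrow> r \<odot>\<^bsub>A\<^esub> \<one>\<^bsub>A\<^esub> \<in> carrier A"
  by simp

lemma unit_mult:
  assumes "r \<in> carrier R" "s \<in> carrier R"
  shows "(r \<otimes>\<^bsub>R\<^esub> s) \<odot>\<^bsub>A\<^esub> \<one>\<^bsub>A\<^esub> = (r \<odot>\<^bsub>A\<^esub> \<one>\<^bsub>A\<^esub>) \<otimes>\<^bsub>A\<^esub> (s \<odot>\<^bsub>A\<^esub> \<one>\<^bsub>A\<^esub>)"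
  using assms smult_mult_l[of r "\<one>\<^bsub>A\<^esub>" "s \<odot>\<^bsub>A\<^esub> \<one>\<^bsub>A\<^esub>"] by (simp add: smult_assoc1)

lemma unit_central:
  assumes "r \<in> carrier R" "a \<in> carrier A"
  shows "a \<otimes>\<^bsub>A\<^esub> (r \<odot>\<^bsub>A\<^esub> \<one>\<^bsub>A\<^esub>) = (r \<odot>\<^bsub>A\<^esub> \<one>\<^bsub>A\<^esub>) \<otimes>\<^bsub>A\<^esub> a"
  using assms smult_mult_l[of r "\<one>\<^bsub>A\<^esub>" a] smult_mult_r[of r a "\<one>\<^bsub>A\<^esub>"] by simp

end

context
  fixes R :: "('r, 'k) ring_scheme" and A :: "('r, 'a) module" and M :: "('a, 'm) module"
  assumes RA: "assoc_algebra R A" and M: "left_module A M"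
begin

interpretation RA: assoc_algebra R A by (rule RA)
interpretation M: left_module A M by (rule M)

lemma scal_closed [simp, intro]: "r \<in> carrier R \<Longrightarrow> x \<in> carrier M \<Longrightarrow> scal A M r x \<in> carrier M"
  unfolding scal_def by (intro M.smult_closed RA.unit_closed)

lemma scal_add_r:
  "r \<in> carrier R \<Longrightarrow> x \<in> carrier M \<Longrightarrow> y \<in> carrier M \<Longrightarrow> scal A M r (x \<oplus>\<^bsub>M\<^esub> y) = scal A M r x \<oplus>\<^bsub>M\<^esub> scal A M r y"
  unfolding scal_def by (intro M.smult_r_distr RA.unit_closed)

lemma scal_add_l:
  "r \<in> carrier R \<Longrightarrow> s \<in> carrier R \<Longrightarrow> x \<in> carrier M \<Longrightarrow>
     scal A M (r \<oplus>\<^bsub>R\<^esub> s) x = scal A M r x \<oplus>\<^bsub>M\<^esub> scal A M s x"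
  unfolding scal_def by (simp add: RA.smult_l_distr M.smult_l_distr)

lemma scal_mult:
  "r \<in> carrier R \<Longrightarrow> s \<in> carrier R \<Longrightarrow> x \<in> carrier M \<Longrightarrow>
     scal A M (r \<otimes>\<^bsub>R\<^esub> s) x = scal A M r (scal A M s x)"
  unfolding scal_def by (simp add: RA.unit_mult M.smult_assoc1)

lemma scal_one: "x \<in> carrier M \<Longrightarrow> scal A M \<one>\<^bsub>R\<^esub> x = x"
  unfolding scal_def by (simp add: RA.smult_one M.smult_one)

lemma scal_smult:
  "r \<in> carrier R \<Longrightarrow> a \<in> carrier A \<Longrightarrow> x \<in> carrier M \<Longrightarrow>
     scal A M r (a \<odot>\<^bsub>M\<^esub> x) = a \<odot>\<^bsub>M\<^esub> scal A M r x"
  unfolding scal_def by (simp add: RA.unit_central flip: M.smult_assoc1)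

lemma left_module_restrict: "left_module R (restrict_scalars A M)"
proof -
  have "abelian_group (restrict_scalars A M)"
    by (rule abelian_groupI') (auto simp: M.M.a_ac intro: M.M.l_neg bexI[OF _ M.M.a_inv_closed])
  then show ?thesis
    by (auto simp: left_module_def left_module_axioms_def RA.R.ring_axioms scal_add_l scal_add_r scal_mult scal_one)
qed

lemma scal_Hom:
  "left_module A N \<Longrightarrow> f \<in> Hom A M N \<Longrightarrow> r \<in> carrier R \<Longrightarrow> x \<in> carrier M \<Longrightarrow> f (scal A M r x) = scal A N r (f x)"
  unfolding scal_def by (simp add: Hom_smult)

lemma scal_is_Hom: "r \<in> carrier R \<Longrightarrow> (\<lambda>x\<in>carrier M. scal A M r x) \<in> Hom A M M"
  by (rule Hom_restrictI[OF M]) (auto simp: scal_add_r scal_smult)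

lemma scal_zero_l [simp]: "x \<in> carrier M \<Longrightarrow> scal A M \<zero>\<^bsub>R\<^esub> x = \<zero>\<^bsub>M\<^esub>"
  unfolding scal_def by (simp add: RA.smult_l_null)

lemma scal_msum_r:
  "r \<in> carrier R \<Longrightarrow> (\<And>k. k < n \<Longrightarrow> f k \<in> carrier M) \<Longrightarrow>
     scal A M r (msum M f n) = msum M (\<lambda>k. scal A M r (f k)) n"
  using left_module.smult_msum_r[OF left_module_restrict, of r n f] by simp

lemma scal_msum_l:
  "x \<in> carrier M \<Longrightarrow> (\<And>k. k < n \<Longrightarrow> f k \<in> carrier R) \<Longrightarrow>
     scal A M (msum R f n) x = msum M (\<lambda>k. scal A M (f k) x) n"
  using left_module.smult_msum_l[OF left_module_restrict, of x n f] by simp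

lemma scal_minus_l:
  "r \<in> carrier R \<Longrightarrow> s \<in> carrier R \<Longrightarrow> x \<in> carrier M \<Longrightarrow>
     scal A M (r \<ominus>\<^bsub>R\<^esub> s) x = scal A M r x \<ominus>\<^bsub>M\<^esub> scal A M s x"
proof -
  assume a: "r \<in> carrier R" "s \<in> carrier R" "x \<in> carrier M"
  have "scal A M (r \<ominus>\<^bsub>R\<^esub> s) x \<oplus>\<^bsub>M\<^esub> scal A M s x = scal A M r x"
    using a by (simp add: scal_add_l[symmetric] RA.R.minus_eq RA.R.a_assoc RA.R.l_neg)
  then show ?thesis
    using a by (metis M.M.add.inv_solve_right' M.M.minus_eq RA.R.minus_closed a_minus_def scal_closed)
qed

context
  fixes n :: nat and E :: "nat \<Rightarrow> nat \<Rightarrow> 'r"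
  assumes E: "\<And>l k. l < n \<Longrightarrow> k < n \<Longrightarrow> E l k \<in> carrier R"
begin

lemma mact_Hom: "(\<lambda>x\<in>carrier (pow_module M n). mact A M n E x) \<in> Hom A (pow_module M n) (pow_module M n)"
proof (rule Hom_restrictI[OF left_module_pow[OF M]])
  fix x assume x: "x \<in> carrier (pow_module M n)"
  show "mact A M n E x \<in> carrier (pow_module M n)"
    unfolding mact_def using x E by (intro powI M.M.msum_closed scal_closed) auto
  show "mact A M n E (x \<oplus>\<^bsub>pow_module M n\<^esub> y) = mact A M n E x \<oplus>\<^bsub>pow_module M n\<^esub> mact A M n E y"
    if y: "y \<in> carrier (pow_module M n)" for y
  proof -
    have "msum M (\<lambda>k. scal A M (E l k) ((x \<oplus>\<^bsub>pow_module M n\<^esub> y) k)) n =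
        msum M (\<lambda>k. scal A M (E l k) (x k)) n \<oplus>\<^bsub>M\<^esub> msum M (\<lambda>k. scal A M (E l k) (y k)) n" if l: "l < n" for l
      using powD[OF x] powD[OF y] E[OF l]
      by (subst M.M.msum_add[symmetric]) (auto intro!: msum_cong simp: scal_add_r)
    then show ?thesis by (auto simp: mact_def fun_eq_iff)
  qed
  show "mact A M n E (a \<odot>\<^bsub>pow_module M n\<^esub> x) = a \<odot>\<^bsub>pow_module M n\<^esub> mact A M n E x" if a: "a \<in> carrier A" for a
  proof -
    have "msum M (\<lambda>k. scal A M (E l k) ((a \<odot>\<^bsub>pow_module M n\<^esub> x) k)) n = a \<odot>\<^bsub>M\<^esub> msum M (\<lambda>k. scal A M (E l k) (x k)) n"
      if l: "l < n" for l
      using powD[OF x] E[OF l] a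
      by (subst M.smult_msum_r) (auto intro!: msum_cong simp: scal_smult)
    then show ?thesis by (auto simp: mact_def fun_eq_iff)
  qed
qed

lemma mact_closed: "x \<in> carrier (pow_module M n) \<Longrightarrow> mact A M n E x \<in> carrier (pow_module M n)"
  unfolding mact_def using E by (intro powI M.M.msum_closed scal_closed) auto

lemma mact_mact:
  assumes F: "\<And>l k. l < n \<Longrightarrow> k < n \<Longrightarrow> F l k \<in> carrier R" and x: "x \<in> carrier (pow_module M n)"
  shows "mact A M n E (mact A M n F x) = mact A M n (\<lambda>l k. msum R (\<lambda>j. E l j \<otimes>\<^bsub>R\<^esub> F j k) n) x"
proof -
  have "msum M (\<lambda>j. scal A M (E l j) (mact A M n F x j)) n =
      msum M (\<lambda>k. scal A M (msum R (\<lambda>j. E l j \<otimes>\<^bsub>R\<^esub> F j k) n) (x k)) n" if l: "l < n" for l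
  proof -
    have "msum M (\<lambda>j. scal A M (E l j) (mact A M n F x j)) n =
        msum M (\<lambda>j. msum M (\<lambda>k. scal A M (E l j \<otimes>\<^bsub>R\<^esub> F j k) (x k)) n) n"
      using powD[OF x] E[OF l] F
      by (intro msum_cong) (auto simp: mact_def scal_msum_r scal_mult intro!: msum_cong)
    also have "\<dots> = msum M (\<lambda>k. msum M (\<lambda>j. scal A M (E l j \<otimes>\<^bsub>R\<^esub> F j k) (x k)) n) n"
      using powD[OF x] E[OF l] F by (intro M.M.msum_swap) auto
    also have "\<dots> = msum M (\<lambda>k. scal A M (msum R (\<lambda>j. E l j \<otimes>\<^bsub>R\<^esub> F j k) n) (x k)) n"
      using powD[OF x] E[OF l] F by (intro msum_cong) (subst scal_msum_l; auto)
    finally show ?thesis .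
  qed
  then show ?thesis by (auto simp: mact_def fun_eq_iff)
qed

end

lemma mact_cong:
  "(\<And>l k. l < n \<Longrightarrow> k < n \<Longrightarrow> E l k = F l k) \<Longrightarrow> mact A M n E x = mact A M n F x"
  by (auto simp: mact_def fun_eq_iff intro!: msum_cong)

context
  fixes n :: nat and E :: "nat \<Rightarrow> nat \<Rightarrow> 'r"
  assumes idem: "idem_matrix R n E"
begin

lemma idem_closed: "l < n \<Longrightarrow> k < n \<Longrightarrow> E l k \<in> carrier R"
  using idem by (simp add: idem_matrix_def)

lemma mact_idem: "x \<in> carrier (pow_module M n) \<Longrightarrow> mact A M n E (mact A M n E x) = mact A M n E x"
  using idem by (subst mact_mact) (auto simp: idem_matrix_def intro!: mact_cong)

lemma carrier_Fix: "x \<in> carrier (Fix A M n E) \<longleftrightarrow> x \<in> carrier (pow_module M n) \<and> mact A M n E x = x"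
  by (simp add: Fix_def)

lemma Fix_coordinate:
  "x \<in> carrier (Fix A M n E) \<Longrightarrow> l < n \<Longrightarrow> msum M (\<lambda>k. scal A M (E l k) (x k)) n = x l"
proof -
  assume x: "x \<in> carrier (Fix A M n E)" and l: "l < n"
  then have "mact A M n E x l = x l" unfolding carrier_Fix by simp
  then show ?thesis using l by (simp add: mact_def)
qed

lemma submodule_Fix: "submodule (carrier (Fix A M n E)) A (pow_module M n)"
proof -
  note h = mact_Hom[of n E, OF idem_closed]
  note c = left_module.smult_closed[OF left_module_pow[OF M]]
    abelian_monoid.a_closed[OF abelian_group.axioms(1)[OF left_moduleD(2)[OF left_module_pow[OF M, of n]]]]
    abelian_monoid.zero_closed[OF abelian_group.axioms(1)[OF left_moduleD(2)[OF left_module_pow[OF M, of n]]]]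
  show ?thesis
  proof (rule submoduleI[OF left_module_pow[OF M]])
    show "carrier (Fix A M n E) \<subseteq> carrier (pow_module M n)" by (auto simp: carrier_Fix)
    show "\<zero>\<^bsub>pow_module M n\<^esub> \<in> carrier (Fix A M n E)"
      using Hom_zero[OF left_module_pow[OF M] left_module_pow[OF M] h] c(3)
      unfolding carrier_Fix by (simp del: pow_module_simps)
    show "x \<oplus>\<^bsub>pow_module M n\<^esub> y \<in> carrier (Fix A M n E)" if "x \<in> carrier (Fix A M n E)" "y \<in> carrier (Fix A M n E)" for x y
      using that Hom_add[OF h, of x y] c(2)[of x y]
      unfolding carrier_Fix by (simp del: pow_module_simps)
    show "a \<odot>\<^bsub>pow_module M n\<^esub> x \<in> carrier (Fix A M n E)" if "a \<in> carrier A" "x \<in> carrier (Fix A M n E)" for a x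
      using that Hom_smult[OF h, of a x] c(1)[of a x]
      unfolding carrier_Fix by (simp del: pow_module_simps)
  qed
qed

lemma Fix_eq: "Fix A M n E = (pow_module M n)\<lparr>carrier := carrier (Fix A M n E)\<rparr>"
  by (simp add: Fix_def)

lemma left_module_Fix: "left_module A (Fix A M n E)"
  by (subst Fix_eq) (rule left_module_submodule[OF left_module_pow[OF M] submodule_Fix])

lemma Fix_ops [simp]:
  "\<zero>\<^bsub>Fix A M n E\<^esub> = (\<lambda>i\<in>{..<n}. \<zero>\<^bsub>M\<^esub>)"
  "x \<oplus>\<^bsub>Fix A M n E\<^esub> y = (\<lambda>i\<in>{..<n}. x i \<oplus>\<^bsub>M\<^esub> y i)"
  "a \<odot>\<^bsub>Fix A M n E\<^esub> x = (\<lambda>i\<in>{..<n}. a \<odot>\<^bsub>M\<^esub> x i)"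
  by (simp_all add: Fix_def)

lemma Fix_proj: "k < n \<Longrightarrow> (\<lambda>x\<in>carrier (Fix A M n E). x k) \<in> Hom A (Fix A M n E) M"
  by (rule Hom_restrictI[OF left_module_Fix]) (auto simp: carrier_Fix)

lemma mact_onto_Fix:
  "(\<lambda>x\<in>carrier (pow_module M n). mact A M n E x) \<in> Hom A (pow_module M n) (Fix A M n E)"
  "(\<lambda>x\<in>carrier (pow_module M n). mact A M n E x) ` carrier (pow_module M n) = carrier (Fix A M n E)"
proof -
  have c: "mact A M n E x \<in> carrier (Fix A M n E)" if "x \<in> carrier (pow_module M n)" for x
    using that mact_idem mact_closed[of n E x] idem_closed unfolding carrier_Fix by (simp del: pow_module_simps)
  show "(\<lambda>x\<in>carrier (pow_module M n). mact A M n E x) \<in> Hom A (pow_module M n) (Fix A M n E)"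
  proof -
    have "(\<lambda>x\<in>carrier (pow_module M n). mact A M n E x) \<in>
        Hom A (pow_module M n) ((pow_module M n)\<lparr>carrier := carrier (Fix A M n E)\<rparr>)"
      by (rule Hom_into_sub[OF left_module_pow[OF M] mact_Hom[OF idem_closed]])
        (simp_all add: c del: pow_module_simps)
    then show ?thesis by (simp only: Fix_eq[symmetric])
  qed
  show "(\<lambda>x\<in>carrier (pow_module M n). mact A M n E x) ` carrier (pow_module M n) = carrier (Fix A M n E)"
  proof (intro equalityI subsetI)
    fix x assume x: "x \<in> carrier (Fix A M n E)"
    then have "x \<in> carrier (pow_module M n)" "mact A M n E x = x" by (auto simp: carrier_Fix)
    then show "x \<in> (\<lambda>x\<in>carrier (pow_module M n). mact A M n E x) ` carrier (pow_module M n)"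
      by (intro image_eqI[of _ _ x]) (auto simp del: pow_module_simps)
  qed (use c in \<open>auto simp del: pow_module_simps\<close>)
qed

text \<open>
  The \<open>k\<close>-th column of \<open>E\<close>, as the map \<open>m \<mapsto> m \<otimes> u\<close> for the \<open>k\<close>-th generator \<open>u\<close> of \<open>U\<close>.
\<close>

definition col :: "nat \<Rightarrow> 'm \<Rightarrow> nat \<Rightarrow> 'm" where
  "col k = (\<lambda>m\<in>carrier M. \<lambda>l\<in>{..<n}. scal A M (E l k) m)"

lemma col_Hom:
  assumes k: "k < n" shows "col k \<in> Hom A M (Fix A M n E)"
  unfolding col_def
proof (rule Hom_restrictI[OF M])
  fix m assume m: "m \<in> carrier M"
  have "msum M (\<lambda>j. scal A M (E l j) (scal A M (E j k) m)) n = scal A M (E l k) m" if l: "l < n" for l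
  proof -
    have "msum M (\<lambda>j. scal A M (E l j) (scal A M (E j k) m)) n = msum M (\<lambda>j. scal A M (E l j \<otimes>\<^bsub>R\<^esub> E j k) m) n"
      using idem_closed l k m by (intro msum_cong) (simp add: scal_mult)
    also have "\<dots> = scal A M (msum R (\<lambda>j. E l j \<otimes>\<^bsub>R\<^esub> E j k) n) m"
      using idem_closed l k m by (intro scal_msum_l[symmetric]) auto
    also have "\<dots> = scal A M (E l k) m" using idem l k by (simp add: idem_matrix_def)
    finally show ?thesis .
  qed
  then have "mact A M n E (\<lambda>l\<in>{..<n}. scal A M (E l k) m) = (\<lambda>l\<in>{..<n}. scal A M (E l k) m)"
    by (auto simp: mact_def fun_eq_iff cong: msum_cong)
  then show "(\<lambda>l\<in>{..<n}. scal A M (E l k) m) \<in> carrier (Fix A M n E)"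
    using idem_closed k m unfolding carrier_Fix by auto
qed (use idem_closed k in \<open>auto simp: fun_eq_iff scal_add_r scal_smult\<close>)

lemma col_apply: "m \<in> carrier M \<Longrightarrow> col k m = (\<lambda>l\<in>{..<n}. scal A M (E l k) m)"
  by (simp add: col_def)

text \<open>
  Through columns and coordinates, questions about maps from or to \<open>M \<otimes> U\<close> reduce to maps
  from or to \<open>M\<close>.
\<close>

lemma Fix_sum_col:
  assumes x: "x \<in> carrier (Fix A M n E)"
  shows "msum (Fix A M n E) (\<lambda>k. col k (x k)) n = x"
proof -
  have xM: "x k \<in> carrier M" if "k < n" for k using x that by (auto simp: carrier_Fix)
  have c: "msum (Fix A M n E) (\<lambda>k. col k (x k)) n \<in> carrier (Fix A M n E)"
    using xM Hom_closed[OF col_Hom]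
    by (intro abelian_group.msum_closed[OF left_moduleD(2)[OF left_module_Fix]]) auto
  have "msum (Fix A M n E) (\<lambda>k. col k (x k)) n l = x l" if l: "l < n" for l
  proof -
    have "msum (Fix A M n E) f j l = msum M (\<lambda>k. f k l) j" for f j
      using l by (induction j) auto
    then have "msum (Fix A M n E) (\<lambda>k. col k (x k)) n l = msum M (\<lambda>k. scal A M (E l k) (x k)) n"
      using xM l by (simp add: col_apply cong: msum_cong)
    then show ?thesis using Fix_coordinate[OF x l] by simp
  qed
  then show ?thesis using c x by (intro pow_eqI[of _ M n _ M]) (auto simp: carrier_Fix)
qed

end

end

lemma idem_matrix_dual_basis:
  assumes R: "cring R" and U: "left_module R U" and d: "dual_basis R U n u t"
  shows "idem_matrix R n (\<lambda>l k. t l (u k))"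
proof -
  interpret R: cring R by fact
  note d' = dual_basisD[OF d]
  have "msum R (\<lambda>j. t l (u j) \<otimes>\<^bsub>R\<^esub> t j (u k)) n = t l (u k)" if "l < n" "k < n" for l k
  proof -
    have ms: "msum (self_algebra R) f m = msum R f m" for f m by (induction m) auto
    have "t l (u k) = msum R (\<lambda>j. t j (u k) \<otimes>\<^bsub>R\<^esub> t l (u j)) n"
      using Hom_dual_basis[OF U left_module_self[OF R.ring_axioms] d d'(2)[OF that(1)] d'(1)[OF that(2)]]
      by (simp add: ms)
    also have "\<dots> = msum R (\<lambda>j. t l (u j) \<otimes>\<^bsub>R\<^esub> t j (u k)) n"
      using d' that by (intro msum_cong) (auto simp: R.m_comm)
    finally show ?thesis by simp
  qed
  then show ?thesis using d' by (auto simp: idem_matrix_def)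
qed

text \<open>
  Whether the tensor product is a module at all will be read off from a surjection onto it.
\<close>

lemma left_module_image:
  assumes N: "left_module A N" and p: "p \<in> Hom A N Q" and surj: "p ` carrier N = carrier Q"
    and zero: "p \<zero>\<^bsub>N\<^esub> = \<zero>\<^bsub>Q\<^esub>"
  shows "left_module A Q"
proof -
  interpret N: left_module A N by fact
  have Q: "\<exists>x\<in>carrier N. y = p x" if "y \<in> carrier Q" for y using that surj by auto
  note a = Hom_add[OF p, symmetric] and s = Hom_smult[OF p, symmetric] and c = Hom_closed[OF p]
  have "abelian_group Q"
  proof (rule abelian_groupI')
    fix x y assume xy: "x \<in> carrier Q" "y \<in> carrier Q"
    obtain x' y' where "x' \<in> carrier N" "x = p x'" "y' \<in> carrier N" "y = p y'" using Q xy by metis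
    then show "x \<oplus>\<^bsub>Q\<^esub> y \<in> carrier Q" "x \<oplus>\<^bsub>Q\<^esub> y = y \<oplus>\<^bsub>Q\<^esub> x" by (simp_all add: a c N.M.a_comm)
    fix z assume "z \<in> carrier Q"
    then obtain z' where "z' \<in> carrier N" "z = p z'" using Q by metis
    then show "x \<oplus>\<^bsub>Q\<^esub> y \<oplus>\<^bsub>Q\<^esub> z = x \<oplus>\<^bsub>Q\<^esub> (y \<oplus>\<^bsub>Q\<^esub> z)"
      using \<open>x' \<in> carrier N\<close> \<open>x = p x'\<close> \<open>y' \<in> carrier N\<close> \<open>y = p y'\<close> by (simp add: a N.M.a_assoc)
  next
    show "\<zero>\<^bsub>Q\<^esub> \<in> carrier Q" using c[of "\<zero>\<^bsub>N\<^esub>"] zero by simp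
  next
    fix x assume "x \<in> carrier Q"
    then obtain x' where x: "x' \<in> carrier N" "x = p x'" using Q by metis
    then show "\<zero>\<^bsub>Q\<^esub> \<oplus>\<^bsub>Q\<^esub> x = x" by (simp add: a zero[symmetric])
    show "\<exists>y\<in>carrier Q. y \<oplus>\<^bsub>Q\<^esub> x = \<zero>\<^bsub>Q\<^esub>"
      using x by (intro bexI[of _ "p (\<ominus>\<^bsub>N\<^esub> x')"]) (simp_all add: a c zero[symmetric] N.M.l_neg)
  qed
  moreover have "left_module_axioms A Q"
  proof
    fix a' b x y assume ab: "a' \<in> carrier A" "b \<in> carrier A" and xy: "x \<in> carrier Q" "y \<in> carrier Q"
    obtain x' y' where "x' \<in> carrier N" "x = p x'" "y' \<in> carrier N" "y = p y'" using Q xy by metis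
    then show "a' \<odot>\<^bsub>Q\<^esub> (x \<oplus>\<^bsub>Q\<^esub> y) = a' \<odot>\<^bsub>Q\<^esub> x \<oplus>\<^bsub>Q\<^esub> a' \<odot>\<^bsub>Q\<^esub> y"
      using ab by (simp add: a s N.smult_closed N.smult_r_distr)
  next
    fix a' b x assume ab: "a' \<in> carrier A" "b \<in> carrier A" and "x \<in> carrier Q"
    then obtain x' where x: "x' \<in> carrier N" "x = p x'" using Q by metis
    then show "(a' \<oplus>\<^bsub>A\<^esub> b) \<odot>\<^bsub>Q\<^esub> x = a' \<odot>\<^bsub>Q\<^esub> x \<oplus>\<^bsub>Q\<^esub> b \<odot>\<^bsub>Q\<^esub> x"
        "(a' \<otimes>\<^bsub>A\<^esub> b) \<odot>\<^bsub>Q\<^esub> x = a' \<odot>\<^bsub>Q\<^esub> (b \<odot>\<^bsub>Q\<^esub> x)"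
      using ab by (simp_all add: a s N.smult_closed N.smult_l_distr N.smult_assoc1)
  next
    fix a' x assume "a' \<in> carrier A" "x \<in> carrier Q"
    then show "a' \<odot>\<^bsub>Q\<^esub> x \<in> carrier Q" using Q[of x] by (auto simp: s c N.smult_closed)
  next
    fix x assume "x \<in> carrier Q"
    then show "\<one>\<^bsub>A\<^esub> \<odot>\<^bsub>Q\<^esub> x = x" using Q[of x] by (auto simp: s N.smult_one)
  qed
  ultimately show ?thesis by (simp add: left_module_def N.A.ring_axioms)
qed

text \<open>
  The maps \<open>m \<otimes> w \<mapsto> (t l w \<cdot> m)\<^sub>l\<close> and \<open>y \<mapsto> \<Sum> y k \<otimes> u k\<close> are inverse to each other.
  On the free abelian group, the first one kills the relations, and the composite of both differs
  from the identity by relations only; so the relations are exactly its kernel.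
\<close>

lemma tensor_iso_Fix:
  fixes R :: "('r, 'k) ring_scheme" and A :: "('r, 'a) module" and M :: "('a, 'm) module"
    and U :: "('r, 'u) module"
  assumes RA: "assoc_algebra R A" and M: "left_module A M" and U: "left_module R U"
    and d: "dual_basis R U n u t"
  shows "left_module A (tensor R A M U) \<and> (\<exists>g. g \<in> Iso A (Fix A M n (\<lambda>l k. t l (u k))) (tensor R A M U))"
proof -
  interpret RA: assoc_algebra R A by fact
  interpret M: left_module A M by fact
  interpret U: left_module R U by fact
  let ?E = "\<lambda>l k. t l (u k)"
  note d' = dual_basisD[OF d]
  have idem: "idem_matrix R n ?E" by (rule idem_matrix_dual_basis[OF RA.R.is_cring U d])
  let ?F = "Fix A M n ?E"
  have F: "left_module A ?F" by (rule left_module_Fix[OF RA M idem])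
  interpret F: left_module A ?F by (rule F)
  note sc = scal_closed[OF RA M]
  define S where "S = carrier M \<times> carrier U"
  let ?G = "free_Abelian_group S"
  define K where "K = {c :: ('m \<times> 'u) \<Rightarrow>\<^sub>0 int. Poly_Mapping.keys c \<subseteq> S}"
  interpret G: comm_group ?G by (rule abelian_free_Abelian_group)
  define Rel where "Rel = tensor_relations R A M U"
  define I where "I = generate ?G Rel"
  have K: "carrier ?G = K" by (auto simp: K_def)
  have K0 [simp]: "0 \<in> K" by (simp add: K_def)
  have frK: "frag_of (m, w) \<in> K" if "m \<in> carrier M" "w \<in> carrier U" for m w
    using that by (simp add: S_def K_def)
  have Kd: "x - y \<in> K" and Ka: "x + y \<in> K" if "x \<in> K" "y \<in> K" for x y
    using that keys_diff[of x y] keys_add[of x y] by (auto simp: K_def)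
  have RelK: "Rel \<subseteq> K"
    unfolding Rel_def tensor_relations_def
    by (auto intro!: Kd frK U.smult_closed sc)
  interpret I: subgroup I ?G unfolding I_def by (rule G.generate_is_subgroup) (use RelK K in simp)
  have IK: "I \<subseteq> K" using I.subset K by simp
  have I0: "0 \<in> I" using I.one_closed by simp
  have Ia: "x + y \<in> I" if "x \<in> I" "y \<in> I" for x y using I.m_closed[OF that] by simp
  have Im: "- x \<in> I" if "x \<in> I" for x
  proof -
    have "Poly_Mapping.keys x \<subseteq> S" using that IK by (auto simp: K_def)
    then show ?thesis using I.m_inv_closed[OF that] by (simp only: inv_free_Abelian_group)
  qed
  have Id: "x - y \<in> I" if "x \<in> I" "y \<in> I" for x y using Ia[OF that(1) Im[OF that(2)]] by simp
  have RelI: "x \<in> I" if "x \<in> Rel" for x using that unfolding I_def by (rule generate.incl)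
  have r1: "frag_of (m \<oplus>\<^bsub>M\<^esub> m', w) - frag_of (m, w) - frag_of (m', w) \<in> Rel"
    if "m \<in> carrier M" "m' \<in> carrier M" "w \<in> carrier U" for m m' w
    using that unfolding Rel_def tensor_relations_def by blast
  have r2: "frag_of (m, w \<oplus>\<^bsub>U\<^esub> w') - frag_of (m, w) - frag_of (m, w') \<in> Rel"
    if "m \<in> carrier M" "w \<in> carrier U" "w' \<in> carrier U" for m w w'
    using that unfolding Rel_def tensor_relations_def by blast
  have r3: "frag_of (scal A M r m, w) - frag_of (m, r \<odot>\<^bsub>U\<^esub> w) \<in> Rel"
    if "r \<in> carrier R" "m \<in> carrier M" "w \<in> carrier U" for m w r
    using that unfolding Rel_def tensor_relations_def by simp blast

  define \<phi> where "\<phi> = (\<lambda>(m, w). \<lambda>l\<in>{..<n}. scal A M (t l w) m)"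
  have \<phi>F: "\<phi> (m, w) \<in> carrier ?F" if m: "m \<in> carrier M" and w: "w \<in> carrier U" for m w
  proof -
    have "msum M (\<lambda>k. scal A M (t l (u k)) (scal A M (t k w) m)) n = scal A M (t l w) m" if l: "l < n" for l
    proof -
      have ms: "msum (self_algebra R) f j = msum R f j" for f j by (induction j) auto
      have "msum M (\<lambda>k. scal A M (t l (u k)) (scal A M (t k w) m)) n =
          msum M (\<lambda>k. scal A M (t k w \<otimes>\<^bsub>R\<^esub> t l (u k)) m) n"
        using d' l m w by (intro msum_cong) (simp add: scal_mult[OF RA M] RA.R.m_comm flip: scal_mult[OF RA M])
      also have "\<dots> = scal A M (msum R (\<lambda>k. t k w \<otimes>\<^bsub>R\<^esub> t l (u k)) n) m"
        using d' l m w by (intro scal_msum_l[OF RA M, symmetric]) auto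
      also have "msum R (\<lambda>k. t k w \<otimes>\<^bsub>R\<^esub> t l (u k)) n = t l w"
        using Hom_dual_basis[OF U left_module_self[OF RA.R.ring_axioms] d d'(2)[OF l] w] by (simp add: ms)
      finally show ?thesis .
    qed
    then have "mact A M n ?E (\<phi> (m, w)) = \<phi> (m, w)"
      by (auto simp: mact_def \<phi>_def fun_eq_iff cong: msum_cong)
    moreover have "\<phi> (m, w) \<in> carrier (pow_module M n)"
      using d' m w sc by (auto simp: \<phi>_def)
    ultimately show ?thesis by (simp add: carrier_Fix[OF RA M idem])
  qed
  have cgF: "comm_group (add_monoid ?F)" by (rule F.M.a_comm_group)
  obtain h where h: "h \<in> hom ?G (add_monoid ?F)" "\<And>p. p \<in> S \<Longrightarrow> h (frag_of p) = \<phi> p"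
    using comm_group.free_Abelian_group_universal[OF cgF, of \<phi> S] \<phi>F by (auto simp: S_def image_subset_iff)
  have hc: "h x \<in> carrier ?F" if "x \<in> K" for x using hom_in_carrier[OF h(1), of x] that by (simp add: K_def)
  have ha: "h (x + y) = h x \<oplus>\<^bsub>?F\<^esub> h y" if "x \<in> K" "y \<in> K" for x y
    using hom_mult[OF h(1), of x y] that by (simp add: K_def)
  have hd: "h (x - y) = h x \<ominus>\<^bsub>?F\<^esub> h y" if "x \<in> K" "y \<in> K" for x y
  proof -
    have "h x = h (x - y) \<oplus>\<^bsub>?F\<^esub> h y" using ha[OF Kd[OF that] that(2)] by simp
    then show ?thesis
      using hc[OF Kd[OF that]] hc[OF that(2)]
      by (simp add: F.M.minus_eq F.M.a_assoc F.M.r_neg del: Fix_ops[OF RA M idem])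
  qed
  have h0: "h 0 = \<zero>\<^bsub>?F\<^esub>"
    using hd[of 0 0] hc[of 0] F.M.minus_eq_zero_iff[of "h 0" "h 0"] by simp
  have hf: "h (frag_of (m, w)) = (\<lambda>l\<in>{..<n}. scal A M (t l w) m)" if "m \<in> carrier M" "w \<in> carrier U" for m w
    using h(2)[of "(m, w)"] that by (simp add: S_def \<phi>_def)
  have hRel0: "h (x - y - z) = \<zero>\<^bsub>?F\<^esub>"
    if "x \<in> K" "y \<in> K" "z \<in> K" "h x = h y \<oplus>\<^bsub>?F\<^esub> h z" for x y z
  proof -
    have "h (y + z) = h x" using ha[OF that(2,3)] that(4) by simp
    then have "h (x - (y + z)) = \<zero>\<^bsub>?F\<^esub>"
      using hd[OF that(1) Ka[OF that(2,3)]] hc[OF that(1)] F.M.minus_eq_zero_iff by simp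
    then show ?thesis by (simp add: algebra_simps)
  qed
  have hRel: "h x = \<zero>\<^bsub>?F\<^esub>" if "x \<in> Rel" for x
    using that unfolding Rel_def tensor_relations_def
  proof (elim UnE CollectE exE conjE)
    fix m m' w assume a: "x = frag_of (m \<oplus>\<^bsub>M\<^esub> m', w) - frag_of (m, w) - frag_of (m', w)"
      "m \<in> carrier M" "m' \<in> carrier M" "w \<in> carrier U"
    have "h (frag_of (m \<oplus>\<^bsub>M\<^esub> m', w)) = h (frag_of (m, w)) \<oplus>\<^bsub>?F\<^esub> h (frag_of (m', w))"
      using a d' by (auto simp: hf Fix_ops[OF RA M idem] fun_eq_iff scal_add_r[OF RA M])
    then show ?thesis unfolding a(1) using a by (intro hRel0 frK) auto
  next
    fix m w w' assume a: "x = frag_of (m, w \<oplus>\<^bsub>U\<^esub> w') - frag_of (m, w) - frag_of (m, w')"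
      "m \<in> carrier M" "w \<in> carrier U" "w' \<in> carrier U"
    have "h (frag_of (m, w \<oplus>\<^bsub>U\<^esub> w')) = h (frag_of (m, w)) \<oplus>\<^bsub>?F\<^esub> h (frag_of (m, w'))"
      using a d' by (auto simp: hf Fix_ops[OF RA M idem] fun_eq_iff scal_add_l[OF RA M] Hom_add[OF d'(2)])
    then show ?thesis unfolding a(1) using a by (intro hRel0 frK) auto
  next
    fix r m w assume a: "x = frag_of (r \<odot>\<^bsub>restrict_scalars A M\<^esub> m, w) - frag_of (m, r \<odot>\<^bsub>U\<^esub> w)"
      "r \<in> carrier R" "m \<in> carrier M" "w \<in> carrier U"
    have k: "frag_of (scal A M r m, w) \<in> K" "frag_of (m, r \<odot>\<^bsub>U\<^esub> w) \<in> K"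
      using a by (auto intro!: frK U.smult_closed sc)
    have "h (frag_of (scal A M r m, w)) = h (frag_of (m, r \<odot>\<^bsub>U\<^esub> w))"
      using a d'
      by (auto simp: hf U.smult_closed sc fun_eq_iff Hom_smult[OF d'(2)] RA.R.m_comm scal_mult[OF RA M, symmetric])
    then show ?thesis unfolding a(1) using hd[OF k] hc[OF k(2)] F.M.minus_eq_zero_iff by simp
  qed
  have hI: "h x = \<zero>\<^bsub>?F\<^esub>" if "x \<in> I" for x
    using that unfolding I_def
  proof (induction x rule: generate.induct)
    case one then show ?case using h0 by simp
  next
    case (incl x) then show ?case by (rule hRel)
  next
    case (inv x)
    then have "x \<in> K" using RelK by auto
    moreover from this have "inv\<^bsub>?G\<^esub> x = - x" by (intro inv_free_Abelian_group) (simp add: K_def)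
    ultimately show ?case
      using hd[of 0 x] h0 hRel[OF inv] F.M.minus_eq_zero_iff[of "\<zero>\<^bsub>?F\<^esub>" "\<zero>\<^bsub>?F\<^esub>"] by simp
  next
    case (eng x y)
    have "x \<in> K" "y \<in> K" using eng(1,2) IK unfolding I_def by auto
    then show ?case using ha[of x y] eng F.M.l_zero[OF F.M.zero_closed] by simp
  qed

  \<comment> \<open>Modulo the relations each element is a combination of the \<open>u k\<close>.\<close>
  define B where "B y = (\<Sum>k<n. frag_of (y k, u k))" for y :: "nat \<Rightarrow> 'm"
  have z2: "frag_of (m, \<zero>\<^bsub>U\<^esub>) \<in> I" if "m \<in> carrier M" for m
    using Im[OF RelI[OF r2[OF that U.M.zero_closed U.M.zero_closed]]] by simp
  have z1: "frag_of (\<zero>\<^bsub>M\<^esub>, w) \<in> I" if "w \<in> carrier U" for w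
    using Im[OF RelI[OF r1[OF M.M.zero_closed M.M.zero_closed that]]] by simp
  have sumI: "frag_of (m, msum U f j) - (\<Sum>k<j. frag_of (m, f k)) \<in> I"
    if m: "m \<in> carrier M" and f: "\<And>k. k < n \<Longrightarrow> f k \<in> carrier U" and j: "j \<le> n" for m f j
    using j
  proof (induction j)
    case 0 then show ?case using z2[OF m] by simp
  next
    case (Suc j)
    have "frag_of (m, msum U f j \<oplus>\<^bsub>U\<^esub> f j) - frag_of (m, msum U f j) - frag_of (m, f j) \<in> I"
      using Suc f m by (intro RelI r2) auto
    from Ia[OF this Suc.IH] Suc.prems show ?case by (simp add: algebra_simps)
  qed
  have sumI': "(\<Sum>k<j. g k) - (\<Sum>k<j. g' k) \<in> I" if "\<And>k. k < j \<Longrightarrow> g k - g' k \<in> I" for g g' :: "nat \<Rightarrow> _" and j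
    using that
  proof (induction j)
    case (Suc j)
    have "(\<Sum>k<j. g k) - (\<Sum>k<j. g' k) + (g j - g' j) \<in> I" using Suc by (intro Ia) auto
    then show ?case by (simp add: algebra_simps)
  qed (simp add: I0)
  have Bd: "B (h (x - y)) - (B (h x) - B (h y)) \<in> I" if "x \<in> K" "y \<in> K" for x y
  proof -
    have c: "h x k \<in> carrier M" "h y k \<in> carrier M" "h (x - y) k \<in> carrier M" if k: "k < n" for k
      using hc[OF \<open>x \<in> K\<close>] hc[OF \<open>y \<in> K\<close>] hc[OF Kd[OF \<open>x \<in> K\<close> \<open>y \<in> K\<close>]] k by (auto simp: carrier_Fix[OF RA M idem])
    have s: "h x k = h (x - y) k \<oplus>\<^bsub>M\<^esub> h y k" if "k < n" for k
    proof -
      have "h x = h (x - y) \<oplus>\<^bsub>?F\<^esub> h y" using ha[OF Kd[OF \<open>x \<in> K\<close> \<open>y \<in> K\<close>] \<open>y \<in> K\<close>] by simp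
      then show ?thesis using that by (simp add: Fix_ops[OF RA M idem])
    qed
    have "frag_of (h (x - y) k, u k) - (frag_of (h x k, u k) - frag_of (h y k, u k)) \<in> I" if k: "k < n" for k
      using Im[OF RelI[OF r1[OF c(3)[OF k] c(2)[OF k] d'(1)[OF k]]]] s[OF k] by (simp add: algebra_simps)
    from sumI'[OF this, of n] show ?thesis by (simp add: B_def sum_subtractf)
  qed
  have BI: "x - B (h x) \<in> I" if "x \<in> K" for x
  proof -
    have xS: "Poly_Mapping.keys x \<subseteq> S" using that by (simp add: K_def)
    then show ?thesis
    proof (induction x rule: free_Abelian_group_induct[consumes 1, case_names 1 2 3])
      case 1
      have "0 - B (h 0) = - (\<Sum>k<n. frag_of (\<zero>\<^bsub>M\<^esub>, u k))"
        by (simp add: h0 B_def Fix_ops[OF RA M idem])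
      moreover have "(\<Sum>k<n. frag_of (\<zero>\<^bsub>M\<^esub>, u k)) - (\<Sum>k<n. 0) \<in> I"
        using z1 d'(1) by (intro sumI') auto
      ultimately show ?case using Im by simp
    next
      case (2 x y)
      have "x - B (h x) - (y - B (h y)) - (B (h (x - y)) - (B (h x) - B (h y))) \<in> I"
        using Id[OF Id[OF 2(3,4)] Bd[of x y]] 2(1,2) by (simp add: K_def)
      then show ?case by (simp add: algebra_simps)
    next
      case (3 p)
      then obtain m w where p: "p = (m, w)" "m \<in> carrier M" "w \<in> carrier U" by (auto simp: S_def)
      have "frag_of (m, msum U (\<lambda>k. t k w \<odot>\<^bsub>U\<^esub> u k) n) - (\<Sum>k<n. frag_of (m, t k w \<odot>\<^bsub>U\<^esub> u k)) \<in> I"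
        using p d' by (intro sumI) (auto intro!: U.smult_closed)
      then have 1: "frag_of (m, w) - (\<Sum>k<n. frag_of (m, t k w \<odot>\<^bsub>U\<^esub> u k)) \<in> I" using d'(3)[OF p(3)] by simp
      have 2: "(\<Sum>k<n. frag_of (scal A M (t k w) m, u k)) - (\<Sum>k<n. frag_of (m, t k w \<odot>\<^bsub>U\<^esub> u k)) \<in> I"
        using p d' by (intro sumI' RelI r3) auto
      have "B (h (frag_of p)) = (\<Sum>k<n. frag_of (scal A M (t k w) m, u k))"
        using p by (simp add: B_def hf)
      then show ?case using Id[OF 1 2] p(1) by (simp add: algebra_simps)
    qed
  qed

  \<comment> \<open>The action of the algebra respects the relations.\<close>
  define act :: "'a \<Rightarrow> ('m \<times> 'u \<Rightarrow>\<^sub>0 int) \<Rightarrow> ('m \<times> 'u \<Rightarrow>\<^sub>0 int)"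
    where "act a = frag_extend (\<lambda>(m, w). frag_of (a \<odot>\<^bsub>M\<^esub> m, w))" for a
  have act_diff: "act a (x - y) = act a x - act a y" for a x y by (simp add: act_def frag_extend_diff)
  have act0: "act a 0 = 0" for a by (simp add: act_def)
  have act_fr: "act a (frag_of (m, w)) = frag_of (a \<odot>\<^bsub>M\<^esub> m, w)" for a m w by (simp add: act_def)
  have actK: "act a x \<in> K" and hact: "h (act a x) = a \<odot>\<^bsub>?F\<^esub> h x" if a: "a \<in> carrier A" and x: "x \<in> K" for a x
  proof -
    have xS: "Poly_Mapping.keys x \<subseteq> S" using x by (simp add: K_def)
    then have "act a x \<in> K \<and> h (act a x) = a \<odot>\<^bsub>?F\<^esub> h x"
    proof (induction x rule: free_Abelian_group_induct[consumes 1, case_names 1 2 3])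
      case 1 then show ?case using F.smult_zero_r[OF a] by (simp add: act0 h0)
    next
      case (2 x y)
      have xy: "x \<in> K" "y \<in> K" using 2(1,2) by (auto simp: K_def)
      have "a \<odot>\<^bsub>?F\<^esub> (h x \<ominus>\<^bsub>?F\<^esub> h y) = a \<odot>\<^bsub>?F\<^esub> h x \<ominus>\<^bsub>?F\<^esub> a \<odot>\<^bsub>?F\<^esub> h y"
        using F.smult_minus_r[OF a, of "h y"] F.smult_r_distr[OF a] hc[of x] hc[of y] xy by (simp add: F.M.minus_eq)
      then show ?case using 2 xy Kd[of "act a x" "act a y"] hd[of x y] hd[of "act a x" "act a y"] by (simp add: act_diff)
    next
      case (3 p)
      then obtain m w where p: "p = (m, w)" "m \<in> carrier M" "w \<in> carrier U" by (auto simp: S_def)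
      then show ?case using a frK[of "a \<odot>\<^bsub>M\<^esub> m" w] d'
        by (auto simp: act_fr hf M.smult_closed Fix_ops[OF RA M idem] fun_eq_iff scal_smult[OF RA M])
    qed
    then show "act a x \<in> K" "h (act a x) = a \<odot>\<^bsub>?F\<^esub> h x" by auto
  qed
  have inI: "x \<in> I \<longleftrightarrow> h x = \<zero>\<^bsub>?F\<^esub>" if "x \<in> K" for x
  proof
    assume hx: "h x = \<zero>\<^bsub>?F\<^esub>"
    have "B (h x) \<in> I" using BI[of 0] Im[of "0 - B (h 0)"] h0 hx by simp
    from Ia[OF BI[OF that] this] show "x \<in> I" by simp
  qed (rule hI)

  \<comment> \<open>The elements of the tensor product are the fibres of \<open>h\<close>.\<close>
  let ?P = "pre_tensor M U"
  have P: "carrier ?P = K" "\<And>x y. x \<oplus>\<^bsub>?P\<^esub> y = x + y" "\<And>a x. a \<odot>\<^bsub>?P\<^esub> x = act a x"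
    by (auto simp: pre_tensor_def S_def act_def K_def)
  define cos where "cos x = I +>\<^bsub>?P\<^esub> x" for x
  have cos: "cos x = {z. z - x \<in> I}" for x
    unfolding cos_def a_r_coset_def' P(2) by force
  have cosh: "cos x = {z \<in> K. h z = h x}" if x: "x \<in> K" for x
  proof -
    have "z - x \<in> I \<longleftrightarrow> z \<in> K \<and> h z = h x" for z
    proof
      assume zx: "z - x \<in> I"
      then have "z - x \<in> K" using IK by blast
      from Ka[OF this x] have z: "z \<in> K" by simp
      then show "z \<in> K \<and> h z = h x"
        using hI[OF zx] hd[OF z x] F.M.minus_eq_zero_iff[OF hc[OF z] hc[OF x]] by simp
    next
      assume "z \<in> K \<and> h z = h x"
      then show "z - x \<in> I"
        using inI[OF Kd, of z x] x hd[of z x] F.M.minus_eq_zero_iff[OF hc hc, of z x] by simp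
    qed
    then show ?thesis unfolding cos by blast
  qed
  let ?T = "tensor R A M U"
  have Tdef: "?T = quot ?P I"
    by (simp add: tensor_def I_def S_def Rel_def)
  have Tc: "carrier ?T = cos ` K"
    unfolding Tdef quot_def A_RCOSETS_def' cos_def P(1) by auto
  have Tadd: "cos x \<oplus>\<^bsub>?T\<^esub> cos y = cos (x + y)" if x: "x \<in> K" and y: "y \<in> K" for x y
  proof -
    have "cos x \<oplus>\<^bsub>?T\<^esub> cos y = {p + q | p q. p \<in> cos x \<and> q \<in> cos y}"
      unfolding Tdef quot_def by (auto simp: set_add_def' P(2))
    also have "\<dots> = cos (x + y)"
    proof (intro equalityI subsetI)
      fix z assume "z \<in> {p + q | p q. p \<in> cos x \<and> q \<in> cos y}"
      then obtain p q where "z = p + q" "p - x \<in> I" "q - y \<in> I" by (auto simp: cos)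
      then show "z \<in> cos (x + y)" using Ia[of "p - x" "q - y"] by (simp add: cos algebra_simps)
    next
      fix z assume z: "z \<in> cos (x + y)"
      then have "z = (z - y) + y" "z - y \<in> cos x" "y \<in> cos y" using I0 by (auto simp: cos algebra_simps)
      then show "z \<in> {p + q | p q. p \<in> cos x \<and> q \<in> cos y}" by blast
    qed
    finally show ?thesis .
  qed
  have Tsm: "a \<odot>\<^bsub>?T\<^esub> cos x = cos (act a x)" if a: "a \<in> carrier A" and x: "x \<in> K" for a x
  proof -
    have "a \<odot>\<^bsub>?T\<^esub> cos x = (\<Union>z\<in>cos x. cos (act a z))"
      unfolding Tdef quot_def by (simp add: P(3) cos_def)
    also have "\<dots> = (\<Union>z\<in>cos x. cos (act a x))"
      by (intro SUP_cong refl) (use a x in \<open>auto simp: cosh actK hact\<close>)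
    also have "\<dots> = cos (act a x)"
    proof -
      have "x \<in> cos x" using I0 by (simp add: cos)
      then show ?thesis by auto
    qed
    finally show ?thesis .
  qed
  have hB: "B y \<in> K" "h (B y) = y" if y: "y \<in> carrier ?F" for y
  proof -
    have yM: "y k \<in> carrier M" if "k < n" for k using that y by (auto simp: carrier_Fix[OF RA M idem])
    have "h (\<Sum>k<j. frag_of (y k, u k)) = msum ?F (\<lambda>k. \<phi> (y k, u k)) j \<and> (\<Sum>k<j. frag_of (y k, u k)) \<in> K" if "j \<le> n" for j
      using that
    proof (induction j)
      case 0 then show ?case using h0 by simp
    next
      case (Suc j)
      then have c: "frag_of (y j, u j) \<in> K" using yM d'(1) by (intro frK) auto
      have "h (frag_of (y j, u j)) = \<phi> (y j, u j)" using yM d'(1) Suc(2) by (intro h(2)) (auto simp: S_def)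
      then show ?case using Suc ha[of "\<Sum>k<j. frag_of (y k, u k)" "frag_of (y j, u j)"]
          Ka[of "\<Sum>k<j. frag_of (y k, u k)" "frag_of (y j, u j)"] c by simp
    qed
    from this[of n] have 1: "h (B y) = msum ?F (\<lambda>k. \<phi> (y k, u k)) n" "B y \<in> K" by (auto simp: B_def)
    have "msum ?F (\<lambda>k. \<phi> (y k, u k)) n = msum ?F (\<lambda>k. col A M n ?E k (y k)) n"
      using yM by (intro msum_cong) (simp add: \<phi>_def col_apply[OF RA M idem])
    also have "\<dots> = y" by (rule Fix_sum_col[OF RA M idem y])
    finally show "B y \<in> K" "h (B y) = y" using 1 by auto
  qed
  have cos_eq: "cos x = cos y \<longleftrightarrow> h x = h y" if "x \<in> K" "y \<in> K" for x y
  proof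
    assume "cos x = cos y"
    moreover have "x \<in> cos x" using I0 by (simp add: cos)
    ultimately show "h x = h y" using cosh[OF that(2)] by auto
  qed (simp add: cosh that)
  define g where "g = (\<lambda>y\<in>carrier ?F. cos (B y))"
  have g: "g y = cos x" if "x \<in> K" "h x = y" for x y
    using hc[OF that(1)] hB[of y] that by (simp add: g_def cos_eq)
  have "g \<in> Hom A ?F ?T"
    unfolding g_def
  proof (rule Hom_restrictI[OF F])
    fix y assume y: "y \<in> carrier ?F"
    show "cos (B y) \<in> carrier ?T" using hB[OF y] Tc by auto
    show "cos (B (y \<oplus>\<^bsub>?F\<^esub> z)) = cos (B y) \<oplus>\<^bsub>?T\<^esub> cos (B z)" if z: "z \<in> carrier ?F" for z
      using Tadd[OF hB(1)[OF y] hB(1)[OF z]] hB[OF F.M.a_closed[OF y z]] hB[OF y] hB[OF z]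
        ha[OF hB(1)[OF y] hB(1)[OF z]] Ka[OF hB(1)[OF y] hB(1)[OF z]]
      by (simp add: cos_eq)
    show "cos (B (a \<odot>\<^bsub>?F\<^esub> y)) = a \<odot>\<^bsub>?T\<^esub> cos (B y)" if a: "a \<in> carrier A" for a
      using Tsm[OF a hB(1)[OF y]] hB[OF F.smult_closed[OF a y]] hB[OF y]
        hact[OF a hB(1)[OF y]] actK[OF a hB(1)[OF y]]
      by (simp add: cos_eq)
  qed
  moreover have "inj_on g (carrier ?F)"
    by (rule inj_onI) (simp add: g_def cos_eq hB)
  moreover have surj: "g ` carrier ?F = carrier ?T"
  proof (intro equalityI subsetI)
    fix C assume "C \<in> carrier ?T"
    then obtain x where x: "C = cos x" "x \<in> K" using Tc by auto
    then have "C = g (h x)" using g by simp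
    then show "C \<in> g ` carrier ?F" using hc[OF x(2)] by simp
  qed (use hB Tc in \<open>auto simp: g_def\<close>)
  ultimately have giso: "g \<in> Iso A ?F ?T" by (rule IsoI)
  have "g \<zero>\<^bsub>?F\<^esub> = cos 0" by (rule g[OF K0 h0])
  also have "\<dots> = \<zero>\<^bsub>?T\<^esub>" by (simp add: Tdef quot_def cos)
  finally have "left_module A ?T"
    by (intro left_module_image[OF F IsoD(1)[OF giso] surj])
  with giso show ?thesis by blast
qed

section \<open>Filtered modules\<close>

text \<open>
  A filtration peeled off from the top: each step splits off the last quotient \<open>\<Delta> l \<otimes> U\<close>, given
  by an idempotent matrix, and continues with the kernel. Induction over such filtrations deals
  with one epimorphism at a time instead of a chain of submodules.
\<close>

inductive dfilt ::
  "('r, 'k) ring_scheme \<Rightarrow> ('r, 'a) module \<Rightarrow> 'l set \<Rightarrow> ('l \<Rightarrow> ('a, 'd) module) \<Rightarrow> ('a, 'm) module \<Rightarrow> bool"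
  for R A \<Lambda> \<Delta> where
  zero: "carrier M = {\<zero>\<^bsub>M\<^esub>} \<Longrightarrow> dfilt R A \<Lambda> \<Delta> M"
| step: "l \<in> \<Lambda> \<Longrightarrow> idem_matrix R n E \<Longrightarrow> g \<in> Hom A M (Fix A (\<Delta> l) n E) \<Longrightarrow>
    g ` carrier M = carrier (Fix A (\<Delta> l) n E) \<Longrightarrow>
    dfilt R A \<Lambda> \<Delta> (M\<lparr>carrier := a_kernel M (Fix A (\<Delta> l) n E) g\<rparr>) \<Longrightarrow> dfilt R A \<Lambda> \<Delta> M"

lemma dfilt_mono: "dfilt R A \<Lambda> \<Delta> M \<Longrightarrow> \<Lambda> \<subseteq> \<Lambda>' \<Longrightarrow> dfilt R A \<Lambda>' \<Delta> M"
  by (induction rule: dfilt.induct) (auto intro: dfilt.intros)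

lemma idem_matrix_one:
  assumes "cring R" shows "idem_matrix R 1 (\<lambda>_ _. \<one>\<^bsub>R\<^esub>)"
proof -
  interpret cring R by fact
  show ?thesis by (simp add: idem_matrix_def)
qed

text \<open>The complementary idempotent \<open>1 - E\<close>.\<close>

definition comp_matrix :: "('r, 'k) ring_scheme \<Rightarrow> (nat \<Rightarrow> nat \<Rightarrow> 'r) \<Rightarrow> nat \<Rightarrow> nat \<Rightarrow> 'r" where
  "comp_matrix R E l k = (if l = k then \<one>\<^bsub>R\<^esub> else \<zero>\<^bsub>R\<^esub>) \<ominus>\<^bsub>R\<^esub> E l k"

lemma (in abelian_group) msum_minus:
  assumes "\<And>k. k < n \<Longrightarrow> f k \<in> carrier G" "\<And>k. k < n \<Longrightarrow> g k \<in> carrier G"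
  shows "msum G (\<lambda>k. f k \<ominus> g k) n = msum G f n \<ominus> msum G g n"
  using assms
proof (induction n)
  case 0
  show ?case using minus_eq_zero_iff[OF zero_closed zero_closed] by simp
next
  case (Suc n)
  then show ?case by (simp add: minus_eq minus_add a_ac)
qed

lemma idem_comp_matrix:
  fixes R (structure)
  assumes R: "cring R" and E: "idem_matrix R n E"
  shows "idem_matrix R n (comp_matrix R E)"
proof -
  interpret cring R by fact
  have c: "E l k \<in> carrier R" if "l < n" "k < n" for l k using E that by (simp add: idem_matrix_def)
  have cc: "comp_matrix R E l k \<in> carrier R" if "l < n" "k < n" for l k using c that by (simp add: comp_matrix_def)
  have "msum R (\<lambda>j. comp_matrix R E l j \<otimes> comp_matrix R E j k) n = comp_matrix R E l k" if l: "l < n" and k: "k < n" for l k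
  proof -
    have "comp_matrix R E l j \<otimes> comp_matrix R E j k =
        (if j = l then comp_matrix R E l k else \<zero>) \<ominus> ((if j = k then E l k else \<zero>) \<ominus> E l j \<otimes> E j k)" if j: "j < n" for j
      using c[OF l j] c[OF j k] c[OF l k]
      by (auto simp: comp_matrix_def minus_eq l_distr r_distr l_minus r_minus minus_add a_ac l_neg r_neg)
    then have "msum R (\<lambda>j. comp_matrix R E l j \<otimes> comp_matrix R E j k) n =
        msum R (\<lambda>j. (if j = l then comp_matrix R E l k else \<zero>) \<ominus> ((if j = k then E l k else \<zero>) \<ominus> E l j \<otimes> E j k)) n"
      by (intro msum_cong) simp
    also have "\<dots> = msum R (\<lambda>j. if j = l then comp_matrix R E l k else \<zero>) n \<ominus>
        (msum R (\<lambda>j. if j = k then E l k else \<zero>) n \<ominus> msum R (\<lambda>j. E l j \<otimes> E j k) n)"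
      using c cc l k by (subst msum_minus; (subst msum_minus)?) auto
    also have "\<dots> = comp_matrix R E l k"
      using E cc[OF l k] c[OF l k] l k by (simp add: msum_delta idem_matrix_def minus_eq r_neg)
    finally show ?thesis .
  qed
  then show ?thesis using cc by (simp add: idem_matrix_def)
qed

lemma assoc_algebraD:
  assumes "assoc_algebra R A" shows "cring R" "ring A"
proof -
  interpret RA: assoc_algebra R A by fact
  show "cring R" by (rule RA.R.is_cring)
  show "ring A" using assms by (simp add: assoc_algebra_def)
qed

text \<open>
  So the kernel of the projection of \<open>M\<^sup>n\<close> onto \<open>M \<otimes> U\<close> is \<open>M \<otimes> U'\<close> for a complement \<open>U'\<close>
  of \<open>U\<close>.
\<close>

lemma mact_comp_matrix:
  assumes RA: "assoc_algebra R A" and M: "left_module A M" and E: "idem_matrix R n E"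
    and x: "x \<in> carrier (pow_module M n)"
  shows "mact A M n (comp_matrix R E) x = x \<longleftrightarrow> mact A M n E x = \<zero>\<^bsub>pow_module M n\<^esub>"
proof -
  interpret RA: assoc_algebra R A by fact
  interpret M: left_module A M by fact
  have c: "E l k \<in> carrier R" if "l < n" "k < n" for l k using E that by (simp add: idem_matrix_def)
  note sc = scal_closed[OF RA M]
  have xk: "x k \<in> carrier M" if "k < n" for k using powD[OF x that] .
  have *: "msum M (\<lambda>k. scal A M (comp_matrix R E l k) (x k)) n = x l \<ominus>\<^bsub>M\<^esub> msum M (\<lambda>k. scal A M (E l k) (x k)) n"
    if l: "l < n" for l
  proof -
    have "msum M (\<lambda>k. scal A M (comp_matrix R E l k) (x k)) n =
        msum M (\<lambda>k. (if k = l then x l else \<zero>\<^bsub>M\<^esub>) \<ominus>\<^bsub>M\<^esub> scal A M (E l k) (x k)) n"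
      using c[OF l] xk
      by (intro msum_cong) (auto simp: comp_matrix_def scal_minus_l[OF RA M] scal_one[OF RA M] scal_zero_l[OF RA M])
    also have "\<dots> = msum M (\<lambda>k. if k = l then x l else \<zero>\<^bsub>M\<^esub>) n \<ominus>\<^bsub>M\<^esub> msum M (\<lambda>k. scal A M (E l k) (x k)) n"
      using c[OF l] xk l by (intro M.M.msum_minus) (auto intro: sc)
    also have "msum M (\<lambda>k. if k = l then x l else \<zero>\<^bsub>M\<^esub>) n = x l" using l xk by (intro M.M.msum_delta) auto
    finally show ?thesis .
  qed
  have mc: "msum M (\<lambda>k. scal A M (E l k) (x k)) n \<in> carrier M" if "l < n" for l
    using c[OF that] xk by (intro M.M.msum_closed sc) auto
  have eq: "x l \<ominus>\<^bsub>M\<^esub> y = x l \<longleftrightarrow> y = \<zero>\<^bsub>M\<^esub>" if "l < n" "y \<in> carrier M" for l y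
  proof -
    have "x l \<ominus>\<^bsub>M\<^esub> y = x l \<Longrightarrow> y = \<zero>\<^bsub>M\<^esub>"
      using that xk[OF that(1)] M.M.add.l_cancel[of "x l" "\<ominus>\<^bsub>M\<^esub> y" "\<zero>\<^bsub>M\<^esub>"] M.M.minus_minus[of y]
      by (simp add: M.M.minus_eq)
    then show ?thesis using that xk[OF that(1)] by (auto simp: M.M.minus_eq)
  qed
  have "mact A M n (comp_matrix R E) x = x \<longleftrightarrow> (\<forall>l<n. mact A M n (comp_matrix R E) x l = x l)"
  proof
    assume a: "\<forall>l<n. mact A M n (comp_matrix R E) x l = x l"
    have "x \<in> extensional {..<n}" using x by (simp add: PiE_iff)
    then show "mact A M n (comp_matrix R E) x = x"
      using a by (intro extensionalityI[of _ "{..<n}"]) (auto simp: mact_def)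
  qed simp
  also have "\<dots> \<longleftrightarrow> (\<forall>l<n. msum M (\<lambda>k. scal A M (E l k) (x k)) n = \<zero>\<^bsub>M\<^esub>)"
    using * mc eq by (auto simp: mact_def)
  also have "\<dots> \<longleftrightarrow> mact A M n E x = \<zero>\<^bsub>pow_module M n\<^esub>"
    by (auto simp: mact_def fun_eq_iff)
  finally show ?thesis .
qed

lemma dfilt_extension:
  assumes RA: "assoc_algebra R A" and D: "\<And>l. l \<in> \<Lambda> \<Longrightarrow> left_module A (\<Delta> l)"
    and Q: "dfilt R A \<Lambda> \<Delta> Q" and lQ: "left_module A Q" and lM: "left_module A M"
    and f: "f \<in> Hom A M Q" "f ` carrier M = carrier Q"
    and ker: "dfilt R A \<Lambda> \<Delta> (M\<lparr>carrier := a_kernel M Q f\<rparr>)"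
  shows "dfilt R A \<Lambda> \<Delta> M"
  using Q lQ lM f ker
proof (induction arbitrary: M f rule: dfilt.induct)
  case (zero Q)
  have "a_kernel M Q f = carrier M"
    using zero(1) Hom_closed[OF zero(4)] by (auto simp: set_eq_iff)
  then show ?case using zero by simp
next
  case (step l n E g Q)
  let ?F = "Fix A (\<Delta> l) n E"
  let ?h = "compose (carrier M) g f"
  let ?K = "{x \<in> carrier M. f x \<in> a_kernel Q ?F g}"
  have F: "left_module A ?F" by (rule left_module_Fix[OF RA D[OF step(1)] step(2)])
  have kQ: "submodule (a_kernel Q ?F g) A Q" by (rule submodule_kernel[OF step(7) F step(3)])
  have K: "submodule ?K A M" by (rule submodule_preimage[OF step(8,7,9) kQ])
  have h: "?h \<in> Hom A M ?F" by (rule Hom_compose[OF step(8,9,3)])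
  have kh: "a_kernel M ?F ?h = ?K" using Hom_closed[OF step(9)] by (auto simp: set_eq_iff)
  have hs: "?h ` carrier M = carrier ?F"
    using step(4,10) by (simp add: image_image[symmetric] cong: image_cong)
  let ?f = "restrict f ?K"
  have f: "?f \<in> Hom A (M\<lparr>carrier := ?K\<rparr>) (Q\<lparr>carrier := a_kernel Q ?F g\<rparr>)"
    by (rule Hom_into_sub[OF left_module_submodule[OF step(8) K] Hom_restrict_sub[OF step(8) K step(9)]]) simp
  have "dfilt R A \<Lambda> \<Delta> (M\<lparr>carrier := ?K\<rparr>)"
  proof (rule step.IH[OF left_module_submodule[OF step(7) kQ] left_module_submodule[OF step(8) K] f])
    show "?f ` carrier (M\<lparr>carrier := ?K\<rparr>) = carrier (Q\<lparr>carrier := a_kernel Q ?F g\<rparr>)"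
    proof (intro equalityI subsetI)
      fix y assume "y \<in> carrier (Q\<lparr>carrier := a_kernel Q ?F g\<rparr>)"
      then have y: "y \<in> a_kernel Q ?F g" "y \<in> carrier Q" by auto
      then obtain x where "x \<in> carrier M" "f x = y" using step(10) by (metis imageE)
      then show "y \<in> ?f ` carrier (M\<lparr>carrier := ?K\<rparr>)" using y by (intro image_eqI[of _ _ x]) auto
    qed auto
    have "a_kernel (M\<lparr>carrier := ?K\<rparr>) (Q\<lparr>carrier := a_kernel Q ?F g\<rparr>) ?f = a_kernel M Q f"
      using Hom_zero[OF step(7) F step(3)] Hom_closed[OF step(9)] by (auto simp: set_eq_iff)
    then show "dfilt R A \<Lambda> \<Delta> (M\<lparr>carrier := ?K\<rparr>\<lparr>carrier := a_kernel (M\<lparr>carrier := ?K\<rparr>) (Q\<lparr>carrier := a_kernel Q ?F g\<rparr>) ?f\<rparr>)"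
      using step(11) by simp
  qed
  then show ?case
    using dfilt.step[where M=M and g="?h" and \<Delta>=\<Delta> and l=l and \<Lambda>=\<Lambda>, OF step(1,2) h hs] unfolding kh by simp
qed

lemma dfilt_iso:
  assumes RA: "assoc_algebra R A" and D: "\<And>l. l \<in> \<Lambda> \<Longrightarrow> left_module A (\<Delta> l)"
    and Q: "dfilt R A \<Lambda> \<Delta> Q" and lQ: "left_module A Q" and lM: "left_module A M" and f: "f \<in> Iso A M Q"
  shows "dfilt R A \<Lambda> \<Delta> M"
proof (rule dfilt_extension[OF RA D Q lQ lM IsoD(1)[OF f] IsoD(3)[OF f]])
  interpret M: left_module A M by fact
  have "a_kernel M Q f = {\<zero>\<^bsub>M\<^esub>}"
    using inj_on_iff_kernel[OF lM lQ IsoD(1)[OF f]] IsoD(2)[OF f] Hom_zero[OF lM lQ IsoD(1)[OF f]] by auto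
  then show "dfilt R A \<Lambda> \<Delta> (M\<lparr>carrier := a_kernel M Q f\<rparr>)" by (intro dfilt.zero) simp
qed auto

lemma dfilt_Fix:
  assumes RA: "assoc_algebra R A" and D: "left_module A (\<Delta> l)" and l: "l \<in> \<Lambda>" and E: "idem_matrix R n E"
  shows "dfilt R A \<Lambda> \<Delta> (Fix A (\<Delta> l) n E)"
proof -
  let ?F = "Fix A (\<Delta> l) n E"
  have F: "left_module A ?F" by (rule left_module_Fix[OF RA D E])
  interpret F: left_module A ?F by (rule F)
  have "a_kernel ?F ?F (\<lambda>x\<in>carrier ?F. x) = {\<zero>\<^bsub>?F\<^esub>}"
    using F.M.zero_closed by (auto simp del: Fix_ops[OF RA D E])
  then have "dfilt R A \<Lambda> \<Delta> (?F\<lparr>carrier := a_kernel ?F ?F (\<lambda>x\<in>carrier ?F. x)\<rparr>)"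
    by (intro dfilt.zero) simp
  then show ?thesis by (intro dfilt.step[where \<Delta>=\<Delta> and l=l, OF l E Hom_id[OF F]]) auto
qed

text \<open>
  The case \<open>U = R\<close>, by which \<open>\<Delta> l\<close> itself counts as a filtered module.
\<close>

lemma Fix_one:
  assumes RA: "assoc_algebra R A" and M: "left_module A M"
  shows "(\<lambda>x\<in>carrier M. \<lambda>k\<in>{..<1}. x) \<in> Iso A M (Fix A M 1 (\<lambda>_ _. \<one>\<^bsub>R\<^esub>))"
proof (rule IsoI)
  interpret RA: assoc_algebra R A by fact
  interpret M: left_module A M by fact
  let ?f = "\<lambda>x\<in>carrier M. \<lambda>k\<in>{..<1::nat}. x"
  note id = idem_matrix_one[OF RA.R.is_cring]
  have c: "y \<in> carrier (Fix A M 1 (\<lambda>_ _. \<one>\<^bsub>R\<^esub>)) \<longleftrightarrow> y \<in> {..<1} \<rightarrow>\<^sub>E carrier M" for y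
  proof -
    have "mact A M 1 (\<lambda>_ _. \<one>\<^bsub>R\<^esub>) y = y" if "y \<in> {..<1} \<rightarrow>\<^sub>E carrier M"
      using that scal_one[OF RA M, of "y 0"]
      by (intro extensionalityI[of _ "{..<1}"]) (auto simp: mact_def PiE_iff)
    then show ?thesis by (simp only: carrier_Fix[OF RA M id] pow_module_simps) blast
  qed
  show "?f \<in> Hom A M (Fix A M 1 (\<lambda>_ _. \<one>\<^bsub>R\<^esub>))"
    by (rule Hom_restrictI[OF M]) (auto simp: c Fix_ops[OF RA M id] fun_eq_iff simp del: One_nat_def)
  show "inj_on ?f (carrier M)"
  proof (rule inj_onI)
    fix x y assume xy: "x \<in> carrier M" "y \<in> carrier M" "?f x = ?f y"
    then have "?f x 0 = ?f y 0" by (simp only:)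
    then show "x = y" using xy(1,2) by simp
  qed
  show "?f ` carrier M = carrier (Fix A M 1 (\<lambda>_ _. \<one>\<^bsub>R\<^esub>))"
  proof (intro equalityI subsetI)
    fix y assume "y \<in> carrier (Fix A M 1 (\<lambda>_ _. \<one>\<^bsub>R\<^esub>))"
    then have y: "y \<in> {..<1} \<rightarrow>\<^sub>E carrier M" using c by blast
    then have "y = ?f (y 0)" by (intro extensionalityI[of _ "{..<1}"]) (auto simp: PiE_iff)
    then show "y \<in> ?f ` carrier M" using y by blast
  qed (auto simp: c split: if_splits simp del: One_nat_def)
qed

lemma dfilt_standard:
  assumes RA: "assoc_algebra R A" and D: "\<And>l. l \<in> \<Lambda> \<Longrightarrow> left_module A (\<Delta> l)" and l: "l \<in> \<Lambda>"
  shows "dfilt R A \<Lambda> \<Delta> (\<Delta> l)"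
proof -
  have id: "idem_matrix R 1 (\<lambda>_ _. \<one>\<^bsub>R\<^esub>)" by (rule idem_matrix_one[OF assoc_algebraD(1)[OF RA]])
  show ?thesis
    by (rule dfilt_iso[OF RA D dfilt_Fix[where \<Delta>=\<Delta> and l=l, OF RA D[OF l] l id] left_module_Fix[OF RA D[OF l] id] D[OF l] Fix_one[OF RA D[OF l]]])
qed

lemma dsum_insert_kernel:
  assumes A: "ring A" and M: "\<And>j. j \<in> insert i I \<Longrightarrow> left_module A (M j)" and i: "i \<notin> I"
  defines "D \<equiv> dsum (insert i I) M"
  shows "\<exists>p\<in>Hom A D (M i). p ` carrier D = carrier (M i) \<and>
    (\<exists>q. q \<in> Iso A (D\<lparr>carrier := a_kernel D (M i) p\<rparr>) (dsum I M))"
proof -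
  have M': "\<forall>j\<in>insert i I. left_module A (M j)" using M by blast
  have lD: "left_module A D" unfolding D_def by (rule left_module_dsum[OF A M])
  have lMi: "left_module A (M i)" using M by blast
  note m = dsum_insert_maps[OF A M' i, folded D_def]
  obtain p q h k where p: "p \<in> Hom A D (M i)" and q: "q \<in> Hom A D (dsum I M)" and h: "h \<in> Hom A (M i) D"
    and k: "k \<in> Hom A (dsum I M) D" and s: "\<And>x. x \<in> carrier D \<Longrightarrow> h (p x) \<oplus>\<^bsub>D\<^esub> k (q x) = x"
    and ph: "\<And>x. x \<in> carrier (M i) \<Longrightarrow> p (h x) = x"
    and qk: "\<And>x. x \<in> carrier (dsum I M) \<Longrightarrow> q (k x) = x"
    and pk: "\<And>x. x \<in> carrier (dsum I M) \<Longrightarrow> p (k x) = \<zero>\<^bsub>M i\<^esub>"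
    using that[OF m(1-5) m(6) m(8) m(9)] by blast
  interpret D: left_module A D by (rule lD)
  let ?K = "a_kernel D (M i) p"
  have sK: "submodule ?K A D" by (rule submodule_kernel[OF lD lMi p])
  have ps: "p ` carrier D = carrier (M i)"
  proof (intro equalityI subsetI)
    fix x assume x: "x \<in> carrier (M i)"
    then show "x \<in> p ` carrier D" using ph[OF x] Hom_closed[OF h x] by (metis imageI)
  qed (use Hom_closed[OF p] in auto)
  have "restrict q ?K \<in> Iso A (D\<lparr>carrier := ?K\<rparr>) (dsum I M)"
  proof (rule IsoI[OF Hom_restrict_sub[OF lD sK q]])
    show "inj_on (restrict q ?K) (carrier (D\<lparr>carrier := ?K\<rparr>))"
    proof (rule inj_onI)
      fix x y assume "x \<in> carrier (D\<lparr>carrier := ?K\<rparr>)" "y \<in> carrier (D\<lparr>carrier := ?K\<rparr>)"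
        and xy: "restrict q ?K x = restrict q ?K y"
      then have "x \<in> carrier D" "p x = \<zero>\<^bsub>M i\<^esub>" "y \<in> carrier D" "p y = \<zero>\<^bsub>M i\<^esub>" "q x = q y" by auto
      then show "x = y" using s[of x] s[of y] by simp
    qed
    show "restrict q ?K ` carrier (D\<lparr>carrier := ?K\<rparr>) = carrier (dsum I M)"
    proof (intro equalityI subsetI)
      fix x assume x: "x \<in> carrier (dsum I M)"
      then have "k x \<in> ?K" using pk[OF x] Hom_closed[OF k x] by simp
      then show "x \<in> restrict q ?K ` carrier (D\<lparr>carrier := ?K\<rparr>)"
        using qk[OF x] by (intro image_eqI[of _ _ "k x"]) simp_all
    next
      fix x assume "x \<in> restrict q ?K ` carrier (D\<lparr>carrier := ?K\<rparr>)"
      then obtain z where "z \<in> carrier D" "x = q z" by auto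
      then show "x \<in> carrier (dsum I M)" using Hom_closed[OF q] by blast
    qed
  qed
  then show ?thesis using p ps by blast
qed

lemma dfilt_dsum:
  assumes RA: "assoc_algebra R A" and D: "\<And>l. l \<in> \<Lambda> \<Longrightarrow> left_module A (\<Delta> l)" and fin: "finite I"
    and M: "\<And>i. i \<in> I \<Longrightarrow> left_module A (M i)" "\<And>i. i \<in> I \<Longrightarrow> dfilt R A \<Lambda> \<Delta> (M i)"
  shows "dfilt R A \<Lambda> \<Delta> (dsum I M)"
  using fin M
proof (induction I rule: finite_induct)
  case empty
  then show ?case by (intro dfilt.zero) auto
next
  case (insert i I)
  have A: "ring A" by (rule assoc_algebraD(2)[OF RA])
  let ?D = "dsum (insert i I) M"
  have lD: "left_module A ?D" by (rule left_module_dsum[OF A insert(4)])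
  have lI: "left_module A (dsum I M)" by (rule left_module_dsum[OF A]) (use insert in auto)
  have lMi: "left_module A (M i)" using insert by blast
  obtain p q where p: "p \<in> Hom A ?D (M i)" "p ` carrier ?D = carrier (M i)"
    and q: "q \<in> Iso A (?D\<lparr>carrier := a_kernel ?D (M i) p\<rparr>) (dsum I M)"
    using dsum_insert_kernel[where M=M, OF A insert(4) insert(2)] by blast
  have "dfilt R A \<Lambda> \<Delta> (dsum I M)" using insert by auto
  from dfilt_iso[OF RA D this lI left_module_submodule[OF lD submodule_kernel[OF lD lMi p(1)]] q]
  show ?case using dfilt_extension[OF RA D insert(5)[of i] lMi lD p] by auto
qed

lemma finitely_generated_zero:
  assumes "left_module A M" "carrier M = {\<zero>\<^bsub>M\<^esub>}" shows "finitely_generated A M"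
  by (rule fgp_finitely_generated[OF fgp_zero[OF assms]])

lemma finitely_generated_dsum:
  assumes A: "ring A" and fin: "finite I"
    and M: "\<And>i. i \<in> I \<Longrightarrow> left_module A (M i)" "\<And>i. i \<in> I \<Longrightarrow> finitely_generated A (M i)"
  shows "finitely_generated A (dsum I M)"
  using fin M
proof (induction I rule: finite_induct)
  case empty
  then show ?case by (intro finitely_generated_zero left_module_dsum[OF A]) auto
next
  case (insert i I)
  let ?D = "dsum (insert i I) M"
  have lD: "left_module A ?D" by (rule left_module_dsum[OF A insert(4)])
  have lI: "left_module A (dsum I M)" by (rule left_module_dsum[OF A]) (use insert in auto)
  have lMi: "left_module A (M i)" using insert by blast
  obtain p q where p: "p \<in> Hom A ?D (M i)" "p ` carrier ?D = carrier (M i)"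
    and q: "q \<in> Iso A (?D\<lparr>carrier := a_kernel ?D (M i) p\<rparr>) (dsum I M)"
    using dsum_insert_kernel[where M=M, OF A insert(4) insert(2)] by blast
  have lK: "left_module A (?D\<lparr>carrier := a_kernel ?D (M i) p\<rparr>)"
    by (rule left_module_submodule[OF lD submodule_kernel[OF lD lMi p(1)]])
  obtain r where r: "r \<in> Iso A (dsum I M) (?D\<lparr>carrier := a_kernel ?D (M i) p\<rparr>)"
    using isomorphic_sym[OF lK, of "dsum I M"] q by (auto simp: isomorphic_def)
  have "finitely_generated A (dsum I M)" using insert by auto
  from finitely_generated_image[OF lI lK IsoD(1)[OF r] IsoD(3)[OF r] this]
  show ?case using finitely_generated_extension[OF lD lMi p] insert(5) by auto
qed

lemma finitely_generated_Fix:
  assumes RA: "assoc_algebra R A" and M: "left_module A M" "finitely_generated A M" and E: "idem_matrix R n E"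
  shows "finitely_generated A (Fix A M n E)"
proof (rule finitely_generated_image[OF left_module_pow[OF M(1)] left_module_Fix[OF RA M(1) E] mact_onto_Fix[OF RA M(1) E]])
  show "finitely_generated A (pow_module M n)"
    unfolding pow_module_def by (rule finitely_generated_dsum[OF assoc_algebraD(2)[OF RA]]) (use M in auto)
qed

lemma dfilt_finitely_generated:
  assumes RA: "assoc_algebra R A" and D: "\<And>l. l \<in> \<Lambda> \<Longrightarrow> \<Delta> l \<in> fg_modules A"
    and Q: "dfilt R A \<Lambda> \<Delta> Q" and lQ: "left_module A Q"
  shows "finitely_generated A Q"
  using Q lQ
proof (induction rule: dfilt.induct)
  case (zero Q)
  then show ?case by (intro finitely_generated_zero)
next
  case (step l n E g Q)
  have Dl: "left_module A (\<Delta> l)" "finitely_generated A (\<Delta> l)" using D[OF step(1)] by (auto simp: fg_modules_def)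
  have F: "left_module A (Fix A (\<Delta> l) n E)" by (rule left_module_Fix[OF RA Dl(1) step(2)])
  show ?case
    by (rule finitely_generated_extension[OF step(7) F step(3,4) finitely_generated_Fix[OF RA Dl step(2)]
          step.IH[OF left_module_submodule[OF step(7) submodule_kernel[OF step(7) F step(3)]]]])
qed

lemma quot_map:
  assumes N: "left_module A N" and K: "submodule K A N"
  defines "\<pi> \<equiv> \<lambda>x\<in>carrier N. K +>\<^bsub>N\<^esub> x"
  shows "\<pi> \<in> Hom A N (quot N K)" "\<pi> ` carrier N = carrier (quot N K)"
    "\<And>x y. x \<in> carrier N \<Longrightarrow> y \<in> carrier N \<Longrightarrow> \<pi> x = \<pi> y \<longleftrightarrow> x \<ominus>\<^bsub>N\<^esub> y \<in> K"
    "left_module A (quot N K)"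
proof -
  interpret N: left_module A N by fact
  note K' = submoduleD[OF K]
  have sub: "abelian_subgroup K N"
    using K N.M.abelian_group_axioms by (intro abelian_subgroupI3 additive_subgroupI) (auto simp: submodule_def)
  interpret K: abelian_subgroup K N by (rule sub)
  have cos: "K +>\<^bsub>N\<^esub> x = {z \<in> carrier N. z \<ominus>\<^bsub>N\<^esub> x \<in> K}" if x: "x \<in> carrier N" for x
  proof (intro equalityI subsetI)
    fix z assume "z \<in> K +>\<^bsub>N\<^esub> x"
    then obtain k where "k \<in> K" "z = k \<oplus>\<^bsub>N\<^esub> x" by (auto simp: a_r_coset_def')
    then show "z \<in> {z \<in> carrier N. z \<ominus>\<^bsub>N\<^esub> x \<in> K}" using x K'(1) by (auto simp: N.M.minus_eq N.M.a_assoc N.M.r_neg)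
  next
    fix z assume z: "z \<in> {z \<in> carrier N. z \<ominus>\<^bsub>N\<^esub> x \<in> K}"
    then have "z = (z \<ominus>\<^bsub>N\<^esub> x) \<oplus>\<^bsub>N\<^esub> x" using x by (simp add: N.M.minus_eq N.M.a_assoc N.M.l_neg)
    then show "z \<in> K +>\<^bsub>N\<^esub> x" using z by (auto simp: a_r_coset_def')
  qed
  have eq: "K +>\<^bsub>N\<^esub> x = K +>\<^bsub>N\<^esub> y \<longleftrightarrow> x \<ominus>\<^bsub>N\<^esub> y \<in> K" if "x \<in> carrier N" "y \<in> carrier N" for x y
  proof
    assume e: "K +>\<^bsub>N\<^esub> x = K +>\<^bsub>N\<^esub> y"
    have "x \<in> K +>\<^bsub>N\<^esub> x" using that K'(2) by (simp add: cos N.M.minus_eq N.M.r_neg)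
    then show "x \<ominus>\<^bsub>N\<^esub> y \<in> K" unfolding e using that by (simp add: cos)
  next
    assume k: "x \<ominus>\<^bsub>N\<^esub> y \<in> K"
    have tele: "z \<ominus>\<^bsub>N\<^esub> y = (z \<ominus>\<^bsub>N\<^esub> x) \<oplus>\<^bsub>N\<^esub> (x \<ominus>\<^bsub>N\<^esub> y)"
      if "z \<in> carrier N" "x \<in> carrier N" "y \<in> carrier N" for z x y
      using that by (simp add: N.M.minus_eq N.M.a_assoc N.M.r_neg1)
    have "y \<ominus>\<^bsub>N\<^esub> x = \<ominus>\<^bsub>N\<^esub> (x \<ominus>\<^bsub>N\<^esub> y)"
      using that by (simp add: N.M.minus_eq N.M.minus_add N.M.a_comm)
    then have k': "y \<ominus>\<^bsub>N\<^esub> x \<in> K" using K'(5)[OF k] by simp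
    have "z \<ominus>\<^bsub>N\<^esub> x \<in> K \<longleftrightarrow> z \<ominus>\<^bsub>N\<^esub> y \<in> K" if z: "z \<in> carrier N" for z
    proof
      assume "z \<ominus>\<^bsub>N\<^esub> x \<in> K"
      from K'(3)[OF this k] show "z \<ominus>\<^bsub>N\<^esub> y \<in> K" by (simp only: tele[OF z \<open>x \<in> carrier N\<close> \<open>y \<in> carrier N\<close>])
    next
      assume "z \<ominus>\<^bsub>N\<^esub> y \<in> K"
      from K'(3)[OF this k'] show "z \<ominus>\<^bsub>N\<^esub> x \<in> K" by (simp only: tele[OF z \<open>y \<in> carrier N\<close> \<open>x \<in> carrier N\<close>])
    qed
    then show "K +>\<^bsub>N\<^esub> x = K +>\<^bsub>N\<^esub> y" using that by (auto simp: cos)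
  qed
  have mem: "x \<in> K +>\<^bsub>N\<^esub> x" if "x \<in> carrier N" for x
    using that K'(2) by (simp add: cos N.M.minus_eq N.M.r_neg)
  have sm: "a \<odot>\<^bsub>quot N K\<^esub> (K +>\<^bsub>N\<^esub> x) = K +>\<^bsub>N\<^esub> (a \<odot>\<^bsub>N\<^esub> x)" if a: "a \<in> carrier A" and x: "x \<in> carrier N" for a x
  proof -
    have "K +>\<^bsub>N\<^esub> (a \<odot>\<^bsub>N\<^esub> z) = K +>\<^bsub>N\<^esub> (a \<odot>\<^bsub>N\<^esub> x)" if z: "z \<in> K +>\<^bsub>N\<^esub> x" for z
    proof -
      have z': "z \<in> carrier N" "z \<ominus>\<^bsub>N\<^esub> x \<in> K" using z cos[OF x] by auto
      have "a \<odot>\<^bsub>N\<^esub> z \<ominus>\<^bsub>N\<^esub> a \<odot>\<^bsub>N\<^esub> x = a \<odot>\<^bsub>N\<^esub> (z \<ominus>\<^bsub>N\<^esub> x)"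
        using a x z' by (simp add: N.M.minus_eq N.smult_r_distr N.smult_minus_r)
      then show ?thesis using eq[of "a \<odot>\<^bsub>N\<^esub> z" "a \<odot>\<^bsub>N\<^esub> x"] a x z' K'(4) by (simp add: N.smult_closed)
    qed
    then have "(\<Union>z\<in>K +>\<^bsub>N\<^esub> x. K +>\<^bsub>N\<^esub> (a \<odot>\<^bsub>N\<^esub> z)) = (\<Union>z\<in>K +>\<^bsub>N\<^esub> x. K +>\<^bsub>N\<^esub> (a \<odot>\<^bsub>N\<^esub> x))" by (intro SUP_cong refl)
    then show ?thesis using mem[OF x] by (auto simp: quot_def)
  qed
  show \<pi>: "\<pi> \<in> Hom A N (quot N K)" unfolding \<pi>_def
  proof (rule Hom_restrictI[OF N])
    show "K +>\<^bsub>N\<^esub> (x \<oplus>\<^bsub>N\<^esub> y) = (K +>\<^bsub>N\<^esub> x) \<oplus>\<^bsub>quot N K\<^esub> (K +>\<^bsub>N\<^esub> y)" if "x \<in> carrier N" "y \<in> carrier N" for x y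
      using K.a_rcos_sum[OF that] by (simp add: quot_def)
  qed (simp_all add: sm, auto simp: quot_def A_RCOSETS_def')
  show \<pi>s: "\<pi> ` carrier N = carrier (quot N K)"
    by (auto simp: \<pi>_def quot_def A_RCOSETS_def')
  show "\<pi> x = \<pi> y \<longleftrightarrow> x \<ominus>\<^bsub>N\<^esub> y \<in> K" if "x \<in> carrier N" "y \<in> carrier N" for x y
    using eq that by (simp add: \<pi>_def)
  have "\<pi> \<zero>\<^bsub>N\<^esub> = \<zero>\<^bsub>quot N K\<^esub>"
  proof -
    have "z \<ominus>\<^bsub>N\<^esub> \<zero>\<^bsub>N\<^esub> = z" if "z \<in> carrier N" for z using that by (simp add: N.M.minus_eq)
    then show ?thesis using cos[of "\<zero>\<^bsub>N\<^esub>"] K'(1) by (auto simp: \<pi>_def quot_def)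
  qed
  from left_module_image[OF N \<pi> \<pi>s this] show "left_module A (quot N K)" .
qed

lemma quot_iso:
  assumes N: "left_module A N" and L: "left_module A L" and g: "g \<in> Hom A N L" and s: "g ` carrier N = carrier L"
  shows "\<exists>h. h \<in> Iso A (quot N (a_kernel N L g)) L"
proof -
  interpret N: left_module A N by fact
  interpret L: left_module A L by fact
  let ?K = "a_kernel N L g"
  note q = quot_map[OF N submodule_kernel[OF N L g]]
  let ?\<pi> = "\<lambda>x\<in>carrier N. ?K +>\<^bsub>N\<^esub> x"
  have e: "?\<pi> x = ?\<pi> y \<longleftrightarrow> g x = g y" if "x \<in> carrier N" "y \<in> carrier N" for x y
    using q(3)[OF that] Hom_diff_eq_zero[OF N L g that] that Hom_closed[OF g] L.M.minus_eq_zero_iff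
    by (simp add: restrict_def)
  have z: "?\<pi> \<zero>\<^bsub>N\<^esub> = \<zero>\<^bsub>quot N ?K\<^esub>" using Hom_zero[OF N q(4) q(1)] .
  obtain h where h: "h \<in> Hom A (quot N ?K) L" "\<And>x. x \<in> carrier N \<Longrightarrow> h (?\<pi> x) = g x"
  proof (rule Hom_factor[OF N q(4) L q(1) g q(2)])
    fix x assume x: "x \<in> carrier N" and "?\<pi> x = \<zero>\<^bsub>quot N ?K\<^esub>"
    then have "?\<pi> x = ?\<pi> \<zero>\<^bsub>N\<^esub>" using z by simp
    then show "g x = \<zero>\<^bsub>L\<^esub>" using e[OF x N.M.zero_closed] Hom_zero[OF N L g] by simp
  qed blast
  have rep: "\<exists>x\<in>carrier N. C = ?\<pi> x" if "C \<in> carrier (quot N ?K)" for C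
    using that unfolding q(2)[symmetric] by (rule imageE) blast
  have "h \<in> Iso A (quot N ?K) L"
  proof (rule IsoI[OF h(1)])
    show "inj_on h (carrier (quot N ?K))"
    proof (rule inj_onI)
      fix C D assume "C \<in> carrier (quot N ?K)" "D \<in> carrier (quot N ?K)" and CD: "h C = h D"
      then obtain x y where xy: "x \<in> carrier N" "C = ?\<pi> x" "y \<in> carrier N" "D = ?\<pi> y" using rep by blast
      then have "g x = g y" using CD h(2)[OF xy(1)] h(2)[OF xy(3)] by simp
      then show "C = D" using e[OF xy(1,3)] xy(2,4) by simp
    qed
    show "h ` carrier (quot N ?K) = carrier L"
    proof (intro equalityI subsetI)
      fix y assume "y \<in> carrier L"
      then obtain x where x: "x \<in> carrier N" "y = g x" using s by blast
      then have "y = h (?\<pi> x)" using h(2) by simp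
      then show "y \<in> h ` carrier (quot N ?K)" using Hom_closed[OF q(1) x(1)] by (rule image_eqI)
    qed (use Hom_closed[OF h(1)] in blast)
  qed
  then show ?thesis by blast
qed

lemma assoc_algebra_self:
  assumes "cring R" shows "assoc_algebra R (self_algebra R)"
proof -
  interpret cring R by fact
  have L: "left_module R (self_algebra R)" by (rule left_module_self[OF ring_axioms])
  have "module R (self_algebra R)" using L left_module_iff_module[OF assms] by blast
  moreover have "ring (self_algebra R)"
  proof (rule ringI)
    show "abelian_group (self_algebra R)" using left_moduleD(2)[OF L] .
    show "monoid (self_algebra R)" by (rule monoidI) (auto simp: m_assoc)
  qed (auto simp: l_distr r_distr)
  ultimately show ?thesis
    by (auto simp: assoc_algebra_def assoc_algebra_axioms_def m_ac)
qed

lemma scal_self [simp]: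
  assumes "cring R" "r \<in> carrier R"
  shows "scal (self_algebra R) U r x = r \<odot>\<^bsub>U\<^esub> x"
proof -
  interpret cring R by fact
  show ?thesis using assms(2) by (simp add: scal_def)
qed

text \<open>
  The columns of \<open>E\<close> generate its image, and the coordinates are dual to them.
\<close>

lemma R_proj_of_matrix:
  fixes R :: "('r, 'k) ring_scheme" (structure)
  assumes R: "cring R" and E: "idem_matrix R n E"
  defines "U \<equiv> Fix (self_algebra R) (self_algebra R) n E"
  shows "\<exists>u t. left_module R U \<and> dual_basis R U n u t \<and> (\<forall>l<n. \<forall>k<n. t l (u k) = E l k)"
proof -
  interpret cring R by fact
  let ?S = "self_algebra R"
  have RS: "assoc_algebra R ?S" by (rule assoc_algebra_self[OF R])
  have S: "left_module R ?S" by (rule left_module_self[OF ring_axioms])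
  have S': "left_module ?S ?S"
  proof -
    have "self_algebra ?S = ?S" by (simp add: self_algebra_def)
    then show ?thesis using left_module_self[OF assoc_algebraD(2)[OF RS]] by simp
  qed
  have Hom_eq': "Hom ?S M ?S = Hom R M ?S" for M :: "('r, 'x) module" by (simp add: Hom_def)
  have Hom_eq2: "Hom ?S ?S M = Hom R ?S M" for M :: "('r, 'x) module" by (simp add: Hom_def)
  have U': "left_module ?S U" unfolding U_def by (rule left_module_Fix[OF RS S' E])
  have U: "left_module R U"
    using U' ring_axioms unfolding left_module_def left_module_axioms_def by simp
  define u where "u k = col ?S ?S n E k \<one>" for k
  define t where "t l = (\<lambda>x\<in>carrier U. x l)" for l
  have col: "col ?S ?S n E k \<in> Hom R ?S U" if "k < n" for k
    using col_Hom[OF RS S' E that] unfolding U_def Hom_eq2 .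
  have tH: "t l \<in> Hom R U ?S" if "l < n" for l
    using Fix_proj[OF RS S' E that] unfolding U_def[symmetric] t_def Hom_eq' .
  have uU: "u k \<in> carrier U" if "k < n" for k using Hom_closed[OF col[OF that], of \<one>] by (simp add: u_def)
  have "msum U (\<lambda>k. t k x \<odot>\<^bsub>U\<^esub> u k) n = x" if x: "x \<in> carrier U" for x
  proof -
    have xk: "x k \<in> carrier R" if "k < n" for k using Hom_closed[OF tH[OF that] x] x by (simp add: t_def)
    have "msum U (\<lambda>k. t k x \<odot>\<^bsub>U\<^esub> u k) n = msum U (\<lambda>k. col ?S ?S n E k (x k)) n"
    proof (rule msum_cong)
      fix k assume k: "k < n"
      show "t k x \<odot>\<^bsub>U\<^esub> u k = col ?S ?S n E k (x k)"
        using Hom_smult[OF col[OF k] xk[OF k], of \<one>] xk[OF k] x by (simp add: t_def u_def)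
    qed
    also have "\<dots> = x" unfolding U_def by (rule Fix_sum_col[OF RS S' E]) (use x in \<open>simp add: U_def\<close>)
    finally show ?thesis .
  qed
  then have d: "dual_basis R U n u t" using uU tH by (auto simp: dual_basis_def)
  have "t l (u k) = E l k" if "l < n" "k < n" for l k
  proof -
    have c: "E l k \<in> carrier R" using E that by (simp add: idem_matrix_def)
    have "t l (u k) = u k l" using uU[OF that(2)] by (simp add: t_def)
    also have "\<dots> = E l k"
      using c that by (simp add: u_def col_apply[OF RS S' E] scal_self[OF R])
    finally show ?thesis .
  qed
  then show ?thesis using U d by blast
qed

lemma Fix_cong:
  assumes "\<And>l k. l < n \<Longrightarrow> k < n \<Longrightarrow> E l k = E' l k" shows "Fix A M n E = Fix A M n E'"
proof -
  have "mact A M n E = mact A M n E'"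
    by (rule ext) (auto simp: mact_def fun_eq_iff assms intro!: msum_cong)
  then show ?thesis by (simp add: Fix_def)
qed

lemma fgp_R_proj: "U \<in> R_proj R \<longleftrightarrow> fgp R U"
  unfolding R_proj_def by (rule fg_projectives_iff)

lemma tensor_of_matrix:
  assumes RA: "assoc_algebra R A" and M: "left_module A M" and E: "idem_matrix R n E"
  obtains U where "U \<in> R_proj R" "isomorphic A (Fix A M n E) (tensor R A M U)"
    "U = Fix (self_algebra R) (self_algebra R) n E" "left_module A (tensor R A M U)"
proof -
  let ?U = "Fix (self_algebra R) (self_algebra R) n E"
  have R: "cring R" by (rule assoc_algebraD(1)[OF RA])
  obtain u t where ut: "left_module R ?U" "dual_basis R ?U n u t" "\<And>l k. l < n \<Longrightarrow> k < n \<Longrightarrow> t l (u k) = E l k"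
    using R_proj_of_matrix[OF R E] by blast
  have 1: "?U \<in> R_proj R" unfolding fgp_R_proj fgp_def using ut(1,2) by blast
  have F: "Fix A M n (\<lambda>l k. t l (u k)) = Fix A M n E" by (rule Fix_cong) (rule ut(3))
  show thesis
    using that[OF 1] tensor_iso_Fix[OF RA M ut(1,2)] unfolding F isomorphic_def by blast
qed

lemma tensor_matrix:
  assumes RA: "assoc_algebra R A" and M: "left_module A M" and U: "U \<in> R_proj R"
  obtains n E where "idem_matrix R n E" "isomorphic A (tensor R A M U) (Fix A M n E)"
    "left_module A (tensor R A M U)"
proof -
  have R: "cring R" by (rule assoc_algebraD(1)[OF RA])
  obtain n u t where ut: "left_module R U" "dual_basis R U n u t" using U unfolding fgp_R_proj fgp_def by blast
  have E: "idem_matrix R n (\<lambda>l k. t l (u k))" by (rule idem_matrix_dual_basis[OF R ut])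
  show thesis
    using that[OF E] tensor_iso_Fix[OF RA M ut] isomorphic_sym[OF left_module_Fix[OF RA M E]]
    unfolding isomorphic_def by blast
qed

lemma dfilt_imp_filtered:
  assumes RA: "assoc_algebra R A" and D: "\<And>l. l \<in> \<Lambda> \<Longrightarrow> left_module A (\<Delta> l)"
    and M: "dfilt R A \<Lambda> \<Delta> M" and lM: "left_module A M"
  shows "filtered A (Delta_tilde R A \<Lambda> \<Delta>) M"
  using M lM
proof (induction rule: dfilt.induct)
  case (zero M)
  show ?case unfolding filtered_def
    by (intro exI[of _ 0] exI[of _ "\<lambda>_. {\<zero>\<^bsub>M\<^esub>}"]) (use zero submodule_zero[OF zero(2)] in auto)
next
  case (step l n E g M)
  let ?F = "Fix A (\<Delta> l) n E"
  let ?K = "a_kernel M ?F g"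
  have F: "left_module A ?F" by (rule left_module_Fix[OF RA D[OF step(1)] step(2)])
  have K: "submodule ?K A M" by (rule submodule_kernel[OF step(7) F step(3)])
  have lK: "left_module A (M\<lparr>carrier := ?K\<rparr>)" by (rule left_module_submodule[OF step(7) K])
  obtain m H where H: "H 0 = {\<zero>\<^bsub>M\<^esub>}" "H m = ?K" "\<And>i. i \<le> m \<Longrightarrow> submodule (H i) A (M\<lparr>carrier := ?K\<rparr>)"
     "\<And>i. i < m \<Longrightarrow> H i \<subseteq> H (Suc i) \<and>
        (\<exists>L\<in>Delta_tilde R A \<Lambda> \<Delta>. isomorphic A (quot (M\<lparr>carrier := H (Suc i)\<rparr>) (H i)) L)"
    using step.IH[OF lK] unfolding filtered_def by auto
  define H' where "H' i = (if i \<le> m then H i else carrier M)" for i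
  have sub: "submodule (H' i) A M" if "i \<le> Suc m" for i
  proof (cases "i \<le> m")
    case True
    then show ?thesis using submodule_of_submodule[OF step(7) K H(3)] by (simp add: H'_def)
  next
    case False
    then show ?thesis using submodule_carrier[OF step(7)] by (simp add: H'_def)
  qed
  have "H' i \<subseteq> H' (Suc i) \<and>
        (\<exists>L\<in>Delta_tilde R A \<Lambda> \<Delta>. isomorphic A (quot (M\<lparr>carrier := H' (Suc i)\<rparr>) (H' i)) L)" if i: "i < Suc m" for i
  proof (cases "i < m")
    case True
    then show ?thesis using H(4)[OF True] by (simp add: H'_def)
  next
    case False
    then have i: "i = m" using i by simp
    obtain U where U: "U \<in> R_proj R" "isomorphic A ?F (tensor R A (\<Delta> l) U)"
      using tensor_of_matrix[OF RA D[OF step(1)] step(2)] by blast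
    have "tensor R A (\<Delta> l) U \<in> Delta_tilde R A \<Lambda> \<Delta>" using U(1) step(1) unfolding Delta_tilde_def by blast
    moreover have "isomorphic A (quot M ?K) ?F"
      using quot_iso[OF step(7) F step(3,4)] by (auto simp: isomorphic_def)
    then have "isomorphic A (quot M ?K) (tensor R A (\<Delta> l) U)"
      using isomorphic_trans[OF quot_map(4)[OF step(7) K]] U(2) by blast
    ultimately show ?thesis using i H(2) by (auto simp: H'_def)
  qed
  then show ?case unfolding filtered_def
    using H(1) sub by (intro exI[of _ "Suc m"] exI[of _ H']) (auto simp: H'_def)
qed

lemma filtered_imp_dfilt:
  assumes RA: "assoc_algebra R A" and D: "\<And>l. l \<in> \<Lambda> \<Longrightarrow> left_module A (\<Delta> l)"
    and M: "filtered A (Delta_tilde R A \<Lambda> \<Delta>) M" and lM: "left_module A M"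
  shows "dfilt R A \<Lambda> \<Delta> M"
proof -
  obtain m H where H: "H 0 = {\<zero>\<^bsub>M\<^esub>}" "H m = carrier M" "\<And>i. i \<le> m \<Longrightarrow> submodule (H i) A M"
     "\<And>i. i < m \<Longrightarrow> H i \<subseteq> H (Suc i) \<and>
        (\<exists>L\<in>Delta_tilde R A \<Lambda> \<Delta>. isomorphic A (quot (M\<lparr>carrier := H (Suc i)\<rparr>) (H i)) L)"
    using M unfolding filtered_def by auto
  have "i \<le> m \<Longrightarrow> dfilt R A \<Lambda> \<Delta> (M\<lparr>carrier := H i\<rparr>)" for i
  proof (induction i)
    case 0
    then show ?case using H(1) by (intro dfilt.zero) simp
  next
    case (Suc i)
    let ?N = "M\<lparr>carrier := H (Suc i)\<rparr>"
    have N: "left_module A ?N" by (rule left_module_submodule[OF lM H(3)]) (use Suc in simp)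
    have sub: "H i \<subseteq> H (Suc i)" using H(4)[of i] Suc by auto
    have K: "submodule (H i) A ?N"
      by (rule submoduleI[OF N]) (use submoduleD[OF H(3)[of i]] sub Suc in auto)
    interpret N: left_module A ?N by (rule N)
    note q = quot_map[OF N K]
    obtain l U where lU: "l \<in> \<Lambda>" "U \<in> R_proj R" "isomorphic A (quot ?N (H i)) (tensor R A (\<Delta> l) U)"
      using H(4)[of i] Suc unfolding Delta_tilde_def by auto
    obtain n E where E: "idem_matrix R n E" "isomorphic A (tensor R A (\<Delta> l) U) (Fix A (\<Delta> l) n E)"
      using tensor_matrix[OF RA D[OF lU(1)] lU(2)] by blast
    let ?F = "Fix A (\<Delta> l) n E"
    have F: "left_module A ?F" by (rule left_module_Fix[OF RA D[OF lU(1)] E(1)])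
    obtain s where s: "s \<in> Iso A (quot ?N (H i)) ?F"
      using isomorphic_trans[OF q(4) lU(3) E(2)] by (auto simp: isomorphic_def)
    let ?\<pi> = "\<lambda>x\<in>carrier ?N. H i +>\<^bsub>?N\<^esub> x"
    let ?g = "compose (carrier ?N) s ?\<pi>"
    have g: "?g \<in> Hom A ?N ?F" by (rule Hom_compose[OF N q(1) IsoD(1)[OF s]])
    have gs: "?g ` carrier ?N = carrier ?F"
    proof -
      have "?g ` carrier ?N = s ` (?\<pi> ` carrier ?N)" unfolding image_image by (intro image_cong refl) simp
      then show ?thesis unfolding q(2) IsoD(3)[OF s] .
    qed
    have "a_kernel ?N ?F ?g = H i"
    proof -
      have "?g x = \<zero>\<^bsub>?F\<^esub> \<longleftrightarrow> x \<in> H i" if x: "x \<in> carrier ?N" for x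
      proof -
        have "?g x = \<zero>\<^bsub>?F\<^esub> \<longleftrightarrow> ?g x = ?g \<zero>\<^bsub>?N\<^esub>" using Hom_zero[OF N F g] by simp
        also have "\<dots> \<longleftrightarrow> s (?\<pi> x) = s (?\<pi> \<zero>\<^bsub>?N\<^esub>)" using x N.M.zero_closed by (simp only: compose_apply)
        also have "\<dots> \<longleftrightarrow> ?\<pi> x = ?\<pi> \<zero>\<^bsub>?N\<^esub>"
          using inj_on_eq_iff[OF IsoD(2)[OF s] Hom_closed[OF q(1) x] Hom_closed[OF q(1) N.M.zero_closed]] .
        also have "\<dots> \<longleftrightarrow> x \<in> H i" using q(3)[OF x N.M.zero_closed] x N.M.minus_eq[of x "\<zero>\<^bsub>?N\<^esub>"] N.M.r_zero[OF x] N.M.add.inv_one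
          by (simp add: a_inv_def)
        finally show ?thesis .
      qed
      then show ?thesis using sub by auto
    qed
    then have "dfilt R A \<Lambda> \<Delta> (?N\<lparr>carrier := a_kernel ?N ?F ?g\<rparr>)" using Suc by simp
    then show ?case by (rule dfilt.step[where \<Delta>=\<Delta> and l=l, OF lU(1) E(1) g gs])
  qed
  from this[of m] show ?thesis using H(2) by simp
qed

lemma Filt_iff:
  assumes RA: "assoc_algebra R A" and D: "\<And>l. l \<in> \<Lambda> \<Longrightarrow> \<Delta> l \<in> fg_modules A"
  shows "M \<in> Filt A (Delta_tilde R A \<Lambda> \<Delta>) \<longleftrightarrow> left_module A M \<and> dfilt R A \<Lambda> \<Delta> M"
proof -
  have D': "left_module A (\<Delta> l)" if "l \<in> \<Lambda>" for l using D[OF that] by (simp add: fg_modules_def)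
  show ?thesis
    using dfilt_imp_filtered[OF RA D'] filtered_imp_dfilt[OF RA D'] dfilt_finitely_generated[OF RA D]
    by (auto simp: Filt_def fg_modules_def)
qed

section \<open>Nonzero homomorphisms\<close>

definition linked :: "('a, 'k) ring_scheme \<Rightarrow> ('a, 'm) module \<Rightarrow> ('a, 'n) module \<Rightarrow> bool" where
  "linked A M N \<longleftrightarrow> (\<exists>f\<in>Hom A M N. \<exists>x\<in>carrier M. f x \<noteq> \<zero>\<^bsub>N\<^esub>)"

lemma linked_refl:
  assumes M: "left_module A M" and nz: "carrier M \<noteq> {\<zero>\<^bsub>M\<^esub>}" shows "linked A M M"
proof -
  interpret M: left_module A M by (rule M)
  obtain x where "x \<in> carrier M" "x \<noteq> \<zero>\<^bsub>M\<^esub>" using nz M.M.zero_closed by blast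
  then show ?thesis unfolding linked_def by (intro bexI[of _ "\<lambda>x\<in>carrier M. x"] bexI[of _ x] Hom_id[OF M]) auto
qed

lemma linked_iso_source:
  assumes L: "left_module A L" and i: "isomorphic A L M" and l: "linked A M N" shows "linked A L N"
proof -
  obtain i where i: "i \<in> Iso A L M" using i by (auto simp: isomorphic_def)
  obtain f x where f: "f \<in> Hom A M N" and x: "x \<in> carrier M" "f x \<noteq> \<zero>\<^bsub>N\<^esub>" using l unfolding linked_def by blast
  obtain z where z: "z \<in> carrier L" "x = i z" using IsoD(3)[OF i] x(1) by blast
  show ?thesis unfolding linked_def
    by (rule bexI[OF _ Hom_compose[OF L IsoD(1)[OF i] f]], rule bexI[OF _ z(1)]) (use x(2) z in simp)
qed

lemma linked_iso_target:
  assumes L: "left_module A L" and M: "left_module A M" and N: "left_module A N"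
    and l: "linked A L M" and i: "isomorphic A M N" shows "linked A L N"
proof -
  interpret M: left_module A M by (rule M)
  obtain i where i: "i \<in> Iso A M N" using i by (auto simp: isomorphic_def)
  obtain f x where f: "f \<in> Hom A L M" and x: "x \<in> carrier L" "f x \<noteq> \<zero>\<^bsub>M\<^esub>" using l unfolding linked_def by blast
  have "i (f x) \<noteq> i \<zero>\<^bsub>M\<^esub>" using inj_onD[OF IsoD(2)[OF i] _ Hom_closed[OF f x(1)] M.M.zero_closed] x(2) by blast
  then have "i (f x) \<noteq> \<zero>\<^bsub>N\<^esub>" unfolding Hom_zero[OF M N IsoD(1)[OF i]] .
  then show ?thesis unfolding linked_def
    by (intro bexI[OF _ Hom_compose[OF L f IsoD(1)[OF i]]] bexI[OF _ x(1)]) (use x(1) in simp)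
qed

text \<open>
  A nonzero map out of \<open>M \<otimes> U\<close> cannot vanish on all columns, as they generate.
\<close>

lemma linked_Fix_source:
  assumes RA: "assoc_algebra R A" and M: "left_module A M" and E: "idem_matrix R n E" and N: "left_module A N"
    and l: "linked A (Fix A M n E) N" shows "linked A M N"
proof (rule ccontr)
  let ?F = "Fix A M n E"
  assume nl: "\<not> linked A M N"
  interpret N: left_module A N by (rule N)
  have lF: "left_module A ?F" by (rule left_module_Fix[OF RA M E])
  obtain f x where f: "f \<in> Hom A ?F N" and x: "x \<in> carrier ?F" "f x \<noteq> \<zero>\<^bsub>N\<^esub>" using l unfolding linked_def by blast
  have xk: "x k \<in> carrier M" if "k < n" for k using x(1) that by (auto simp: carrier_Fix[OF RA M E])
  have cH: "col A M n E k \<in> Hom A M ?F" if "k < n" for k by (rule col_Hom[OF RA M E that])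
  have z: "f (col A M n E k (x k)) = \<zero>\<^bsub>N\<^esub>" if k: "k < n" for k
  proof (rule ccontr)
    assume "f (col A M n E k (x k)) \<noteq> \<zero>\<^bsub>N\<^esub>"
    then have "linked A M N" unfolding linked_def
      by (intro bexI[OF _ Hom_compose[OF M cH[OF k] f]] bexI[OF _ xk[OF k]]) (use xk[OF k] in simp)
    then show False using nl by simp
  qed
  have "f x = f (msum ?F (\<lambda>k. col A M n E k (x k)) n)" unfolding Fix_sum_col[OF RA M E x(1)] ..
  also have "\<dots> = msum N (\<lambda>k. f (col A M n E k (x k))) n"
    by (rule Hom_msum[OF lF N f]) (rule Hom_closed[OF cH xk])
  also have "\<dots> = \<zero>\<^bsub>N\<^esub>" by (rule N.M.msum_zero) (rule z)
  finally show False using x(2) by simp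
qed

lemma linked_Fix_target:
  assumes RA: "assoc_algebra R A" and M: "left_module A M" and E: "idem_matrix R n E" and L: "left_module A L"
    and l: "linked A L (Fix A M n E)" shows "linked A L M"
proof -
  let ?F = "Fix A M n E"
  obtain f x where f: "f \<in> Hom A L ?F" and x: "x \<in> carrier L" "f x \<noteq> \<zero>\<^bsub>?F\<^esub>" using l unfolding linked_def by blast
  have fx: "f x \<in> carrier ?F" by (rule Hom_closed[OF f x(1)])
  have "\<exists>k<n. f x k \<noteq> \<zero>\<^bsub>M\<^esub>"
  proof (rule ccontr)
    assume "\<not> (\<exists>k<n. f x k \<noteq> \<zero>\<^bsub>M\<^esub>)"
    then have "f x = \<zero>\<^bsub>?F\<^esub>"
      using fx by (auto simp: Fix_ops[OF RA M E] carrier_Fix[OF RA M E] PiE_iff extensional_def fun_eq_iff)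
    then show False using x(2) by simp
  qed
  then obtain k where k: "k < n" "f x k \<noteq> \<zero>\<^bsub>M\<^esub>" by blast
  show ?thesis unfolding linked_def
    by (intro bexI[OF _ Hom_compose[OF L f Fix_proj[OF RA M E k(1)]]] bexI[OF _ x(1)]) (use fx k x(1) in simp)
qed

section \<open>Split quasi-hereditary algebras\<close>

lemma complement_projection:
  assumes M: "left_module A M" and H: "submodule H A M" and K: "submodule K A M"
    and sum: "H <+>\<^bsub>M\<^esub> K = carrier M" and int: "H \<inter> K = {\<zero>\<^bsub>M\<^esub>}"
  shows "\<exists>p\<in>Hom A M (M\<lparr>carrier := H\<rparr>). \<forall>x\<in>H. p x = x"
proof -
  interpret M: left_module A M by fact
  note H' = submoduleD[OF H] and K' = submoduleD[OF K]
  have ex: "\<exists>h\<in>H. x \<ominus>\<^bsub>M\<^esub> h \<in> K" if x: "x \<in> carrier M" for x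
  proof -
    obtain h k where hk: "h \<in> H" "k \<in> K" "x = h \<oplus>\<^bsub>M\<^esub> k" using x unfolding sum[symmetric] set_add_def' by auto
    then have "h \<in> carrier M" "k \<in> carrier M" using H' K' by auto
    then have "x \<ominus>\<^bsub>M\<^esub> h = k" unfolding hk(3) by (simp add: M.M.minus_eq M.M.a_comm[of h k] M.M.a_assoc M.M.r_neg)
    then show ?thesis using hk(1,2) by (intro bexI[of _ h]) simp_all
  qed
  have uniq: "h = h'" if h: "h \<in> H" "h' \<in> H" "x \<ominus>\<^bsub>M\<^esub> h \<in> K" "x \<ominus>\<^bsub>M\<^esub> h' \<in> K" and x: "x \<in> carrier M" for x h h'
  proof -
    have c: "h \<in> carrier M" "h' \<in> carrier M" using h H' by auto
    have "\<ominus>\<^bsub>M\<^esub> (x \<ominus>\<^bsub>M\<^esub> h) = h \<ominus>\<^bsub>M\<^esub> x"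
      using c x by (simp add: M.M.minus_eq M.M.minus_add M.M.a_comm)
    moreover have "h \<ominus>\<^bsub>M\<^esub> h' = (h \<ominus>\<^bsub>M\<^esub> x) \<oplus>\<^bsub>M\<^esub> (x \<ominus>\<^bsub>M\<^esub> h')"
      using c x by (simp add: M.M.minus_eq M.M.a_assoc M.M.r_neg1)
    ultimately have "h \<ominus>\<^bsub>M\<^esub> h' \<in> K" using K'(3)[OF K'(5)[OF h(3)] h(4)] by simp
    moreover have "h \<ominus>\<^bsub>M\<^esub> h' \<in> H" using H'(3)[OF h(1) H'(5)[OF h(2)]] by (simp add: M.M.minus_eq)
    ultimately have "h \<ominus>\<^bsub>M\<^esub> h' = \<zero>\<^bsub>M\<^esub>" using int by blast
    then show ?thesis using M.M.minus_eq_zero_iff[OF c] by simp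
  qed
  define p where "p x = (SOME h. h \<in> H \<and> x \<ominus>\<^bsub>M\<^esub> h \<in> K)" for x
  have p: "p x \<in> H" "x \<ominus>\<^bsub>M\<^esub> p x \<in> K" if "x \<in> carrier M" for x
  proof -
    have "\<exists>h. h \<in> H \<and> x \<ominus>\<^bsub>M\<^esub> h \<in> K" using ex[OF that] by blast
    from someI_ex[OF this] show "p x \<in> H" "x \<ominus>\<^bsub>M\<^esub> p x \<in> K" by (auto simp: p_def)
  qed
  have pc: "p x \<in> carrier M" if "x \<in> carrier M" for x using p(1)[OF that] H' by auto
  have pI: "p x = h" if "x \<in> carrier M" "h \<in> H" "x \<ominus>\<^bsub>M\<^esub> h \<in> K" for x h
    by (rule uniq[OF p(1) that(2) p(2) that(3) that(1)]) (use that in auto)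
  have "(\<lambda>x\<in>carrier M. p x) \<in> Hom A M (M\<lparr>carrier := H\<rparr>)"
  proof (rule Hom_restrictI[OF M])
    fix x assume x: "x \<in> carrier M"
    show "p x \<in> carrier (M\<lparr>carrier := H\<rparr>)" using p(1)[OF x] by simp
    show "p (x \<oplus>\<^bsub>M\<^esub> y) = p x \<oplus>\<^bsub>M\<lparr>carrier := H\<rparr>\<^esub> p y" if y: "y \<in> carrier M" for y
    proof -
      have "(x \<oplus>\<^bsub>M\<^esub> y) \<ominus>\<^bsub>M\<^esub> (p x \<oplus>\<^bsub>M\<^esub> p y) = (x \<ominus>\<^bsub>M\<^esub> p x) \<oplus>\<^bsub>M\<^esub> (y \<ominus>\<^bsub>M\<^esub> p y)"
        using x y pc[OF x] pc[OF y] by (simp add: M.M.minus_eq M.M.minus_add M.M.a_ac)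
      then have "p (x \<oplus>\<^bsub>M\<^esub> y) = p x \<oplus>\<^bsub>M\<^esub> p y"
        using K'(3)[OF p(2)[OF x] p(2)[OF y]] H'(3)[OF p(1)[OF x] p(1)[OF y]] x y by (intro pI) auto
      then show ?thesis by simp
    qed
    show "p (a \<odot>\<^bsub>M\<^esub> x) = a \<odot>\<^bsub>M\<lparr>carrier := H\<rparr>\<^esub> p x" if a: "a \<in> carrier A" for a
    proof -
      have "a \<odot>\<^bsub>M\<^esub> x \<ominus>\<^bsub>M\<^esub> a \<odot>\<^bsub>M\<^esub> p x = a \<odot>\<^bsub>M\<^esub> (x \<ominus>\<^bsub>M\<^esub> p x)"
        using x a pc[OF x] by (simp add: M.M.minus_eq M.smult_r_distr M.smult_minus_r)
      then have "p (a \<odot>\<^bsub>M\<^esub> x) = a \<odot>\<^bsub>M\<^esub> p x"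
        using K'(4)[OF a p(2)[OF x]] H'(4)[OF a p(1)[OF x]] x a by (intro pI) (auto intro: M.smult_closed)
      then show ?thesis by simp
    qed
  qed
  moreover have "p x = x" if "x \<in> H" for x
    using that H' K'(2) by (intro pI) (auto simp: M.M.minus_eq M.M.r_neg)
  ultimately show ?thesis using H'(1) by (intro bexI[of _ "\<lambda>x\<in>carrier M. p x"]) auto
qed

locale quasi_hereditary =
  fixes R :: "('r, 'k) ring_scheme" and A :: "('r, 'a) module" and \<Lambda> :: "('l::order) set"
    and \<Delta> :: "'l \<Rightarrow> ('a, 'm) module"
  assumes qh: "split_quasi_hereditary R A \<Lambda> \<Delta>" and universe: "module_universe TYPE('a) TYPE('m)"
begin

lemma RA: "assoc_algebra R A"
  using qh by (auto simp: split_quasi_hereditary_def projective_Noetherian_algebra_def)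

lemma ring_A: "ring A" by (rule assoc_algebraD(2)[OF RA])

lemma cring_R: "cring R" by (rule assoc_algebraD(1)[OF RA])

lemma std_fg: "l \<in> \<Lambda> \<Longrightarrow> \<Delta> l \<in> fg_modules A"
  using qh by (simp add: split_quasi_hereditary_def)

lemma std_module: "l \<in> \<Lambda> \<Longrightarrow> left_module A (\<Delta> l)"
  by (rule fg_modulesD(1)[OF std_fg])

lemma Hom_order:
  assumes "l \<in> \<Lambda>" "m \<in> \<Lambda>" "f \<in> Hom A (\<Delta> l) (\<Delta> m)" "x \<in> carrier (\<Delta> l)" "f x \<noteq> \<zero>\<^bsub>\<Delta> m\<^esub>"
  shows "l \<le> m"
proof -
  have "f \<noteq> (\<lambda>x\<in>carrier (\<Delta> l). \<zero>\<^bsub>\<Delta> m\<^esub>)" using assms(4,5) by auto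
  then have "Hom A (\<Delta> l) (\<Delta> m) \<noteq> {\<lambda>x\<in>carrier (\<Delta> l). \<zero>\<^bsub>\<Delta> m\<^esub>}" using assms(3) by auto
  moreover have "\<forall>l\<in>\<Lambda>. \<forall>m\<in>\<Lambda>. Hom A (\<Delta> l) (\<Delta> m) \<noteq> {\<lambda>x\<in>carrier (\<Delta> l). \<zero>\<^bsub>\<Delta> m\<^esub>} \<longrightarrow> l \<le> m"
    using qh by (simp add: split_quasi_hereditary_def)
  ultimately show ?thesis using assms(1,2) by simp
qed

lemma linked_order: "l \<in> \<Lambda> \<Longrightarrow> m \<in> \<Lambda> \<Longrightarrow> linked A (\<Delta> l) (\<Delta> m) \<Longrightarrow> l \<le> m"
  unfolding linked_def using Hom_order by blast

abbreviation filt :: "('a, 'x) module \<Rightarrow> bool" where "filt \<equiv> dfilt R A \<Lambda> \<Delta>"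

lemma filt_iso: "filt Q \<Longrightarrow> left_module A Q \<Longrightarrow> left_module A M \<Longrightarrow> f \<in> Iso A M Q \<Longrightarrow> filt M"
  by (rule dfilt_iso[where \<Lambda>=\<Lambda> and \<Delta>=\<Delta>, OF RA std_module])

lemma filt_extension:
  "filt Q \<Longrightarrow> left_module A Q \<Longrightarrow> left_module A M \<Longrightarrow> f \<in> Hom A M Q \<Longrightarrow> f ` carrier M = carrier Q \<Longrightarrow>
    filt (M\<lparr>carrier := a_kernel M Q f\<rparr>) \<Longrightarrow> filt M"
  by (rule dfilt_extension[where \<Lambda>=\<Lambda> and \<Delta>=\<Delta>, OF RA std_module])

lemma filt_dsum:
  "finite I \<Longrightarrow> (\<And>i. i \<in> I \<Longrightarrow> left_module A (M i)) \<Longrightarrow> (\<And>i. i \<in> I \<Longrightarrow> filt (M i)) \<Longrightarrow> filt (dsum I M)"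
  by (rule dfilt_dsum[where \<Lambda>=\<Lambda> and \<Delta>=\<Delta>, OF RA std_module]) auto

lemma filt_standard: "l \<in> \<Lambda> \<Longrightarrow> filt (\<Delta> l)"
  by (rule dfilt_standard[where \<Lambda>=\<Lambda> and \<Delta>=\<Delta>, OF RA std_module])

lemma filt_fg: "filt M \<Longrightarrow> left_module A M \<Longrightarrow> finitely_generated A M"
  by (rule dfilt_finitely_generated[where \<Lambda>=\<Lambda> and \<Delta>=\<Delta>, OF RA std_fg])

lemma Filt_filt: "M \<in> Filt A (Delta_tilde R A \<Lambda> \<Delta>) \<longleftrightarrow> left_module A M \<and> filt M"
  by (rule Filt_iff[OF RA std_fg])

definition standard_cover :: "'l \<Rightarrow> ('a, 'm) module \<Rightarrow> bool" where
  "standard_cover l P \<longleftrightarrow> fgp A P \<and> (\<exists>g\<in>Hom A P (\<Delta> l). g ` carrier P = carrier (\<Delta> l) \<and>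
     dfilt R A {m \<in> \<Lambda>. l < m} \<Delta> (P\<lparr>carrier := a_kernel P (\<Delta> l) g\<rparr>))"

lemma projective_covers:
  "\<exists>P. (\<forall>l\<in>\<Lambda>. standard_cover l (P l)) \<and> add_closure A (dsum \<Lambda> P) = (fg_projectives A :: ('a, 'm) module set)"
proof -
  have "\<exists>P :: 'l \<Rightarrow> ('a, 'm) module.
        (\<forall>l\<in>\<Lambda>. P l \<in> fg_projectives A \<and>
           (\<exists>(C :: ('a, 'm) module) f g. C \<in> fg_modules A \<and> short_exact A C f (P l) g (\<Delta> l) \<and>
              filtered A (Delta_tilde R A {m \<in> \<Lambda>. l < m} \<Delta>) C)) \<and>
        add_closure A (dsum \<Lambda> P) = (fg_projectives A :: ('a, 'm) module set)"
    using qh unfolding split_quasi_hereditary_def by (elim conjE)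
  then obtain P :: "'l \<Rightarrow> ('a, 'm) module" where
    P': "\<forall>l\<in>\<Lambda>. P l \<in> fg_projectives A \<and>
           (\<exists>(C :: ('a, 'm) module) f g. C \<in> fg_modules A \<and> short_exact A C f (P l) g (\<Delta> l) \<and>
              filtered A (Delta_tilde R A {m \<in> \<Lambda>. l < m} \<Delta>) C)"
    and add: "add_closure A (dsum \<Lambda> P) = (fg_projectives A :: ('a, 'm) module set)"
    by blast
  note P = bspec[OF P']
  have "standard_cover l (P l)" if l: "l \<in> \<Lambda>" for l
  proof -
    have fgp: "fgp A (P l)" using P[OF l] by (simp add: fg_projectives_iff)
    have lP: "left_module A (P l)" using fgp by (simp add: fgp_def)
    obtain C :: "('a, 'm) module" and f g where C: "C \<in> fg_modules A" and ex: "short_exact A C f (P l) g (\<Delta> l)"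
      and fil: "filtered A (Delta_tilde R A {m \<in> \<Lambda>. l < m} \<Delta>) C" using P[OF l] by auto
    have lC: "left_module A C" by (rule fg_modulesD(1)[OF C])
    have D: "left_module A (\<Delta> m)" if "m \<in> {m \<in> \<Lambda>. l < m}" for m using that std_module by simp
    have dC: "dfilt R A {m \<in> \<Lambda>. l < m} \<Delta> C" by (rule filtered_imp_dfilt[OF RA D fil lC])
    let ?K = "(P l)\<lparr>carrier := a_kernel (P l) (\<Delta> l) g\<rparr>"
    have g: "g \<in> Hom A (P l) (\<Delta> l)" "g ` carrier (P l) = carrier (\<Delta> l)"
      and f: "f \<in> Hom A C (P l)" "inj_on f (carrier C)" "f ` carrier C = a_kernel (P l) (\<Delta> l) g"
      using ex by (auto simp: short_exact_def)
    have lK: "left_module A ?K" by (rule left_module_submodule[OF lP submodule_kernel[OF lP std_module[OF l] g(1)]])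
    have "f \<in> Hom A C ?K" by (rule Hom_into_sub[OF lC f(1)]) (use f(3) in blast)
    then have "f \<in> Iso A C ?K" using f by (intro IsoI) simp_all
    then have "isomorphic A ?K C" using isomorphic_sym[OF lC, of ?K] by (auto simp: isomorphic_def)
    then obtain i where i: "i \<in> Iso A ?K C" by (auto simp: isomorphic_def)
    have "dfilt R A {m \<in> \<Lambda>. l < m} \<Delta> ?K"
      by (rule dfilt_iso[where \<Lambda>="{m \<in> \<Lambda>. l < m}" and \<Delta>=\<Delta>, OF RA D dC lC lK i])
    then show ?thesis using fgp g unfolding standard_cover_def by blast
  qed
  with add show ?thesis by blast
qed

lemma projective_cover_filt:
  fixes P :: "('a, 'x) module"
  assumes l: "l \<in> \<Lambda>" and P: "left_module A P" and g: "g \<in> Hom A P (\<Delta> l)" "g ` carrier P = carrier (\<Delta> l)"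
    and k: "dfilt R A {m \<in> \<Lambda>. l < m} \<Delta> (P\<lparr>carrier := a_kernel P (\<Delta> l) g\<rparr>)"
  shows "filt P"
  by (rule filt_extension[OF filt_standard[OF l] std_module[OF l] P g dfilt_mono[OF k]]) auto

text \<open>
  The witness is a copy of a power of \<open>\<Oplus> P(l)\<close> that has the regular module as a summand. Working with the
  power and the two maps avoids the question whether summands of filtered modules are filtered.
\<close>

lemma filtered_generator:
  obtains S :: "('a, 'm) module" and s \<sigma> where "fgp A S" "filt S" "s \<in> carrier S"
    "\<sigma> \<in> Hom A S (self_algebra A)" "\<sigma> s = \<one>\<^bsub>A\<^esub>"
proof -
  obtain P where P: "\<forall>l\<in>\<Lambda>. standard_cover l (P l)"
    and add: "add_closure A (dsum \<Lambda> P) = (fg_projectives A :: ('a, 'm) module set)"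
    using projective_covers by blast
  have fin: "finite \<Lambda>" using qh by (simp add: split_quasi_hereditary_def)
  have Pl: "left_module A (P l)" if "l \<in> \<Lambda>" for l
    using bspec[OF P that] by (simp add: standard_cover_def fgp_def)
  have Pf: "filt (P l)" if "l \<in> \<Lambda>" for l
    using bspec[OF P that] projective_cover_filt[OF that Pl[OF that]] unfolding standard_cover_def by blast
  have Pp: "fgp A (P l)" if "l \<in> \<Lambda>" for l using bspec[OF P that] by (simp add: standard_cover_def)
  let ?Q = "dsum \<Lambda> P"
  have Q: "fgp A ?Q" "filt ?Q" "left_module A ?Q"
    by (rule fgp_dsum[OF ring_A fin Pp], assumption, rule filt_dsum[OF fin Pl Pf], assumption+,
        rule left_module_dsum[OF ring_A Pl])
  have self: "left_module A (self_algebra A)" by (rule left_module_self[OF ring_A])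
  obtain A0 :: "('a, 'm) module" and i where A0: "A0 \<in> fg_modules A" and i: "i \<in> Iso A (self_algebra A) A0"
    using universe_copy[OF universe self fgp_finitely_generated[OF fgp_self[OF ring_A]]] by blast
  have lA0: "left_module A A0" by (rule fg_modulesD(1)[OF A0])
  have "A0 \<in> fg_projectives A"
    using fgp_iso[OF fgp_self[OF ring_A] lA0 i] by (simp add: fg_projectives_iff)
  then have "A0 \<in> add_closure A ?Q" using add by simp
  then obtain n where "direct_summand A A0 (dsum {..<n::nat} (\<lambda>_. ?Q))" unfolding add_closure_def by blast
  then obtain H K where H: "submodule H A (pow_module ?Q n)" and K: "submodule K A (pow_module ?Q n)"
    and HK: "H <+>\<^bsub>pow_module ?Q n\<^esub> K = carrier (pow_module ?Q n)" "H \<inter> K = {\<zero>\<^bsub>pow_module ?Q n\<^esub>}"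
    and iso: "isomorphic A A0 ((pow_module ?Q n)\<lparr>carrier := H\<rparr>)"
    unfolding direct_summand_def pow_module_def by blast
  let ?D = "pow_module ?Q n"
  have D: "fgp A ?D" "filt ?D" "left_module A ?D"
    unfolding pow_module_def
    by (rule fgp_dsum[OF ring_A _ Q(1)], simp, rule filt_dsum[OF _ Q(3,2)], simp, rule left_module_dsum[OF ring_A Q(3)])
  obtain S :: "('a, 'm) module" and j where S: "S \<in> fg_modules A" and j: "j \<in> Iso A ?D S"
    using universe_copy[OF universe D(3) fgp_finitely_generated[OF D(1)]] by blast
  have lS: "left_module A S" by (rule fg_modulesD(1)[OF S])
  obtain j' where j': "j' \<in> Iso A S ?D" "\<forall>x\<in>carrier ?D. j' (j x) = x"
    using Iso_inverse_ex[OF D(3) j] by blast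
  have sf: "fgp A S" by (rule fgp_iso[OF D(1) lS j])
  have sF: "filt S" by (rule filt_iso[OF D(2,3) lS j'(1)])
  obtain p where p: "p \<in> Hom A ?D (?D\<lparr>carrier := H\<rparr>)" "\<And>x. x \<in> H \<Longrightarrow> p x = x"
    using complement_projection[OF D(3) H K HK] by blast
  obtain k where k: "k \<in> Iso A A0 (?D\<lparr>carrier := H\<rparr>)" using iso by (auto simp: isomorphic_def)
  have ki: "compose (carrier (self_algebra A)) k i \<in> Iso A (self_algebra A) (?D\<lparr>carrier := H\<rparr>)" (is "?q \<in> _")
    by (rule Iso_compose[OF self i k])
  obtain q' where q': "q' \<in> Iso A (?D\<lparr>carrier := H\<rparr>) (self_algebra A)" "\<forall>x\<in>carrier (self_algebra A). q' (?q x) = x"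
    using Iso_inverse_ex[OF self ki] by blast
  interpret A: ring A by (rule ring_A)
  have oneA: "\<one>\<^bsub>A\<^esub> \<in> carrier (self_algebra A)" by simp
  define h where "h = ?q \<one>\<^bsub>A\<^esub>"
  have h: "h \<in> H" using Hom_closed[OF IsoD(1)[OF ki] oneA] by (simp add: h_def)
  have hD: "h \<in> carrier ?D" using h submoduleD(1)[OF H] by blast
  define \<sigma> where "\<sigma> = compose (carrier S) q' (compose (carrier S) p j')"
  have \<sigma>: "\<sigma> \<in> Hom A S (self_algebra A)" unfolding \<sigma>_def
    by (rule Hom_compose[OF lS Hom_compose[OF lS IsoD(1)[OF j'(1)] p(1)] IsoD(1)[OF q'(1)]])
  have jh: "j h \<in> carrier S" by (rule Hom_closed[OF IsoD(1)[OF j] hD])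
  have "\<sigma> (j h) = q' (p (j' (j h)))" using jh by (simp add: \<sigma>_def)
  also have "\<dots> = q' h" using bspec[OF j'(2) hD] p(2)[OF h] by simp
  also have "\<dots> = \<one>\<^bsub>A\<^esub>" unfolding h_def by (rule bspec[OF q'(2) oneA])
  finally show thesis using that[OF sf sF jh \<sigma>] by blast
qed

text \<open>
  Covers are built in whatever type is convenient and moved into the universe \<open>'m\<close> afterwards.
\<close>

lemma cover_copy:
  fixes T :: "('a, 'x) module" and X :: "('a, 'y) module"
  assumes T: "fgp A T" "filt T" and X: "left_module A X" and f: "f \<in> Hom A T X" "f ` carrier T = carrier X"
    and k: "filt (T\<lparr>carrier := a_kernel T X f\<rparr>)"
  shows "\<exists>(T' :: ('a, 'm) module) f'. fgp A T' \<and> filt T' \<and> f' \<in> Hom A T' X \<and> f' ` carrier T' = carrier X \<and>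
    filt (T'\<lparr>carrier := a_kernel T' X f'\<rparr>)"
proof -
  have lT: "left_module A T" using T by (simp add: fgp_def)
  obtain T' :: "('a, 'm) module" and i where T': "T' \<in> fg_modules A" and i: "i \<in> Iso A T T'"
    using universe_copy[OF universe lT fgp_finitely_generated[OF T(1)]] by blast
  have lT': "left_module A T'" by (rule fg_modulesD(1)[OF T'])
  obtain j where j: "j \<in> Iso A T' T" "\<forall>x\<in>carrier T. j (i x) = x"
    using Iso_inverse_ex[OF lT i] by blast
  let ?f = "compose (carrier T') f j"
  have f': "?f \<in> Hom A T' X" by (rule Hom_compose[OF lT' IsoD(1)[OF j(1)] f(1)])
  have s: "?f ` carrier T' = carrier X"
  proof -
    have "?f ` carrier T' = f ` (j ` carrier T')" unfolding image_image by (intro image_cong refl) simp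
    then show ?thesis using IsoD(3)[OF j(1)] f(2) by simp
  qed
  let ?K = "T\<lparr>carrier := a_kernel T X f\<rparr>" and ?K' = "T'\<lparr>carrier := a_kernel T' X ?f\<rparr>"
  have sK: "submodule (a_kernel T X f) A T" and sK': "submodule (a_kernel T' X ?f) A T'"
    by (rule submodule_kernel[OF lT X f(1)], rule submodule_kernel[OF lT' X f'])
  have "restrict j (a_kernel T' X ?f) \<in> Iso A ?K' ?K"
  proof (rule IsoI)
    show "restrict j (a_kernel T' X ?f) \<in> Hom A ?K' ?K"
      using Hom_closed[OF IsoD(1)[OF j(1)]]
      by (intro Hom_into_sub[OF left_module_submodule[OF lT' sK'] Hom_restrict_sub[OF lT' sK' IsoD(1)[OF j(1)]]]) auto
    show "inj_on (restrict j (a_kernel T' X ?f)) (carrier ?K')"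
      using IsoD(2)[OF j(1)] by (auto simp: inj_on_def)
    show "restrict j (a_kernel T' X ?f) ` carrier ?K' = carrier ?K"
    proof (intro equalityI subsetI)
      fix x assume "x \<in> carrier ?K"
      then have x: "x \<in> carrier T" "f x = \<zero>\<^bsub>X\<^esub>" by auto
      then have "i x \<in> a_kernel T' X ?f" using Hom_closed[OF IsoD(1)[OF i] x(1)] bspec[OF j(2) x(1)] by simp
      then show "x \<in> restrict j (a_kernel T' X ?f) ` carrier ?K'"
        using bspec[OF j(2) x(1)] by (intro image_eqI[of _ _ "i x"]) simp_all
    qed (use Hom_closed[OF IsoD(1)[OF j(1)]] in auto)
  qed
  from filt_iso[OF k left_module_submodule[OF lT sK] left_module_submodule[OF lT' sK'] this]
  have "filt ?K'" .
  moreover have "filt T'" by (rule filt_iso[OF T(2) lT lT' j(1)])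
  ultimately show ?thesis using fgp_iso[OF T(1) lT' i] f' s by blast
qed

text \<open>
  The cover is \<open>P(l)\<^sup>n \<rightarrow> \<Delta>(l)\<^sup>n \<rightarrow> \<Delta>(l) \<otimes> U\<close>. If \<open>U'\<close> is the complement of \<open>U\<close> and \<open>C(l)\<close> the
  kernel of \<open>P(l) \<rightarrow> \<Delta>(l)\<close>, the kernel of the composite is an extension of \<open>\<Delta>(l) \<otimes> U'\<close> by
  \<open>C(l)\<^sup>n\<close>.
\<close>

lemma cover_Fix:
  assumes l: "l \<in> \<Lambda>" and E: "idem_matrix R n E"
  shows "\<exists>(T :: ('a, 'm) module) f. fgp A T \<and> filt T \<and> f \<in> Hom A T (Fix A (\<Delta> l) n E) \<and>
    f ` carrier T = carrier (Fix A (\<Delta> l) n E) \<and> filt (T\<lparr>carrier := a_kernel T (Fix A (\<Delta> l) n E) f\<rparr>)"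
proof -
  obtain P where P: "\<forall>l\<in>\<Lambda>. standard_cover l (P l)" using projective_covers by blast
  let ?P = "P l" and ?D = "\<Delta> l" and ?F = "Fix A (\<Delta> l) n E" and ?F' = "Fix A (\<Delta> l) n (comp_matrix R E)"
  obtain g where fP: "fgp A ?P" and g: "g \<in> Hom A ?P ?D" "g ` carrier ?P = carrier ?D"
    and k: "dfilt R A {m \<in> \<Lambda>. l < m} \<Delta> (?P\<lparr>carrier := a_kernel ?P ?D g\<rparr>)"
    using bspec[OF P l] unfolding standard_cover_def by blast
  have lP: "left_module A ?P" using fP by (simp add: fgp_def)
  have lD: "left_module A ?D" by (rule std_module[OF l])
  have FP: "filt ?P" by (rule projective_cover_filt[OF l lP g k])
  let ?T = "pow_module ?P n"
  have T: "fgp A ?T" "filt ?T" "left_module A ?T"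
    unfolding pow_module_def
    by (rule fgp_dsum[OF ring_A _ fP], simp, rule filt_dsum[OF _ lP FP], simp, rule left_module_dsum[OF ring_A lP])
  have E': "idem_matrix R n (comp_matrix R E)" by (rule idem_comp_matrix[OF cring_R E])
  have F: "left_module A ?F" and F': "left_module A ?F'"
    by (rule left_module_Fix[OF RA lD E], rule left_module_Fix[OF RA lD E'])
  define G where "G = (\<lambda>x\<in>carrier ?T. \<lambda>i\<in>{..<n}. g (x i))"
  have G: "G \<in> Hom A ?T (pow_module ?D n)"
  proof -
    have "(\<lambda>x\<in>carrier ?T. \<lambda>i\<in>{..<n}. compose (carrier ?T) g (\<lambda>x\<in>carrier ?T. x i) x) \<in> Hom A ?T (pow_module ?D n)"
      unfolding pow_module_def[of ?D] by (rule dsum_tuple[OF T(3)]) (auto intro!: Hom_compose[OF T(3) pow_proj[OF lP] g(1)] simp del: pow_module_simps)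
    also have "(\<lambda>x\<in>carrier ?T. \<lambda>i\<in>{..<n}. compose (carrier ?T) g (\<lambda>x\<in>carrier ?T. x i) x) = G"
      by (auto simp: G_def fun_eq_iff simp del: pow_module_simps)
    finally show ?thesis .
  qed
  have Gx: "G x i = g (x i)" if "x \<in> carrier ?T" "i < n" for x i
    using that by (simp add: G_def del: pow_module_simps)
  have Gs: "G ` carrier ?T = carrier (pow_module ?D n)"
  proof (intro equalityI subsetI)
    fix y assume y: "y \<in> carrier (pow_module ?D n)"
    have "\<forall>i. \<exists>x. i < n \<longrightarrow> x \<in> carrier ?P \<and> g x = y i"
    proof
      fix i
      show "\<exists>x. i < n \<longrightarrow> x \<in> carrier ?P \<and> g x = y i" using powD[OF y, of i] g(2) by (metis imageE)
    qed
    then obtain x where x: "\<And>i. i < n \<Longrightarrow> x i \<in> carrier ?P \<and> g (x i) = y i" by metis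
    have xT: "(\<lambda>i\<in>{..<n}. x i) \<in> carrier ?T" using x by (intro powI) auto
    have "G (\<lambda>i\<in>{..<n}. x i) = y"
      by (rule pow_eqI[OF Hom_closed[OF G xT] y]) (use Gx[OF xT] x in auto)
    then show "y \<in> G ` carrier ?T" using xT by blast
  qed (use Hom_closed[OF G] in blast)
  let ?m = "\<lambda>x\<in>carrier (pow_module ?D n). mact A ?D n E x"
  note m = mact_onto_Fix[OF RA lD E]
  define f where "f = compose (carrier ?T) ?m G"
  have f: "f \<in> Hom A ?T ?F" unfolding f_def by (rule Hom_compose[OF T(3) G m(1)])
  have fs: "f ` carrier ?T = carrier ?F"
  proof -
    have "f ` carrier ?T = ?m ` (G ` carrier ?T)" unfolding f_def image_image by (intro image_cong refl) simp
    then show ?thesis unfolding Gs m(2) .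
  qed
  have zF: "\<zero>\<^bsub>?F\<^esub> = \<zero>\<^bsub>pow_module ?D n\<^esub>" by (simp add: Fix_def)
  have fx: "f x = \<zero>\<^bsub>?F\<^esub> \<longleftrightarrow> G x \<in> carrier ?F'" if x: "x \<in> carrier ?T" for x
    using mact_comp_matrix[OF RA lD E Hom_closed[OF G x]] Hom_closed[OF G x] x zF
    by (simp add: f_def carrier_Fix[OF RA lD E'] del: pow_module_simps)
  let ?K = "a_kernel ?T ?F f"
  have sK: "submodule ?K A ?T" by (rule submodule_kernel[OF T(3) F f])
  have lK: "left_module A (?T\<lparr>carrier := ?K\<rparr>)" by (rule left_module_submodule[OF T(3) sK])
  let ?G = "restrict G ?K"
  have G': "?G \<in> Hom A (?T\<lparr>carrier := ?K\<rparr>) ?F'"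
  proof -
    have "?G \<in> Hom A (?T\<lparr>carrier := ?K\<rparr>) ((pow_module ?D n)\<lparr>carrier := carrier ?F'\<rparr>)"
    proof (rule Hom_into_sub[OF lK Hom_restrict_sub[OF T(3) sK G]])
      fix x assume "x \<in> carrier (?T\<lparr>carrier := ?K\<rparr>)"
      then have "x \<in> carrier ?T" "f x = \<zero>\<^bsub>?F\<^esub>" "x \<in> ?K" by (simp_all del: pow_module_simps)
      then show "restrict G ?K x \<in> carrier ?F'" using iffD1[OF fx] by simp
    qed
    then show ?thesis using Fix_eq[OF RA lD E'] by simp
  qed
  have Gs': "?G ` carrier (?T\<lparr>carrier := ?K\<rparr>) = carrier ?F'"
  proof (intro equalityI subsetI)
    fix y assume y: "y \<in> carrier ?F'"
    then have "y \<in> carrier (pow_module ?D n)" using carrier_Fix[OF RA lD E'] by blast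
    then obtain x where x: "x \<in> carrier ?T" "y = G x" using Gs by (metis imageE)
    then have "x \<in> ?K" using fx[OF x(1)] y by (simp del: pow_module_simps)
    then show "y \<in> ?G ` carrier (?T\<lparr>carrier := ?K\<rparr>)" using x(2) by (intro image_eqI[of _ _ x]) simp_all
  qed (use Hom_closed[OF G'] in blast)
  have "a_kernel (?T\<lparr>carrier := ?K\<rparr>) ?F' ?G = ({..<n} \<rightarrow>\<^sub>E a_kernel ?P ?D g)"
  proof -
    have z': "\<zero>\<^bsub>?F'\<^esub> = \<zero>\<^bsub>pow_module ?D n\<^esub>" by (simp add: Fix_def)
    have "x \<in> ?K \<and> G x = \<zero>\<^bsub>?F'\<^esub> \<longleftrightarrow> x \<in> {..<n} \<rightarrow>\<^sub>E a_kernel ?P ?D g" for x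
    proof
      assume x: "x \<in> ?K \<and> G x = \<zero>\<^bsub>?F'\<^esub>"
      then have xT: "x \<in> carrier ?T" by simp
      have "g (x i) = \<zero>\<^bsub>?D\<^esub>" if "i < n" for i using x Gx[OF xT that] that by (simp add: z')
      then show "x \<in> {..<n} \<rightarrow>\<^sub>E a_kernel ?P ?D g" using xT by (auto simp: PiE_iff)
    next
      assume x: "x \<in> {..<n} \<rightarrow>\<^sub>E a_kernel ?P ?D g"
      then have xT: "x \<in> carrier ?T" by (auto simp: PiE_iff)
      have "G x = \<zero>\<^bsub>?F'\<^esub>" unfolding z'
        using x xT by (auto simp: G_def fun_eq_iff PiE_iff)
      moreover have "\<zero>\<^bsub>?F'\<^esub> \<in> carrier ?F'"
        using left_moduleD(2)[OF F'] by (simp add: abelian_group_def abelian_monoid.zero_closed)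
      ultimately show "x \<in> ?K \<and> G x = \<zero>\<^bsub>?F'\<^esub>" using fx[OF xT] xT by (simp del: pow_module_simps Fix_ops[OF RA lD E'])
    qed
    moreover have "x \<in> a_kernel (?T\<lparr>carrier := ?K\<rparr>) ?F' ?G \<longleftrightarrow> x \<in> ?K \<and> G x = \<zero>\<^bsub>?F'\<^esub>" for x by auto
    ultimately show ?thesis by blast
  qed
  moreover have "filt (pow_module (?P\<lparr>carrier := a_kernel ?P ?D g\<rparr>) n)"
    unfolding pow_module_def
    using filt_dsum[of "{..<n}" "\<lambda>_. ?P\<lparr>carrier := a_kernel ?P ?D g\<rparr>"] dfilt_mono[OF k, of \<Lambda>]
      left_module_submodule[OF lP submodule_kernel[OF lP lD g(1)]] by auto
  moreover have "pow_module (?P\<lparr>carrier := a_kernel ?P ?D g\<rparr>) n = ?T\<lparr>carrier := {..<n} \<rightarrow>\<^sub>E a_kernel ?P ?D g\<rparr>"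
    unfolding pow_module_def by (rule dsum_sub_family)
  ultimately have "filt (?T\<lparr>carrier := ?K\<rparr>\<lparr>carrier := a_kernel (?T\<lparr>carrier := ?K\<rparr>) ?F' ?G\<rparr>)" by simp
  then have "filt (?T\<lparr>carrier := ?K\<rparr>)"
    by (rule dfilt.step[where \<Delta>=\<Delta> and l=l, OF l E' G' Gs'])
  then show ?thesis by (rule cover_copy[OF T(1,2) F f fs])
qed

text \<open>
  The horseshoe argument: a cover of a quotient lifts to the extension and, together with a cover of
  the submodule, covers the extension; the kernels form an extension as well.
\<close>

lemma horseshoe:
  fixes T1 T2 :: "('a, 'm) module" and X :: "('a, 'x) module" and F :: "('a, 'y) module"
  assumes X: "left_module A X" and F: "left_module A F" and g: "g \<in> Hom A X F" "g ` carrier X = carrier F"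
    and T1: "fgp A T1" "filt T1" and f1: "f1 \<in> Hom A T1 (X\<lparr>carrier := a_kernel X F g\<rparr>)"
      "f1 ` carrier T1 = a_kernel X F g"
    and k1: "filt (T1\<lparr>carrier := a_kernel T1 (X\<lparr>carrier := a_kernel X F g\<rparr>) f1\<rparr>)"
    and T2: "fgp A T2" "filt T2" and f2: "f2 \<in> Hom A T2 F" "f2 ` carrier T2 = carrier F"
    and k2: "filt (T2\<lparr>carrier := a_kernel T2 F f2\<rparr>)"
  shows "\<exists>(T :: ('a, 'm) module) f. fgp A T \<and> filt T \<and> f \<in> Hom A T X \<and> f ` carrier T = carrier X \<and>
    filt (T\<lparr>carrier := a_kernel T X f\<rparr>)"
proof -
  interpret X: left_module A X by fact
  interpret F: left_module A F by fact
  have lT1: "left_module A T1" and lT2: "left_module A T2" using T1 T2 by (auto simp: fgp_def)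
  interpret T1: left_module A T1 by (rule lT1)
  interpret T2: left_module A T2 by (rule lT2)
  let ?K = "a_kernel X F g"
  have sK: "submodule ?K A X" by (rule submodule_kernel[OF X F g(1)])
  have f1X: "f1 \<in> Hom A T1 X" by (rule Hom_from_sub_iff[OF f1(1)]) auto
  obtain h where h: "h \<in> Hom A T2 X" "\<And>x. x \<in> carrier T2 \<Longrightarrow> g (h x) = f2 x"
    using fgp_lift[OF T2(1) X F g f2(1)] by blast
  define T where "T = dsum (UNIV :: bool set) (\<lambda>b. if b then T1 else T2)"
  have T: "left_module A T" unfolding T_def by (rule left_module_dsum[OF ring_A]) (use lT1 lT2 in auto)
  have cT: "x \<in> carrier T \<longleftrightarrow> x True \<in> carrier T1 \<and> x False \<in> carrier T2" for x
    by (auto simp: T_def PiE_iff all_bool_eq split: if_splits)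
  have aT: "(x \<oplus>\<^bsub>T\<^esub> y) True = x True \<oplus>\<^bsub>T1\<^esub> y True" "(x \<oplus>\<^bsub>T\<^esub> y) False = x False \<oplus>\<^bsub>T2\<^esub> y False" for x y
    by (simp_all add: T_def)
  have sT: "(a \<odot>\<^bsub>T\<^esub> x) True = a \<odot>\<^bsub>T1\<^esub> x True" "(a \<odot>\<^bsub>T\<^esub> x) False = a \<odot>\<^bsub>T2\<^esub> x False" for x a
    by (simp_all add: T_def)
  have fT: "fgp A T" unfolding T_def by (rule fgp_dsum[OF ring_A]) (use T1 T2 in auto)
  have FT: "filt T" unfolding T_def by (rule filt_dsum) (use T1 T2 lT1 lT2 in auto)
  define f where "f = (\<lambda>x\<in>carrier T. f1 (x True) \<oplus>\<^bsub>X\<^esub> h (x False))"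
  note c1 = Hom_closed[OF f1X] and ch = Hom_closed[OF h(1)]
  have f: "f \<in> Hom A T X" unfolding f_def
    by (rule Hom_restrictI[OF T])
      (auto simp: cT aT sT c1 ch Hom_add[OF f1X] Hom_add[OF h(1)] Hom_smult[OF f1X] Hom_smult[OF h(1)]
        X.smult_r_distr X.M.a_ac)
  have gf1: "g (f1 x) = \<zero>\<^bsub>F\<^esub>" if "x \<in> carrier T1" for x
    using Hom_closed[OF f1(1) that] by simp
  have gf: "g (f x) = f2 (x False)" if "x \<in> carrier T" for x
    using that Hom_closed[OF f2(1)] by (simp add: f_def cT Hom_add[OF g(1)] c1 ch gf1 h(2))
  have fs: "f ` carrier T = carrier X"
  proof (intro equalityI subsetI)
    fix x assume x: "x \<in> carrier X"
    obtain y where y: "y \<in> carrier T2" "f2 y = g x" using f2(2) Hom_closed[OF g(1) x] by (metis imageE)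
    have "g (x \<ominus>\<^bsub>X\<^esub> h y) = \<zero>\<^bsub>F\<^esub>"
      using Hom_diff_eq_zero[OF X F g(1) x ch[OF y(1)]] h(2)[OF y(1)] y Hom_closed[OF g(1) x] F.M.minus_eq_zero_iff by simp
    then have "x \<ominus>\<^bsub>X\<^esub> h y \<in> ?K" using x ch[OF y(1)] by simp
    then obtain z where z: "z \<in> carrier T1" "f1 z = x \<ominus>\<^bsub>X\<^esub> h y" using f1(2) by (metis imageE)
    let ?w = "\<lambda>b. if b then z else y"
    have "?w \<in> carrier T" using z y by (simp add: cT)
    moreover have "f ?w = x"
      using z(2) x ch[OF y(1)] \<open>?w \<in> carrier T\<close> by (simp add: f_def X.M.minus_eq X.M.a_assoc X.M.l_neg)
    ultimately show "x \<in> f ` carrier T" by blast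
  qed (use Hom_closed[OF f] in blast)
  let ?N = "a_kernel T X f" and ?N2 = "a_kernel T2 F f2"
  have sN: "submodule ?N A T" by (rule submodule_kernel[OF T X f])
  have sN2: "submodule ?N2 A T2" by (rule submodule_kernel[OF lT2 F f2(1)])
  have lN: "left_module A (T\<lparr>carrier := ?N\<rparr>)" and lN2: "left_module A (T2\<lparr>carrier := ?N2\<rparr>)"
    by (rule left_module_submodule[OF T sN], rule left_module_submodule[OF lT2 sN2])
  define q where "q = (\<lambda>x\<in>?N. x False)"
  have q: "q \<in> Hom A (T\<lparr>carrier := ?N\<rparr>) (T2\<lparr>carrier := ?N2\<rparr>)"
  proof -
    have "x False \<in> ?N2" if "x \<in> ?N" for x
      using that gf[of x] Hom_zero[OF X F g(1)] by (simp add: cT)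
    then show ?thesis unfolding q_def using Hom_restrictI[OF lN, of "\<lambda>x. x False" "T2\<lparr>carrier := ?N2\<rparr>"] by (simp add: aT sT)
  qed
  have qs: "q ` carrier (T\<lparr>carrier := ?N\<rparr>) = carrier (T2\<lparr>carrier := ?N2\<rparr>)"
  proof (intro equalityI subsetI)
    fix y assume "y \<in> carrier (T2\<lparr>carrier := ?N2\<rparr>)"
    then have y: "y \<in> carrier T2" "f2 y = \<zero>\<^bsub>F\<^esub>" by auto
    then have "\<ominus>\<^bsub>X\<^esub> h y \<in> ?K" using h(2)[OF y(1)] ch[OF y(1)] Hom_minus[OF X F g(1) ch[OF y(1)]]
        F.M.minus_equality[of "\<zero>\<^bsub>F\<^esub>" "\<zero>\<^bsub>F\<^esub>"] by simp
    then obtain z where z: "z \<in> carrier T1" "f1 z = \<ominus>\<^bsub>X\<^esub> h y" using f1(2) by (metis imageE)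
    let ?w = "\<lambda>b. if b then z else y"
    have w: "?w \<in> carrier T" using z y by (simp add: cT)
    then have "?w \<in> ?N" using z(2) ch[OF y(1)] by (simp add: f_def X.M.l_neg)
    then show "y \<in> q ` carrier (T\<lparr>carrier := ?N\<rparr>)" by (intro image_eqI[of _ _ ?w]) (simp_all add: q_def)
  qed (use Hom_closed[OF q] in blast)
  let ?Z = "a_kernel (T\<lparr>carrier := ?N\<rparr>) (T2\<lparr>carrier := ?N2\<rparr>) q"
    and ?N1 = "a_kernel T1 (X\<lparr>carrier := ?K\<rparr>) f1"
  have Z: "x \<in> ?Z \<longleftrightarrow> x True \<in> ?N1 \<and> x False = \<zero>\<^bsub>T2\<^esub>" for x
  proof -
    have "x \<in> ?Z \<longleftrightarrow> x \<in> carrier T \<and> f x = \<zero>\<^bsub>X\<^esub> \<and> x False = \<zero>\<^bsub>T2\<^esub>" by (auto simp: q_def)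
    also have "\<dots> \<longleftrightarrow> x True \<in> ?N1 \<and> x False = \<zero>\<^bsub>T2\<^esub>"
      using Hom_zero[OF lT2 X h(1)] c1 by (auto simp: cT f_def)
    finally show ?thesis .
  qed
  have sZ: "submodule ?Z A (T\<lparr>carrier := ?N\<rparr>)" by (rule submodule_kernel[OF lN lN2 q])
  have lZ: "left_module A (T\<lparr>carrier := ?Z\<rparr>)" using left_module_submodule[OF lN sZ] by simp
  have sN1: "submodule ?N1 A T1"
    by (rule submodule_kernel[OF lT1 left_module_submodule[OF X sK] f1(1)])
  have lN1: "left_module A (T1\<lparr>carrier := ?N1\<rparr>)" by (rule left_module_submodule[OF lT1 sN1])
  have "(\<lambda>x\<in>?Z. x True) \<in> Iso A (T\<lparr>carrier := ?Z\<rparr>) (T1\<lparr>carrier := ?N1\<rparr>)"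
  proof (rule IsoI)
    show "(\<lambda>x\<in>?Z. x True) \<in> Hom A (T\<lparr>carrier := ?Z\<rparr>) (T1\<lparr>carrier := ?N1\<rparr>)"
      using Hom_restrictI[OF lZ, of "\<lambda>x. x True" "T1\<lparr>carrier := ?N1\<rparr>"] Z by (simp add: aT sT del: a_kernel_iff)
    show "inj_on (\<lambda>x\<in>?Z. x True) (carrier (T\<lparr>carrier := ?Z\<rparr>))"
    proof (rule inj_onI)
      fix x y assume "x \<in> carrier (T\<lparr>carrier := ?Z\<rparr>)" "y \<in> carrier (T\<lparr>carrier := ?Z\<rparr>)" "(\<lambda>x\<in>?Z. x True) x = (\<lambda>x\<in>?Z. x True) y"
      then have "x True = y True" "x False = y False" using Z[of x] Z[of y] by (simp_all del: a_kernel_iff)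
      then show "x = y" by (metis (full_types) ext)
    qed
    show "(\<lambda>x\<in>?Z. x True) ` carrier (T\<lparr>carrier := ?Z\<rparr>) = carrier (T1\<lparr>carrier := ?N1\<rparr>)"
    proof (intro equalityI subsetI)
      fix z assume "z \<in> carrier (T1\<lparr>carrier := ?N1\<rparr>)"
      then have "(\<lambda>b. if b then z else \<zero>\<^bsub>T2\<^esub>) \<in> ?Z" using Z[of "\<lambda>b. if b then z else \<zero>\<^bsub>T2\<^esub>"] by (simp del: a_kernel_iff)
      then show "z \<in> (\<lambda>x\<in>?Z. x True) ` carrier (T\<lparr>carrier := ?Z\<rparr>)"
        by (intro image_eqI[of _ _ "\<lambda>b. if b then z else \<zero>\<^bsub>T2\<^esub>"]) (simp_all del: a_kernel_iff)
    next
      fix z assume "z \<in> (\<lambda>x\<in>?Z. x True) ` carrier (T\<lparr>carrier := ?Z\<rparr>)"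
      then obtain x where "x \<in> ?Z" "z = x True" by (auto simp del: a_kernel_iff)
      then show "z \<in> carrier (T1\<lparr>carrier := ?N1\<rparr>)" using Z[of x] by simp
    qed
  qed
  then have "filt (T\<lparr>carrier := ?Z\<rparr>)" by (rule filt_iso[OF k1 lN1 lZ])
  then have "filt (T\<lparr>carrier := ?N\<rparr>)" using filt_extension[OF k2 lN2 lN q qs] by simp
  from cover_copy[OF fT FT X f fs this] show ?thesis .
qed

text \<open>
  Because the kernel is filtered too, the cover is part of a short exact sequence inside the category
  of filtered modules. This is how an exact equivalence, which sees nothing else, recognises
  projective modules.
\<close>

lemma filtered_cover:
  fixes X :: "('a, 'x) module"
  assumes "filt X" "left_module A X"
  shows "\<exists>(T :: ('a, 'm) module) f. fgp A T \<and> filt T \<and> f \<in> Hom A T X \<and> f ` carrier T = carrier X \<and>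
    filt (T\<lparr>carrier := a_kernel T X f\<rparr>)"
  using assms
proof (induction rule: dfilt.induct)
  case (zero X)
  interpret X: left_module A X by (rule zero(2))
  have "a_kernel X X (\<lambda>x\<in>carrier X. x) = {\<zero>\<^bsub>X\<^esub>}"
  proof -
    have "\<zero>\<^bsub>X\<^esub> \<in> a_kernel X X (\<lambda>x\<in>carrier X. x)" by simp
    moreover have "a_kernel X X (\<lambda>x\<in>carrier X. x) \<subseteq> carrier X" by auto
    ultimately show ?thesis unfolding zero(1) by blast
  qed
  then have "filt (X\<lparr>carrier := a_kernel X X (\<lambda>x\<in>carrier X. x)\<rparr>)" by (intro dfilt.zero) simp
  moreover have "filt X" by (rule dfilt.zero[OF zero(1)])
  ultimately show ?case
    by (intro cover_copy[OF fgp_zero[OF zero(2,1)] _ zero(2) Hom_id[OF zero(2)]]) auto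
next
  case (step l n E g X)
  let ?F = "Fix A (\<Delta> l) n E"
  have F: "left_module A ?F" by (rule left_module_Fix[OF RA std_module[OF step(1)] step(2)])
  have lK: "left_module A (X\<lparr>carrier := a_kernel X ?F g\<rparr>)"
    by (rule left_module_submodule[OF step(7) submodule_kernel[OF step(7) F step(3)]])
  obtain T1 :: "('a, 'm) module" and f1 where T1: "fgp A T1" "filt T1" "f1 \<in> Hom A T1 (X\<lparr>carrier := a_kernel X ?F g\<rparr>)"
    "f1 ` carrier T1 = carrier (X\<lparr>carrier := a_kernel X ?F g\<rparr>)"
    "filt (T1\<lparr>carrier := a_kernel T1 (X\<lparr>carrier := a_kernel X ?F g\<rparr>) f1\<rparr>)"
    using step.IH[OF lK] by blast
  have f1s: "f1 ` carrier T1 = a_kernel X ?F g" using T1(4) by simp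
  obtain T2 :: "('a, 'm) module" and f2 where T2: "fgp A T2" "filt T2" "f2 \<in> Hom A T2 ?F"
    "f2 ` carrier T2 = carrier ?F" "filt (T2\<lparr>carrier := a_kernel T2 ?F f2\<rparr>)"
    using cover_Fix[OF step(1,2)] by blast
  show ?case by (rule horseshoe[OF step(7) F step(3,4) T1(1-3) f1s T1(5) T2])
qed

text \<open>
  A nonzero map on \<open>C\<close> would be nonzero on some factor \<open>\<Delta>(k) \<otimes> U\<close>, hence yield a nonzero map from
  \<open>\<Delta>(k)\<close> to \<open>\<Delta>(l)\<close>.
\<close>

lemma Hom_vanish:
  assumes "dfilt R A \<Lambda>0 \<Delta> C" "left_module A C" "\<Lambda>0 \<subseteq> \<Lambda>" "l \<in> \<Lambda>" "\<And>k. k \<in> \<Lambda>0 \<Longrightarrow> \<not> k \<le> l"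
    and "h \<in> Hom A C (\<Delta> l)" "x \<in> carrier C"
  shows "h x = \<zero>\<^bsub>\<Delta> l\<^esub>"
  using assms
proof (induction arbitrary: h x rule: dfilt.induct)
  case (zero C)
  have "x = \<zero>\<^bsub>C\<^esub>" using zero(1,7) by simp
  then show ?case using Hom_zero[OF zero(2) std_module[OF zero(4)] zero(6)] by simp
next
  case (step k n E g C)
  let ?F = "Fix A (\<Delta> k) n E"
  have k: "k \<in> \<Lambda>" using step(1,8) by blast
  note lk = std_module[OF k] and ll = std_module[OF step(9)]
  have F: "left_module A ?F" by (rule left_module_Fix[OF RA lk step(2)])
  have sK: "submodule (a_kernel C ?F g) A C" by (rule submodule_kernel[OF step(7) F step(3)])
  have K0: "h y = \<zero>\<^bsub>\<Delta> l\<^esub>" if y: "y \<in> a_kernel C ?F g" for y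
  proof -
    have "restrict h (a_kernel C ?F g) y = \<zero>\<^bsub>\<Delta> l\<^esub>"
      by (rule step.IH[OF left_module_submodule[OF step(7) sK] step(8,9) step(10) Hom_restrict_sub[OF step(7) sK step(11)]])
        (use y in auto)
    then show ?thesis using y by simp
  qed
  obtain h' where h': "h' \<in> Hom A ?F (\<Delta> l)" "\<forall>y\<in>carrier C. h' (g y) = h y"
    by (rule Hom_factor[OF step(7) F ll step(3) step(11) step(4)]) (use K0 in auto)
  show ?case
  proof (rule ccontr)
    assume "h x \<noteq> \<zero>\<^bsub>\<Delta> l\<^esub>"
    then have "h' (g x) \<noteq> \<zero>\<^bsub>\<Delta> l\<^esub>" using h'(2) step(12) by simp
    then have "linked A ?F (\<Delta> l)" unfolding linked_def using h'(1) Hom_closed[OF step(3,12)] by blast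
    then have "k \<le> l" by (intro linked_order[OF k step(9)] linked_Fix_source[OF RA lk step(2) ll])
    then show False using step(10)[OF step(1)] by simp
  qed
qed

text \<open>
  An isomorphism of algebras from \<open>End(\<Delta>(l))\<close> to \<open>R\<close> must send multiplication by \<open>r\<close> to \<open>r\<close>, so all
  endomorphisms are scalars.
\<close>

lemma End_ring_iso:
  assumes l: "l \<in> \<Lambda>"
  shows "\<exists>h. (\<forall>f\<in>Hom A (\<Delta> l) (\<Delta> l). h f \<in> carrier R) \<and> inj_on h (Hom A (\<Delta> l) (\<Delta> l)) \<and>
    (\<forall>r\<in>carrier R. h (\<lambda>x\<in>carrier (\<Delta> l). scal A (\<Delta> l) r x) = r)"
proof -
  interpret R: cring R by (rule cring_R)
  let ?M = "\<Delta> l"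
  have M: "left_module A ?M" by (rule std_module[OF l])
  have "algebra_isomorphic R (End_algebra A ?M) (self_algebra R)"
    using qh l unfolding split_quasi_hereditary_def by blast
  then obtain h where h: "h \<in> ring_iso (End_algebra A ?M) (self_algebra R)"
    "\<forall>r\<in>carrier R. \<forall>x\<in>carrier (End_algebra A ?M). h (r \<odot>\<^bsub>End_algebra A ?M\<^esub> x) = r \<odot>\<^bsub>self_algebra R\<^esub> h x"
    unfolding algebra_isomorphic_def by blast
  have cE: "carrier (End_algebra A ?M) = Hom A ?M ?M" by (simp add: End_algebra_def)
  have one: "h (\<lambda>x\<in>carrier ?M. x) = \<one>\<^bsub>R\<^esub>"
    using h(1) by (auto simp: ring_iso_def ring_hom_def End_algebra_def)
  have b: "bij_betw h (Hom A ?M ?M) (carrier R)" using h(1) by (simp add: ring_iso_def cE)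
  have "h (\<lambda>x\<in>carrier ?M. scal A ?M r x) = r" if r: "r \<in> carrier R" for r
  proof -
    have "r \<odot>\<^bsub>End_algebra A ?M\<^esub> (\<lambda>x\<in>carrier ?M. x) = (\<lambda>x\<in>carrier ?M. scal A ?M r x)"
      by (auto simp: End_algebra_def fun_eq_iff)
    moreover have "h (r \<odot>\<^bsub>End_algebra A ?M\<^esub> (\<lambda>x\<in>carrier ?M. x)) = r \<odot>\<^bsub>self_algebra R\<^esub> h (\<lambda>x\<in>carrier ?M. x)"
      using h(2) r cE Hom_id[OF M] by blast
    ultimately show ?thesis using r one by simp
  qed
  then show ?thesis using b by (auto simp: bij_betw_def)
qed

lemma End_scalar:
  assumes l: "l \<in> \<Lambda>" and s: "s \<in> Hom A (\<Delta> l) (\<Delta> l)"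
  shows "\<exists>r\<in>carrier R. \<forall>x\<in>carrier (\<Delta> l). s x = scal A (\<Delta> l) r x"
proof -
  obtain h where h: "\<forall>f\<in>Hom A (\<Delta> l) (\<Delta> l). h f \<in> carrier R" "inj_on h (Hom A (\<Delta> l) (\<Delta> l))"
    "\<forall>r\<in>carrier R. h (\<lambda>x\<in>carrier (\<Delta> l). scal A (\<Delta> l) r x) = r" using End_ring_iso[OF l] by blast
  have r: "h s \<in> carrier R" using h(1) s by blast
  have "h (\<lambda>x\<in>carrier (\<Delta> l). scal A (\<Delta> l) (h s) x) = h s" using h(3) r by blast
  then have eq: "(\<lambda>x\<in>carrier (\<Delta> l). scal A (\<Delta> l) (h s) x) = s"
    by (rule inj_onD[OF h(2)]) (rule scal_is_Hom[OF RA std_module[OF l] r], rule s)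
  have "s x = scal A (\<Delta> l) (h s) x" if "x \<in> carrier (\<Delta> l)" for x
    using fun_cong[OF eq, of x] that by simp
  then show ?thesis using r by blast
qed

lemma scalar_faithful:
  assumes l: "l \<in> \<Lambda>" and r: "r \<in> carrier R" "\<And>x. x \<in> carrier (\<Delta> l) \<Longrightarrow> scal A (\<Delta> l) r x = \<zero>\<^bsub>\<Delta> l\<^esub>"
  shows "r = \<zero>\<^bsub>R\<^esub>"
proof -
  interpret R: cring R by (rule cring_R)
  obtain h where h: "\<forall>r\<in>carrier R. h (\<lambda>x\<in>carrier (\<Delta> l). scal A (\<Delta> l) r x) = r" using End_ring_iso[OF l] by blast
  have "(\<lambda>x\<in>carrier (\<Delta> l). scal A (\<Delta> l) r x) = (\<lambda>x\<in>carrier (\<Delta> l). scal A (\<Delta> l) \<zero>\<^bsub>R\<^esub> x)"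
    by (rule restrict_ext) (simp add: r(2) scal_zero_l[OF RA std_module[OF l]])
  from trans[OF trans[OF sym[OF bspec[OF h r(1)]] arg_cong[OF this, of h]] bspec[OF h R.zero_closed]]
  show ?thesis .
qed

lemma End_idempotent:
  assumes conn: "connected_ring R" and l: "l \<in> \<Lambda>" and e: "e \<in> Hom A (\<Delta> l) (\<Delta> l)"
    and idem: "\<And>x. x \<in> carrier (\<Delta> l) \<Longrightarrow> e (e x) = e x"
  shows "(\<forall>x\<in>carrier (\<Delta> l). e x = \<zero>\<^bsub>\<Delta> l\<^esub>) \<or> (\<forall>x\<in>carrier (\<Delta> l). e x = x)"
proof -
  interpret R: cring R by (rule cring_R)
  interpret L: left_module A "\<Delta> l" by (rule std_module[OF l])
  note sc = scal_closed[OF RA std_module[OF l]]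
  obtain r where r: "r \<in> carrier R" "\<And>x. x \<in> carrier (\<Delta> l) \<Longrightarrow> e x = scal A (\<Delta> l) r x"
    using End_scalar[OF l e] by blast
  have "r \<otimes>\<^bsub>R\<^esub> r \<ominus>\<^bsub>R\<^esub> r = \<zero>\<^bsub>R\<^esub>"
  proof (rule scalar_faithful[OF l])
    fix x assume x: "x \<in> carrier (\<Delta> l)"
    have "scal A (\<Delta> l) r (scal A (\<Delta> l) r x) = scal A (\<Delta> l) r x"
      using idem[OF x] r(2)[OF x] r(2)[OF sc[OF r(1) x]] by simp
    then show "scal A (\<Delta> l) (r \<otimes>\<^bsub>R\<^esub> r \<ominus>\<^bsub>R\<^esub> r) x = \<zero>\<^bsub>\<Delta> l\<^esub>"
      using r(1) x sc L.M.minus_eq_zero_iff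
      by (simp add: scal_minus_l[OF RA std_module[OF l]] scal_mult[OF RA std_module[OF l]])
  qed (use r in simp)
  then have "r \<otimes>\<^bsub>R\<^esub> r = r" using r(1) R.minus_eq_zero_iff by simp
  then have "r = \<zero>\<^bsub>R\<^esub> \<or> r = \<one>\<^bsub>R\<^esub>" using conn r(1) unfolding connected_ring_def by blast
  then show ?thesis
    using r(2) scal_zero_l[OF RA std_module[OF l]] scal_one[OF RA std_module[OF l]] by auto
qed

text \<open>
  The filtration may contain vanishing factors; the quotient is the first nonzero one from the top.
\<close>

lemma top_quotient:
  assumes "filt Y" "left_module A Y" "carrier Y \<noteq> {\<zero>\<^bsub>Y\<^esub>}"
  shows "\<exists>l\<in>\<Lambda>. \<exists>n E g. idem_matrix R n E \<and> g \<in> Hom A Y (Fix A (\<Delta> l) n E) \<and> g ` carrier Y = carrier (Fix A (\<Delta> l) n E) \<and>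
    carrier (Fix A (\<Delta> l) n E) \<noteq> {\<zero>\<^bsub>Fix A (\<Delta> l) n E\<^esub>} \<and> filt (Y\<lparr>carrier := a_kernel Y (Fix A (\<Delta> l) n E) g\<rparr>)"
  using assms
proof (induction rule: dfilt.induct)
  case (zero M)
  then show ?case by simp
next
  case (step l n E g Y)
  let ?F = "Fix A (\<Delta> l) n E"
  show ?case
  proof (cases "carrier ?F = {\<zero>\<^bsub>?F\<^esub>}")
    case True
    then have "a_kernel Y ?F g = carrier Y" using Hom_closed[OF step(3)] by (auto simp: set_eq_iff)
    then have "Y\<lparr>carrier := a_kernel Y ?F g\<rparr> = Y" by simp
    then show ?thesis using step.IH step(7,8) by simp
  next
    case False
    then show ?thesis using step(1-5) by blast
  qed
qed

lemma Hom_msum_pointwise: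
  fixes M :: "('a, 'x) module" and N :: "('a, 'y) module"
  assumes M: "left_module A M" and N: "left_module A N" and f: "\<And>k. k < n \<Longrightarrow> f k \<in> Hom A M N"
  shows "(\<lambda>x\<in>carrier M. msum N (\<lambda>k. f k x) n) \<in> Hom A M N"
proof (rule Hom_restrictI[OF M])
  interpret N: left_module A N by (rule N)
  note c = Hom_closed[OF f]
  fix x assume x: "x \<in> carrier M"
  show "msum N (\<lambda>k. f k x) n \<in> carrier N" using c x by (intro N.M.msum_closed) auto
  show "msum N (\<lambda>k. f k (x \<oplus>\<^bsub>M\<^esub> y)) n = msum N (\<lambda>k. f k x) n \<oplus>\<^bsub>N\<^esub> msum N (\<lambda>k. f k y) n" if y: "y \<in> carrier M" for y
    using x y c by (subst N.M.msum_add[symmetric]) (auto intro!: msum_cong simp: Hom_add[OF f])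
  show "msum N (\<lambda>k. f k (a \<odot>\<^bsub>M\<^esub> x)) n = a \<odot>\<^bsub>N\<^esub> msum N (\<lambda>k. f k x) n" if a: "a \<in> carrier A" for a
    using x a c by (subst N.smult_msum_r) (auto intro!: msum_cong simp: Hom_smult[OF f])
qed

text \<open>
  Over a connected ring a standard module has no proper nonzero filtered quotient. The top factor
  \<open>\<Delta>(v) \<otimes> U\<close> of such a quotient receives a nonzero map from \<open>\<Delta>(l)\<close>, so \<open>l \<le> v\<close>. Hence the
  indices above \<open>v\<close> are not below \<open>l\<close>, and every map from the projective cover \<open>P(v)\<close> to \<open>\<Delta>(l)\<close> factors
  through \<open>\<Delta>(v)\<close>. Lifting the columns of \<open>U\<close> along \<open>\<Delta>(l) \<rightarrow> \<Delta>(v) \<otimes> U\<close> therefore splits this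
  epimorphism, and the resulting idempotent endomorphism of \<open>\<Delta>(l)\<close> can only be the identity.
\<close>

lemma standard_quotient_injective:
  fixes Y :: "('a, 'y) module"
  assumes conn: "connected_ring R" and l: "l \<in> \<Lambda>" and Y: "filt Y" "left_module A Y" "carrier Y \<noteq> {\<zero>\<^bsub>Y\<^esub>}"
    and g: "g \<in> Hom A (\<Delta> l) Y" "g ` carrier (\<Delta> l) = carrier Y"
  shows "inj_on g (carrier (\<Delta> l))"
proof -
  let ?L = "\<Delta> l"
  have lL: "left_module A ?L" by (rule std_module[OF l])
  interpret L: left_module A ?L by (rule lL)
  obtain v n E q where v: "v \<in> \<Lambda>" and E: "idem_matrix R n E" and q: "q \<in> Hom A Y (Fix A (\<Delta> v) n E)"
    "q ` carrier Y = carrier (Fix A (\<Delta> v) n E)" and nz: "carrier (Fix A (\<Delta> v) n E) \<noteq> {\<zero>\<^bsub>Fix A (\<Delta> v) n E\<^esub>}"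
    using top_quotient[OF Y] by blast
  let ?V = "\<Delta> v" and ?F = "Fix A (\<Delta> v) n E"
  have lV: "left_module A ?V" by (rule std_module[OF v])
  have F: "left_module A ?F" by (rule left_module_Fix[OF RA lV E])
  interpret F: left_module A ?F by (rule F)
  define G where "G = compose (carrier ?L) q g"
  have G: "G \<in> Hom A ?L ?F" unfolding G_def by (rule Hom_compose[OF lL g(1) q(1)])
  have Gs: "G ` carrier ?L = carrier ?F"
  proof -
    have "G ` carrier ?L = q ` (g ` carrier ?L)" unfolding G_def image_image by (intro image_cong refl) simp
    then show ?thesis unfolding g(2) q(2) .
  qed
  obtain y where y: "y \<in> carrier ?F" "y \<noteq> \<zero>\<^bsub>?F\<^esub>" using nz F.M.zero_closed by blast
  obtain x where x: "x \<in> carrier ?L" "G x = y" using y(1) Gs by (metis imageE)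
  have "linked A ?L ?F" unfolding linked_def using G x y(2) by blast
  then have lv: "l \<le> v" by (intro linked_order[OF l v] linked_Fix_target[OF RA lV E lL])
  obtain P where "standard_cover v P" using projective_covers v by blast
  then obtain p where P: "fgp A P" and p: "p \<in> Hom A P ?V" "p ` carrier P = carrier ?V"
    and k: "dfilt R A {m \<in> \<Lambda>. v < m} \<Delta> (P\<lparr>carrier := a_kernel P ?V p\<rparr>)"
    unfolding standard_cover_def by blast
  have lP: "left_module A P" using P by (simp add: fgp_def)
  have sC: "submodule (a_kernel P ?V p) A P" by (rule submodule_kernel[OF lP lV p(1)])
  have lC: "left_module A (P\<lparr>carrier := a_kernel P ?V p\<rparr>)" by (rule left_module_submodule[OF lP sC])
  \<comment> \<open>no index above \<open>v\<close> is below \<open>l\<close>, so the kernel of \<open>p\<close> has no maps to \<open>\<Delta> l\<close>\<close>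
  have factor: "\<exists>s\<in>Hom A ?V ?L. \<forall>w\<in>carrier P. s (p w) = h w" if h: "h \<in> Hom A P ?L" for h
  proof -
    have "h w = \<zero>\<^bsub>?L\<^esub>" if w: "w \<in> a_kernel P ?V p" for w
    proof -
      have "restrict h (a_kernel P ?V p) w = \<zero>\<^bsub>?L\<^esub>"
        by (rule Hom_vanish[OF k lC _ l _ Hom_restrict_sub[OF lP sC h]]) (use w lv in auto)
      then show ?thesis using w by simp
    qed
    then obtain s where "s \<in> Hom A ?V ?L" "\<And>w. w \<in> carrier P \<Longrightarrow> s (p w) = h w"
      using Hom_factor[OF lP lV lL p(1) h p(2)] by auto
    then show ?thesis by blast
  qed
  have lift: "\<exists>h\<in>Hom A P ?L. \<forall>w\<in>carrier P. G (h w) = col A ?V n E j (p w)" if j: "j < n" for j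
  proof -
    have c: "compose (carrier P) (col A ?V n E j) p \<in> Hom A P ?F"
      by (rule Hom_compose[OF lP p(1) col_Hom[OF RA lV E j]])
    obtain h where "h \<in> Hom A P ?L" "\<And>w. w \<in> carrier P \<Longrightarrow> G (h w) = compose (carrier P) (col A ?V n E j) p w"
      using fgp_lift[OF P lL F G Gs c] by auto
    then show ?thesis by (intro bexI[of _ h]) auto
  qed
  have "\<exists>s\<in>Hom A ?V ?L. \<forall>m\<in>carrier ?V. G (s m) = col A ?V n E j m" if j: "j < n" for j
  proof -
    obtain h where h: "h \<in> Hom A P ?L" "\<forall>w\<in>carrier P. G (h w) = col A ?V n E j (p w)" using lift[OF j] by blast
    then obtain s where s: "s \<in> Hom A ?V ?L" "\<forall>w\<in>carrier P. s (p w) = h w" using factor[OF h(1)] by blast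
    have "G (s m) = col A ?V n E j m" if m: "m \<in> carrier ?V" for m
    proof -
      obtain w where w: "w \<in> carrier P" "p w = m" using m p(2) by (metis imageE)
      have "G (s (p w)) = col A ?V n E j (p w)" using s(2) h(2) w(1) by simp
      then show ?thesis using w(2) by simp
    qed
    then show ?thesis using s(1) by blast
  qed
  then have "\<forall>j. \<exists>s. j < n \<longrightarrow> s \<in> Hom A ?V ?L \<and> (\<forall>m\<in>carrier ?V. G (s m) = col A ?V n E j m)" by blast
  then obtain s where s: "\<forall>j<n. s j \<in> Hom A ?V ?L \<and> (\<forall>m\<in>carrier ?V. G (s j m) = col A ?V n E j m)" by metis
  define S where "S = (\<lambda>w\<in>carrier ?F. msum ?L (\<lambda>j. compose (carrier ?F) (s j) (\<lambda>w\<in>carrier ?F. w j) w) n)"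
  have S: "S \<in> Hom A ?F ?L" unfolding S_def
    by (rule Hom_msum_pointwise[OF F lL]) (use s Hom_compose[OF F Fix_proj[OF RA lV E]] in blast)
  have GS: "G (S w) = w" if w: "w \<in> carrier ?F" for w
  proof -
    have wV: "w j \<in> carrier ?V" if "j < n" for j
      using w powD[OF _ that, of w ?V] carrier_Fix[OF RA lV E] by blast
    have "G (S w) = G (msum ?L (\<lambda>j. s j (w j)) n)" using w by (simp add: S_def)
    also have "\<dots> = msum ?F (\<lambda>j. G (s j (w j))) n"
    proof (rule Hom_msum[OF lL F G])
      fix j assume j: "j < n"
      have "s j \<in> Hom A ?V ?L" using s j by blast
      from Hom_closed[OF this wV[OF j]] show "s j (w j) \<in> carrier ?L" .
    qed
    also have "\<dots> = msum ?F (\<lambda>j. col A ?V n E j (w j)) n" by (rule msum_cong) (use s wV in blast)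
    also have "\<dots> = w" by (rule Fix_sum_col[OF RA lV E w])
    finally show ?thesis .
  qed
  let ?e = "compose (carrier ?L) S G"
  have e: "?e \<in> Hom A ?L ?L" by (rule Hom_compose[OF lL G S])
  have ee: "?e (?e w) = ?e w" if w: "w \<in> carrier ?L" for w
    using GS[OF Hom_closed[OF G w]] w Hom_closed[OF S Hom_closed[OF G w]] by simp
  from End_idempotent[OF conn l e ee]
  have "\<forall>w\<in>carrier ?L. S (G w) = w"
  proof
    assume "\<forall>w\<in>carrier ?L. ?e w = \<zero>\<^bsub>?L\<^esub>"
    then have "S y = \<zero>\<^bsub>?L\<^esub>" using x by auto
    then have "y = \<zero>\<^bsub>?F\<^esub>" using GS[OF y(1)] Hom_zero[OF lL F G] by simp
    then show ?thesis using y(2) by simp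
  next
    assume e1: "\<forall>w\<in>carrier ?L. ?e w = w"
    show ?thesis
    proof
      fix w assume "w \<in> carrier ?L"
      then show "S (G w) = w" using bspec[OF e1, of w] by simp
    qed
  qed
  then have SG: "S (q (g w)) = w" if "w \<in> carrier ?L" for w using that by (simp add: G_def)
  show ?thesis
  proof (rule inj_onI)
    fix w w' assume w: "w \<in> carrier ?L" "w' \<in> carrier ?L" "g w = g w'"
    have "w = S (q (g w))" using SG[OF w(1)] by simp
    also have "\<dots> = w'" unfolding w(3) by (rule SG[OF w(2)])
    finally show "w = w'" .
  qed
qed

end

section \<open>Strict Morita contexts\<close>

locale bimodule =
  fixes A :: "('a, 'k) ring_scheme" and B :: "('b, 'j) ring_scheme"
    and X :: "('a, 'x) module" and xr :: "'x \<Rightarrow> 'b \<Rightarrow> 'x"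
  assumes X: "left_module A X" and ring_B: "ring B"
    and xr_closed: "x \<in> carrier X \<Longrightarrow> b \<in> carrier B \<Longrightarrow> xr x b \<in> carrier X"
    and xr_add_l: "x \<in> carrier X \<Longrightarrow> x' \<in> carrier X \<Longrightarrow> b \<in> carrier B \<Longrightarrow> xr (x \<oplus>\<^bsub>X\<^esub> x') b = xr x b \<oplus>\<^bsub>X\<^esub> xr x' b"
    and xr_add_r: "x \<in> carrier X \<Longrightarrow> b \<in> carrier B \<Longrightarrow> b' \<in> carrier B \<Longrightarrow> xr x (b \<oplus>\<^bsub>B\<^esub> b') = xr x b \<oplus>\<^bsub>X\<^esub> xr x b'"
    and xr_mult: "x \<in> carrier X \<Longrightarrow> b \<in> carrier B \<Longrightarrow> b' \<in> carrier B \<Longrightarrow> xr x (b \<otimes>\<^bsub>B\<^esub> b') = xr (xr x b) b'"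
    and xr_one: "x \<in> carrier X \<Longrightarrow> xr x \<one>\<^bsub>B\<^esub> = x"
    and xr_smult: "a \<in> carrier A \<Longrightarrow> x \<in> carrier X \<Longrightarrow> b \<in> carrier B \<Longrightarrow> xr (a \<odot>\<^bsub>X\<^esub> x) b = a \<odot>\<^bsub>X\<^esub> xr x b"

definition hom_module ::
  "('a, 'k) ring_scheme \<Rightarrow> ('a, 'x) module \<Rightarrow> ('x \<Rightarrow> 'b \<Rightarrow> 'x) \<Rightarrow> ('a, 'm) module \<Rightarrow> ('b, 'x \<Rightarrow> 'm) module" where
  "hom_module A X xr M = \<lparr>carrier = Hom A X M, monoid.mult = undefined, monoid.one = undefined,
     ring.zero = (\<lambda>x\<in>carrier X. \<zero>\<^bsub>M\<^esub>), ring.add = (\<lambda>f g. \<lambda>x\<in>carrier X. f x \<oplus>\<^bsub>M\<^esub> g x),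
     smult = (\<lambda>b f. \<lambda>x\<in>carrier X. f (xr x b))\<rparr>"

lemma hom_module_simps [simp]:
  "carrier (hom_module A X xr M) = Hom A X M"
  "\<zero>\<^bsub>hom_module A X xr M\<^esub> = (\<lambda>x\<in>carrier X. \<zero>\<^bsub>M\<^esub>)"
  "f \<oplus>\<^bsub>hom_module A X xr M\<^esub> g = (\<lambda>x\<in>carrier X. f x \<oplus>\<^bsub>M\<^esub> g x)"
  "b \<odot>\<^bsub>hom_module A X xr M\<^esub> f = (\<lambda>x\<in>carrier X. f (xr x b))"
  by (simp_all add: hom_module_def)

lemma msum_hom_module: "x \<in> carrier X \<Longrightarrow> msum (hom_module A X xr M) f n x = msum M (\<lambda>k. f k x) n"
  by (induction n) auto

lemma Hom_plus:
  assumes X: "left_module A X" and M: "left_module A M" and f: "f \<in> Hom A X M" and g: "g \<in> Hom A X M"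
  shows "(\<lambda>x\<in>carrier X. f x \<oplus>\<^bsub>M\<^esub> g x) \<in> Hom A X M"
proof -
  interpret M: left_module A M by fact
  show ?thesis
    by (rule Hom_restrictI[OF X])
      (auto simp: Hom_closed[OF f] Hom_closed[OF g] Hom_add[OF f] Hom_add[OF g] Hom_smult[OF f] Hom_smult[OF g]
        M.smult_r_distr M.M.a_ac)
qed

lemma (in bimodule) hom_left_module:
  assumes M: "left_module A M" shows "left_module B (hom_module A X xr M)"
proof -
  interpret M: left_module A M by fact
  interpret X: left_module A X by (rule X)
  let ?H = "hom_module A X xr M"
  have ab: "abelian_group ?H"
  proof (rule abelian_groupI')
    fix f g assume f: "f \<in> carrier ?H" and g: "g \<in> carrier ?H"
    note fc = Hom_closed[of f A X M] and gc = Hom_closed[of g A X M]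
    show "f \<oplus>\<^bsub>?H\<^esub> g \<in> carrier ?H" using Hom_plus[OF X M] f g by simp
    show "f \<oplus>\<^bsub>?H\<^esub> g = g \<oplus>\<^bsub>?H\<^esub> f" using f g fc gc by (auto simp: fun_eq_iff M.M.a_comm)
    show "f \<oplus>\<^bsub>?H\<^esub> g \<oplus>\<^bsub>?H\<^esub> h = f \<oplus>\<^bsub>?H\<^esub> (g \<oplus>\<^bsub>?H\<^esub> h)" if "h \<in> carrier ?H" for h
      using f g that fc gc Hom_closed[of h A X M] by (auto simp: fun_eq_iff M.M.a_assoc)
  next
    show "\<zero>\<^bsub>?H\<^esub> \<in> carrier ?H" using Hom_restrictI[OF X, of "\<lambda>_. \<zero>\<^bsub>M\<^esub>" M] by simp
  next
    fix f assume f: "f \<in> carrier ?H"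
    then have fH: "f \<in> Hom A X M" by simp
    note fc = Hom_closed[OF fH]
    have z: "\<zero>\<^bsub>?H\<^esub> \<oplus>\<^bsub>?H\<^esub> f \<in> Hom A X M"
      using Hom_plus[OF X M Hom_restrictI[OF X, of "\<lambda>_. \<zero>\<^bsub>M\<^esub>" M] fH] by simp
    show "\<zero>\<^bsub>?H\<^esub> \<oplus>\<^bsub>?H\<^esub> f = f" by (rule Hom_eqI[OF z fH]) (simp add: fc)
    have n: "(\<lambda>x\<in>carrier X. \<ominus>\<^bsub>M\<^esub> f x) \<in> Hom A X M"
      by (rule Hom_restrictI[OF X])
        (auto simp: fc Hom_add[OF fH] Hom_smult[OF fH] M.M.minus_add M.smult_minus_r)
    show "\<exists>g\<in>carrier ?H. g \<oplus>\<^bsub>?H\<^esub> f = \<zero>\<^bsub>?H\<^esub>"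
      using n by (intro bexI[of _ "\<lambda>x\<in>carrier X. \<ominus>\<^bsub>M\<^esub> f x"]) (auto simp: fun_eq_iff fc M.M.l_neg)
  qed
  moreover have "left_module_axioms B ?H"
  proof
    fix b f assume b: "b \<in> carrier B" and f: "f \<in> carrier ?H"
    then have fH: "f \<in> Hom A X M" by simp
    show "b \<odot>\<^bsub>?H\<^esub> f \<in> carrier ?H"
      using Hom_restrictI[OF X, of "\<lambda>x. f (xr x b)" M] b
      by (simp add: xr_closed xr_add_l xr_smult Hom_closed[OF fH] Hom_add[OF fH] Hom_smult[OF fH])
    show "(b \<oplus>\<^bsub>B\<^esub> b') \<odot>\<^bsub>?H\<^esub> f = b \<odot>\<^bsub>?H\<^esub> f \<oplus>\<^bsub>?H\<^esub> b' \<odot>\<^bsub>?H\<^esub> f" if "b' \<in> carrier B" for b'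
      using b that by (auto simp: fun_eq_iff xr_add_r xr_closed Hom_add[OF fH])
    show "(b \<otimes>\<^bsub>B\<^esub> b') \<odot>\<^bsub>?H\<^esub> f = b \<odot>\<^bsub>?H\<^esub> (b' \<odot>\<^bsub>?H\<^esub> f)" if "b' \<in> carrier B" for b'
      using b that by (auto simp: fun_eq_iff xr_mult xr_closed)
    show "b \<odot>\<^bsub>?H\<^esub> (f \<oplus>\<^bsub>?H\<^esub> g) = b \<odot>\<^bsub>?H\<^esub> f \<oplus>\<^bsub>?H\<^esub> b \<odot>\<^bsub>?H\<^esub> g" if "g \<in> carrier ?H" for g
      using b by (auto simp: fun_eq_iff xr_closed)
  next
    fix f assume "f \<in> carrier ?H"
    then have fH: "f \<in> Hom A X M" by simp
    have "(\<lambda>x\<in>carrier X. f (xr x \<one>\<^bsub>B\<^esub>)) = (\<lambda>x\<in>carrier X. f x)" by (rule restrict_ext) (simp add: xr_one)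
    also have "\<dots> = f" using Hom_extensional[OF fH] by (rule extensional_restrict)
    finally show "\<one>\<^bsub>B\<^esub> \<odot>\<^bsub>?H\<^esub> f = f" by simp
  qed
  ultimately show ?thesis by (simp add: left_module_def ring_B)
qed

text \<open>
  A strict Morita context, with the pairings \<open>X \<otimes> Y \<rightarrow> A\<close> and \<open>Y \<otimes> X \<rightarrow> B\<close> given as balanced
  biadditive maps. Their surjectivity amounts to \<open>1\<close> being a sum of values.
\<close>

locale morita_context =
  l?: bimodule A B X xr + r: bimodule B A Y yr
  for A :: "('a, 'k) ring_scheme" and B :: "('b, 'j) ring_scheme"
    and X :: "('a, 'x) module" and xr :: "'x \<Rightarrow> 'b \<Rightarrow> 'x"
    and Y :: "('b, 'y) module" and yr :: "'y \<Rightarrow> 'a \<Rightarrow> 'y" +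
  fixes p :: "'x \<Rightarrow> 'y \<Rightarrow> 'a" and q :: "'y \<Rightarrow> 'x \<Rightarrow> 'b"
  assumes p_closed: "x \<in> carrier X \<Longrightarrow> y \<in> carrier Y \<Longrightarrow> p x y \<in> carrier A"
    and p_add_l: "x \<in> carrier X \<Longrightarrow> x' \<in> carrier X \<Longrightarrow> y \<in> carrier Y \<Longrightarrow> p (x \<oplus>\<^bsub>X\<^esub> x') y = p x y \<oplus>\<^bsub>A\<^esub> p x' y"
    and p_add_r: "x \<in> carrier X \<Longrightarrow> y \<in> carrier Y \<Longrightarrow> y' \<in> carrier Y \<Longrightarrow> p x (y \<oplus>\<^bsub>Y\<^esub> y') = p x y \<oplus>\<^bsub>A\<^esub> p x y'"
    and p_smult: "a \<in> carrier A \<Longrightarrow> x \<in> carrier X \<Longrightarrow> y \<in> carrier Y \<Longrightarrow> p (a \<odot>\<^bsub>X\<^esub> x) y = a \<otimes>\<^bsub>A\<^esub> p x y"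
    and p_yr: "x \<in> carrier X \<Longrightarrow> y \<in> carrier Y \<Longrightarrow> a \<in> carrier A \<Longrightarrow> p x (yr y a) = p x y \<otimes>\<^bsub>A\<^esub> a"
    and p_balanced: "x \<in> carrier X \<Longrightarrow> b \<in> carrier B \<Longrightarrow> y \<in> carrier Y \<Longrightarrow> p (xr x b) y = p x (b \<odot>\<^bsub>Y\<^esub> y)"
    and q_closed: "y \<in> carrier Y \<Longrightarrow> x \<in> carrier X \<Longrightarrow> q y x \<in> carrier B"
    and q_add_l: "y \<in> carrier Y \<Longrightarrow> y' \<in> carrier Y \<Longrightarrow> x \<in> carrier X \<Longrightarrow> q (y \<oplus>\<^bsub>Y\<^esub> y') x = q y x \<oplus>\<^bsub>B\<^esub> q y' x"
    and q_add_r: "y \<in> carrier Y \<Longrightarrow> x \<in> carrier X \<Longrightarrow> x' \<in> carrier X \<Longrightarrow> q y (x \<oplus>\<^bsub>X\<^esub> x') = q y x \<oplus>\<^bsub>B\<^esub> q y x'"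
    and q_smult: "b \<in> carrier B \<Longrightarrow> y \<in> carrier Y \<Longrightarrow> x \<in> carrier X \<Longrightarrow> q (b \<odot>\<^bsub>Y\<^esub> y) x = b \<otimes>\<^bsub>B\<^esub> q y x"
    and q_xr: "y \<in> carrier Y \<Longrightarrow> x \<in> carrier X \<Longrightarrow> b \<in> carrier B \<Longrightarrow> q y (xr x b) = q y x \<otimes>\<^bsub>B\<^esub> b"
    and q_balanced: "y \<in> carrier Y \<Longrightarrow> a \<in> carrier A \<Longrightarrow> x \<in> carrier X \<Longrightarrow> q (yr y a) x = q y (a \<odot>\<^bsub>X\<^esub> x)"
    and pq: "x \<in> carrier X \<Longrightarrow> y \<in> carrier Y \<Longrightarrow> x' \<in> carrier X \<Longrightarrow> p x y \<odot>\<^bsub>X\<^esub> x' = xr x (q y x')"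
    and qp: "y \<in> carrier Y \<Longrightarrow> x \<in> carrier X \<Longrightarrow> y' \<in> carrier Y \<Longrightarrow> q y x \<odot>\<^bsub>Y\<^esub> y' = yr y (p x y')"
    and p_onto: "\<exists>m u w. (\<forall>j<m. u j \<in> carrier X \<and> w j \<in> carrier Y) \<and> msum A (\<lambda>j. p (u j) (w j)) (m::nat) = \<one>\<^bsub>A\<^esub>"
    and q_onto: "\<exists>n v z. (\<forall>i<n. v i \<in> carrier Y \<and> z i \<in> carrier X) \<and> msum B (\<lambda>i. q (v i) (z i)) (n::nat) = \<one>\<^bsub>B\<^esub>"

lemma (in morita_context) dual: "morita_context B A Y yr X xr q p"
proof (intro morita_context.intro morita_context_axioms.intro)
  show "bimodule B A Y yr" by (rule r.bimodule_axioms)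
  show "bimodule A B X xr" by (rule l.bimodule_axioms)
qed (fact p_closed p_add_l p_add_r p_smult p_yr p_balanced q_closed q_add_l q_add_r q_smult
    q_xr q_balanced pq qp p_onto q_onto)+

lemmas (in morita_context) Y = r.X and yr_closed = r.xr_closed and yr_add_l = r.xr_add_l and yr_add_r = r.xr_add_r
  and yr_mult = r.xr_mult and yr_one = r.xr_one and yr_smult = r.xr_smult

context morita_context begin

lemma tau_Hom:
  assumes M: "left_module A M" and "y \<in> carrier Y" "m \<in> carrier M"
  shows "(\<lambda>x\<in>carrier X. p x y \<odot>\<^bsub>M\<^esub> m) \<in> Hom A X M"
proof -
  interpret M: left_module A M by fact
  show ?thesis
    by (rule Hom_restrictI[OF X]) (use assms in \<open>auto simp: p_closed p_add_l p_smult M.smult_closed M.smult_l_distr M.smult_assoc1\<close>)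
qed

lemma xr_msum:
  assumes "x \<in> carrier X" "\<And>i. i < n \<Longrightarrow> f i \<in> carrier B"
  shows "xr x (msum B f n) = msum X (\<lambda>i. xr x (f i)) n"
proof -
  have "abelian_group B" using left_moduleD(1)[OF Y] by (simp add: ring_def)
  then show ?thesis
    by (rule additive_msum[OF _ left_moduleD(2)[OF X]]) (use assms in \<open>auto intro: xr_closed xr_add_r\<close>)
qed

text \<open>
  \<open>Hom A X M\<close> is \<open>Y \<otimes>\<^sub>A M\<close>, with \<open>tau y m\<close> in the role of \<open>y \<otimes> m\<close>. So generators of \<open>Y\<close> and
  of \<open>M\<close> combine to generators.
\<close>

lemma hom_finitely_generated:
  assumes M: "left_module A M" and fg: "finitely_generated A M"
  shows "finitely_generated B (hom_module A X xr M)"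
proof -
  interpret M: left_module A M by fact
  interpret X: left_module A X by (rule X)
  interpret Y: left_module B Y by (rule Y)
  interpret d: morita_context B A Y yr X xr q p by (rule dual)
  let ?H = "hom_module A X xr M"
  have lH: "left_module B ?H" by (rule hom_left_module[OF M])
  define tau where "tau y m = (\<lambda>x\<in>carrier X. p x y \<odot>\<^bsub>M\<^esub> m)" for y m
  obtain S where S: "finite S" "S \<subseteq> carrier M" "\<forall>H. submodule H A M \<and> S \<subseteq> H \<longrightarrow> H = carrier M"
    using fg unfolding finitely_generated_iff[OF M] by blast
  obtain k u w where uw: "\<forall>j<k. u j \<in> carrier X \<and> w j \<in> carrier Y" "msum A (\<lambda>j. p (u j) (w j)) (k::nat) = \<one>\<^bsub>A\<^esub>"
    using p_onto by blast
  obtain n v z where vz: "\<forall>i<n. v i \<in> carrier Y \<and> z i \<in> carrier X" "msum B (\<lambda>i. q (v i) (z i)) (n::nat) = \<one>\<^bsub>B\<^esub>"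
    using q_onto by blast
  have tau: "tau y m \<in> carrier ?H" if "y \<in> carrier Y" "m \<in> carrier M" for y m
    using tau_Hom[OF M that] by (simp add: tau_def)
  have tau_b: "tau (b \<odot>\<^bsub>Y\<^esub> y) m = b \<odot>\<^bsub>?H\<^esub> tau y m" if "b \<in> carrier B" "y \<in> carrier Y" for b y m
    using that by (auto simp: tau_def fun_eq_iff xr_closed p_balanced)
  have tau_y: "tau (y \<oplus>\<^bsub>Y\<^esub> y') m = tau y m \<oplus>\<^bsub>?H\<^esub> tau y' m"
    if "y \<in> carrier Y" "y' \<in> carrier Y" "m \<in> carrier M" for y y' m
    using that by (auto simp: tau_def fun_eq_iff p_add_r p_closed M.smult_l_distr)
  have tau_m: "tau y (m \<oplus>\<^bsub>M\<^esub> m') = tau y m \<oplus>\<^bsub>?H\<^esub> tau y m'"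
    if "y \<in> carrier Y" "m \<in> carrier M" "m' \<in> carrier M" for y m m'
    using that by (auto simp: tau_def fun_eq_iff p_closed M.smult_r_distr)
  have tau_a: "tau y (a \<odot>\<^bsub>M\<^esub> m) = tau (yr y a) m" if "y \<in> carrier Y" "m \<in> carrier M" "a \<in> carrier A" for y m a
    using that by (auto simp: tau_def fun_eq_iff p_closed p_yr M.smult_assoc1)
  have tau_0: "tau y \<zero>\<^bsub>M\<^esub> = \<zero>\<^bsub>?H\<^esub>" if "y \<in> carrier Y" for y
    using that by (auto simp: tau_def fun_eq_iff p_closed)
  let ?T = "(\<lambda>(j, s). tau (w j) s) ` ({..<k} \<times> S)"
  show ?thesis unfolding finitely_generated_iff[OF lH]
  proof (intro exI[of _ ?T] conjI allI impI)
    show "finite ?T" using S(1) by simp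
    show "?T \<subseteq> carrier ?H" using uw(1) S(2) tau by auto
    fix H assume "submodule H B ?H \<and> ?T \<subseteq> H"
    then have H: "submodule H B ?H" and TH: "?T \<subseteq> H" by auto
    note H' = submoduleD[OF H]
    have msH: "msum ?H f i \<in> H" if "\<And>j. j < i \<Longrightarrow> f j \<in> H" for f and i :: nat
      using that by (induction i) (use H' in \<open>auto simp del: hom_module_simps\<close>)
    have tS: "tau y s \<in> H" if y: "y \<in> carrier Y" and s: "s \<in> S" for y s
    proof -
      have sM: "s \<in> carrier M" using S(2) s by blast
      have pc: "p (u j) (w j) \<in> carrier A" if "j < k" for j using uw(1) that p_closed by blast
      have "y = yr y (msum A (\<lambda>j. p (u j) (w j)) k)" using yr_one[OF y] uw(2) by simp
      also have "\<dots> = msum Y (\<lambda>j. yr y (p (u j) (w j))) k" by (rule d.xr_msum[OF y pc])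
      also have "\<dots> = msum Y (\<lambda>j. q y (u j) \<odot>\<^bsub>Y\<^esub> w j) k"
        by (rule msum_cong) (use uw(1) y qp in auto)
      finally have ye: "y = msum Y (\<lambda>j. q y (u j) \<odot>\<^bsub>Y\<^esub> w j) k" .
      have "tau (msum Y (\<lambda>j. q y (u j) \<odot>\<^bsub>Y\<^esub> w j) k) s = msum ?H (\<lambda>j. tau (q y (u j) \<odot>\<^bsub>Y\<^esub> w j) s) k"
        by (rule additive_msum[OF Y.M.abelian_group_axioms left_moduleD(2)[OF lH]])
          (use tau tau_y sM uw(1) y in \<open>auto intro!: Y.smult_closed q_closed simp del: hom_module_simps\<close>)
      moreover have "msum ?H (\<lambda>j. tau (q y (u j) \<odot>\<^bsub>Y\<^esub> w j) s) k \<in> H"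
      proof (rule msH)
        fix j assume j: "j < k"
        have "tau (w j) s \<in> H" using TH j s by blast
        then show "tau (q y (u j) \<odot>\<^bsub>Y\<^esub> w j) s \<in> H"
          using H'(4) uw(1) j y tau_b q_closed by (metis (no_types))
      qed
      ultimately show ?thesis using ye by simp
    qed
    have "submodule {m \<in> carrier M. \<forall>y\<in>carrier Y. tau y m \<in> H} A M"
      by (rule M.submodule_minus) (use H' in \<open>auto simp: tau_0 tau_m tau_a yr_closed M.smult_closed simp del: hom_module_simps\<close>)
    moreover have "S \<subseteq> {m \<in> carrier M. \<forall>y\<in>carrier Y. tau y m \<in> H}" using tS S(2) by blast
    ultimately have "{m \<in> carrier M. \<forall>y\<in>carrier Y. tau y m \<in> H} = carrier M" using S(3) by blast
    then have tH: "tau y m \<in> H" if "y \<in> carrier Y" "m \<in> carrier M" for y m using that by blast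
    have "g \<in> H" if g: "g \<in> carrier ?H" for g
    proof -
      have gH: "g \<in> Hom A X M" using g by simp
      have qc: "q (v i) (z i) \<in> carrier B" if "i < n" for i using vz(1) that q_closed by blast
      have zc: "z i \<in> carrier X" "v i \<in> carrier Y" if "i < n" for i using vz(1) that by auto
      let ?s = "msum ?H (\<lambda>i. tau (v i) (g (z i))) n"
      have sH: "?s \<in> H" by (rule msH) (use tH zc Hom_closed[OF gH] in blast)
      have "g = ?s"
      proof (rule Hom_eqI[OF gH])
        show "?s \<in> Hom A X M" using sH H'(1) by auto
        fix x assume x: "x \<in> carrier X"
        have "g x = g (xr x (msum B (\<lambda>i. q (v i) (z i)) n))" using xr_one[OF x] vz(2) by simp
        also have "\<dots> = g (msum X (\<lambda>i. xr x (q (v i) (z i))) n)" using xr_msum[OF x qc] by simp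
        also have "\<dots> = msum M (\<lambda>i. g (xr x (q (v i) (z i)))) n"
          by (rule Hom_msum[OF X M gH]) (use x qc xr_closed in auto)
        also have "\<dots> = msum M (\<lambda>i. p x (v i) \<odot>\<^bsub>M\<^esub> g (z i)) n"
        proof (rule msum_cong)
          fix i assume i: "i < n"
          show "g (xr x (q (v i) (z i))) = p x (v i) \<odot>\<^bsub>M\<^esub> g (z i)"
            using pq[OF x zc(2)[OF i] zc(1)[OF i]] Hom_smult[OF gH p_closed[OF x zc(2)[OF i]] zc(1)[OF i]] by simp
        qed
        also have "\<dots> = ?s x" using x by (simp add: msum_hom_module tau_def)
        finally show "g x = ?s x" .
      qed
      then show ?thesis using sH by simp
    qed
    then show "H = carrier ?H" using H'(1) by blast
  qed
qed

text \<open>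
  The unit of the equivalence. If \<open>Q\<close> is a copy of \<open>Hom A X M\<close> and \<open>N\<close> one of \<open>Hom B Y Q\<close>, then each
  \<open>z \<in> N\<close>, seen as a biadditive map on \<open>X \<times> Y\<close>, has the form \<open>p x y \<cdot> m\<close> for exactly one \<open>m\<close>.
\<close>

lemma double_hom_iso:
  fixes Q :: "('b, 'q) module" and M :: "('a, 'm) module" and N :: "('a, 'n) module"
  assumes M: "left_module A M" and Q: "left_module B Q" and N: "left_module A N"
    and i: "i \<in> Iso B Q (hom_module A X xr M)" and k: "k \<in> Iso A N (hom_module B Y yr Q)"
    and uw: "\<forall>j<m. u j \<in> carrier X \<and> w j \<in> carrier Y" "msum A (\<lambda>j. p (u j) (w j)) (m::nat) = \<one>\<^bsub>A\<^esub>"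
  shows "(\<lambda>z\<in>carrier N. msum M (\<lambda>j. i (k z (w j)) (u j)) m) \<in> Iso A N M"
proof -
  interpret M: left_module A M by fact
  interpret X: left_module A X by (rule X)
  interpret Y: left_module B Y by (rule Y)
  interpret N: left_module A N by fact
  note i' = IsoD[OF i] and k' = IsoD[OF k]
  have kH: "k z \<in> Hom B Y Q" if "z \<in> carrier N" for z using Hom_closed[OF k'(1) that] by simp
  have kc: "k z y \<in> carrier Q" if "z \<in> carrier N" "y \<in> carrier Y" for z y using Hom_closed[OF kH[OF that(1)] that(2)] .
  have iH: "i c \<in> Hom A X M" if "c \<in> carrier Q" for c using Hom_closed[OF i'(1) that] by simp
  have ic: "i c x \<in> carrier M" if "c \<in> carrier Q" "x \<in> carrier X" for c x using Hom_closed[OF iH[OF that(1)] that(2)] .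
  have ia: "i (c \<oplus>\<^bsub>Q\<^esub> d) x = i c x \<oplus>\<^bsub>M\<^esub> i d x" if "c \<in> carrier Q" "d \<in> carrier Q" "x \<in> carrier X" for c d x
    using Hom_add[OF i'(1) that(1,2)] that(3) by simp
  have isc: "i (b \<odot>\<^bsub>Q\<^esub> c) x = i c (xr x b)" if "c \<in> carrier Q" "b \<in> carrier B" "x \<in> carrier X" for c b x
    using Hom_smult[OF i'(1) that(2,1)] that(3) by simp
  have ka: "k (z \<oplus>\<^bsub>N\<^esub> z') y = k z y \<oplus>\<^bsub>Q\<^esub> k z' y" if "z \<in> carrier N" "z' \<in> carrier N" "y \<in> carrier Y" for z z' y
    using Hom_add[OF k'(1) that(1,2)] that(3) by simp
  have ks: "k (a \<odot>\<^bsub>N\<^esub> z) y = k z (yr y a)" if "z \<in> carrier N" "a \<in> carrier A" "y \<in> carrier Y" for z a y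
    using Hom_smult[OF k'(1) that(2,1)] that(3) by simp
  have uX: "u j \<in> carrier X" and wY: "w j \<in> carrier Y" if "j < m" for j using uw(1) that by auto
  define t where "t z = msum M (\<lambda>j. i (k z (w j)) (u j)) m" for z
  have tc: "t z \<in> carrier M" if z: "z \<in> carrier N" for z
    unfolding t_def by (rule M.M.msum_closed) (rule ic[OF kc[OF z wY] uX])
  have char: "i (k z y) x = p x y \<odot>\<^bsub>M\<^esub> t z" if z: "z \<in> carrier N" and y: "y \<in> carrier Y" and x: "x \<in> carrier X" for z y x
  proof -
    have "p x y \<odot>\<^bsub>M\<^esub> i (k z (w j)) (u j) = i (k z (yr y (p (u j) (w j)))) x" if j: "j < m" for j
    proof -
      note [simp] = uX[OF j] wY[OF j] z y x
      have "p x y \<odot>\<^bsub>M\<^esub> i (k z (w j)) (u j) = i (k z (w j)) (p x y \<odot>\<^bsub>X\<^esub> u j)"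
        by (rule Hom_smult[OF iH[OF kc], symmetric]) (simp_all add: p_closed)
      also have "\<dots> = i (k z (w j)) (xr x (q y (u j)))" by (simp add: pq)
      also have "\<dots> = i (q y (u j) \<odot>\<^bsub>Q\<^esub> k z (w j)) x" by (simp add: isc kc q_closed)
      also have "\<dots> = i (k z (q y (u j) \<odot>\<^bsub>Y\<^esub> w j)) x" by (simp add: Hom_smult[OF kH] q_closed)
      also have "\<dots> = i (k z (yr y (p (u j) (w j)))) x" by (simp add: qp)
      finally show ?thesis .
    qed
    then have "p x y \<odot>\<^bsub>M\<^esub> t z = msum M (\<lambda>j. i (k z (yr y (p (u j) (w j)))) x) m"
      unfolding t_def using M.smult_msum_r[OF p_closed[OF x y], of m "\<lambda>j. i (k z (w j)) (u j)"] ic[OF kc[OF z wY] uX]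
      by (simp cong: msum_cong)
    also have "\<dots> = i (k z (yr y (msum A (\<lambda>j. p (u j) (w j)) m))) x"
      by (rule additive_msum[OF M.A.abelian_group_axioms M.M.abelian_group_axioms, of "\<lambda>a. i (k z (yr y a)) x", symmetric])
        (use z y x uX wY in \<open>auto simp: ic kc yr_closed yr_add_r Hom_add[OF kH] ia p_closed\<close>)
    also have "\<dots> = i (k z y) x" using uw(2) yr_one[OF y] by simp
    finally show ?thesis by simp
  qed
  have "(\<lambda>z\<in>carrier N. t z) \<in> Hom A N M"
  proof (rule Hom_restrictI[OF N])
    fix z assume z: "z \<in> carrier N"
    show "t z \<in> carrier M" by (rule tc[OF z])
    show "t (z \<oplus>\<^bsub>N\<^esub> z') = t z \<oplus>\<^bsub>M\<^esub> t z'" if z': "z' \<in> carrier N" for z'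
    proof -
      have "t (z \<oplus>\<^bsub>N\<^esub> z') = msum M (\<lambda>j. i (k z (w j)) (u j) \<oplus>\<^bsub>M\<^esub> i (k z' (w j)) (u j)) m"
        unfolding t_def by (rule msum_cong) (simp add: ka z z' uX wY ia kc)
      also have "\<dots> = t z \<oplus>\<^bsub>M\<^esub> t z'" unfolding t_def by (rule M.M.msum_add) (simp_all add: ic kc z z' uX wY)
      finally show ?thesis .
    qed
    show "t (a \<odot>\<^bsub>N\<^esub> z) = a \<odot>\<^bsub>M\<^esub> t z" if a: "a \<in> carrier A" for a
    proof -
      have "t (a \<odot>\<^bsub>N\<^esub> z) = msum M (\<lambda>j. p (u j) (w j) \<odot>\<^bsub>M\<^esub> (a \<odot>\<^bsub>M\<^esub> t z)) m"
        unfolding t_def[of "a \<odot>\<^bsub>N\<^esub> z"]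
        by (rule msum_cong) (simp add: ks z a uX wY char yr_closed p_yr p_closed M.smult_assoc1 tc)
      also have "\<dots> = msum A (\<lambda>j. p (u j) (w j)) m \<odot>\<^bsub>M\<^esub> (a \<odot>\<^bsub>M\<^esub> t z)"
        by (rule M.smult_msum_l[symmetric]) (simp_all add: M.smult_closed tc z a p_closed uX wY)
      also have "\<dots> = a \<odot>\<^bsub>M\<^esub> t z" by (simp add: uw(2) M.smult_one M.smult_closed tc z a)
      finally show ?thesis .
    qed
  qed
  moreover have "inj_on (\<lambda>z\<in>carrier N. t z) (carrier N)"
  proof (rule inj_onI)
    fix z z' assume z: "z \<in> carrier N" and z': "z' \<in> carrier N" and "(\<lambda>z\<in>carrier N. t z) z = (\<lambda>z\<in>carrier N. t z) z'"
    then have tt: "t z = t z'" by simp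
    have "k z y = k z' y" if y: "y \<in> carrier Y" for y
    proof -
      have "i (k z y) = i (k z' y)"
        by (rule Hom_eqI[OF iH[OF kc[OF z y]] iH[OF kc[OF z' y]]]) (simp add: char z z' y tt)
      then show ?thesis using inj_onD[OF i'(2) _ kc[OF z y] kc[OF z' y]] by simp
    qed
    then have "k z = k z'" by (rule Hom_eqI[OF kH[OF z] kH[OF z']])
    then show "z = z'" using inj_onD[OF k'(2) _ z z'] by simp
  qed
  moreover have "(\<lambda>z\<in>carrier N. t z) ` carrier N = carrier M"
  proof (intro equalityI subsetI)
    fix a assume a: "a \<in> carrier M"
    have "\<exists>c\<in>carrier Q. i c = (\<lambda>x\<in>carrier X. p x y \<odot>\<^bsub>M\<^esub> a)" if y: "y \<in> carrier Y" for y
    proof -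
      have "(\<lambda>x\<in>carrier X. p x y \<odot>\<^bsub>M\<^esub> a) \<in> i ` carrier Q" using tau_Hom[OF M y a] i'(3) by simp
      then show ?thesis by (metis imageE)
    qed
    then have "\<forall>y. \<exists>c. y \<in> carrier Y \<longrightarrow> c \<in> carrier Q \<and> i c = (\<lambda>x\<in>carrier X. p x y \<odot>\<^bsub>M\<^esub> a)" by blast
    then obtain c where c: "\<forall>y. y \<in> carrier Y \<longrightarrow> c y \<in> carrier Q \<and> i (c y) = (\<lambda>x\<in>carrier X. p x y \<odot>\<^bsub>M\<^esub> a)" by metis
    have cc: "c y \<in> carrier Q" and ci: "x \<in> carrier X \<Longrightarrow> i (c y) x = p x y \<odot>\<^bsub>M\<^esub> a" if "y \<in> carrier Y" for y x
      using c that by auto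
    interpret Q: left_module B Q by (rule Q)
    have "(\<lambda>y\<in>carrier Y. c y) \<in> Hom B Y Q"
    proof (rule Hom_restrictI[OF Y])
      fix y assume y: "y \<in> carrier Y"
      show "c y \<in> carrier Q" by (rule cc[OF y])
      show "c (y \<oplus>\<^bsub>Y\<^esub> y') = c y \<oplus>\<^bsub>Q\<^esub> c y'" if y': "y' \<in> carrier Y" for y'
      proof (rule inj_onD[OF i'(2)])
        show "i (c (y \<oplus>\<^bsub>Y\<^esub> y')) = i (c y \<oplus>\<^bsub>Q\<^esub> c y')"
          by (rule Hom_eqI[OF iH iH]) (simp_all add: cc y y' ia ci p_add_r p_closed a M.smult_l_distr)
      qed (simp_all add: cc y y')
      show "c (b \<odot>\<^bsub>Y\<^esub> y) = b \<odot>\<^bsub>Q\<^esub> c y" if b: "b \<in> carrier B" for b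
      proof (rule inj_onD[OF i'(2)])
        show "i (c (b \<odot>\<^bsub>Y\<^esub> y)) = i (b \<odot>\<^bsub>Q\<^esub> c y)"
          by (rule Hom_eqI[OF iH iH]) (simp_all add: cc y b isc ci Y.smult_closed Q.smult_closed xr_closed p_balanced)
      qed (simp_all add: cc y b Y.smult_closed Q.smult_closed)
    qed
    then have "(\<lambda>y\<in>carrier Y. c y) \<in> k ` carrier N" using k'(3) by simp
    then obtain z where z: "z \<in> carrier N" "k z = (\<lambda>y\<in>carrier Y. c y)" by (metis imageE)
    have "t z = msum M (\<lambda>j. p (u j) (w j) \<odot>\<^bsub>M\<^esub> a) m"
      unfolding t_def by (rule msum_cong) (simp add: z(2) ci uX wY)
    also have "\<dots> = msum A (\<lambda>j. p (u j) (w j)) m \<odot>\<^bsub>M\<^esub> a"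
      by (rule M.smult_msum_l[symmetric]) (simp_all add: a p_closed uX wY)
    also have "\<dots> = a" by (simp add: uw(2) M.smult_one a)
    finally show "a \<in> (\<lambda>z\<in>carrier N. t z) ` carrier N" using z(1) by force
  qed (use tc in auto)
  ultimately show ?thesis unfolding t_def by (rule IsoI)
qed

end

text \<open>
  A bimodule whose right action identifies \<open>B\<close> with the opposite of the endomorphism ring of a
  progenerator \<open>X\<close> belongs to a Morita context. The partner of \<open>X\<close> is its dual, \<open>p\<close> is evaluation,
  and \<open>q y x\<close> is the element of \<open>B\<close> that acts as the endomorphism \<open>x' \<mapsto> y x' \<cdot> x\<close>.
\<close>

lemma (in bimodule) progenerator_context:
  assumes fgp: "fgp A X"
    and full: "\<And>g. g \<in> Hom A X X \<Longrightarrow> \<exists>b\<in>carrier B. \<forall>x\<in>carrier X. g x = xr x b"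
    and faithful: "\<And>b. b \<in> carrier B \<Longrightarrow> (\<And>x. x \<in> carrier X \<Longrightarrow> xr x b = \<zero>\<^bsub>X\<^esub>) \<Longrightarrow> b = \<zero>\<^bsub>B\<^esub>"
    and gen: "\<exists>m u w. (\<forall>j<m. u j \<in> carrier X \<and> w j \<in> Hom A X (self_algebra A)) \<and>
      msum A (\<lambda>j. w j (u j)) (m::nat) = \<one>\<^bsub>A\<^esub>"
  shows "\<exists>yr p q. morita_context A B X xr (hom_module A X xr (self_algebra A)) yr p q"
proof -
  interpret X: left_module A X by (rule X)
  interpret B: ring B by (rule ring_B)
  have S: "left_module A (self_algebra A)" by (rule left_module_self[OF X.A.ring_axioms])
  let ?Y = "hom_module A X xr (self_algebra A)"
  have Y: "left_module B ?Y" by (rule hom_left_module[OF S])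
  define yr where "yr y a = (\<lambda>x\<in>carrier X. y x \<otimes>\<^bsub>A\<^esub> a)" for y a
  define p where "p x y = y x" for x :: 'x and y :: "'x \<Rightarrow> 'a"
  define q where "q y x = (SOME b. b \<in> carrier B \<and> (\<forall>x'\<in>carrier X. xr x' b = y x' \<odot>\<^bsub>X\<^esub> x))" for y x
  have yc: "y x \<in> carrier A" if "y \<in> carrier ?Y" "x \<in> carrier X" for y x using Hom_closed[of y A X "self_algebra A" x] that by simp
  have ya: "y (x \<oplus>\<^bsub>X\<^esub> x') = y x \<oplus>\<^bsub>A\<^esub> y x'" if "y \<in> carrier ?Y" "x \<in> carrier X" "x' \<in> carrier X" for y x x'
    using Hom_add[of y A X "self_algebra A" x x'] that by simp
  have ys: "y (a \<odot>\<^bsub>X\<^esub> x) = a \<otimes>\<^bsub>A\<^esub> y x" if "y \<in> carrier ?Y" "x \<in> carrier X" "a \<in> carrier A" for y x a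
    using Hom_smult[of y A X "self_algebra A" a x] that by simp
  have yrH: "yr y a \<in> carrier ?Y" if "y \<in> carrier ?Y" "a \<in> carrier A" for y a
    using Hom_restrictI[OF X, of "\<lambda>x. y x \<otimes>\<^bsub>A\<^esub> a" "self_algebra A"] that
    by (simp add: yr_def yc ya ys X.A.l_distr X.A.m_assoc del: hom_module_simps(2-))
  have q: "q y x \<in> carrier B \<and> (\<forall>x'\<in>carrier X. xr x' (q y x) = y x' \<odot>\<^bsub>X\<^esub> x)" if y: "y \<in> carrier ?Y" and x: "x \<in> carrier X" for y x
  proof -
    have "(\<lambda>x'\<in>carrier X. y x' \<odot>\<^bsub>X\<^esub> x) \<in> Hom A X X"
      by (rule Hom_restrictI[OF X]) (simp_all add: X.smult_closed yc[OF y] ya[OF y] ys[OF y] x X.smult_l_distr X.smult_assoc1)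
    from full[OF this] have "\<exists>b. b \<in> carrier B \<and> (\<forall>x'\<in>carrier X. xr x' b = y x' \<odot>\<^bsub>X\<^esub> x)" by auto
    from someI_ex[OF this] show ?thesis by (simp add: q_def)
  qed
  have qc: "q y x \<in> carrier B" if "y \<in> carrier ?Y" "x \<in> carrier X" for y x using q[OF that] by blast
  have qa: "xr x' (q y x) = y x' \<odot>\<^bsub>X\<^esub> x" if "y \<in> carrier ?Y" "x \<in> carrier X" "x' \<in> carrier X" for y x x' using q[OF that(1,2)] that(3) by blast
  have uniq: "b = b'" if b: "b \<in> carrier B" "b' \<in> carrier B" and eq: "\<And>x. x \<in> carrier X \<Longrightarrow> xr x b = xr x b'" for b b'
  proof -
    have "xr x (b \<ominus>\<^bsub>B\<^esub> b') = \<zero>\<^bsub>X\<^esub>" if x: "x \<in> carrier X" for x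
    proof -
      have "xr x (b \<ominus>\<^bsub>B\<^esub> b') \<oplus>\<^bsub>X\<^esub> xr x b' = xr x ((b \<ominus>\<^bsub>B\<^esub> b') \<oplus>\<^bsub>B\<^esub> b')" using b x by (simp add: xr_add_r)
      also have "\<dots> = xr x b'" using b eq[OF x] by (simp add: B.minus_eq B.a_assoc B.l_neg)
      also have "\<dots> = \<zero>\<^bsub>X\<^esub> \<oplus>\<^bsub>X\<^esub> xr x b'" using b x by (simp add: xr_closed)
      finally show ?thesis
        using X.M.add.r_cancel[of "xr x b'" "xr x (b \<ominus>\<^bsub>B\<^esub> b')" "\<zero>\<^bsub>X\<^esub>"] b x by (simp add: xr_closed)
    qed
    then have "b \<ominus>\<^bsub>B\<^esub> b' = \<zero>\<^bsub>B\<^esub>" using b by (intro faithful) auto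
    then show ?thesis using B.minus_eq_zero_iff[OF b] by simp
  qed
  have Ha: "(f \<oplus>\<^bsub>?Y\<^esub> g) x = f x \<oplus>\<^bsub>A\<^esub> g x" if "x \<in> carrier X" for f g x using that by simp
  have Hs: "(b \<odot>\<^bsub>?Y\<^esub> f) x = f (xr x b)" if "x \<in> carrier X" for f b x using that by simp
  interpret Y: left_module B ?Y by (rule Y)
  note [simp del] = hom_module_simps
  have "morita_context A B X xr ?Y yr p q"
  proof (intro morita_context.intro morita_context_axioms.intro)
    show "bimodule A B X xr" by (rule bimodule_axioms)
    show "bimodule B A ?Y yr"
    proof (intro bimodule.intro Y X.A.ring_axioms)
      fix y a assume y: "y \<in> carrier ?Y" and a: "a \<in> carrier A"
      show "yr y a \<in> carrier ?Y" by (rule yrH[OF y a])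
      show "yr (y \<oplus>\<^bsub>?Y\<^esub> y') a = yr y a \<oplus>\<^bsub>?Y\<^esub> yr y' a" if "y' \<in> carrier ?Y" for y'
        using y a that by (auto simp: yr_def hom_module_simps(3) fun_eq_iff yc X.A.l_distr)
      show "yr y (a \<oplus>\<^bsub>A\<^esub> a') = yr y a \<oplus>\<^bsub>?Y\<^esub> yr y a'" if "a' \<in> carrier A" for a'
        using y a that by (auto simp: yr_def hom_module_simps(3) fun_eq_iff yc X.A.r_distr)
      show "yr y (a \<otimes>\<^bsub>A\<^esub> a') = yr (yr y a) a'" if "a' \<in> carrier A" for a'
        using y a that by (auto simp: yr_def fun_eq_iff yc X.A.m_assoc)
    next
      fix y assume y: "y \<in> carrier ?Y"
      have "yr y \<one>\<^bsub>A\<^esub> = (\<lambda>x\<in>carrier X. y x)" unfolding yr_def by (rule restrict_ext) (simp add: yc[OF y])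
      also have "\<dots> = y" using y by (intro extensional_restrict Hom_extensional) (auto simp: hom_module_simps(1))
      finally show "yr y \<one>\<^bsub>A\<^esub> = y" .
    next
      fix b y a assume "b \<in> carrier B" "y \<in> carrier ?Y" "a \<in> carrier A"
      then show "yr (b \<odot>\<^bsub>?Y\<^esub> y) a = b \<odot>\<^bsub>?Y\<^esub> yr y a" by (auto simp: yr_def hom_module_simps(4) fun_eq_iff xr_closed)
    qed
    show "\<exists>m u w. (\<forall>j<m. u j \<in> carrier X \<and> w j \<in> carrier ?Y) \<and> msum A (\<lambda>j. p (u j) (w j)) (m::nat) = \<one>\<^bsub>A\<^esub>"
      using gen by (simp add: p_def hom_module_simps(1))
    show "\<exists>n v z. (\<forall>i<n. v i \<in> carrier ?Y \<and> z i \<in> carrier X) \<and> msum B (\<lambda>i. q (v i) (z i)) (n::nat) = \<one>\<^bsub>B\<^esub>"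
    proof -
      obtain n u t where d: "dual_basis A X n u t" using fgp by (rule fgpE)
      note d' = dual_basisD[OF d]
      have tY: "t i \<in> carrier ?Y" if "i < n" for i using d'(2)[OF that] by (simp add: hom_module_simps(1))
      have "msum B (\<lambda>i. q (t i) (u i)) n = \<one>\<^bsub>B\<^esub>"
      proof (rule uniq)
        fix x assume x: "x \<in> carrier X"
        have "xr x (msum B (\<lambda>i. q (t i) (u i)) n) = msum X (\<lambda>i. xr x (q (t i) (u i))) n"
          by (rule additive_msum[OF B.abelian_group_axioms X.M.abelian_group_axioms])
            (auto intro!: xr_closed xr_add_r x qc tY d'(1))
        also have "\<dots> = msum X (\<lambda>i. t i x \<odot>\<^bsub>X\<^esub> u i) n" by (rule msum_cong) (simp add: qa tY d'(1) x)
        also have "\<dots> = xr x \<one>\<^bsub>B\<^esub>" using d'(3)[OF x] xr_one[OF x] by simp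
        finally show "xr x (msum B (\<lambda>i. q (t i) (u i)) n) = xr x \<one>\<^bsub>B\<^esub>" .
      qed (auto intro!: B.msum_closed qc tY d'(1))
      then show ?thesis using tY d'(1) by blast
    qed
    fix y x assume y: "y \<in> carrier ?Y" and x: "x \<in> carrier X"
    show "q y x \<in> carrier B" by (rule qc[OF y x])
    show "q (y \<oplus>\<^bsub>?Y\<^esub> y') x = q y x \<oplus>\<^bsub>B\<^esub> q y' x" if y': "y' \<in> carrier ?Y" for y'
      by (rule uniq) (simp_all add: qc x y y' qa xr_add_r Ha X.smult_l_distr yc)
    show "q y (x \<oplus>\<^bsub>X\<^esub> x') = q y x \<oplus>\<^bsub>B\<^esub> q y x'" if x': "x' \<in> carrier X" for x'
      by (rule uniq) (simp_all add: qc x y x' qa xr_add_r X.smult_r_distr yc)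
    show "q (b \<odot>\<^bsub>?Y\<^esub> y) x = b \<otimes>\<^bsub>B\<^esub> q y x" if b: "b \<in> carrier B" for b
      by (rule uniq) (simp_all add: qc x y b qa xr_mult xr_closed Hs Y.smult_closed)
    show "q y (xr x b) = q y x \<otimes>\<^bsub>B\<^esub> b" if b: "b \<in> carrier B" for b
      by (rule uniq) (simp_all add: qc x y b qa xr_mult xr_closed xr_smult yc)
    show "q (yr y a) x = q y (a \<odot>\<^bsub>X\<^esub> x)" if a: "a \<in> carrier A" for a
    proof -
      have "yr y a x' = y x' \<otimes>\<^bsub>A\<^esub> a" if "x' \<in> carrier X" for x' using that by (simp add: yr_def)
      then show ?thesis
        by (intro uniq) (simp_all add: qc x y a qa yrH X.smult_closed X.smult_assoc1 yc)
    qed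
    show "q y x \<odot>\<^bsub>?Y\<^esub> y' = yr y (p x y')" if y': "y' \<in> carrier ?Y" for y'
      unfolding hom_module_simps(4) yr_def p_def by (rule restrict_ext) (simp add: qa x y ys[OF y'] yc)
  next
    fix x y assume x: "x \<in> carrier X" and y: "y \<in> carrier ?Y"
    show "p x y \<in> carrier A" using x y by (simp add: p_def yc)
    show "p (x \<oplus>\<^bsub>X\<^esub> x') y = p x y \<oplus>\<^bsub>A\<^esub> p x' y" if "x' \<in> carrier X" for x' using x y that by (simp add: p_def ya)
    show "p x (y \<oplus>\<^bsub>?Y\<^esub> y') = p x y \<oplus>\<^bsub>A\<^esub> p x y'" if "y' \<in> carrier ?Y" for y' using x by (simp add: p_def Ha)
    show "p (a \<odot>\<^bsub>X\<^esub> x) y = a \<otimes>\<^bsub>A\<^esub> p x y" if "a \<in> carrier A" for a using x y that by (simp add: p_def ys)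
    show "p x (yr y a) = p x y \<otimes>\<^bsub>A\<^esub> a" if "a \<in> carrier A" for a using x by (simp add: p_def yr_def)
    show "p (xr x b) y = p x (b \<odot>\<^bsub>?Y\<^esub> y)" if "b \<in> carrier B" for b using x by (simp add: p_def Hs)
    show "p x y \<odot>\<^bsub>X\<^esub> x' = xr x (q y x')" if "x' \<in> carrier X" for x' using x y that by (simp add: p_def qa)
  qed
  then show ?thesis by blast
qed

section \<open>The functors of a Morita context\<close>

text \<open>\<open>F\<close> is a copy of the functor \<open>Hom A X\<close>; \<open>i\<close> identifies its values with the modules of homomorphisms.\<close>

definition represents ::
  "('a, 'k) ring_scheme \<Rightarrow> ('a, 'x) module \<Rightarrow> ('x \<Rightarrow> 'b \<Rightarrow> 'x) \<Rightarrow> ('b, 'j) ring_scheme \<Rightarrow>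
    ('a, 'm, 'b, 'n) mod_functor \<Rightarrow> (('a, 'm) module \<Rightarrow> 'n \<Rightarrow> 'x \<Rightarrow> 'm) \<Rightarrow> bool" where
  "represents A X xr B F i \<longleftrightarrow>
     (\<forall>M\<in>fg_modules A. fobj F M \<in> fg_modules B \<and> i M \<in> Iso B (fobj F M) (hom_module A X xr M)) \<and>
     (\<forall>M\<in>fg_modules A. \<forall>N\<in>fg_modules A. \<forall>f\<in>Hom A M N. farr F M N f \<in> Hom B (fobj F M) (fobj F N) \<and>
        (\<forall>z\<in>carrier (fobj F M). i N (farr F M N f z) = compose (carrier X) f (i M z)))"

lemma representsD:
  assumes "represents A X xr B F i"
  shows "M \<in> fg_modules A \<Longrightarrow> fobj F M \<in> fg_modules B"
    "M \<in> fg_modules A \<Longrightarrow> i M \<in> Iso B (fobj F M) (hom_module A X xr M)"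
    "M \<in> fg_modules A \<Longrightarrow> N \<in> fg_modules A \<Longrightarrow> f \<in> Hom A M N \<Longrightarrow> farr F M N f \<in> Hom B (fobj F M) (fobj F N)"
    "M \<in> fg_modules A \<Longrightarrow> N \<in> fg_modules A \<Longrightarrow> f \<in> Hom A M N \<Longrightarrow> z \<in> carrier (fobj F M) \<Longrightarrow>
       i N (farr F M N f z) = compose (carrier X) f (i M z)"
  using assms unfolding represents_def by blast+

lemma (in morita_context) ex_represents:
  assumes U: "module_universe TYPE('b) TYPE('n)"
  shows "\<exists>(F :: ('a, 'm, 'b, 'n) mod_functor) i. represents A X xr B F i"
proof -
  have "\<exists>(Q :: ('b, 'n) module) i. Q \<in> fg_modules B \<and> i \<in> Iso B Q (hom_module A X xr M)"
    if "M \<in> fg_modules A" for M :: "('a, 'm) module"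
  proof -
    have lM: "left_module A M" "finitely_generated A M" using that by (auto simp: fg_modules_def)
    obtain Q :: "('b, 'n) module" and j where Q: "Q \<in> fg_modules B" and j: "j \<in> Iso B (hom_module A X xr M) Q"
      using universe_copy[OF U hom_left_module[OF lM(1)] hom_finitely_generated[OF lM]] by blast
    have "isomorphic B Q (hom_module A X xr M)"
      by (rule isomorphic_sym[OF hom_left_module[OF lM(1)]]) (use j in \<open>auto simp: isomorphic_def\<close>)
    then show ?thesis using Q unfolding isomorphic_def by blast
  qed
  then have "\<forall>M. \<exists>Q i. (M :: ('a, 'm) module) \<in> fg_modules A \<longrightarrow> (Q :: ('b, 'n) module) \<in> fg_modules B \<and> i \<in> Iso B Q (hom_module A X xr M)"
    by blast
  then obtain Q i where Qi: "\<forall>M. (M :: ('a, 'm) module) \<in> fg_modules A \<longrightarrow> (Q M :: ('b, 'n) module) \<in> fg_modules B \<and> i M \<in> Iso B (Q M) (hom_module A X xr M)"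
    by metis
  have "\<forall>M. \<exists>j. M \<in> fg_modules A \<longrightarrow> j \<in> Iso B (hom_module A X xr M) (Q M) \<and> (\<forall>f\<in>Hom A X M. i M (j f) = f)"
  proof
    fix M :: "('a, 'm) module"
    show "\<exists>j. M \<in> fg_modules A \<longrightarrow> j \<in> Iso B (hom_module A X xr M) (Q M) \<and> (\<forall>f\<in>Hom A X M. i M (j f) = f)"
    proof (cases "M \<in> fg_modules A")
      case True
      then have lQ: "left_module B (Q M)" and iM: "i M \<in> Iso B (Q M) (hom_module A X xr M)" using Qi by (auto simp: fg_modules_def)
      show ?thesis using Iso_inverse_ex[OF lQ iM] by auto
    qed simp
  qed
  then obtain j where j: "\<forall>M. M \<in> fg_modules A \<longrightarrow> j M \<in> Iso B (hom_module A X xr M) (Q M) \<and> (\<forall>f\<in>Hom A X M. i M (j M f) = f)"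
    by metis
  define F :: "('a, 'm, 'b, 'n) mod_functor" where
    "F = \<lparr>fobj = Q, farr = (\<lambda>M N f. \<lambda>z\<in>carrier (Q M). j N (compose (carrier X) f (i M z)))\<rparr>"
  have "represents A X xr B F i"
    unfolding represents_def
  proof (intro conjI ballI)
    fix M :: "('a, 'm) module" assume M: "M \<in> fg_modules A"
    show "fobj F M \<in> fg_modules B" "i M \<in> Iso B (fobj F M) (hom_module A X xr M)" using Qi M by (auto simp: F_def)
    fix N :: "('a, 'm) module" and f assume N: "N \<in> fg_modules A" and f: "f \<in> Hom A M N"
    have iM: "i M \<in> Hom B (Q M) (hom_module A X xr M)" and jN: "j N \<in> Hom B (hom_module A X xr N) (Q N)"
      and lQ: "left_module B (Q M)"
      using Qi[rule_format, OF M] IsoD(1)[OF conjunct1[OF j[rule_format, OF N]]] IsoD(1) by (auto simp: fg_modules_def)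
    have iz: "i M z \<in> Hom A X M" if "z \<in> carrier (Q M)" for z using Hom_closed[OF iM that] by simp
    have c: "compose (carrier X) f (i M z) \<in> carrier (hom_module A X xr N)" if "z \<in> carrier (Q M)" for z
      using Hom_compose[OF X iz[OF that] f] by simp
    show "farr F M N f \<in> Hom B (fobj F M) (fobj F N)"
      unfolding F_def mod_functor.simps
    proof (rule Hom_restrictI[OF lQ])
      fix z assume z: "z \<in> carrier (Q M)"
      show "j N (compose (carrier X) f (i M z)) \<in> carrier (Q N)" by (rule Hom_closed[OF jN c[OF z]])
      show "j N (compose (carrier X) f (i M (z \<oplus>\<^bsub>Q M\<^esub> z'))) =
          j N (compose (carrier X) f (i M z)) \<oplus>\<^bsub>Q N\<^esub> j N (compose (carrier X) f (i M z'))" if z': "z' \<in> carrier (Q M)" for z'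
      proof -
        have "compose (carrier X) f (i M (z \<oplus>\<^bsub>Q M\<^esub> z')) =
            compose (carrier X) f (i M z) \<oplus>\<^bsub>hom_module A X xr N\<^esub> compose (carrier X) f (i M z')"
          using Hom_add[OF iM z z'] Hom_closed[OF iz[OF z]] Hom_closed[OF iz[OF z']]
          by (auto simp: fun_eq_iff compose_def Hom_add[OF f])
        then show ?thesis using Hom_add[OF jN c[OF z] c[OF z']] by simp
      qed
      show "j N (compose (carrier X) f (i M (b \<odot>\<^bsub>Q M\<^esub> z))) = b \<odot>\<^bsub>Q N\<^esub> j N (compose (carrier X) f (i M z))" if b: "b \<in> carrier B" for b
      proof -
        have "compose (carrier X) f (i M (b \<odot>\<^bsub>Q M\<^esub> z)) = b \<odot>\<^bsub>hom_module A X xr N\<^esub> compose (carrier X) f (i M z)"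
          using Hom_smult[OF iM b z] b by (auto simp: fun_eq_iff compose_def xr_closed)
        then show ?thesis using Hom_smult[OF jN b c[OF z]] by simp
      qed
    qed
    show "i N (farr F M N f z) = compose (carrier X) f (i M z)" if z: "z \<in> carrier (fobj F M)" for z
      using j N c z by (simp add: F_def)
  qed
  then show ?thesis by blast
qed

lemma (in morita_context) represents_is_functor:
  fixes F :: "('a, 'm, 'b, 'n) mod_functor"
  assumes F: "represents A X xr B F i"
  shows "is_functor A (fg_modules A) B (fg_modules B) F"
proof -
  note F' = representsD[OF F]
  have lF: "left_module B (fobj F M)" if "M \<in> fg_modules A" for M using fg_modulesD(1)[OF F'(1)[OF that]] .
  have inj: "z = z'" if "M \<in> fg_modules A" "z \<in> carrier (fobj F M)" "z' \<in> carrier (fobj F M)" "i M z = i M z'" for M z z'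
    using inj_onD[OF IsoD(2)[OF F'(2)[OF that(1)]] that(4,2,3)] .
  have iz: "i M z \<in> Hom A X M" if "M \<in> fg_modules A" "z \<in> carrier (fobj F M)" for M z
    using Hom_closed[OF IsoD(1)[OF F'(2)[OF that(1)]] that(2)] by simp
  show ?thesis unfolding is_functor_def
  proof (intro conjI ballI)
    fix M :: "('a, 'm) module" assume M: "M \<in> fg_modules A"
    note lM = fg_modulesD(1)[OF M]
    have "farr F M M (\<lambda>x\<in>carrier M. x) z = z" if z: "z \<in> carrier (fobj F M)" for z
    proof (rule inj[OF M Hom_closed[OF F'(3)[OF M M Hom_id[OF lM]] z] z])
      have "compose (carrier X) (\<lambda>x\<in>carrier M. x) (i M z) = i M z"
        by (rule Hom_eqI[OF Hom_compose[OF X iz[OF M z] Hom_id[OF lM]] iz[OF M z]]) (simp add: Hom_closed[OF iz[OF M z]])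
      then show "i M (farr F M M (\<lambda>x\<in>carrier M. x) z) = i M z" using F'(4)[OF M M Hom_id[OF lM] z] by simp
    qed
    then show "farr F M M (\<lambda>x\<in>carrier M. x) = (\<lambda>x\<in>carrier (fobj F M). x)"
      by (intro Hom_eqI[OF F'(3)[OF M M Hom_id[OF lM]] Hom_id[OF lF[OF M]]]) simp
  next
    fix L M N :: "('a, 'm) module" and f g assume L: "L \<in> fg_modules A" and M: "M \<in> fg_modules A" and N: "N \<in> fg_modules A"
      and f: "f \<in> Hom A L M" and g: "g \<in> Hom A M N"
    note lL = fg_modulesD(1)[OF L]
    have gf: "compose (carrier L) g f \<in> Hom A L N" by (rule Hom_compose[OF lL f g])
    note Ff = F'(3)[OF L M f] and Fg = F'(3)[OF M N g] and Fgf = F'(3)[OF L N gf]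
    show "farr F L N (compose (carrier L) g f) = compose (carrier (fobj F L)) (farr F M N g) (farr F L M f)"
    proof (rule Hom_eqI[OF Fgf Hom_compose[OF lF[OF L] Ff Fg]])
      fix z assume z: "z \<in> carrier (fobj F L)"
      note fz = Hom_closed[OF Ff z]
      have "i N (farr F L N (compose (carrier L) g f) z) = i N (farr F M N g (farr F L M f z))"
        unfolding F'(4)[OF L N gf z] F'(4)[OF M N g fz] F'(4)[OF L M f z]
        using Hom_closed[OF iz[OF L z]] by (auto simp: compose_def fun_eq_iff)
      then have "farr F L N (compose (carrier L) g f) z = farr F M N g (farr F L M f z)"
        by (rule inj[OF N Hom_closed[OF Fgf z] Hom_closed[OF Fg fz]])
      then show "farr F L N (compose (carrier L) g f) z = compose (carrier (fobj F L)) (farr F M N g) (farr F L M f) z"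
        using z by simp
    qed
  qed (use F' in auto)
qed

lemma (in morita_context) represents_unit:
  assumes F: "represents A X xr B F i" and G: "represents B Y yr A G k"
  shows "naturally_isomorphic A (fg_modules A) A (functor_comp G F) incl"
proof -
  note F' = representsD[OF F] and G' = representsD[OF G]
  obtain m u w where uw: "\<forall>j<m. u j \<in> carrier X \<and> w j \<in> carrier Y" "msum A (\<lambda>j. p (u j) (w j)) (m::nat) = \<one>\<^bsub>A\<^esub>"
    using p_onto by blast
  define t where "t M = (\<lambda>z\<in>carrier (fobj G (fobj F M)). msum M (\<lambda>j. i M (k (fobj F M) z (w j)) (u j)) m)" for M
  have t: "t M \<in> Iso A (fobj G (fobj F M)) M" if M: "M \<in> fg_modules A" for M
    unfolding t_def
    by (rule double_hom_iso[OF fg_modulesD(1)[OF M] fg_modulesD(1)[OF F'(1)[OF M]]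
          fg_modulesD(1)[OF G'(1)[OF F'(1)[OF M]]] F'(2)[OF M] G'(2)[OF F'(1)[OF M]] uw])
  have "compose (carrier (fobj G (fobj F M))) (t N) (farr G (fobj F M) (fobj F N) (farr F M N f)) =
      compose (carrier (fobj G (fobj F M))) f (t M)"
    if M: "M \<in> fg_modules A" and N: "N \<in> fg_modules A" and f: "f \<in> Hom A M N" for M N f
  proof -
    let ?Ff = "farr F M N f"
    have Ff: "?Ff \<in> Hom B (fobj F M) (fobj F N)" by (rule F'(3)[OF M N f])
    have "t N (farr G (fobj F M) (fobj F N) ?Ff z) = f (t M z)" if z: "z \<in> carrier (fobj G (fobj F M))" for z
    proof -
      have kz: "k (fobj F M) z \<in> Hom B Y (fobj F M)"
        using Hom_closed[OF IsoD(1)[OF G'(2)[OF F'(1)[OF M]]] z] by simp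
      have gz: "farr G (fobj F M) (fobj F N) ?Ff z \<in> carrier (fobj G (fobj F N))"
        by (rule Hom_closed[OF G'(3)[OF F'(1)[OF M] F'(1)[OF N] Ff] z])
      have iz: "i M c \<in> Hom A X M" if "c \<in> carrier (fobj F M)" for c
        using Hom_closed[OF IsoD(1)[OF F'(2)[OF M]] that] by simp
      have kw: "k (fobj F M) z (w j) \<in> carrier (fobj F M)" if "j < m" for j using Hom_closed[OF kz] uw(1) that by blast
      have "t N (farr G (fobj F M) (fobj F N) ?Ff z) =
          msum N (\<lambda>j. i N (k (fobj F N) (farr G (fobj F M) (fobj F N) ?Ff z) (w j)) (u j)) m"
        using gz by (simp add: t_def)
      also have "\<dots> = msum N (\<lambda>j. f (i M (k (fobj F M) z (w j)) (u j))) m"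
      proof (rule msum_cong)
        fix j assume j: "j < m"
        then show "i N (k (fobj F N) (farr G (fobj F M) (fobj F N) ?Ff z) (w j)) (u j) = f (i M (k (fobj F M) z (w j)) (u j))"
          using G'(4)[OF F'(1)[OF M] F'(1)[OF N] Ff z] F'(4)[OF M N f kw[OF j]] uw(1) by simp
      qed
      also have "\<dots> = f (msum M (\<lambda>j. i M (k (fobj F M) z (w j)) (u j)) m)"
        by (rule Hom_msum[OF fg_modulesD(1)[OF M] fg_modulesD(1)[OF N] f, symmetric])
          (use Hom_closed[OF iz[OF kw]] uw(1) in auto)
      also have "\<dots> = f (t M z)" using z by (simp add: t_def)
      finally show ?thesis .
    qed
    then show ?thesis by (auto simp: compose_def fun_eq_iff)
  qed
  then show ?thesis
    unfolding naturally_isomorphic_def functor_comp_def incl_def using t by (intro exI[of _ t]) simp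
qed

lemma (in morita_context) represents_equivalence:
  assumes F: "represents A X xr B F i" and U: "module_universe TYPE('a) TYPE('m)"
  shows "category_equivalence A (fg_modules A :: ('a, 'm) module set) B (fg_modules B) F"
proof -
  interpret d: morita_context B A Y yr X xr q p by (rule dual)
  obtain G k where G: "represents B Y yr A (G :: ('b, 'c, 'a, 'm) mod_functor) k"
    using d.ex_represents[OF U] by blast
  have "quasi_inverse A (fg_modules A) B (fg_modules B) F G"
    unfolding quasi_inverse_def
    using represents_is_functor[OF F] d.represents_is_functor[OF G] represents_unit[OF F G] d.represents_unit[OF G F] by blast
  then show ?thesis unfolding category_equivalence_def by blast
qed

section \<open>Exact equivalences between categories of filtered modules\<close>

lemma is_functorD:
  assumes "is_functor A \<C> B \<D> F"
  shows "M \<in> \<C> \<Longrightarrow> fobj F M \<in> \<D>"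
    "M \<in> \<C> \<Longrightarrow> N \<in> \<C> \<Longrightarrow> f \<in> Hom A M N \<Longrightarrow> farr F M N f \<in> Hom B (fobj F M) (fobj F N)"
    "M \<in> \<C> \<Longrightarrow> x \<in> carrier (fobj F M) \<Longrightarrow> farr F M M (\<lambda>x\<in>carrier M. x) x = x"
    "L \<in> \<C> \<Longrightarrow> M \<in> \<C> \<Longrightarrow> N \<in> \<C> \<Longrightarrow> f \<in> Hom A L M \<Longrightarrow> g \<in> Hom A M N \<Longrightarrow> x \<in> carrier (fobj F L) \<Longrightarrow>
      farr F L N (compose (carrier L) g f) x = farr F M N g (farr F L M f x)"
  using assms unfolding is_functor_def by (simp_all add: compose_def)

lemma quasi_inverse_sym: "quasi_inverse A \<C> B \<D> F G \<Longrightarrow> quasi_inverse B \<D> A \<C> G F"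
  by (simp add: quasi_inverse_def)

lemma quasi_inverse_unit:
  assumes "quasi_inverse A \<C> B \<D> F G"
  shows "\<exists>\<eta>. (\<forall>M\<in>\<C>. \<eta> M \<in> Iso A (fobj G (fobj F M)) M) \<and>
    (\<forall>M\<in>\<C>. \<forall>N\<in>\<C>. \<forall>f\<in>Hom A M N. \<forall>z\<in>carrier (fobj G (fobj F M)).
      \<eta> N (farr G (fobj F M) (fobj F N) (farr F M N f) z) = f (\<eta> M z))"
proof -
  have "naturally_isomorphic A \<C> A (functor_comp G F) incl" using assms by (simp add: quasi_inverse_def)
  then obtain \<eta> where \<eta>: "\<forall>M\<in>\<C>. \<eta> M \<in> Iso A (fobj G (fobj F M)) M"
    "\<forall>M\<in>\<C>. \<forall>N\<in>\<C>. \<forall>f\<in>Hom A M N.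
        compose (carrier (fobj G (fobj F M))) (\<eta> N) (farr G (fobj F M) (fobj F N) (farr F M N f)) =
        compose (carrier (fobj G (fobj F M))) f (\<eta> M)"
    unfolding naturally_isomorphic_def functor_comp_def incl_def by auto
  have "\<eta> N (farr G (fobj F M) (fobj F N) (farr F M N f) z) = f (\<eta> M z)"
    if "M \<in> \<C>" "N \<in> \<C>" "f \<in> Hom A M N" "z \<in> carrier (fobj G (fobj F M))" for M N f z
    using fun_cong[OF bspec[OF bspec[OF bspec[OF \<eta>(2) that(1)] that(2)] that(3)], of z] that(4) by simp
  then show ?thesis using \<eta>(1) by blast
qed

lemma equivalence_faithful:
  assumes qi: "quasi_inverse A \<C> B \<D> F G" and M: "M \<in> \<C>" and N: "N \<in> \<C>"
    and f: "f \<in> Hom A M N" and g: "g \<in> Hom A M N" and eq: "farr F M N f = farr F M N g"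
  shows "f = g"
proof -
  obtain \<eta> where \<eta>: "\<forall>M\<in>\<C>. \<eta> M \<in> Iso A (fobj G (fobj F M)) M"
    "\<forall>M\<in>\<C>. \<forall>N\<in>\<C>. \<forall>f\<in>Hom A M N. \<forall>z\<in>carrier (fobj G (fobj F M)).
      \<eta> N (farr G (fobj F M) (fobj F N) (farr F M N f) z) = f (\<eta> M z)"
    using quasi_inverse_unit[OF qi] by blast
  have surj: "\<eta> M ` carrier (fobj G (fobj F M)) = carrier M" using IsoD(3) \<eta>(1) M by blast
  have nat: "\<eta> N (farr G (fobj F M) (fobj F N) (farr F M N h) z) = h (\<eta> M z)"
    if "h \<in> Hom A M N" "z \<in> carrier (fobj G (fobj F M))" for h z using \<eta>(2) M N that by blast
  show ?thesis
  proof (rule Hom_eqI[OF f g])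
    fix x assume "x \<in> carrier M"
    then obtain z where z: "z \<in> carrier (fobj G (fobj F M))" "x = \<eta> M z" using surj by (metis imageE)
    show "f x = g x" unfolding z(2) nat[OF f z(1), symmetric] nat[OF g z(1), symmetric] eq ..
  qed
qed

lemma equivalence_full:
  assumes qi: "quasi_inverse A \<C> B \<D> F G" and lC: "\<And>M. M \<in> \<C> \<Longrightarrow> left_module A M"
    and M: "M \<in> \<C>" and N: "N \<in> \<C>" and h: "h \<in> Hom B (fobj F M) (fobj F N)"
  shows "\<exists>f\<in>Hom A M N. farr F M N f = h"
proof -
  obtain \<eta> where \<eta>: "\<forall>M\<in>\<C>. \<eta> M \<in> Iso A (fobj G (fobj F M)) M"
    "\<forall>M\<in>\<C>. \<forall>N\<in>\<C>. \<forall>f\<in>Hom A M N. \<forall>z\<in>carrier (fobj G (fobj F M)).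
      \<eta> N (farr G (fobj F M) (fobj F N) (farr F M N f) z) = f (\<eta> M z)"
    using quasi_inverse_unit[OF qi] by blast
  have F: "is_functor A \<C> B \<D> F" and G: "is_functor B \<D> A \<C> G" using qi by (auto simp: quasi_inverse_def)
  note F' = is_functorD[OF F] and G' = is_functorD[OF G]
  let ?M = "fobj G (fobj F M)" and ?N = "fobj G (fobj F N)"
  have \<eta>M: "\<eta> M \<in> Iso A ?M M" and \<eta>N: "\<eta> N \<in> Iso A ?N N" using \<eta>(1) M N by auto
  have lM: "left_module A ?M" by (rule lC[OF G'(1)[OF F'(1)[OF M]]])
  obtain e where e: "e \<in> Iso A M ?M" "\<forall>x\<in>carrier ?M. e (\<eta> M x) = x" using Iso_inverse_ex[OF lM \<eta>M] by blast
  let ?h = "farr G (fobj F M) (fobj F N) h"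
  have Gh: "?h \<in> Hom A ?M ?N" by (rule G'(2)[OF F'(1)[OF M] F'(1)[OF N] h])
  define f where "f = compose (carrier M) (\<eta> N) (compose (carrier M) ?h e)"
  have f: "f \<in> Hom A M N" unfolding f_def
    by (rule Hom_compose[OF lC[OF M] Hom_compose[OF lC[OF M] IsoD(1)[OF e(1)] Gh] IsoD(1)[OF \<eta>N]])
  have Ff: "farr F M N f \<in> Hom B (fobj F M) (fobj F N)" by (rule F'(2)[OF M N f])
  have GFf: "farr G (fobj F M) (fobj F N) (farr F M N f) \<in> Hom A ?M ?N" by (rule G'(2)[OF F'(1)[OF M] F'(1)[OF N] Ff])
  have "farr G (fobj F M) (fobj F N) (farr F M N f) = ?h"
  proof (rule Hom_eqI[OF GFf Gh])
    fix z assume z: "z \<in> carrier ?M"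
    have "\<eta> N (farr G (fobj F M) (fobj F N) (farr F M N f) z) = f (\<eta> M z)" using \<eta>(2) M N f z by blast
    also have "\<dots> = \<eta> N (?h z)" using Hom_closed[OF IsoD(1)[OF \<eta>M] z] bspec[OF e(2) z] by (simp add: f_def)
    finally show "farr G (fobj F M) (fobj F N) (farr F M N f) z = ?h z"
      using inj_onD[OF IsoD(2)[OF \<eta>N] _ Hom_closed[OF GFf z] Hom_closed[OF Gh z]] by blast
  qed
  then have "farr F M N f = h"
    by (rule equivalence_faithful[OF quasi_inverse_sym[OF qi] F'(1)[OF M] F'(1)[OF N] Ff h])
  then show ?thesis using f by blast
qed

text \<open>
  Exactness makes the functor additive: it maps the two split exact sequences of a biproduct to
  short exact sequences, so it preserves the biproduct, and \<open>f + g\<close> factors through one.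
\<close>

lemma exact_functor_additive:
  assumes F: "is_functor A \<C> B \<D> F" and ex: "exact_functor A \<C> B F"
    and lC: "\<And>M. M \<in> \<C> \<Longrightarrow> left_module A M" and lD: "\<And>M. M \<in> \<D> \<Longrightarrow> left_module B M"
    and W: "W \<in> \<C>" and M: "M \<in> \<C>" and Z: "Z \<in> \<C>"
    and i: "i1 \<in> Hom A W Z" "i2 \<in> Hom A W Z" and p: "p1 \<in> Hom A Z W" "p2 \<in> Hom A Z W"
    and pi: "\<And>x. x \<in> carrier W \<Longrightarrow> p1 (i1 x) = x" "\<And>x. x \<in> carrier W \<Longrightarrow> p2 (i2 x) = x"
      "\<And>x. x \<in> carrier W \<Longrightarrow> p1 (i2 x) = \<zero>\<^bsub>W\<^esub>" "\<And>x. x \<in> carrier W \<Longrightarrow> p2 (i1 x) = \<zero>\<^bsub>W\<^esub>"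
    and sum: "\<And>z. z \<in> carrier Z \<Longrightarrow> i1 (p1 z) \<oplus>\<^bsub>Z\<^esub> i2 (p2 z) = z"
    and f: "f \<in> Hom A W M" and g: "g \<in> Hom A W M" and x: "x \<in> carrier (fobj F W)"
  shows "farr F W M (\<lambda>w\<in>carrier W. f w \<oplus>\<^bsub>M\<^esub> g w) x = farr F W M f x \<oplus>\<^bsub>fobj F M\<^esub> farr F W M g x"
proof -
  note F' = is_functorD[OF F]
  note lW = lC[OF W] and lM = lC[OF M] and lZ = lC[OF Z]
  interpret W: left_module A W by (rule lW)
  interpret M: left_module A M by (rule lM)
  interpret Z: left_module A Z by (rule lZ)
  interpret FZ: left_module B "fobj F Z" by (rule lD[OF F'(1)[OF Z]])
  interpret FW: left_module B "fobj F W" by (rule lD[OF F'(1)[OF W]])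
  note lFZ = lD[OF F'(1)[OF Z]] and lFW = lD[OF F'(1)[OF W]] and lFM = lD[OF F'(1)[OF M]]
  have ses: "short_exact A W i Z q W"
    if "i \<in> Hom A W Z" "q \<in> Hom A Z W" "i' \<in> Hom A W Z" "q' \<in> Hom A Z W" "\<And>x. x \<in> carrier W \<Longrightarrow> q (i x) = \<zero>\<^bsub>W\<^esub>"
      "\<And>x. x \<in> carrier W \<Longrightarrow> q' (i x) = x" "\<And>x. x \<in> carrier W \<Longrightarrow> q (i' x) = x"
      "\<And>z. z \<in> carrier Z \<Longrightarrow> q z = \<zero>\<^bsub>W\<^esub> \<Longrightarrow> z = i (q' z)" for i q i' q'
    unfolding short_exact_def
  proof (intro conjI that(1,2))
    show "inj_on i (carrier W)" using that(6) by (metis inj_onI)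
    show "i ` carrier W = a_kernel Z W q"
    proof (intro equalityI subsetI)
      fix z assume "z \<in> a_kernel Z W q"
      then have z: "z \<in> carrier Z" "q z = \<zero>\<^bsub>W\<^esub>" by auto
      show "z \<in> i ` carrier W" using that(8)[OF z] Hom_closed[OF that(4) z(1)] by (rule image_eqI)
    qed (use Hom_closed[OF that(1)] that(5) in auto)
    show "q ` carrier Z = carrier W"
    proof (intro equalityI subsetI)
      fix w assume w: "w \<in> carrier W"
      show "w \<in> q ` carrier Z" using that(7)[OF w, symmetric] Hom_closed[OF that(3) w] by (rule image_eqI)
    qed (use Hom_closed[OF that(2)] in auto)
  qed
  have s1: "short_exact A W i1 Z p2 W"
  proof (rule ses[OF i(1) p(2) i(2) p(1) pi(4) pi(1) pi(2)])
    fix z assume "z \<in> carrier Z" "p2 z = \<zero>\<^bsub>W\<^esub>"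
    then show "z = i1 (p1 z)" using sum[of z] Hom_zero[OF lW lZ i(2)] Hom_closed[OF i(1) Hom_closed[OF p(1)]] by simp
  qed
  have s2: "short_exact A W i2 Z p1 W"
  proof (rule ses[OF i(2) p(1) i(1) p(2) pi(3) pi(2) pi(1)])
    fix z assume "z \<in> carrier Z" "p1 z = \<zero>\<^bsub>W\<^esub>"
    then show "z = i2 (p2 z)" using sum[of z] Hom_zero[OF lW lZ i(1)] Hom_closed[OF i(2) Hom_closed[OF p(2)]] by simp
  qed
  let ?i1 = "farr F W Z i1" and ?i2 = "farr F W Z i2" and ?p1 = "farr F Z W p1" and ?p2 = "farr F Z W p2"
  note Fi1 = F'(2)[OF W Z i(1)] and Fi2 = F'(2)[OF W Z i(2)] and Fp1 = F'(2)[OF Z W p(1)] and Fp2 = F'(2)[OF Z W p(2)]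
  have "short_exact B (fobj F W) ?i1 (fobj F Z) ?p2 (fobj F W)" using ex s1 W Z unfolding exact_functor_def by blast
  then have e1: "?i1 ` carrier (fobj F W) = a_kernel (fobj F Z) (fobj F W) ?p2" by (simp add: short_exact_def)
  have "short_exact B (fobj F W) ?i2 (fobj F Z) ?p1 (fobj F W)" using ex s2 W Z unfolding exact_functor_def by blast
  then have e2: "?i2 ` carrier (fobj F W) = a_kernel (fobj F Z) (fobj F W) ?p1" by (simp add: short_exact_def)
  have inv: "farr F Z W q (farr F W Z i w) = w"
    if "i \<in> Hom A W Z" "q \<in> Hom A Z W" "\<And>x. x \<in> carrier W \<Longrightarrow> q (i x) = x" "w \<in> carrier (fobj F W)" for i q w
  proof -
    have "compose (carrier W) q i = (\<lambda>x\<in>carrier W. x)" using that(3) by (auto simp: compose_def fun_eq_iff)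
    then show ?thesis using F'(4)[OF W Z W that(1,2,4)] F'(3)[OF W that(4)] by simp
  qed
  have rec: "y = ?i1 (?p1 y) \<oplus>\<^bsub>fobj F Z\<^esub> ?i2 (?p2 y)" if y: "y \<in> carrier (fobj F Z)" for y
  proof -
    let ?y2 = "?i2 (?p2 y)"
    have y2: "?y2 \<in> carrier (fobj F Z)" by (rule Hom_closed[OF Fi2 Hom_closed[OF Fp2 y]])
    have "?p2 (y \<ominus>\<^bsub>fobj F Z\<^esub> ?y2) = ?p2 y \<ominus>\<^bsub>fobj F W\<^esub> ?p2 ?y2" by (rule Hom_diff_eq_zero[OF lFZ lFW Fp2 y y2])
    also have "\<dots> = \<zero>\<^bsub>fobj F W\<^esub>"
      using inv[OF i(2) p(2) pi(2) Hom_closed[OF Fp2 y]] Hom_closed[OF Fp2 y] FW.M.minus_eq_zero_iff by simp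
    finally have "y \<ominus>\<^bsub>fobj F Z\<^esub> ?y2 \<in> ?i1 ` carrier (fobj F W)" unfolding e1 using y y2 by simp
    then obtain z where z: "z \<in> carrier (fobj F W)" "y \<ominus>\<^bsub>fobj F Z\<^esub> ?y2 = ?i1 z" by (metis imageE)
    have "?y2 \<in> a_kernel (fobj F Z) (fobj F W) ?p1" unfolding e2[symmetric] using Hom_closed[OF Fp2 y] by (rule imageI)
    then have "?p1 ?y2 = \<zero>\<^bsub>fobj F W\<^esub>" by simp
    then have "?p1 (y \<ominus>\<^bsub>fobj F Z\<^esub> ?y2) = ?p1 y"
      using Hom_diff_eq_zero[OF lFZ lFW Fp1 y y2] Hom_closed[OF Fp1 y] FW.M.minus_eq[of "?p1 y" "\<zero>\<^bsub>fobj F W\<^esub>"]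
        FW.M.minus_equality[of "\<zero>\<^bsub>fobj F W\<^esub>" "\<zero>\<^bsub>fobj F W\<^esub>"] by simp
    then have "z = ?p1 y" unfolding z(2) using inv[OF i(1) p(1) pi(1) z(1)] by simp
    then have "y \<ominus>\<^bsub>fobj F Z\<^esub> ?y2 = ?i1 (?p1 y)" using z(2) by simp
    then have "(y \<ominus>\<^bsub>fobj F Z\<^esub> ?y2) \<oplus>\<^bsub>fobj F Z\<^esub> ?y2 = ?i1 (?p1 y) \<oplus>\<^bsub>fobj F Z\<^esub> ?y2" by simp
    then show ?thesis using y y2 by (simp add: FZ.M.minus_eq FZ.M.a_assoc FZ.M.l_neg)
  qed
  define h where "h = (\<lambda>z\<in>carrier Z. compose (carrier Z) f p1 z \<oplus>\<^bsub>M\<^esub> compose (carrier Z) g p2 z)"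
  define d where "d = (\<lambda>w\<in>carrier W. i1 w \<oplus>\<^bsub>Z\<^esub> i2 w)"
  have h: "h \<in> Hom A Z M" unfolding h_def
    by (rule Hom_plus[OF lZ lM Hom_compose[OF lZ p(1) f] Hom_compose[OF lZ p(2) g]])
  have d: "d \<in> Hom A W Z" unfolding d_def by (rule Hom_plus[OF lW lZ i])
  have dx: "d w \<in> carrier Z" if "w \<in> carrier W" for w by (rule Hom_closed[OF d that])
  have pd: "p1 (d w) = w" "p2 (d w) = w" if w: "w \<in> carrier W" for w
    using w by (simp_all add: d_def Hom_add[OF p(1)] Hom_add[OF p(2)] Hom_closed[OF i(1)] Hom_closed[OF i(2)] pi)
  have hi1: "compose (carrier W) h i1 = f"
    by (rule Hom_eqI[OF Hom_compose[OF lW i(1) h] f])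
      (simp add: h_def Hom_closed[OF i(1)] pi Hom_zero[OF lW lM g] Hom_closed[OF f])
  have hi2: "compose (carrier W) h i2 = g"
    by (rule Hom_eqI[OF Hom_compose[OF lW i(2) h] g])
      (simp add: h_def Hom_closed[OF i(2)] pi Hom_zero[OF lW lM f] Hom_closed[OF g])
  have hd: "compose (carrier W) h d = (\<lambda>w\<in>carrier W. f w \<oplus>\<^bsub>M\<^esub> g w)"
    by (rule Hom_eqI[OF Hom_compose[OF lW d h] Hom_plus[OF lW lM f g]]) (simp add: h_def dx pd)
  have p1d: "compose (carrier W) p1 d = (\<lambda>w\<in>carrier W. w)" and p2d: "compose (carrier W) p2 d = (\<lambda>w\<in>carrier W. w)"
    using pd by (auto simp: compose_def fun_eq_iff)
  let ?h = "farr F Z M h" and ?d = "farr F W Z d"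
  note Fh = F'(2)[OF Z M h] and Fd = F'(2)[OF W Z d]
  have dc: "?d x \<in> carrier (fobj F Z)" by (rule Hom_closed[OF Fd x])
  have "?p1 (?d x) = x" "?p2 (?d x) = x"
    using F'(4)[OF W Z W d p(1) x] F'(4)[OF W Z W d p(2) x] F'(3)[OF W x] p1d p2d by simp_all
  then have dd: "?d x = ?i1 x \<oplus>\<^bsub>fobj F Z\<^esub> ?i2 x" using rec[OF dc] by simp
  have "farr F W M (\<lambda>w\<in>carrier W. f w \<oplus>\<^bsub>M\<^esub> g w) x = ?h (?d x)"
    using F'(4)[OF W Z M d h x] unfolding hd .
  also have "\<dots> = ?h (?i1 x) \<oplus>\<^bsub>fobj F M\<^esub> ?h (?i2 x)"
    unfolding dd by (rule Hom_add[OF Fh Hom_closed[OF Fi1 x] Hom_closed[OF Fi2 x]])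
  also have "\<dots> = farr F W M f x \<oplus>\<^bsub>fobj F M\<^esub> farr F W M g x"
    using F'(4)[OF W Z M i(1) h x] F'(4)[OF W Z M i(2) h x] unfolding hi1 hi2 by simp
  finally show ?thesis .
qed

context quasi_hereditary begin

lemma filt_copy:
  fixes M :: "('a, 'x) module"
  assumes M: "left_module A M" "filt M"
  shows "\<exists>(N :: ('a, 'm) module) j. left_module A N \<and> filt N \<and> j \<in> Iso A M N"
proof -
  obtain N :: "('a, 'm) module" and j where N: "N \<in> fg_modules A" and j: "j \<in> Iso A M N"
    using universe_copy[OF universe M(1) filt_fg[OF M(2,1)]] by blast
  obtain j' where "j' \<in> Iso A N M" using isomorphic_sym[OF M(1), of N] j by (auto simp: isomorphic_def)
  then have "filt N" by (rule filt_iso[OF M(2,1) fg_modulesD(1)[OF N]])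
  then show ?thesis using fg_modulesD(1)[OF N] j by blast
qed

lemma filt_biproduct:
  assumes W: "left_module A W" "filt W"
  shows "\<exists>(Z :: ('a, 'm) module) i1 i2 p1 p2. left_module A Z \<and> filt Z \<and>
    i1 \<in> Hom A W Z \<and> i2 \<in> Hom A W Z \<and> p1 \<in> Hom A Z W \<and> p2 \<in> Hom A Z W \<and>
    (\<forall>x\<in>carrier W. p1 (i1 x) = x \<and> p2 (i2 x) = x \<and> p1 (i2 x) = \<zero>\<^bsub>W\<^esub> \<and> p2 (i1 x) = \<zero>\<^bsub>W\<^esub>) \<and>
    (\<forall>z\<in>carrier Z. i1 (p1 z) \<oplus>\<^bsub>Z\<^esub> i2 (p2 z) = z)"
proof -
  interpret W: left_module A W by (rule W(1))
  let ?D = "dsum (UNIV :: bool set) (\<lambda>_. W)"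
  have D: "left_module A ?D" "filt ?D"
    by (rule left_module_dsum[OF ring_A W(1)], rule filt_dsum) (use W in auto)
  obtain Z :: "('a, 'm) module" and j where Z: "left_module A Z" "filt Z" and j: "j \<in> Iso A ?D Z"
    using filt_copy[OF D] by blast
  obtain j' where j': "j' \<in> Iso A Z ?D" "\<forall>x\<in>carrier ?D. j' (j x) = x" "\<forall>z\<in>carrier Z. j (j' z) = z"
    using Iso_inverse_ex[OF D(1) j] by blast
  define i where "i b = (\<lambda>x\<in>carrier W. \<lambda>c\<in>(UNIV :: bool set). if c = b then x else \<zero>\<^bsub>W\<^esub>)" for b
  define p where "p b = (\<lambda>x\<in>carrier ?D. x b)" for b
  have i: "i b \<in> Hom A W ?D" for b unfolding i_def by (rule dsum_inj[of A "\<lambda>_. W"]) (use W in auto)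
  have p: "p b \<in> Hom A ?D W" for b unfolding p_def by (rule dsum_proj[OF D(1)]) simp
  have pi: "p b (i c x) = (if b = c then x else \<zero>\<^bsub>W\<^esub>)" if x: "x \<in> carrier W" for b c x
    using Hom_closed[OF i x, of c] x by (simp add: p_def i_def del: dsum_simps(1))
  have s: "i True (p True x) \<oplus>\<^bsub>?D\<^esub> i False (p False x) = x" if x: "x \<in> carrier ?D" for x
  proof
    fix b
    have "x True \<in> carrier W" "x False \<in> carrier W" using x by auto
    then show "(i True (p True x) \<oplus>\<^bsub>?D\<^esub> i False (p False x)) b = x b"
      using x by (cases b) (simp_all add: i_def p_def del: dsum_simps(1))
  qed
  let ?i = "\<lambda>b. compose (carrier W) j (i b)" and ?p = "\<lambda>b. compose (carrier Z) (p b) j'"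
  have "?i b \<in> Hom A W Z" "?p b \<in> Hom A Z W" for b
    by (rule Hom_compose[OF W(1) i IsoD(1)[OF j]], rule Hom_compose[OF Z(1) IsoD(1)[OF j'(1)] p])
  moreover have "?p b (?i c x) = (if b = c then x else \<zero>\<^bsub>W\<^esub>)" if x: "x \<in> carrier W" for b c x
    using Hom_closed[OF IsoD(1)[OF j] Hom_closed[OF i x]] bspec[OF j'(2) Hom_closed[OF i x]] pi[OF x] x by simp
  moreover have "?i True (?p True z) \<oplus>\<^bsub>Z\<^esub> ?i False (?p False z) = z" if z: "z \<in> carrier Z" for z
  proof -
    have jz: "j' z \<in> carrier ?D" by (rule Hom_closed[OF IsoD(1)[OF j'(1)] z])
    have pz: "p b (j' z) \<in> carrier W" for b by (rule Hom_closed[OF p jz])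
    have "?i True (?p True z) \<oplus>\<^bsub>Z\<^esub> ?i False (?p False z) = j (i True (p True (j' z))) \<oplus>\<^bsub>Z\<^esub> j (i False (p False (j' z)))"
      using z pz by simp
    also have "\<dots> = j (i True (p True (j' z)) \<oplus>\<^bsub>?D\<^esub> i False (p False (j' z)))"
      by (rule Hom_add[OF IsoD(1)[OF j] Hom_closed[OF i pz] Hom_closed[OF i pz], symmetric])
    also have "\<dots> = z" unfolding s[OF jz] using j'(3) z by blast
    finally show ?thesis .
  qed
  ultimately show ?thesis
    using Z by (intro exI[of _ Z] exI[of _ "?i True"] exI[of _ "?i False"] exI[of _ "?p True"] exI[of _ "?p False"]) simp
qed

end

locale filtered_equivalence =
  src: quasi_hereditary R A \<Lambda> \<Delta> + tgt: quasi_hereditary R A' \<Gamma> \<Delta>'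
  for R :: "('r, 'k) ring_scheme" and A :: "('r, 'a) module" and \<Lambda> :: "('l::order) set"
    and \<Delta> :: "'l \<Rightarrow> ('a, 'm) module" and A' :: "('r, 'b) module" and \<Gamma> :: "('g::order) set"
    and \<Delta>' :: "'g \<Rightarrow> ('b, 'n) module" +
  fixes \<Phi> :: "('a, 'm, 'b, 'n) mod_functor" and \<Psi> :: "('b, 'n, 'a, 'm) mod_functor"
  assumes quasi_inv: "quasi_inverse A (Filt A (Delta_tilde R A \<Lambda> \<Delta>)) A' (Filt A' (Delta_tilde R A' \<Gamma> \<Delta>')) \<Phi> \<Psi>"
    and exact: "exact_functor A (Filt A (Delta_tilde R A \<Lambda> \<Delta>)) A' \<Phi>"
    and exact_inv: "exact_functor A' (Filt A' (Delta_tilde R A' \<Gamma> \<Delta>')) A \<Psi>"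
begin

text \<open>
  Whatever is shown for \<open>\<Phi>\<close> holds for \<open>\<Psi>\<close> by this symmetry.
\<close>

lemma inverse: "filtered_equivalence R A' \<Gamma> \<Delta>' A \<Lambda> \<Delta> \<Psi> \<Phi>"
  by (intro filtered_equivalence.intro filtered_equivalence_axioms.intro tgt.quasi_hereditary_axioms
      src.quasi_hereditary_axioms quasi_inverse_sym[OF quasi_inv] exact exact_inv)

abbreviation "\<C> \<equiv> Filt A (Delta_tilde R A \<Lambda> \<Delta>) :: ('a, 'm) module set"
abbreviation "\<D> \<equiv> Filt A' (Delta_tilde R A' \<Gamma> \<Delta>') :: ('b, 'n) module set"

lemma Phi_functor: "is_functor A \<C> A' \<D> \<Phi>" "is_functor A' \<D> A \<C> \<Psi>"
  using quasi_inv by (auto simp: quasi_inverse_def)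

lemmas obj = is_functorD(1)[OF Phi_functor(1)]
lemmas arr = is_functorD(2)[OF Phi_functor(1)]
lemmas arr_id = is_functorD(3)[OF Phi_functor(1)]
lemmas arr_comp = is_functorD(4)[OF Phi_functor(1)]

lemma \<C>_module: "M \<in> \<C> \<Longrightarrow> left_module A M" using src.Filt_filt by blast
lemma \<D>_module: "M \<in> \<D> \<Longrightarrow> left_module A' M" using tgt.Filt_filt by blast

lemmas faithful = equivalence_faithful[OF quasi_inv]

lemma full: "M \<in> \<C> \<Longrightarrow> N \<in> \<C> \<Longrightarrow> h \<in> Hom A' (fobj \<Phi> M) (fobj \<Phi> N) \<Longrightarrow> \<exists>f\<in>Hom A M N. farr \<Phi> M N f = h"
  by (rule equivalence_full[OF quasi_inv \<C>_module])

lemma arr_add: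
  assumes W: "W \<in> \<C>" and M: "M \<in> \<C>" and f: "f \<in> Hom A W M" and g: "g \<in> Hom A W M" and x: "x \<in> carrier (fobj \<Phi> W)"
  shows "farr \<Phi> W M (\<lambda>w\<in>carrier W. f w \<oplus>\<^bsub>M\<^esub> g w) x = farr \<Phi> W M f x \<oplus>\<^bsub>fobj \<Phi> M\<^esub> farr \<Phi> W M g x"
proof -
  have W': "left_module A W" "src.filt W" using W src.Filt_filt by blast+
  obtain Z :: "('a, 'm) module" and i1 i2 p1 p2 where Z: "left_module A Z" "src.filt Z"
    and b: "i1 \<in> Hom A W Z" "i2 \<in> Hom A W Z" "p1 \<in> Hom A Z W" "p2 \<in> Hom A Z W"
    and pi: "\<forall>x\<in>carrier W. p1 (i1 x) = x \<and> p2 (i2 x) = x \<and> p1 (i2 x) = \<zero>\<^bsub>W\<^esub> \<and> p2 (i1 x) = \<zero>\<^bsub>W\<^esub>"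
    and s: "\<forall>z\<in>carrier Z. i1 (p1 z) \<oplus>\<^bsub>Z\<^esub> i2 (p2 z) = z"
    using src.filt_biproduct[OF W'] by blast
  have Z': "Z \<in> \<C>" using Z src.Filt_filt by blast
  show ?thesis
    by (rule exact_functor_additive[OF Phi_functor(1) exact \<C>_module \<D>_module W M Z' b _ _ _ _ _ f g x]) (use pi s in blast)+
qed

lemma arr_zero:
  assumes W: "W \<in> \<C>" and M: "M \<in> \<C>" and x: "x \<in> carrier (fobj \<Phi> W)"
  shows "farr \<Phi> W M (\<lambda>w\<in>carrier W. \<zero>\<^bsub>M\<^esub>) x = \<zero>\<^bsub>fobj \<Phi> M\<^esub>"
proof -
  interpret M: left_module A M by (rule \<C>_module[OF M])
  interpret FM: left_module A' "fobj \<Phi> M" by (rule \<D>_module[OF obj[OF M]])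
  let ?z = "\<lambda>w\<in>carrier W. \<zero>\<^bsub>M\<^esub>"
  have z: "?z \<in> Hom A W M" by (rule Hom_restrictI[OF \<C>_module[OF W]]) auto
  have "(\<lambda>w\<in>carrier W. ?z w \<oplus>\<^bsub>M\<^esub> ?z w) = ?z" by (rule restrict_ext) simp
  then have "farr \<Phi> W M ?z x \<oplus>\<^bsub>fobj \<Phi> M\<^esub> farr \<Phi> W M ?z x = farr \<Phi> W M ?z x \<oplus>\<^bsub>fobj \<Phi> M\<^esub> \<zero>\<^bsub>fobj \<Phi> M\<^esub>"
    using arr_add[OF W M z z x] Hom_closed[OF arr[OF W M z] x] by simp
  then show ?thesis
    by (rule FM.M.add.l_cancel) (simp_all add: Hom_closed[OF arr[OF W M z] x] del: restrict_apply)
qed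

lemma arr_msum:
  assumes W: "W \<in> \<C>" and M: "M \<in> \<C>" and f: "\<And>k. k < n \<Longrightarrow> f k \<in> Hom A W M" and x: "x \<in> carrier (fobj \<Phi> W)"
  shows "farr \<Phi> W M (\<lambda>w\<in>carrier W. msum M (\<lambda>k. f k w) n) x = msum (fobj \<Phi> M) (\<lambda>k. farr \<Phi> W M (f k) x) n"
  using f
proof (induction n)
  case 0
  have "(\<lambda>w\<in>carrier W. msum M (\<lambda>k. f k w) 0) = (\<lambda>w\<in>carrier W. \<zero>\<^bsub>M\<^esub>)" by (rule restrict_ext) simp
  then show ?case by (simp only: msum.simps arr_zero[OF W M x])
next
  case (Suc n)
  let ?s = "\<lambda>w\<in>carrier W. msum M (\<lambda>k. f k w) n"
  have s: "?s \<in> Hom A W M" by (rule src.Hom_msum_pointwise[OF \<C>_module[OF W] \<C>_module[OF M]]) (use Suc(2) in auto)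
  have fn: "f n \<in> Hom A W M" using Suc(2) by simp
  have eq: "(\<lambda>w\<in>carrier W. msum M (\<lambda>k. f k w) (Suc n)) = (\<lambda>w\<in>carrier W. ?s w \<oplus>\<^bsub>M\<^esub> f n w)" by (rule restrict_ext) simp
  have IH: "farr \<Phi> W M ?s x = msum (fobj \<Phi> M) (\<lambda>k. farr \<Phi> W M (f k) x) n"
    by (rule Suc.IH) (rule Suc.prems, simp)
  show ?case unfolding eq arr_add[OF W M s fn x] IH by simp
qed

lemma arr_eqI:
  assumes "M \<in> \<C>" "N \<in> \<C>" "f \<in> Hom A M N" "g \<in> Hom A M N"
    and "\<And>x. x \<in> carrier (fobj \<Phi> M) \<Longrightarrow> farr \<Phi> M N f x = farr \<Phi> M N g x"
  shows "f = g"
  by (rule faithful[OF assms(1-4)]) (rule Hom_eqI[OF arr[OF assms(1-3)] arr[OF assms(1,2,4)] assms(5)])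

text \<open>
  A projective object of \<open>\<C>\<close> stays projective: the cover of its image by a projective filtered module
  has a filtered kernel, so \<open>\<Psi>\<close> turns it into an epimorphism onto a projective module.
\<close>

lemma preserves_fgp:
  assumes S: "S \<in> \<C>" and fgp: "fgp A S"
  shows "fgp A' (fobj \<Phi> S)"
proof -
  interpret inv: filtered_equivalence R A' \<Gamma> \<Delta>' A \<Lambda> \<Delta> \<Psi> \<Phi> by (rule inverse)
  let ?X = "fobj \<Phi> S"
  have X: "?X \<in> \<D>" by (rule obj[OF S])
  have X': "left_module A' ?X" "tgt.filt ?X" using X tgt.Filt_filt by blast+
  obtain T :: "('b, 'n) module" and f where T: "fgp A' T" "tgt.filt T" and f: "f \<in> Hom A' T ?X" "f ` carrier T = carrier ?X"
    and k: "tgt.filt (T\<lparr>carrier := a_kernel T ?X f\<rparr>)" using tgt.filtered_cover[OF X'(2,1)] by blast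
  have lT: "left_module A' T" using T by (simp add: fgp_def)
  have TD: "T \<in> \<D>" using lT T(2) tgt.Filt_filt by blast
  let ?K = "T\<lparr>carrier := a_kernel T ?X f\<rparr>"
  have sK: "submodule (a_kernel T ?X f) A' T" by (rule submodule_kernel[OF lT X'(1) f(1)])
  have KD: "?K \<in> \<D>" using left_module_submodule[OF lT sK] k tgt.Filt_filt by blast
  let ?i = "\<lambda>x\<in>a_kernel T ?X f. x"
  have "short_exact A' ?K ?i T f ?X" unfolding short_exact_def
  proof (intro conjI)
    show "inj_on ?i (carrier ?K)" by (rule inj_onI) simp
    show "?i ` carrier ?K = a_kernel T ?X f" by (simp add: image_restrict_eq)
  qed (fact Hom_incl[OF lT sK] f)+
  then have "short_exact A (fobj \<Psi> ?K) (farr \<Psi> ?K T ?i) (fobj \<Psi> T) (farr \<Psi> T ?X f) (fobj \<Psi> ?X)"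
    using exact_inv KD TD X unfolding exact_functor_def by blast
  then have fs: "farr \<Psi> T ?X f ` carrier (fobj \<Psi> T) = carrier (fobj \<Psi> ?X)" by (simp add: short_exact_def)
  have lPX: "left_module A (fobj \<Psi> ?X)" and lPT: "left_module A (fobj \<Psi> T)"
    by (rule \<C>_module[OF inv.obj[OF X]], rule \<C>_module[OF inv.obj[OF TD]])
  obtain \<eta> where "\<forall>M\<in>\<C>. \<eta> M \<in> Iso A (fobj \<Psi> (fobj \<Phi> M)) M" using quasi_inverse_unit[OF quasi_inv] by blast
  then have "isomorphic A (fobj \<Psi> ?X) S" using S by (auto simp: isomorphic_def)
  then obtain e where e: "e \<in> Iso A S (fobj \<Psi> ?X)" using isomorphic_sym[OF lPX] by (auto simp: isomorphic_def)
  have PXf: "fgp A (fobj \<Psi> ?X)" by (rule fgp_iso[OF fgp lPX e])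
  obtain s where s: "s \<in> Hom A (fobj \<Psi> ?X) (fobj \<Psi> T)" "\<And>x. x \<in> carrier (fobj \<Psi> ?X) \<Longrightarrow> farr \<Psi> T ?X f (s x) = (\<lambda>x\<in>carrier (fobj \<Psi> ?X). x) x"
    using fgp_lift[OF PXf lPT lPX inv.arr[OF TD X f(1)] fs Hom_id[OF lPX]] by blast
  obtain t where t: "t \<in> Hom A' ?X T" "farr \<Psi> ?X T t = s" using inv.full[OF X TD s(1)] by blast
  have ft: "compose (carrier ?X) f t = (\<lambda>x\<in>carrier ?X. x)"
  proof (rule inv.arr_eqI[OF X X Hom_compose[OF X'(1) t(1) f(1)] Hom_id[OF X'(1)]])
    fix x assume x: "x \<in> carrier (fobj \<Psi> ?X)"
    show "farr \<Psi> ?X ?X (compose (carrier ?X) f t) x = farr \<Psi> ?X ?X (\<lambda>x\<in>carrier ?X. x) x"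
      using inv.arr_comp[OF X TD X t(1) f(1) x] inv.arr_id[OF X x] s(2)[OF x] t(2) x by simp
  qed
  have "f (t x) = x" if "x \<in> carrier ?X" for x using fun_cong[OF ft, of x] that by simp
  then show ?thesis by (rule fgp_retract[OF T(1) X'(1) f(1) t(1)])
qed

end

section \<open>Lifting an exact equivalence to the module categories\<close>

lemma msum_self [simp]: "msum (self_algebra A) f n = msum A f n"
  by (induction n) auto

text \<open>
  The pair \<open>v\<close>, \<open>\<pi>\<close> exhibits the regular module of \<open>A'\<close> as the retract \<open>A' v\<close> of \<open>\<Phi> W\<close>. Right
  multiplication by \<open>b\<close> on \<open>A' v\<close> extends to the endomorphism \<open>rmul b\<close> of \<open>\<Phi> W\<close>, which corresponds to
  an endomorphism \<open>act b\<close> of \<open>W\<close>. The idempotent \<open>act 1\<close> cuts out the summand \<open>X\<close> of \<open>W\<close> that \<open>\<Phi>\<close> would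
  send to the regular module of \<open>A'\<close>.
\<close>

locale pointed_equivalence = filtered_equivalence R A \<Lambda> \<Delta> A' \<Gamma> \<Delta>' \<Phi> \<Psi>
  for R :: "('r, 'k) ring_scheme" and A :: "('r, 'a) module" and \<Lambda> :: "('l::order) set"
    and \<Delta> :: "'l \<Rightarrow> ('a, 'm) module" and A' :: "('r, 'b) module" and \<Gamma> :: "('g::order) set"
    and \<Delta>' :: "'g \<Rightarrow> ('b, 'n) module" and \<Phi> :: "('a, 'm, 'b, 'n) mod_functor"
    and \<Psi> :: "('b, 'n, 'a, 'm) mod_functor" +
  fixes W :: "('a, 'm) module" and v :: 'n and \<pi> :: "'n \<Rightarrow> 'b"
  assumes W: "W \<in> \<C>" and v: "v \<in> carrier (fobj \<Phi> W)"
    and \<pi>: "\<pi> \<in> Hom A' (fobj \<Phi> W) (self_algebra A')" and \<pi>v: "\<pi> v = \<one>\<^bsub>A'\<^esub>"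
begin

abbreviation "V \<equiv> fobj \<Phi> W"

lemma lW: "left_module A W" by (rule \<C>_module[OF W])
lemma lV: "left_module A' V" by (rule \<D>_module[OF obj[OF W]])

interpretation W: left_module A W by (rule lW)
interpretation V: left_module A' V by (rule lV)

lemma \<pi>_closed: "x \<in> carrier V \<Longrightarrow> \<pi> x \<in> carrier A'"
  using Hom_closed[OF \<pi>] by simp

lemma \<pi>_smult: "b \<in> carrier A' \<Longrightarrow> \<pi> (b \<odot>\<^bsub>V\<^esub> v) = b"
  using Hom_smult[OF \<pi> _ v] \<pi>v by simp

definition rmul :: "'b \<Rightarrow> 'n \<Rightarrow> 'n" where
  "rmul b = (\<lambda>x\<in>carrier V. (\<pi> x \<otimes>\<^bsub>A'\<^esub> b) \<odot>\<^bsub>V\<^esub> v)"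

definition act :: "'b \<Rightarrow> 'm \<Rightarrow> 'm" where
  "act b = (SOME f. f \<in> Hom A W W \<and> farr \<Phi> W W f = rmul b)"

lemma point_Hom:
  assumes N: "left_module A' N" and y: "y \<in> carrier N"
  shows "(\<lambda>x\<in>carrier V. \<pi> x \<odot>\<^bsub>N\<^esub> y) \<in> Hom A' V N"
proof -
  interpret N: left_module A' N by (rule N)
  show ?thesis
    using Hom_add[OF \<pi>] Hom_smult[OF \<pi>]
    by (intro Hom_restrictI[OF lV]) (simp_all add: \<pi>_closed y N.smult_closed N.smult_l_distr N.smult_assoc1)
qed

lemma rmul_eq: "b \<in> carrier A' \<Longrightarrow> rmul b = (\<lambda>x\<in>carrier V. \<pi> x \<odot>\<^bsub>V\<^esub> (b \<odot>\<^bsub>V\<^esub> v))"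
  unfolding rmul_def by (rule restrict_ext) (simp add: \<pi>_closed v V.smult_assoc1)

lemma rmul_Hom: "b \<in> carrier A' \<Longrightarrow> rmul b \<in> Hom A' V V"
  by (simp add: rmul_eq point_Hom[OF lV] V.smult_closed v)

lemma act:
  assumes "b \<in> carrier A'" shows "act b \<in> Hom A W W" "farr \<Phi> W W (act b) = rmul b"
proof -
  have "\<exists>f. f \<in> Hom A W W \<and> farr \<Phi> W W f = rmul b" using full[OF W W rmul_Hom[OF assms]] by blast
  from someI_ex[OF this] show "act b \<in> Hom A W W" "farr \<Phi> W W (act b) = rmul b" by (simp_all add: act_def)
qed

lemma act_closed: "b \<in> carrier A' \<Longrightarrow> w \<in> carrier W \<Longrightarrow> act b w \<in> carrier W"
  by (rule Hom_closed[OF act(1)])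

lemma act_eqI:
  assumes "b \<in> carrier A'" "f \<in> Hom A W W" "\<And>x. x \<in> carrier V \<Longrightarrow> farr \<Phi> W W f x = rmul b x"
  shows "act b = f"
  by (rule arr_eqI[OF W W act(1)[OF assms(1)] assms(2)]) (simp add: act(2)[OF assms(1)] assms(3))

lemma act_add:
  assumes b: "b \<in> carrier A'" "b' \<in> carrier A'" and w: "w \<in> carrier W"
  shows "act (b \<oplus>\<^bsub>A'\<^esub> b') w = act b w \<oplus>\<^bsub>W\<^esub> act b' w"
proof -
  have "act (b \<oplus>\<^bsub>A'\<^esub> b') = (\<lambda>w\<in>carrier W. act b w \<oplus>\<^bsub>W\<^esub> act b' w)"
  proof (rule act_eqI[OF _ Hom_plus[OF lW lW act(1)[OF b(1)] act(1)[OF b(2)]]])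
    fix x assume x: "x \<in> carrier V"
    have "farr \<Phi> W W (\<lambda>w\<in>carrier W. act b w \<oplus>\<^bsub>W\<^esub> act b' w) x = rmul b x \<oplus>\<^bsub>V\<^esub> rmul b' x"
      using arr_add[OF W W act(1)[OF b(1)] act(1)[OF b(2)] x] by (simp only: act(2)[OF b(1)] act(2)[OF b(2)])
    also have "\<dots> = rmul (b \<oplus>\<^bsub>A'\<^esub> b') x"
      using b x v by (simp add: rmul_def \<pi>_closed V.A.r_distr V.smult_l_distr)
    finally show "farr \<Phi> W W (\<lambda>w\<in>carrier W. act b w \<oplus>\<^bsub>W\<^esub> act b' w) x = rmul (b \<oplus>\<^bsub>A'\<^esub> b') x" .
  qed (use b in simp)
  then show ?thesis using w by simp
qed

lemma act_mult:
  assumes b: "b \<in> carrier A'" "b' \<in> carrier A'" and w: "w \<in> carrier W"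
  shows "act (b \<otimes>\<^bsub>A'\<^esub> b') w = act b' (act b w)"
proof -
  have "act (b \<otimes>\<^bsub>A'\<^esub> b') = compose (carrier W) (act b') (act b)"
  proof (rule act_eqI[OF _ Hom_compose[OF lW act(1)[OF b(1)] act(1)[OF b(2)]]])
    fix x assume x: "x \<in> carrier V"
    have "farr \<Phi> W W (compose (carrier W) (act b') (act b)) x = rmul b' (rmul b x)"
      using arr_comp[OF W W W act(1)[OF b(1)] act(1)[OF b(2)] x] by (simp only: act(2)[OF b(1)] act(2)[OF b(2)])
    also have "\<dots> = rmul (b \<otimes>\<^bsub>A'\<^esub> b') x"
      using b x v by (simp add: rmul_def \<pi>_closed V.smult_closed \<pi>_smult V.A.m_assoc)
    finally show "farr \<Phi> W W (compose (carrier W) (act b') (act b)) x = rmul (b \<otimes>\<^bsub>A'\<^esub> b') x" .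
  qed (use b in simp)
  then show ?thesis using w by simp
qed

lemma act_one: "b \<in> carrier A' \<Longrightarrow> w \<in> carrier W \<Longrightarrow> act \<one>\<^bsub>A'\<^esub> (act b w) = act b w"
  "b \<in> carrier A' \<Longrightarrow> w \<in> carrier W \<Longrightarrow> act b (act \<one>\<^bsub>A'\<^esub> w) = act b w"
  using act_mult[of b "\<one>\<^bsub>A'\<^esub>" w] act_mult[of "\<one>\<^bsub>A'\<^esub>" b w] by simp_all

definition X :: "('a, 'm) module" where "X = W\<lparr>carrier := act \<one>\<^bsub>A'\<^esub> ` carrier W\<rparr>"

lemma X_iff: "x \<in> carrier X \<longleftrightarrow> x \<in> carrier W \<and> act \<one>\<^bsub>A'\<^esub> x = x"
proof
  assume "x \<in> carrier X"
  then obtain w where "w \<in> carrier W" "x = act \<one>\<^bsub>A'\<^esub> w" by (auto simp: X_def)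
  then show "x \<in> carrier W \<and> act \<one>\<^bsub>A'\<^esub> x = x" using act_closed act_one(1) by simp
next
  assume "x \<in> carrier W \<and> act \<one>\<^bsub>A'\<^esub> x = x"
  then show "x \<in> carrier X" unfolding X_def by (auto intro!: image_eqI[of _ _ x])
qed

lemma submodule_X: "submodule (carrier X) A W"
  using submodule_image[OF lW lW act(1)[OF V.A.one_closed] submodule_carrier[OF lW]] by (simp add: X_def)

lemma X_eq: "X = W\<lparr>carrier := carrier X\<rparr>" by (simp add: X_def)

lemma X_ops [simp]: "\<zero>\<^bsub>X\<^esub> = \<zero>\<^bsub>W\<^esub>" "x \<oplus>\<^bsub>X\<^esub> y = x \<oplus>\<^bsub>W\<^esub> y" "a \<odot>\<^bsub>X\<^esub> x = a \<odot>\<^bsub>W\<^esub> x"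
  by (simp_all add: X_def)

lemma lX: "left_module A X"
  by (subst X_eq) (rule left_module_submodule[OF lW submodule_X])

lemma XW: "x \<in> carrier X \<Longrightarrow> x \<in> carrier W" by (simp add: X_iff)

lemma act_X: "b \<in> carrier A' \<Longrightarrow> w \<in> carrier W \<Longrightarrow> act b w \<in> carrier X"
  using act_closed act_one(1) by (simp add: X_iff)

lemma proj_X: "(\<lambda>w\<in>carrier W. act \<one>\<^bsub>A'\<^esub> w) \<in> Hom A W X"
  using act_X Hom_add[OF act(1)] Hom_smult[OF act(1)] by (intro Hom_restrictI[OF lW]) simp_all

lemma incl_X: "(\<lambda>x\<in>carrier X. x) \<in> Hom A X W"
  by (rule Hom_restrictI[OF lX]) (simp_all add: XW)

lemma X_bimodule: "bimodule A A' X (\<lambda>x b. act b x)"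
proof (rule bimodule.intro[OF lX V.A.ring_axioms])
  show "act \<one>\<^bsub>A'\<^esub> x = x" if "x \<in> carrier X" for x using that by (simp add: X_iff)
next
  fix x b assume x: "x \<in> carrier X" and b: "b \<in> carrier A'"
  show "act b x \<in> carrier X" by (rule act_X[OF b XW[OF x]])
  show "act b (x \<oplus>\<^bsub>X\<^esub> x') = act b x \<oplus>\<^bsub>X\<^esub> act b x'" if "x' \<in> carrier X" for x'
    using Hom_add[OF act(1)[OF b] XW[OF x] XW[OF that]] by simp
  show "act (b \<oplus>\<^bsub>A'\<^esub> b') x = act b x \<oplus>\<^bsub>X\<^esub> act b' x" if "b' \<in> carrier A'" for b'
    using act_add[OF b that XW[OF x]] by simp
  show "act (b \<otimes>\<^bsub>A'\<^esub> b') x = act b' (act b x)" if "b' \<in> carrier A'" for b'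
    by (rule act_mult[OF b that XW[OF x]])
  show "act b (a \<odot>\<^bsub>X\<^esub> x) = a \<odot>\<^bsub>X\<^esub> act b x" if "a \<in> carrier A" for a
    using Hom_smult[OF act(1)[OF b] that XW[OF x]] by simp
qed

definition extend :: "('m \<Rightarrow> 'x) \<Rightarrow> 'm \<Rightarrow> 'x" where
  "extend f = (\<lambda>w\<in>carrier W. f (act \<one>\<^bsub>A'\<^esub> w))"

lemma extend_Hom: assumes f: "f \<in> Hom A X M" shows "extend f \<in> Hom A W M"
proof -
  have "extend f = compose (carrier W) f (\<lambda>w\<in>carrier W. act \<one>\<^bsub>A'\<^esub> w)"
    by (auto simp: extend_def compose_def fun_eq_iff)
  then show ?thesis using Hom_compose[OF lW proj_X f] by simp
qed

lemma extend_X: "x \<in> carrier X \<Longrightarrow> extend f x = f x"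
  by (simp add: extend_def X_iff)

text \<open>
  For \<open>f : X \<rightarrow> M\<close> the map \<open>\<Phi>(extend f)\<close> factors through the retract \<open>A' v\<close>, hence it is determined by
  its value at \<open>v\<close>. In this way \<open>Hom A X M\<close> becomes \<open>\<Phi> M\<close>.
\<close>

lemma arr_extend:
  assumes M: "M \<in> \<C>" and f: "f \<in> Hom A X M" and x: "x \<in> carrier V"
  shows "farr \<Phi> W M (extend f) x = \<pi> x \<odot>\<^bsub>fobj \<Phi> M\<^esub> farr \<Phi> W M (extend f) v"
proof -
  note e = extend_Hom[OF f]
  have one: "\<one>\<^bsub>A'\<^esub> \<in> carrier A'" by simp
  have "compose (carrier W) (extend f) (act \<one>\<^bsub>A'\<^esub>) = extend f"
    using act_one(1)[OF one] act_closed[OF one] by (auto simp: compose_def extend_def fun_eq_iff)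
  then have "farr \<Phi> W M (extend f) x = farr \<Phi> W M (extend f) (rmul \<one>\<^bsub>A'\<^esub> x)"
    using arr_comp[OF W W M act(1)[OF one] e x] act(2)[OF one] by simp
  also have "\<dots> = \<pi> x \<odot>\<^bsub>fobj \<Phi> M\<^esub> farr \<Phi> W M (extend f) v"
    using x v by (simp add: rmul_def \<pi>_closed Hom_smult[OF arr[OF W M e]])
  finally show ?thesis .
qed

lemma extend_eqI:
  assumes M: "M \<in> \<C>" and f: "f \<in> Hom A X M" "g \<in> Hom A X M"
    and eq: "farr \<Phi> W M (extend f) v = farr \<Phi> W M (extend g) v"
  shows "f = g"
proof -
  have "extend f = extend g"
    by (rule arr_eqI[OF W M extend_Hom[OF f(1)] extend_Hom[OF f(2)]])
      (simp add: arr_extend[OF M f(1)] arr_extend[OF M f(2)] eq)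
  then have "f x = g x" if "x \<in> carrier X" for x using extend_X[OF that, of f] extend_X[OF that, of g] by simp
  then show ?thesis by (rule Hom_eqI[OF f])
qed

lemma extend_onto:
  assumes M: "M \<in> \<C>" and y: "y \<in> carrier (fobj \<Phi> M)"
  shows "\<exists>f\<in>Hom A X M. farr \<Phi> W M (extend f) v = y"
proof -
  have one: "\<one>\<^bsub>A'\<^esub> \<in> carrier A'" by simp
  note lM = \<C>_module[OF M] and lFM = \<D>_module[OF obj[OF M]]
  interpret FM: left_module A' "fobj \<Phi> M" by (rule lFM)
  obtain g where g: "g \<in> Hom A W M" "farr \<Phi> W M g = (\<lambda>x\<in>carrier V. \<pi> x \<odot>\<^bsub>fobj \<Phi> M\<^esub> y)"
    using full[OF W M point_Hom[OF lFM y]] by blast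
  let ?f = "restrict g (carrier X)"
  have f: "?f \<in> Hom A X M" using Hom_restrict_sub[OF lW submodule_X g(1)] X_eq by simp
  have "extend ?f = compose (carrier W) g (act \<one>\<^bsub>A'\<^esub>)"
    using act_X[OF one] by (auto simp: extend_def compose_def fun_eq_iff)
  then have "farr \<Phi> W M (extend ?f) v = farr \<Phi> W M g (rmul \<one>\<^bsub>A'\<^esub> v)"
    using arr_comp[OF W W M act(1)[OF one] g(1) v] act(2)[OF one] by simp
  also have "\<dots> = y" using v y by (simp add: g(2) rmul_def \<pi>v \<pi>_smult V.smult_closed FM.smult_one V.smult_one)
  finally show ?thesis using f by blast
qed

lemma extend_action:
  assumes M: "M \<in> \<C>" and f: "f \<in> Hom A X M" and b: "b \<in> carrier A'"
  shows "farr \<Phi> W M (extend (\<lambda>x\<in>carrier X. f (act b x))) v = b \<odot>\<^bsub>fobj \<Phi> M\<^esub> farr \<Phi> W M (extend f) v"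
proof -
  have one: "\<one>\<^bsub>A'\<^esub> \<in> carrier A'" by simp
  have "extend (\<lambda>x\<in>carrier X. f (act b x)) = compose (carrier W) (extend f) (act b)"
    using act_X[OF one] act_one[OF b] act_closed[OF b] by (auto simp: extend_def compose_def fun_eq_iff)
  then have "farr \<Phi> W M (extend (\<lambda>x\<in>carrier X. f (act b x))) v = farr \<Phi> W M (extend f) (rmul b v)"
    using arr_comp[OF W W M act(1)[OF b] extend_Hom[OF f] v] act(2)[OF b] by simp
  also have "\<dots> = b \<odot>\<^bsub>fobj \<Phi> M\<^esub> farr \<Phi> W M (extend f) v"
    using v b by (simp add: rmul_def \<pi>v Hom_smult[OF arr[OF W M extend_Hom[OF f]]])
  finally show ?thesis .
qed

text \<open>
  On the other side of \<open>\<Phi>\<close>, an endomorphism of \<open>X\<close> is one of the left module \<open>A' v\<close>, that is, a right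
  multiplication.
\<close>

lemma X_full:
  assumes g: "g \<in> Hom A X X"
  shows "\<exists>b\<in>carrier A'. \<forall>x\<in>carrier X. g x = act b x"
proof -
  have one: "\<one>\<^bsub>A'\<^esub> \<in> carrier A'" by simp
  let ?g = "compose (carrier X) (\<lambda>x\<in>carrier X. x) g"
  have g': "?g \<in> Hom A X W" by (rule Hom_compose[OF lX g incl_X])
  have e: "extend ?g \<in> Hom A W W" by (rule extend_Hom[OF g'])
  let ?y = "farr \<Phi> W W (extend ?g) v"
  have y: "?y \<in> carrier V" by (rule Hom_closed[OF arr[OF W W e] v])
  let ?b = "\<pi> ?y"
  have b: "?b \<in> carrier A'" by (rule \<pi>_closed[OF y])
  have ge: "compose (carrier W) (act \<one>\<^bsub>A'\<^esub>) (extend ?g) = extend ?g"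
    using act_X[OF one] Hom_closed[OF g] X_iff by (auto simp: extend_def compose_def fun_eq_iff)
  have "act ?b = extend ?g"
  proof (rule act_eqI[OF b e])
    fix x assume x: "x \<in> carrier V"
    have yv: "?y = ?b \<odot>\<^bsub>V\<^esub> v"
    proof -
      have "?y = rmul \<one>\<^bsub>A'\<^esub> ?y" using arr_comp[OF W W W e act(1)[OF one] v] ge act(2)[OF one] by simp
      then show ?thesis using y by (simp add: rmul_def \<pi>_closed)
    qed
    have "farr \<Phi> W W (extend ?g) x = \<pi> x \<odot>\<^bsub>V\<^esub> ?y" by (rule arr_extend[OF W g' x])
    also have "\<dots> = \<pi> x \<odot>\<^bsub>V\<^esub> (?b \<odot>\<^bsub>V\<^esub> v)" using yv by simp
    also have "\<dots> = rmul ?b x" using x by (simp add: rmul_eq[OF b])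
    finally show "farr \<Phi> W W (extend ?g) x = rmul ?b x" .
  qed
  then have "g x = act ?b x" if "x \<in> carrier X" for x
    using extend_X[OF that, of ?g] that Hom_closed[OF g that] by simp
  then show ?thesis using b by blast
qed

lemma X_faithful:
  assumes b: "b \<in> carrier A'" and z: "\<And>x. x \<in> carrier X \<Longrightarrow> act b x = \<zero>\<^bsub>X\<^esub>"
  shows "b = \<zero>\<^bsub>A'\<^esub>"
proof -
  have one: "\<one>\<^bsub>A'\<^esub> \<in> carrier A'" by simp
  have "act b = (\<lambda>w\<in>carrier W. \<zero>\<^bsub>W\<^esub>)"
  proof (rule Hom_eqI[OF act(1)[OF b]])
    show "(\<lambda>w\<in>carrier W. \<zero>\<^bsub>W\<^esub>) \<in> Hom A W W" by (rule Hom_restrictI[OF lW]) auto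
    fix w assume w: "w \<in> carrier W"
    show "act b w = (\<lambda>w\<in>carrier W. \<zero>\<^bsub>W\<^esub>) w" using act_one(2)[OF b w] z[OF act_X[OF one w]] w by simp
  qed
  then have "rmul b v = \<zero>\<^bsub>V\<^esub>" using arr_zero[OF W W v] act(2)[OF b] by simp
  then have "b \<odot>\<^bsub>V\<^esub> v = \<zero>\<^bsub>V\<^esub>" using v b by (simp add: rmul_def \<pi>v)
  then have "\<pi> (b \<odot>\<^bsub>V\<^esub> v) = \<zero>\<^bsub>A'\<^esub>" using Hom_zero[OF lV left_module_self[OF V.A.ring_axioms] \<pi>] by simp
  then show ?thesis using \<pi>_smult[OF b] by simp
qed

lemma X_fgp: assumes "fgp A W" shows "fgp A X"
  by (rule fgp_retract[OF assms lX proj_X incl_X]) (simp add: X_iff)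

text \<open>
  \<open>X\<close> is a generator because \<open>\<Phi> S\<close> is projective: the identity of \<open>\<Phi> S\<close> is a sum of maps that factor
  through \<open>A'\<close>, hence through \<open>V\<close>, so the identity of \<open>S\<close> is a sum of maps that factor through \<open>X\<close>.
\<close>

lemma X_generator:
  assumes S: "S \<in> \<C>" and fS: "fgp A' (fobj \<Phi> S)" and s: "s \<in> carrier S"
    and \<sigma>: "\<sigma> \<in> Hom A S (self_algebra A)" and \<sigma>s: "\<sigma> s = \<one>\<^bsub>A\<^esub>"
  shows "\<exists>m u w. (\<forall>j<m. u j \<in> carrier X \<and> w j \<in> Hom A X (self_algebra A)) \<and>
    msum A (\<lambda>j. w j (u j)) (m::nat) = \<one>\<^bsub>A\<^esub>"
proof -
  have one: "\<one>\<^bsub>A'\<^esub> \<in> carrier A'" by simp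
  note lS = \<C>_module[OF S]
  have lself: "left_module A (self_algebra A)" by (rule left_module_self[OF W.A.ring_axioms])
  obtain n q t where lFS: "left_module A' (fobj \<Phi> S)" and d: "dual_basis A' (fobj \<Phi> S) n q t" using fS by (rule fgpE)
  note d' = dual_basisD[OF d]
  interpret FS: left_module A' "fobj \<Phi> S" by (rule lFS)
  define \<alpha> where "\<alpha> i = (\<lambda>x\<in>carrier (fobj \<Phi> S). t i x \<odot>\<^bsub>V\<^esub> v)" for i
  define \<beta> where "\<beta> i = (\<lambda>x\<in>carrier V. \<pi> x \<odot>\<^bsub>fobj \<Phi> S\<^esub> q i)" for i
  have \<alpha>: "\<alpha> i \<in> Hom A' (fobj \<Phi> S) V" if i: "i < n" for i
    unfolding \<alpha>_def using Hom_add[OF d'(2)[OF i]] Hom_smult[OF d'(2)[OF i]] d'(4)[OF i]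
    by (intro Hom_restrictI[OF lFS]) (simp_all add: v V.smult_closed V.smult_l_distr V.smult_assoc1)
  have \<beta>: "\<beta> i \<in> Hom A' V (fobj \<Phi> S)" if i: "i < n" for i
    unfolding \<beta>_def by (rule point_Hom[OF lFS d'(1)[OF i]])
  have "\<forall>i. \<exists>a. i < n \<longrightarrow> a \<in> Hom A S W \<and> farr \<Phi> S W a = \<alpha> i" using full[OF S W \<alpha>] by blast
  then obtain a where a: "\<And>i. i < n \<Longrightarrow> a i \<in> Hom A S W" "\<And>i. i < n \<Longrightarrow> farr \<Phi> S W (a i) = \<alpha> i" by metis
  have "\<forall>i. \<exists>b. i < n \<longrightarrow> b \<in> Hom A W S \<and> farr \<Phi> W S b = \<beta> i" using full[OF W S \<beta>] by blast
  then obtain b where b: "\<And>i. i < n \<Longrightarrow> b i \<in> Hom A W S" "\<And>i. i < n \<Longrightarrow> farr \<Phi> W S (b i) = \<beta> i" by metis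
  have ba: "compose (carrier S) (b i) (a i) \<in> Hom A S S" if "i < n" for i by (rule Hom_compose[OF lS a(1)[OF that] b(1)[OF that]])
  let ?c = "\<lambda>x\<in>carrier S. msum S (\<lambda>i. compose (carrier S) (b i) (a i) x) n"
  have "?c = (\<lambda>x\<in>carrier S. x)"
  proof (rule arr_eqI[OF S S src.Hom_msum_pointwise[OF lS lS ba] Hom_id[OF lS]])
    fix x assume x: "x \<in> carrier (fobj \<Phi> S)"
    have "farr \<Phi> S S ?c x = msum (fobj \<Phi> S) (\<lambda>i. farr \<Phi> S S (compose (carrier S) (b i) (a i)) x) n"
      by (rule arr_msum[OF S S ba x])
    also have "\<dots> = msum (fobj \<Phi> S) (\<lambda>i. t i x \<odot>\<^bsub>fobj \<Phi> S\<^esub> q i) n"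
    proof (rule msum_cong)
      fix i assume i: "i < n"
      have "farr \<Phi> S S (compose (carrier S) (b i) (a i)) x = \<beta> i (\<alpha> i x)"
        using arr_comp[OF S W S a(1)[OF i] b(1)[OF i] x] a(2)[OF i] b(2)[OF i] by simp
      also have "\<dots> = t i x \<odot>\<^bsub>fobj \<Phi> S\<^esub> q i"
        using x v d'(4)[OF i x] by (simp add: \<alpha>_def \<beta>_def V.smult_closed \<pi>_smult)
      finally show "farr \<Phi> S S (compose (carrier S) (b i) (a i)) x = t i x \<odot>\<^bsub>fobj \<Phi> S\<^esub> q i" .
    qed
    also have "\<dots> = x" by (rule d'(3)[OF x])
    finally show "farr \<Phi> S S ?c x = farr \<Phi> S S (\<lambda>x\<in>carrier S. x) x" using arr_id[OF S x] by simp
  qed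
  from fun_cong[OF this, of s] have sum: "msum S (\<lambda>i. b i (a i s)) n = s" using s by simp
  have aX: "a i s \<in> carrier X" if i: "i < n" for i
  proof -
    have "compose (carrier S) (act \<one>\<^bsub>A'\<^esub>) (a i) = a i"
    proof (rule arr_eqI[OF S W Hom_compose[OF lS a(1)[OF i] act(1)[OF one]] a(1)[OF i]])
      fix x assume x: "x \<in> carrier (fobj \<Phi> S)"
      have "farr \<Phi> S W (compose (carrier S) (act \<one>\<^bsub>A'\<^esub>) (a i)) x = rmul \<one>\<^bsub>A'\<^esub> (\<alpha> i x)"
        using arr_comp[OF S W W a(1)[OF i] act(1)[OF one] x] a(2)[OF i] act(2)[OF one] by simp
      also have "\<dots> = \<alpha> i x"
        using x v d'(4)[OF i x] by (simp add: \<alpha>_def rmul_def V.smult_closed \<pi>_smult)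
      finally show "farr \<Phi> S W (compose (carrier S) (act \<one>\<^bsub>A'\<^esub>) (a i)) x = farr \<Phi> S W (a i) x" using a(2)[OF i] by simp
    qed
    from fun_cong[OF this, of s] show ?thesis using s Hom_closed[OF a(1)[OF i] s] by (simp add: X_iff)
  qed
  define w where "w i = compose (carrier X) \<sigma> (compose (carrier X) (b i) (\<lambda>x\<in>carrier X. x))" for i
  have w: "w i \<in> Hom A X (self_algebra A)" if "i < n" for i
    unfolding w_def by (rule Hom_compose[OF lX Hom_compose[OF lX incl_X b(1)[OF that]] \<sigma>])
  have "msum A (\<lambda>i. w i (a i s)) n = msum A (\<lambda>i. \<sigma> (b i (a i s))) n"
    by (rule msum_cong) (simp add: w_def aX)
  also have "\<dots> = \<sigma> (msum S (\<lambda>i. b i (a i s)) n)"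
    using Hom_msum[OF lS lself \<sigma>, of n "\<lambda>i. b i (a i s)"] Hom_closed[OF b(1) Hom_closed[OF a(1) s]] by simp
  also have "\<dots> = \<one>\<^bsub>A\<^esub>" using sum \<sigma>s by simp
  finally show ?thesis using aX w by (intro exI[of _ n] exI[of _ "\<lambda>i. a i s"] exI[of _ w]) simp
qed

text \<open>
  On \<open>\<C>\<close> the two functors agree because \<open>Hom A X M\<close> is \<open>\<Phi> M\<close>; the isomorphism is evaluation at \<open>v\<close>.
\<close>

lemma extends_functor:
  assumes F: "represents A X (\<lambda>x b. act b x) A' (F :: ('a, 'm, 'b, 'n) mod_functor) i"
  shows "naturally_isomorphic A \<C> A' (functor_comp F incl) (functor_comp incl \<Phi>)"
proof -
  note F' = representsD[OF F]
  have Cfg: "M \<in> fg_modules A" if "M \<in> \<C>" for M using that by (simp add: Filt_def)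
  define z where "z M = (\<lambda>c\<in>carrier (fobj F M). farr \<Phi> W M (extend (i M c)) v)" for M
  have iH: "i M c \<in> Hom A X M" if "M \<in> \<C>" "c \<in> carrier (fobj F M)" for M c
    using Hom_closed[OF IsoD(1)[OF F'(2)[OF Cfg[OF that(1)]]] that(2)] by simp
  have zI: "z M \<in> Iso A' (fobj F M) (fobj \<Phi> M)" if M: "M \<in> \<C>" for M
  proof (rule IsoI)
    note iM = IsoD[OF F'(2)[OF Cfg[OF M]]]
    have lQ: "left_module A' (fobj F M)" by (rule fg_modulesD(1)[OF F'(1)[OF Cfg[OF M]]])
    show "z M \<in> Hom A' (fobj F M) (fobj \<Phi> M)"
      unfolding z_def
    proof (rule Hom_restrictI[OF lQ])
      fix c assume c: "c \<in> carrier (fobj F M)"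
      note ec = extend_Hom[OF iH[OF M c]]
      show "farr \<Phi> W M (extend (i M c)) v \<in> carrier (fobj \<Phi> M)" by (rule Hom_closed[OF arr[OF W M ec] v])
      show "farr \<Phi> W M (extend (i M (c \<oplus>\<^bsub>fobj F M\<^esub> c'))) v =
          farr \<Phi> W M (extend (i M c)) v \<oplus>\<^bsub>fobj \<Phi> M\<^esub> farr \<Phi> W M (extend (i M c')) v" if c': "c' \<in> carrier (fobj F M)" for c'
      proof -
        have "extend (i M (c \<oplus>\<^bsub>fobj F M\<^esub> c')) = (\<lambda>w\<in>carrier W. extend (i M c) w \<oplus>\<^bsub>M\<^esub> extend (i M c') w)"
          using Hom_add[OF iM(1) c c'] act_X[OF V.A.one_closed] by (auto simp: extend_def fun_eq_iff)
        then show ?thesis using arr_add[OF W M ec extend_Hom[OF iH[OF M c']] v] by simp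
      qed
      show "farr \<Phi> W M (extend (i M (b \<odot>\<^bsub>fobj F M\<^esub> c))) v = b \<odot>\<^bsub>fobj \<Phi> M\<^esub> farr \<Phi> W M (extend (i M c)) v" if b: "b \<in> carrier A'" for b
        using Hom_smult[OF iM(1) b c] extend_action[OF M iH[OF M c] b] by simp
    qed
    show "inj_on (z M) (carrier (fobj F M))"
    proof (rule inj_onI)
      fix c c' assume c: "c \<in> carrier (fobj F M)" and c': "c' \<in> carrier (fobj F M)" and "z M c = z M c'"
      then have "i M c = i M c'" by (intro extend_eqI[OF M iH[OF M c] iH[OF M c']]) (simp add: z_def)
      then show "c = c'" by (rule inj_onD[OF iM(2) _ c c'])
    qed
    show "z M ` carrier (fobj F M) = carrier (fobj \<Phi> M)"
    proof (intro equalityI subsetI)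
      fix y assume "y \<in> carrier (fobj \<Phi> M)"
      then obtain f where f: "f \<in> Hom A X M" "farr \<Phi> W M (extend f) v = y" using extend_onto[OF M] by blast
      have "f \<in> i M ` carrier (fobj F M)" using iM(3) f(1) by simp
      then obtain c where "c \<in> carrier (fobj F M)" "f = i M c" by (rule imageE) blast
      then show "y \<in> z M ` carrier (fobj F M)" using f(2) by (intro image_eqI[of _ _ c]) (simp_all add: z_def)
    next
      fix y assume "y \<in> z M ` carrier (fobj F M)"
      then obtain c where c: "c \<in> carrier (fobj F M)" "y = z M c" by blast
      then show "y \<in> carrier (fobj \<Phi> M)"
        using Hom_closed[OF arr[OF W M extend_Hom[OF iH[OF M c(1)]]] v] by (simp add: z_def)
    qed
  qed
  have nat: "z N (farr F M N f c) = farr \<Phi> M N f (z M c)"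
    if M: "M \<in> \<C>" and N: "N \<in> \<C>" and f: "f \<in> Hom A M N" and c: "c \<in> carrier (fobj F M)" for M N f c
  proof -
    have Fc: "farr F M N f c \<in> carrier (fobj F N)" by (rule Hom_closed[OF F'(3)[OF Cfg[OF M] Cfg[OF N] f] c])
    have "extend (i N (farr F M N f c)) = compose (carrier W) f (extend (i M c))"
      using F'(4)[OF Cfg[OF M] Cfg[OF N] f c] act_X[OF V.A.one_closed] by (auto simp: extend_def compose_def fun_eq_iff)
    then show ?thesis
      using arr_comp[OF W M N extend_Hom[OF iH[OF M c]] f v] Fc c by (simp add: z_def)
  qed
  have "compose (carrier (fobj F M)) (z N) (farr F M N f) = compose (carrier (fobj F M)) (farr \<Phi> M N f) (z M)"
    if "M \<in> \<C>" "N \<in> \<C>" "f \<in> Hom A M N" for M N f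
    using nat[OF that] by (auto simp: compose_def fun_eq_iff)
  then show ?thesis
    unfolding naturally_isomorphic_def functor_comp_def incl_def using zI by (intro exI[of _ z]) simp
qed

end

lemma (in filtered_equivalence) extension:
  "\<exists>F. category_equivalence A (fg_modules A :: ('a, 'm) module set) A' (fg_modules A') F \<and>
    naturally_isomorphic A \<C> A' (functor_comp F incl) (functor_comp incl \<Phi>)"
proof -
  interpret inv: filtered_equivalence R A' \<Gamma> \<Delta>' A \<Lambda> \<Delta> \<Psi> \<Phi> by (rule inverse)
  obtain S :: "('a, 'm) module" and s \<sigma> where S: "fgp A S" "src.filt S" and s: "s \<in> carrier S"
    "\<sigma> \<in> Hom A S (self_algebra A)" "\<sigma> s = \<one>\<^bsub>A\<^esub>" using src.filtered_generator by blast
  obtain T :: "('b, 'n) module" and u \<tau> where T: "fgp A' T" "tgt.filt T" and u: "u \<in> carrier T"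
    "\<tau> \<in> Hom A' T (self_algebra A')" "\<tau> u = \<one>\<^bsub>A'\<^esub>" using tgt.filtered_generator by blast
  have S': "S \<in> \<C>" using S src.Filt_filt by (auto simp: fgp_def)
  have T': "T \<in> \<D>" using T tgt.Filt_filt by (auto simp: fgp_def)
  let ?W = "fobj \<Psi> T"
  have W: "?W \<in> \<C>" by (rule inv.obj[OF T'])
  have fW: "fgp A ?W" by (rule inv.preserves_fgp[OF T' T(1)])
  have fS: "fgp A' (fobj \<Phi> S)" by (rule preserves_fgp[OF S' S(1)])
  obtain \<eta> where "\<forall>M\<in>\<D>. \<eta> M \<in> Iso A' (fobj \<Phi> (fobj \<Psi> M)) M"
    using quasi_inverse_unit[OF quasi_inverse_sym[OF quasi_inv]] by blast
  then have e: "\<eta> T \<in> Iso A' (fobj \<Phi> ?W) T" using T' by blast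
  have lV: "left_module A' (fobj \<Phi> ?W)" by (rule \<D>_module[OF obj[OF W]])
  obtain v where v: "v \<in> carrier (fobj \<Phi> ?W)" "\<eta> T v = u" using IsoD(3)[OF e] u(1) by (metis imageE)
  have \<pi>: "compose (carrier (fobj \<Phi> ?W)) \<tau> (\<eta> T) \<in> Hom A' (fobj \<Phi> ?W) (self_algebra A')"
    by (rule Hom_compose[OF lV IsoD(1)[OF e] u(2)])
  interpret pointed_equivalence R A \<Lambda> \<Delta> A' \<Gamma> \<Delta>' \<Phi> \<Psi> ?W v "compose (carrier (fobj \<Phi> ?W)) \<tau> (\<eta> T)"
    by unfold_locales (use W v \<pi> u(3) in auto)
  interpret X: bimodule A A' X "\<lambda>x b. act b x" by (rule X_bimodule)
  obtain yr p q where m: "morita_context A A' X (\<lambda>x b. act b x) (hom_module A X (\<lambda>x b. act b x) (self_algebra A)) yr p q"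
    using X.progenerator_context[OF X_fgp[OF fW] X_full X_faithful X_generator[OF S' fS s]] by blast
  interpret m: morita_context A A' X "\<lambda>x b. act b x" "hom_module A X (\<lambda>x b. act b x) (self_algebra A)" yr p q by (rule m)
  obtain F i where F: "represents A X (\<lambda>x b. act b x) A' (F :: ('a, 'm, 'b, 'n) mod_functor) i"
    using m.ex_represents[OF tgt.universe] by blast
  show ?thesis using m.represents_equivalence[OF F src.universe] extends_functor[OF F] by blast
qed

section \<open>Invertible modules from idempotent matrices\<close>

lemma ring_msum_distrib:
  fixes R (structure)
  assumes R: "cring R" and f: "\<And>k. k < n \<Longrightarrow> f k \<in> carrier R" and a: "a \<in> carrier R"
  shows "a \<otimes> msum R f n = msum R (\<lambda>k. a \<otimes> f k) n"
proof -
  interpret cring R by fact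
  show ?thesis using left_module.smult_msum_r[OF left_module_self[OF ring_axioms] a, of n f] f by simp
qed

text \<open>
  The hypothesis says that the endomorphisms of \<open>U = E R\<^sup>n\<close> commute, so \<open>U\<close> has rank at most one
  everywhere, and the trace \<open>\<tau>\<close> of \<open>E\<close> is its rank. Contracting the relation once expresses that
  the \<open>2 \<times> 2\<close> minors of \<open>E\<close> vanish up to the factor \<open>\<tau>\<close>. Contracting it again shows that \<open>\<tau>\<^sup>2\<close> is an
  idempotent that acts on \<open>U\<close> as the identity, which replaces a discussion of the rank.
\<close>

lemma rank_one_trace:
  fixes R (structure)
  assumes R: "cring R" and E: "idem_matrix R n E"
    and comm: "\<forall>k<n. \<forall>a<n. \<forall>b<n. \<forall>c<n. \<forall>d<n. \<forall>m<n.
      E k a \<otimes> (E b c \<otimes> E d m) = E k c \<otimes> (E d a \<otimes> E b m)"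
  defines "\<tau> \<equiv> msum R (\<lambda>b. E b b) n"
  shows "\<tau> \<in> carrier R"
    "\<lbrakk>k < n; a < n; d < n; m < n\<rbrakk> \<Longrightarrow> \<tau> \<otimes> (E k a \<otimes> E d m) = E d a \<otimes> E k m"
    "\<lbrakk>d < n; m < n\<rbrakk> \<Longrightarrow> (\<tau> \<otimes> \<tau>) \<otimes> E d m = E d m"
    "(\<tau> \<otimes> \<tau>) \<otimes> \<tau> = \<tau>"
proof -
  interpret cring R by fact
  have c: "E l k \<in> carrier R" if "l < n" "k < n" for l k using E that by (simp add: idem_matrix_def)
  have EE: "msum R (\<lambda>j. E l j \<otimes> E j k) n = E l k" if "l < n" "k < n" for l k using E that by (simp add: idem_matrix_def)
  show t: "\<tau> \<in> carrier R" unfolding \<tau>_def by (rule msum_closed) (rule c)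
  have 1: "\<tau> \<otimes> (E k a \<otimes> E d m) = E d a \<otimes> E k m" if i: "k < n" "a < n" "d < n" "m < n" for k a d m
  proof -
    have "\<tau> \<otimes> (E k a \<otimes> E d m) = (E k a \<otimes> E d m) \<otimes> \<tau>" using t c i by (simp add: m_comm)
    also have "\<dots> = msum R (\<lambda>b. (E k a \<otimes> E d m) \<otimes> E b b) n"
      unfolding \<tau>_def by (rule ring_msum_distrib[OF R]) (simp_all add: c i)
    also have "\<dots> = msum R (\<lambda>b. E d a \<otimes> (E k b \<otimes> E b m)) n"
    proof (rule msum_cong)
      fix b assume b: "b < n"
      have "(E k a \<otimes> E d m) \<otimes> E b b = E k a \<otimes> (E b b \<otimes> E d m)" using c i b by (simp add: m_ac)
      also have "\<dots> = E k b \<otimes> (E d a \<otimes> E b m)" using comm i b by blast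
      also have "\<dots> = E d a \<otimes> (E k b \<otimes> E b m)" using c i b by (simp add: m_lcomm)
      finally show "(E k a \<otimes> E d m) \<otimes> E b b = E d a \<otimes> (E k b \<otimes> E b m)" .
    qed
    also have "\<dots> = E d a \<otimes> msum R (\<lambda>b. E k b \<otimes> E b m) n"
      by (rule ring_msum_distrib[OF R, symmetric]) (simp_all add: c i)
    finally show ?thesis unfolding EE[OF i(1,4)] .
  qed
  then show "\<lbrakk>k < n; a < n; d < n; m < n\<rbrakk> \<Longrightarrow> \<tau> \<otimes> (E k a \<otimes> E d m) = E d a \<otimes> E k m" .
  have 2: "(\<tau> \<otimes> \<tau>) \<otimes> E d m = E d m" if i: "d < n" "m < n" for d m
  proof -
    have "(\<tau> \<otimes> \<tau>) \<otimes> E d m = \<tau> \<otimes> (E d m \<otimes> \<tau>)" using t c i by (simp add: m_ac)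
    also have "\<dots> = \<tau> \<otimes> msum R (\<lambda>a. E d m \<otimes> E a a) n"
      using ring_msum_distrib[OF R, of n "\<lambda>b. E b b" "E d m"] c i by (simp add: \<tau>_def)
    also have "\<dots> = msum R (\<lambda>a. \<tau> \<otimes> (E d m \<otimes> E a a)) n"
      by (rule ring_msum_distrib[OF R]) (simp_all add: c i t)
    also have "\<dots> = msum R (\<lambda>a. E d a \<otimes> E a m) n"
    proof (rule msum_cong)
      fix a assume a: "a < n"
      show "\<tau> \<otimes> (E d m \<otimes> E a a) = E d a \<otimes> E a m" using 1[of a a d m] a i c by (simp add: m_comm)
    qed
    finally show ?thesis unfolding EE[OF i] .
  qed
  then show "\<lbrakk>d < n; m < n\<rbrakk> \<Longrightarrow> (\<tau> \<otimes> \<tau>) \<otimes> E d m = E d m" .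
  have "(\<tau> \<otimes> \<tau>) \<otimes> \<tau> = msum R (\<lambda>b. (\<tau> \<otimes> \<tau>) \<otimes> E b b) n"
    using ring_msum_distrib[OF R, of n "\<lambda>b. E b b" "\<tau> \<otimes> \<tau>"] c t by (simp add: \<tau>_def)
  also have "\<dots> = \<tau>" unfolding \<tau>_def by (rule msum_cong) (simp add: 2[unfolded \<tau>_def])
  finally show "(\<tau> \<otimes> \<tau>) \<otimes> \<tau> = \<tau>" .
qed

lemma left_module_self_self:
  assumes "cring R" shows "left_module (self_algebra R) (self_algebra R)"
proof -
  have "self_algebra (self_algebra R) = self_algebra R" by (simp add: self_algebra_def)
  then show ?thesis using left_module_self[OF assoc_algebraD(2)[OF assoc_algebra_self[OF assms]]] by simp
qed

lemma Iso_self [simp]: "Iso (self_algebra R) M N = Iso R M N"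
  by (simp add: Iso_def Hom_def)

text \<open>
  The inverse of \<open>U\<close> is its dual, given by the transposed matrix. Then \<open>U \<otimes> U\<^sup>*\<close> consists of the
  matrices \<open>Y\<close> with \<open>E Y E = Y\<close>. The relations turn this into \<open>\<tau> Y = tr(Y) E\<close>, so, \<open>\<tau>\<close> being a unit,
  \<open>r \<mapsto> r E\<close> is an isomorphism from \<open>R\<close>.
\<close>

lemma Pic_of_matrix:
  fixes R (structure)
  assumes R: "cring R" and E: "idem_matrix R n E"
    and \<tau>: "msum R (\<lambda>b. E b b) n \<otimes> msum R (\<lambda>b. E b b) n = \<one>"
    and rank_one: "\<And>k a d m. \<lbrakk>k < n; a < n; d < n; m < n\<rbrakk> \<Longrightarrow>
      msum R (\<lambda>b. E b b) n \<otimes> (E k a \<otimes> E d m) = E d a \<otimes> E k m"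
  shows "Fix (self_algebra R) (self_algebra R) n E \<in> Pic R"
proof -
  interpret cring R by fact
  let ?S = "self_algebra R" and ?\<tau> = "msum R (\<lambda>b. E b b) n"
  let ?U = "Fix ?S ?S n E"
  define T where "T l k = E k l" for l k
  have c: "E l k \<in> carrier R" if "l < n" "k < n" for l k using E that by (simp add: idem_matrix_def)
  have t: "?\<tau> \<in> carrier R" by (rule msum_closed) (rule c)
  have EE: "msum R (\<lambda>j. E l j \<otimes> E j k) n = E l k" if "l < n" "k < n" for l k using E that by (simp add: idem_matrix_def)
  have T: "idem_matrix R n T"
  proof -
    have "msum R (\<lambda>j. E j l \<otimes> E k j) n = E k l" if "l < n" "k < n" for l k
      unfolding EE[OF that(2,1), symmetric] by (rule msum_cong) (simp add: m_comm c that)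
    then show ?thesis using c by (simp add: idem_matrix_def T_def)
  qed
  have RS: "assoc_algebra R ?S" by (rule assoc_algebra_self[OF R])
  have lS: "left_module ?S ?S" by (rule left_module_self_self[OF R])
  have lU: "left_module ?S ?U" by (rule left_module_Fix[OF RS lS E])
  have lU': "left_module R ?U" using R_proj_of_matrix[OF R E] by blast
  let ?F = "Fix ?S ?U n T"
  have lF: "left_module ?S ?F" by (rule left_module_Fix[OF RS lU T])
  interpret U: left_module ?S ?U by (rule lU)
  let ?c = "col ?S ?S n E"
  have cH: "?c l \<in> Hom ?S ?S ?U" if "l < n" for l by (rule col_Hom[OF RS lS E that])
  have ca: "?c l r j = E j l \<otimes> r" if "l < n" "j < n" "r \<in> carrier R" for l r j
    using that by (simp add: col_apply[OF RS lS E] scal_self[OF R c])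
  have cU: "?c l r \<in> carrier ?U" if "l < n" "r \<in> carrier R" for l r using Hom_closed[OF cH[OF that(1)], of r] that(2) by simp
  define f where "f = (\<lambda>r\<in>carrier ?S. \<lambda>l\<in>{..<n}. ?c l r)"
  have fF: "(\<lambda>l\<in>{..<n}. ?c l r) \<in> carrier ?F" if r: "r \<in> carrier R" for r
  proof -
    let ?y = "\<lambda>l\<in>{..<n}. ?c l r"
    have m: "msum ?U (\<lambda>k. scal ?S ?U (T l k) (?y k)) n = ?c l r" if l: "l < n" for l
    proof -
      have "msum ?U (\<lambda>k. scal ?S ?U (T l k) (?y k)) n = msum ?U (\<lambda>k. ?c k (?c l r k)) n"
      proof (rule msum_cong)
        fix k assume k: "k < n"
        have "scal ?S ?U (T l k) (?y k) = E k l \<odot>\<^bsub>?U\<^esub> ?c k r"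
          unfolding T_def scal_self[OF R c[OF k l]] restrict_apply using k by (simp only: lessThan_iff if_True)
        also have "\<dots> = ?c k (?c l r k)" using Hom_smult[OF cH[OF k], of "E k l" r] c[OF k l] r by (simp add: ca l k)
        finally show "scal ?S ?U (T l k) (?y k) = ?c k (?c l r k)" .
      qed
      also have "\<dots> = ?c l r" by (rule Fix_sum_col[OF RS lS E cU[OF l r]])
      finally show ?thesis .
    qed
    have "mact ?S ?U n T ?y = ?y"
      unfolding mact_def by (rule restrict_ext) (rule m, simp only: lessThan_iff)
    moreover have "(\<lambda>l\<in>{..<n}. ?c l r) \<in> carrier (pow_module ?U n)" by (rule powI) (rule cU[OF _ r])
    ultimately show ?thesis unfolding carrier_Fix[OF RS lU T] by (intro conjI)
  qed
  have f: "f \<in> Hom ?S ?S ?F" unfolding f_def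
  proof (rule Hom_restrictI[OF lS])
    fix r assume r: "r \<in> carrier ?S"
    show "(\<lambda>l\<in>{..<n}. ?c l r) \<in> carrier ?F" using fF r by simp
    show "(\<lambda>l\<in>{..<n}. ?c l (r \<oplus>\<^bsub>?S\<^esub> s)) = (\<lambda>l\<in>{..<n}. ?c l r) \<oplus>\<^bsub>?F\<^esub> (\<lambda>l\<in>{..<n}. ?c l s)" if "s \<in> carrier ?S" for s
      unfolding Fix_ops[OF RS lU T] by (rule restrict_ext) (use Hom_add[OF cH r that] in \<open>simp only: lessThan_iff restrict_apply if_True\<close>)
    show "(\<lambda>l\<in>{..<n}. ?c l (s \<odot>\<^bsub>?S\<^esub> r)) = s \<odot>\<^bsub>?F\<^esub> (\<lambda>l\<in>{..<n}. ?c l r)" if "s \<in> carrier ?S" for s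
      unfolding Fix_ops[OF RS lU T] by (rule restrict_ext) (use Hom_smult[OF cH that r] in \<open>simp only: lessThan_iff restrict_apply if_True\<close>)
  qed
  have "f \<in> Iso ?S ?S ?F"
  proof (rule IsoI[OF f])
    show "inj_on f (carrier ?S)" unfolding inj_on_iff_kernel[OF lS lF f]
    proof (intro ballI impI)
      fix r assume "r \<in> carrier ?S" and z: "f r = \<zero>\<^bsub>?F\<^esub>"
      then have r: "r \<in> carrier R" by simp
      have "E b b \<otimes> r = \<zero>" if b: "b < n" for b
      proof -
        have "?c b r = \<zero>\<^bsub>?U\<^esub>" using fun_cong[OF z, of b] r b unfolding Fix_ops[OF RS lU T] by (simp add: f_def del: Fix_ops[OF RS lS E])
        then have "?c b r b = \<zero>" using b by (simp add: Fix_ops[OF RS lS E])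
        then show ?thesis using ca[OF b b r] by simp
      qed
      then have "msum R (\<lambda>b. r \<otimes> E b b) n = \<zero>" by (intro msum_zero) (simp add: m_comm c r)
      then have "r \<otimes> ?\<tau> = \<zero>" using ring_msum_distrib[OF R, of n "\<lambda>b. E b b" r] c r by simp
      then have "r \<otimes> (?\<tau> \<otimes> ?\<tau>) = \<zero>" using t r by (simp add: m_assoc[symmetric])
      then show "r = \<zero>\<^bsub>?S\<^esub>" using r by (simp add: \<tau>)
    qed
    show "f ` carrier ?S = carrier ?F"
    proof (intro equalityI subsetI)
      fix y assume "y \<in> f ` carrier ?S"
      then obtain r where "r \<in> carrier ?S" "y = f r" by (rule imageE) blast
      then show "y \<in> carrier ?F" using Hom_closed[OF f] by simp
    next
      fix y assume y: "y \<in> carrier ?F"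
      have yU: "y l \<in> carrier ?U" if "l < n" for l using y that by (auto simp: carrier_Fix[OF RS lU T])
      have yR: "y l j \<in> carrier R" if "l < n" "j < n" for l j
        using yU[OF that(1)] that(2) by (auto simp: carrier_Fix[OF RS lS E])
      have y1: "msum R (\<lambda>k. E k l \<otimes> y k j) n = y l j" if l: "l < n" and j: "j < n" for l j
      proof -
        have sc: "scal ?S ?U (T l k) (y k) = E k l \<odot>\<^bsub>?U\<^esub> y k" if "k < n" for k
          unfolding T_def by (rule scal_self[OF R c[OF that l]])
        have scU: "E k l \<odot>\<^bsub>?U\<^esub> y k \<in> carrier ?U" if "k < n" for k by (rule U.smult_closed) (simp_all add: c that l yU)
        have "y l = msum ?U (\<lambda>k. E k l \<odot>\<^bsub>?U\<^esub> y k) n"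
          unfolding Fix_coordinate[OF RS lU T y l, symmetric] by (rule msum_cong) (rule sc)
        then have "(\<lambda>x\<in>carrier ?U. x j) (y l) = msum ?S (\<lambda>k. (\<lambda>x\<in>carrier ?U. x j) (E k l \<odot>\<^bsub>?U\<^esub> y k)) n"
          using Hom_msum[OF lU lS Fix_proj[OF RS lS E j], of n "\<lambda>k. E k l \<odot>\<^bsub>?U\<^esub> y k"] scU by simp
        also have "\<dots> = msum R (\<lambda>k. E k l \<otimes> y k j) n"
          unfolding msum_self by (rule msum_cong) (use scU j in \<open>simp add: Fix_ops[OF RS lS E]\<close>)
        finally show ?thesis using yU[OF l] by simp
      qed
      have y2: "msum R (\<lambda>a. E j a \<otimes> y k a) n = y k j" if k: "k < n" and j: "j < n" for k j
        unfolding Fix_coordinate[OF RS lS E yU[OF k] j, symmetric] msum_self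
        by (rule msum_cong) (simp add: scal_self[OF R c[OF j]])
      let ?tr = "msum R (\<lambda>k. y k k) n"
      have tr: "?tr \<in> carrier R" by (rule msum_closed) (rule yR)
      have s: "?\<tau> \<otimes> ?tr \<in> carrier R" using t tr by simp
      have "y l j = E j l \<otimes> (?\<tau> \<otimes> ?tr)" if l: "l < n" and j: "j < n" for l j
      proof -
        have "?\<tau> \<otimes> y l j = msum R (\<lambda>k. ?\<tau> \<otimes> (E k l \<otimes> y k j)) n"
          unfolding y1[OF l j, symmetric] by (rule ring_msum_distrib[OF R]) (simp_all add: c l yR j t)
        also have "\<dots> = msum R (\<lambda>k. E j l \<otimes> y k k) n"
        proof (rule msum_cong)
          fix k assume k: "k < n"
          have "?\<tau> \<otimes> (E k l \<otimes> y k j) = (?\<tau> \<otimes> E k l) \<otimes> msum R (\<lambda>a. E j a \<otimes> y k a) n"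
            unfolding y2[OF k j] using t c[OF k l] yR[OF k j] by (simp add: m_assoc)
          also have "\<dots> = msum R (\<lambda>a. (?\<tau> \<otimes> E k l) \<otimes> (E j a \<otimes> y k a)) n"
            by (rule ring_msum_distrib[OF R]) (simp_all add: c j k l yR t)
          also have "\<dots> = msum R (\<lambda>a. E j l \<otimes> (E k a \<otimes> y k a)) n"
          proof (rule msum_cong)
            fix a assume a: "a < n"
            have "(?\<tau> \<otimes> E k l) \<otimes> (E j a \<otimes> y k a) = (?\<tau> \<otimes> (E k l \<otimes> E j a)) \<otimes> y k a"
              using t c[OF k l] c[OF j a] yR[OF k a] by (simp add: m_assoc)
            also have "\<dots> = E j l \<otimes> (E k a \<otimes> y k a)"
              unfolding rank_one[OF k l j a] using c[OF j l] c[OF k a] yR[OF k a] by (simp add: m_assoc)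
            finally show "(?\<tau> \<otimes> E k l) \<otimes> (E j a \<otimes> y k a) = E j l \<otimes> (E k a \<otimes> y k a)" .
          qed
          also have "\<dots> = E j l \<otimes> msum R (\<lambda>a. E k a \<otimes> y k a) n"
            by (rule ring_msum_distrib[OF R, symmetric]) (simp_all add: c j k l yR)
          finally show "?\<tau> \<otimes> (E k l \<otimes> y k j) = E j l \<otimes> y k k" unfolding y2[OF k k] .
        qed
        also have "\<dots> = E j l \<otimes> ?tr" by (rule ring_msum_distrib[OF R, symmetric]) (simp_all add: c j l yR)
        finally have e: "?\<tau> \<otimes> y l j = E j l \<otimes> ?tr" .
        have "y l j = (?\<tau> \<otimes> ?\<tau>) \<otimes> y l j" unfolding \<tau> using yR[OF l j] by simp
        also have "\<dots> = ?\<tau> \<otimes> (E j l \<otimes> ?tr)" unfolding e[symmetric] using t yR[OF l j] by (simp add: m_assoc)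
        also have "\<dots> = E j l \<otimes> (?\<tau> \<otimes> ?tr)" using t tr c[OF j l] by (simp add: m_lcomm)
        finally show ?thesis .
      qed
      then have e: "y l j = ?c l (?\<tau> \<otimes> ?tr) j" if "l < n" "j < n" for l j using ca[OF that s] that by simp
      have "y = (\<lambda>l\<in>{..<n}. ?c l (?\<tau> \<otimes> ?tr))"
      proof (rule pow_eqI)
        show "y \<in> carrier (pow_module ?U n)" using y by (simp add: carrier_Fix[OF RS lU T])
        show "(\<lambda>l\<in>{..<n}. ?c l (?\<tau> \<otimes> ?tr)) \<in> carrier (pow_module ?U n)"
          using fF[OF s] by (simp add: carrier_Fix[OF RS lU T])
        fix l assume l: "l < n"
        have "y l = ?c l (?\<tau> \<otimes> ?tr)"
        proof (rule pow_eqI)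
          show "y l \<in> carrier (pow_module ?S n)" "?c l (?\<tau> \<otimes> ?tr) \<in> carrier (pow_module ?S n)"
            using yU[OF l] cU[OF l s] unfolding carrier_Fix[OF RS lS E] by auto
        qed (rule e[OF l])
        then show "y l = (\<lambda>l\<in>{..<n}. ?c l (?\<tau> \<otimes> ?tr)) l" using l by simp
      qed
      then have "y = f (?\<tau> \<otimes> ?tr)" using s by (simp add: f_def)
      then show "y \<in> f ` carrier ?S" using s by (intro image_eqI[of _ _ "?\<tau> \<otimes> ?tr"]) simp_all
    qed
  qed
  then have SF: "isomorphic ?S ?S ?F" by (auto simp: isomorphic_def simp del: Iso_self)
  obtain v t where vt: "left_module R (Fix ?S ?S n T)" "dual_basis R (Fix ?S ?S n T) n v t" "\<forall>l<n. \<forall>k<n. t l (v k) = T l k"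
    using R_proj_of_matrix[OF R T] by blast
  have "Fix ?S ?U n (\<lambda>l k. t l (v k)) = ?F" by (rule Fix_cong) (use vt(3) in blast)
  then have "isomorphic ?S ?F (tensor R ?S ?U (Fix ?S ?S n T))"
    using tensor_iso_Fix[OF RS lU vt(1,2)] unfolding isomorphic_def by auto
  then have "isomorphic ?S (tensor R ?S ?U (Fix ?S ?S n T)) ?S"
    by (rule isomorphic_sym[OF lS isomorphic_trans[OF lS SF]])
  then have "isomorphic R (tensor R ?S ?U (Fix ?S ?S n T)) ?S" by (simp add: isomorphic_def)
  then show ?thesis unfolding Pic_def using lU' vt(1) by blast
qed

text \<open>
  The endomorphism \<open>\<theta> a b\<close> of \<open>M \<otimes> U\<close> is the \<open>b\<close>-th coordinate followed by the \<open>a\<close>-th column. The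
  relation arises when two of them, in both orders, are applied to a column.
\<close>

lemma commuting_endomorphisms:
  fixes R :: "('r, 'k) ring_scheme" (structure)
  assumes RA: "assoc_algebra R A" and M: "left_module A M" and E: "idem_matrix R n E"
    and faithful: "\<And>r. r \<in> carrier R \<Longrightarrow> (\<And>x. x \<in> carrier M \<Longrightarrow> scal A M r x = \<zero>\<^bsub>M\<^esub>) \<Longrightarrow> r = \<zero>"
    and comm: "\<And>f g x. f \<in> Hom A (Fix A M n E) (Fix A M n E) \<Longrightarrow> g \<in> Hom A (Fix A M n E) (Fix A M n E) \<Longrightarrow>
      x \<in> carrier (Fix A M n E) \<Longrightarrow> f (g x) = g (f x)"
    and i: "k < n" "a < n" "b < n" "c < n" "d < n" "m < n"
  shows "E k a \<otimes> (E b c \<otimes> E d m) = E k c \<otimes> (E d a \<otimes> E b m)"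
proof -
  interpret R: cring R by (rule assoc_algebraD(1)[OF RA])
  interpret M: left_module A M by (rule M)
  let ?F = "Fix A M n E" and ?c = "col A M n E"
  have lF: "left_module A ?F" by (rule left_module_Fix[OF RA M E])
  have cl: "E l k \<in> carrier R" if "l < n" "k < n" for l k using E that by (simp add: idem_matrix_def)
  note sc = scal_closed[OF RA M]
  have cH: "?c l \<in> Hom A M ?F" if "l < n" for l by (rule col_Hom[OF RA M E that])
  have ca: "?c l x j = scal A M (E j l) x" if "l < n" "j < n" "x \<in> carrier M" for l x j
    using that by (simp add: col_apply[OF RA M E])
  have cc: "?c l x \<in> carrier ?F" if "l < n" "x \<in> carrier M" for l x by (rule Hom_closed[OF cH[OF that(1)] that(2)])
  define \<theta> where "\<theta> p q = compose (carrier ?F) (?c p) (\<lambda>x\<in>carrier ?F. x q)" for p q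
  have \<theta>: "\<theta> p q \<in> Hom A ?F ?F" if "p < n" "q < n" for p q
    unfolding \<theta>_def by (rule Hom_compose[OF lF Fix_proj[OF RA M E that(2)] cH[OF that(1)]])
  have \<theta>c: "\<theta> p q (?c l x) = ?c p (scal A M (E q l) x)" if "q < n" "l < n" "x \<in> carrier M" for p q l x
    using cc[OF that(2,3)] ca[OF that(2,1,3)] by (simp add: \<theta>_def)
  let ?r = "E k a \<otimes> (E b c \<otimes> E d m)" and ?s = "E k c \<otimes> (E d a \<otimes> E b m)"
  have r: "?r \<in> carrier R" and s: "?s \<in> carrier R" using cl i by simp_all
  have "scal A M (?r \<ominus> ?s) x = \<zero>\<^bsub>M\<^esub>" if x: "x \<in> carrier M" for x
  proof -
    have e: "\<theta> p q (\<theta> p' q' (?c m x)) k = scal A M (E k p \<otimes> (E q p' \<otimes> E q' m)) x"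
      if "p < n" "q < n" "p' < n" "q' < n" for p q p' q'
      using that i x sc cl by (simp add: \<theta>c ca scal_mult[OF RA M])
    have "scal A M ?r x = scal A M ?s x"
      using comm[OF \<theta>[OF i(2,3)] \<theta>[OF i(4,5)] cc[OF i(6) x]] e[OF i(2,3,4,5)] e[OF i(4,5,2,3)] by simp
    then show ?thesis using scal_minus_l[OF RA M r s x] sc[OF r x] sc[OF s x] M.M.minus_eq_zero_iff by simp
  qed
  then have "?r \<ominus> ?s = \<zero>" using faithful[of "?r \<ominus> ?s"] r s by simp
  then show ?thesis using R.minus_eq_zero_iff[OF r s] by simp
qed

lemma Fix_zero_matrix:
  assumes RA: "assoc_algebra R A" and M: "left_module A M" and E: "idem_matrix R n E"
    and z: "\<And>l k. l < n \<Longrightarrow> k < n \<Longrightarrow> E l k = \<zero>\<^bsub>R\<^esub>"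
  shows "carrier (Fix A M n E) = {\<zero>\<^bsub>Fix A M n E\<^esub>}"
proof -
  interpret M: left_module A M by (rule M)
  interpret F: left_module A "Fix A M n E" by (rule left_module_Fix[OF RA M E])
  have "x = \<zero>\<^bsub>Fix A M n E\<^esub>" if x: "x \<in> carrier (Fix A M n E)" for x
  proof -
    have xk: "x k \<in> carrier M" if "k < n" for k using x that by (auto simp: carrier_Fix[OF RA M E])
    have "x l = \<zero>\<^bsub>M\<^esub>" if l: "l < n" for l
      unfolding Fix_coordinate[OF RA M E x l, symmetric]
      by (rule M.M.msum_zero) (simp add: z l scal_zero_l[OF RA M] xk)
    then show ?thesis using x by (auto simp: Fix_ops[OF RA M E] carrier_Fix[OF RA M E] PiE_iff extensional_def fun_eq_iff)
  qed
  then show ?thesis using F.M.zero_closed by blast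
qed

lemma rank_one_Pic:
  assumes RA: "assoc_algebra R A" and M: "left_module A M" and E: "idem_matrix R n E"
    and conn: "connected_ring R"
    and faithful: "\<And>r. r \<in> carrier R \<Longrightarrow> (\<And>x. x \<in> carrier M \<Longrightarrow> scal A M r x = \<zero>\<^bsub>M\<^esub>) \<Longrightarrow> r = \<zero>\<^bsub>R\<^esub>"
    and comm: "\<And>f g x. f \<in> Hom A (Fix A M n E) (Fix A M n E) \<Longrightarrow> g \<in> Hom A (Fix A M n E) (Fix A M n E) \<Longrightarrow>
      x \<in> carrier (Fix A M n E) \<Longrightarrow> f (g x) = g (f x)"
    and nz: "carrier (Fix A M n E) \<noteq> {\<zero>\<^bsub>Fix A M n E\<^esub>}"
  shows "Fix (self_algebra R) (self_algebra R) n E \<in> Pic R"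
proof -
  interpret R: cring R by (rule assoc_algebraD(1)[OF RA])
  have rel: "\<forall>k<n. \<forall>a<n. \<forall>b<n. \<forall>c<n. \<forall>d<n. \<forall>m<n.
      E k a \<otimes>\<^bsub>R\<^esub> (E b c \<otimes>\<^bsub>R\<^esub> E d m) = E k c \<otimes>\<^bsub>R\<^esub> (E d a \<otimes>\<^bsub>R\<^esub> E b m)"
  proof (intro allI impI, rule commuting_endomorphisms[where R=R and A=A and M=M and n=n and E=E, OF RA M E])
    show "r = \<zero>\<^bsub>R\<^esub>" if "r \<in> carrier R" "\<And>x. x \<in> carrier M \<Longrightarrow> scal A M r x = \<zero>\<^bsub>M\<^esub>" for r
      by (rule faithful[OF that])
    show "f (g x) = g (f x)" if "f \<in> Hom A (Fix A M n E) (Fix A M n E)" "g \<in> Hom A (Fix A M n E) (Fix A M n E)"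
      "x \<in> carrier (Fix A M n E)" for f g x by (rule comm[OF that])
  qed
  note tr = rank_one_trace[OF R.is_cring E rel]
  let ?t = "msum R (\<lambda>b. E b b) n"
  have t: "?t \<in> carrier R" by (rule tr(1))
  have "(?t \<otimes>\<^bsub>R\<^esub> ?t) \<otimes>\<^bsub>R\<^esub> (?t \<otimes>\<^bsub>R\<^esub> ?t) = ?t \<otimes>\<^bsub>R\<^esub> ?t"
    using tr(4) t by (simp add: R.m_assoc[symmetric])
  then have "?t \<otimes>\<^bsub>R\<^esub> ?t = \<zero>\<^bsub>R\<^esub> \<or> ?t \<otimes>\<^bsub>R\<^esub> ?t = \<one>\<^bsub>R\<^esub>"
    using conn t unfolding connected_ring_def by simp
  moreover have "?t \<otimes>\<^bsub>R\<^esub> ?t \<noteq> \<zero>\<^bsub>R\<^esub>"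
  proof
    assume z: "?t \<otimes>\<^bsub>R\<^esub> ?t = \<zero>\<^bsub>R\<^esub>"
    have "E l k = \<zero>\<^bsub>R\<^esub>" if "l < n" "k < n" for l k
      using tr(3)[OF that] E that unfolding z by (simp add: idem_matrix_def)
    then show False using Fix_zero_matrix[OF RA M E] nz by blast
  qed
  ultimately show ?thesis by (intro Pic_of_matrix[OF R.is_cring E] tr(2)) auto
qed

section \<open>The correspondence of standard modules\<close>

lemma (in quasi_hereditary) std_nonzero:
  assumes "connected_ring R" "l \<in> \<Lambda>" shows "carrier (\<Delta> l) \<noteq> {\<zero>\<^bsub>\<Delta> l\<^esub>}"
proof
  interpret R: cring R by (rule cring_R)
  assume z: "carrier (\<Delta> l) = {\<zero>\<^bsub>\<Delta> l\<^esub>}"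
  have "scal A (\<Delta> l) \<one>\<^bsub>R\<^esub> x = \<zero>\<^bsub>\<Delta> l\<^esub>" if "x \<in> carrier (\<Delta> l)" for x
    using scal_one[OF RA std_module[OF assms(2)] that] that z by simp
  from scalar_faithful[OF assms(2) R.one_closed this] show False using assms(1) by (simp add: connected_ring_def)
qed

context filtered_equivalence begin

lemma std_in_\<C>: "l \<in> \<Lambda> \<Longrightarrow> \<Delta> l \<in> \<C>"
  using src.Filt_filt src.filt_standard src.std_module by blast

lemma zero_reflect:
  assumes M: "M \<in> \<C>" and z: "carrier (fobj \<Phi> M) = {\<zero>\<^bsub>fobj \<Phi> M\<^esub>}"
  shows "carrier M = {\<zero>\<^bsub>M\<^esub>}"
proof -
  interpret M: left_module A M by (rule \<C>_module[OF M])
  have zH: "(\<lambda>x\<in>carrier M. \<zero>\<^bsub>M\<^esub>) \<in> Hom A M M" by (rule Hom_restrictI[OF \<C>_module[OF M]]) auto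
  have iH: "(\<lambda>x\<in>carrier M. x) \<in> Hom A M M" by (rule Hom_id[OF \<C>_module[OF M]])
  have e: "(\<lambda>x\<in>carrier M. x) = (\<lambda>x\<in>carrier M. \<zero>\<^bsub>M\<^esub>)"
  proof (rule arr_eqI[OF M M iH zH])
    fix x assume x: "x \<in> carrier (fobj \<Phi> M)"
    show "farr \<Phi> M M (\<lambda>x\<in>carrier M. x) x = farr \<Phi> M M (\<lambda>x\<in>carrier M. \<zero>\<^bsub>M\<^esub>) x"
      using x z by (simp only: arr_id[OF M x] arr_zero[OF M M x]) simp
  qed
  have "x = \<zero>\<^bsub>M\<^esub>" if "x \<in> carrier M" for x using fun_cong[OF e, of x] that by simp
  then show ?thesis using M.M.zero_closed by blast
qed

lemma linked_image:
  assumes M: "M \<in> \<C>" and N: "N \<in> \<C>" and l: "linked A M N" shows "linked A' (fobj \<Phi> M) (fobj \<Phi> N)"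
proof (rule ccontr)
  assume nl: "\<not> linked A' (fobj \<Phi> M) (fobj \<Phi> N)"
  interpret N: left_module A N by (rule \<C>_module[OF N])
  obtain f x where f: "f \<in> Hom A M N" and x: "x \<in> carrier M" "f x \<noteq> \<zero>\<^bsub>N\<^esub>" using l unfolding linked_def by blast
  have zH: "(\<lambda>x\<in>carrier M. \<zero>\<^bsub>N\<^esub>) \<in> Hom A M N" by (rule Hom_restrictI[OF \<C>_module[OF M]]) auto
  have "f = (\<lambda>x\<in>carrier M. \<zero>\<^bsub>N\<^esub>)"
  proof (rule arr_eqI[OF M N f zH])
    fix y assume y: "y \<in> carrier (fobj \<Phi> M)"
    have "farr \<Phi> M N f y = \<zero>\<^bsub>fobj \<Phi> N\<^esub>" using nl arr[OF M N f] y unfolding linked_def by blast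
    then show "farr \<Phi> M N f y = farr \<Phi> M N (\<lambda>x\<in>carrier M. \<zero>\<^bsub>N\<^esub>) y" unfolding arr_zero[OF M N y] .
  qed
  then show False using x by simp
qed

lemma round_trip: "M \<in> \<C> \<Longrightarrow> isomorphic A (fobj \<Psi> (fobj \<Phi> M)) M"
  using quasi_inverse_unit[OF quasi_inv] by (auto simp: isomorphic_def)

text \<open>
  Let \<open>F\<close> be the top quotient of \<open>Z = \<Phi>(\<Delta>(l))\<close> and \<open>K\<close> its kernel. Then \<open>\<Psi> F\<close> is a nonzero filtered quotient
  of \<open>\<Psi> Z\<close>, which is \<open>\<Delta>(l)\<close>; so the quotient map is injective, \<open>\<Psi> K\<close> vanishes, and \<open>K\<close> vanishes as well.
\<close>

lemma standard_image:
  assumes conn: "connected_ring R" and l: "l \<in> \<Lambda>"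
  shows "\<exists>\<gamma>\<in>\<Gamma>. \<exists>n E. idem_matrix R n E \<and> isomorphic A' (fobj \<Phi> (\<Delta> l)) (Fix A' (\<Delta>' \<gamma>) n E)"
proof -
  interpret inv: filtered_equivalence R A' \<Gamma> \<Delta>' A \<Lambda> \<Delta> \<Psi> \<Phi> by (rule inverse)
  let ?Z = "fobj \<Phi> (\<Delta> l)"
  have lC: "\<Delta> l \<in> \<C>" by (rule std_in_\<C>[OF l])
  have Z: "?Z \<in> \<D>" by (rule obj[OF lC])
  have Z': "left_module A' ?Z" "tgt.filt ?Z" using Z tgt.Filt_filt by blast+
  have nz: "carrier ?Z \<noteq> {\<zero>\<^bsub>?Z\<^esub>}" using zero_reflect[OF lC] src.std_nonzero[OF conn l] by blast
  obtain \<gamma> n E g where \<gamma>: "\<gamma> \<in> \<Gamma>" and E: "idem_matrix R n E"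
    and g: "g \<in> Hom A' ?Z (Fix A' (\<Delta>' \<gamma>) n E)" "g ` carrier ?Z = carrier (Fix A' (\<Delta>' \<gamma>) n E)"
    and Fnz: "carrier (Fix A' (\<Delta>' \<gamma>) n E) \<noteq> {\<zero>\<^bsub>Fix A' (\<Delta>' \<gamma>) n E\<^esub>}"
    and K: "tgt.filt (?Z\<lparr>carrier := a_kernel ?Z (Fix A' (\<Delta>' \<gamma>) n E) g\<rparr>)"
    using tgt.top_quotient[OF Z'(2,1) nz] by blast
  let ?F = "Fix A' (\<Delta>' \<gamma>) n E"
  have lD: "left_module A' (\<Delta>' \<gamma>)" by (rule tgt.std_module[OF \<gamma>])
  have F: "left_module A' ?F" by (rule left_module_Fix[OF tgt.RA lD E])
  have Ff: "tgt.filt ?F" by (rule dfilt_Fix[where \<Delta>=\<Delta>' and l=\<gamma>, OF tgt.RA lD \<gamma> E])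
  obtain F0 :: "('b, 'n) module" and j where F0: "left_module A' F0" "tgt.filt F0" and j: "j \<in> Iso A' ?F F0"
    using tgt.filt_copy[OF F Ff] by blast
  have F0D: "F0 \<in> \<D>" using F0 tgt.Filt_filt by blast
  interpret F: left_module A' ?F by (rule F)
  interpret Z: left_module A' ?Z by (rule Z'(1))
  have j0: "j y = \<zero>\<^bsub>F0\<^esub> \<longleftrightarrow> y = \<zero>\<^bsub>?F\<^esub>" if y: "y \<in> carrier ?F" for y
    using inj_onD[OF IsoD(2)[OF j] _ y F.M.zero_closed] Hom_zero[OF F F0(1) IsoD(1)[OF j]] by metis
  define q where "q = compose (carrier ?Z) j g"
  have q: "q \<in> Hom A' ?Z F0" unfolding q_def by (rule Hom_compose[OF Z'(1) g(1) IsoD(1)[OF j]])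
  have qs: "q ` carrier ?Z = carrier F0"
  proof -
    have "q ` carrier ?Z = j ` (g ` carrier ?Z)" unfolding q_def image_image by (intro image_cong refl) simp
    then show ?thesis using g(2) IsoD(3)[OF j] by simp
  qed
  have qk: "q z = \<zero>\<^bsub>F0\<^esub> \<longleftrightarrow> g z = \<zero>\<^bsub>?F\<^esub>" if z: "z \<in> carrier ?Z" for z
    using j0[OF Hom_closed[OF g(1) z]] z by (simp add: q_def)
  let ?k = "a_kernel ?Z ?F g"
  let ?K = "?Z\<lparr>carrier := ?k\<rparr>" and ?i = "\<lambda>x\<in>?k. x"
  have sK: "submodule ?k A' ?Z" by (rule submodule_kernel[OF Z'(1) F g(1)])
  have KD: "?K \<in> \<D>" using left_module_submodule[OF Z'(1) sK] K tgt.Filt_filt by blast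
  have "short_exact A' ?K ?i ?Z q F0" unfolding short_exact_def
  proof (intro conjI)
    show "inj_on ?i (carrier ?K)" by (rule inj_onI) simp
    have "?i ` ?k = ?k" by (simp only: image_restrict_eq image_ident)
    also have "?k = a_kernel ?Z F0 q" using qk by (auto simp: set_eq_iff simp del: Fix_ops[OF tgt.RA lD E])
    finally show "?i ` carrier ?K = a_kernel ?Z F0 q" by simp
  qed (fact Hom_incl[OF Z'(1) sK] q qs)+
  then have ses: "short_exact A (fobj \<Psi> ?K) (farr \<Psi> ?K ?Z ?i) (fobj \<Psi> ?Z) (farr \<Psi> ?Z F0 q) (fobj \<Psi> F0)"
    using exact_inv KD Z F0D unfolding exact_functor_def by blast
  let ?p = "farr \<Psi> ?Z F0 q" and ?u = "farr \<Psi> ?K ?Z ?i"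
  have pH: "?p \<in> Hom A (fobj \<Psi> ?Z) (fobj \<Psi> F0)" and uH: "?u \<in> Hom A (fobj \<Psi> ?K) (fobj \<Psi> ?Z)"
    and ps: "?p ` carrier (fobj \<Psi> ?Z) = carrier (fobj \<Psi> F0)" and ui: "inj_on ?u (carrier (fobj \<Psi> ?K))"
    and uk: "?u ` carrier (fobj \<Psi> ?K) = a_kernel (fobj \<Psi> ?Z) (fobj \<Psi> F0) ?p"
    using ses unfolding short_exact_def by blast+
  have lPZ: "left_module A (fobj \<Psi> ?Z)" and lPK: "left_module A (fobj \<Psi> ?K)" and lPF: "left_module A (fobj \<Psi> F0)"
    by (rule \<C>_module[OF inv.obj[OF Z]], rule \<C>_module[OF inv.obj[OF KD]], rule \<C>_module[OF inv.obj[OF F0D]])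
  have Pf: "src.filt (fobj \<Psi> F0)" using inv.obj[OF F0D] src.Filt_filt by blast
  obtain x where "x \<in> carrier ?F" "x \<noteq> \<zero>\<^bsub>?F\<^esub>" using Fnz F.M.zero_closed by blast
  then have "j x \<in> carrier F0" "j x \<noteq> \<zero>\<^bsub>F0\<^esub>" using j0 Hom_closed[OF IsoD(1)[OF j]] by blast+
  then have F0nz: "carrier F0 \<noteq> {\<zero>\<^bsub>F0\<^esub>}" by blast
  have Pnz: "carrier (fobj \<Psi> F0) \<noteq> {\<zero>\<^bsub>fobj \<Psi> F0\<^esub>}" using inv.zero_reflect[OF F0D] F0nz by blast
  obtain e where e: "e \<in> Iso A (\<Delta> l) (fobj \<Psi> ?Z)"
    using isomorphic_sym[OF lPZ round_trip[OF lC]] by (auto simp: isomorphic_def)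
  let ?h = "compose (carrier (\<Delta> l)) ?p e"
  have lL: "left_module A (\<Delta> l)" by (rule src.std_module[OF l])
  have h: "?h \<in> Hom A (\<Delta> l) (fobj \<Psi> F0)" by (rule Hom_compose[OF lL IsoD(1)[OF e] pH])
  have hs: "?h ` carrier (\<Delta> l) = carrier (fobj \<Psi> F0)"
  proof -
    have "?h ` carrier (\<Delta> l) = ?p ` (e ` carrier (\<Delta> l))" unfolding image_image by (intro image_cong refl) simp
    then show ?thesis using ps IsoD(3)[OF e] by simp
  qed
  have hi: "inj_on ?h (carrier (\<Delta> l))" by (rule src.standard_quotient_injective[OF conn l Pf lPF Pnz h hs])
  interpret PK: left_module A "fobj \<Psi> ?K" by (rule lPK)
  have p0: "y = \<zero>\<^bsub>fobj \<Psi> ?Z\<^esub>" if y: "y \<in> carrier (fobj \<Psi> ?Z)" "?p y = \<zero>\<^bsub>fobj \<Psi> F0\<^esub>" for y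
  proof -
    obtain d where d: "d \<in> carrier (\<Delta> l)" "y = e d" using IsoD(3)[OF e] y(1) by (metis imageE)
    have "?h d = \<zero>\<^bsub>fobj \<Psi> F0\<^esub>" using d y(2) by simp
    then have "d = \<zero>\<^bsub>\<Delta> l\<^esub>" using hi d(1) unfolding inj_on_iff_kernel[OF lL lPF h] by blast
    then show ?thesis unfolding d(2) using Hom_zero[OF lL lPZ IsoD(1)[OF e]] by simp
  qed
  have "y = \<zero>\<^bsub>fobj \<Psi> ?K\<^esub>" if y: "y \<in> carrier (fobj \<Psi> ?K)" for y
  proof -
    have "?u y \<in> a_kernel (fobj \<Psi> ?Z) (fobj \<Psi> F0) ?p" unfolding uk[symmetric] using y by (rule imageI)
    then have "?u y = \<zero>\<^bsub>fobj \<Psi> ?Z\<^esub>" using p0 by simp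
    then show ?thesis using ui y unfolding inj_on_iff_kernel[OF lPK lPZ uH] by blast
  qed
  then have "carrier (fobj \<Psi> ?K) = {\<zero>\<^bsub>fobj \<Psi> ?K\<^esub>}" using PK.M.zero_closed by blast
  then have k0: "?k = {\<zero>\<^bsub>?Z\<^esub>}" using inv.zero_reflect[OF KD] by simp
  have "inj_on g (carrier ?Z)" unfolding inj_on_iff_kernel[OF Z'(1) F g(1)]
  proof (intro ballI impI)
    fix z assume "z \<in> carrier ?Z" "g z = \<zero>\<^bsub>?F\<^esub>"
    then have "z \<in> ?k" by (simp only: a_kernel_iff)
    then show "z = \<zero>\<^bsub>?Z\<^esub>" unfolding k0 by simp
  qed
  then have "g \<in> Iso A' ?Z ?F" by (intro IsoI g)
  then show ?thesis using \<gamma> E by (auto simp: isomorphic_def)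
qed

text \<open>
  There are nonzero maps in both directions between \<open>\<Phi>(\<Delta>(l))\<close> and \<open>\<Delta>'(\<gamma>)\<close>. Carried back by \<open>\<Psi>\<close>,
  they yield nonzero maps in both directions between \<open>\<Delta>(l)\<close> and \<open>\<Delta>(k)\<close>, and the order axiom applies.
\<close>

lemma standard_round_trip:
  assumes conn: "connected_ring R" and l: "l \<in> \<Lambda>" and \<gamma>: "\<gamma> \<in> \<Gamma>" and k: "k \<in> \<Lambda>"
    and E: "idem_matrix R n E" and i: "isomorphic A' (fobj \<Phi> (\<Delta> l)) (Fix A' (\<Delta>' \<gamma>) n E)"
    and E': "idem_matrix R n' E'" and i': "isomorphic A (fobj \<Psi> (\<Delta>' \<gamma>)) (Fix A (\<Delta> k) n' E')"
  shows "k = l"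
proof -
  interpret inv: filtered_equivalence R A' \<Gamma> \<Delta>' A \<Lambda> \<Delta> \<Psi> \<Phi> by (rule inverse)
  let ?Z = "fobj \<Phi> (\<Delta> l)" and ?F = "Fix A' (\<Delta>' \<gamma>) n E" and ?Y = "fobj \<Psi> (\<Delta>' \<gamma>)" and ?G = "Fix A (\<Delta> k) n' E'"
  have lC: "\<Delta> l \<in> \<C>" by (rule std_in_\<C>[OF l])
  have gD: "\<Delta>' \<gamma> \<in> \<D>" by (rule inv.std_in_\<C>[OF \<gamma>])
  have ZD: "?Z \<in> \<D>" by (rule obj[OF lC])
  have lL: "left_module A (\<Delta> l)" and lK: "left_module A (\<Delta> k)" and lg: "left_module A' (\<Delta>' \<gamma>)"
    by (rule src.std_module[OF l], rule src.std_module[OF k], rule tgt.std_module[OF \<gamma>])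
  have lZ: "left_module A' ?Z" by (rule \<D>_module[OF ZD])
  have lY: "left_module A ?Y" by (rule \<C>_module[OF inv.obj[OF gD]])
  have lPZ: "left_module A (fobj \<Psi> ?Z)" by (rule \<C>_module[OF inv.obj[OF ZD]])
  have lF: "left_module A' ?F" by (rule left_module_Fix[OF tgt.RA lg E])
  have lG: "left_module A ?G" by (rule left_module_Fix[OF src.RA lK E'])
  have "carrier ?Z \<noteq> {\<zero>\<^bsub>?Z\<^esub>}" using zero_reflect[OF lC] src.std_nonzero[OF conn l] by blast
  then have ZZ: "linked A' ?Z ?Z" by (rule linked_refl[OF lZ])
  have Zg: "linked A' ?Z (\<Delta>' \<gamma>)"
    by (rule linked_Fix_target[OF tgt.RA lg E lZ linked_iso_target[OF lZ lZ lF ZZ i]])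
  have gZ: "linked A' (\<Delta>' \<gamma>) ?Z"
    by (rule linked_Fix_source[OF tgt.RA lg E lZ linked_iso_source[OF lF isomorphic_sym[OF lZ i] ZZ]])
  note r = round_trip[OF lC]
  have "linked A (\<Delta> l) ?Y"
    by (rule linked_iso_source[OF lL isomorphic_sym[OF lPZ r] inv.linked_image[OF ZD gD Zg]])
  then have "linked A (\<Delta> l) (\<Delta> k)"
    by (intro linked_Fix_target[OF src.RA lK E' lL] linked_iso_target[OF lL lY lG _ i'])
  then have 1: "l \<le> k" by (rule src.linked_order[OF l k])
  have "linked A ?Y (\<Delta> l)"
    by (rule linked_iso_target[OF lY lPZ lL inv.linked_image[OF gD ZD gZ] r])
  then have "linked A (\<Delta> k) (\<Delta> l)"
    by (intro linked_Fix_source[OF src.RA lK E' lL] linked_iso_source[OF lG isomorphic_sym[OF lY i']])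
  then have "k \<le> l" by (rule src.linked_order[OF k l])
  then show ?thesis using 1 by simp
qed

lemma standard_End_commute:
  assumes l: "l \<in> \<Lambda>" and f: "f \<in> Hom A' (fobj \<Phi> (\<Delta> l)) (fobj \<Phi> (\<Delta> l))"
    and g: "g \<in> Hom A' (fobj \<Phi> (\<Delta> l)) (fobj \<Phi> (\<Delta> l))" and x: "x \<in> carrier (fobj \<Phi> (\<Delta> l))"
  shows "f (g x) = g (f x)"
proof -
  interpret R: cring R by (rule src.cring_R)
  note lC = std_in_\<C>[OF l] and lL = src.std_module[OF l]
  obtain f0 where f0: "f0 \<in> Hom A (\<Delta> l) (\<Delta> l)" "farr \<Phi> (\<Delta> l) (\<Delta> l) f0 = f" using full[OF lC lC f] by blast
  obtain g0 where g0: "g0 \<in> Hom A (\<Delta> l) (\<Delta> l)" "farr \<Phi> (\<Delta> l) (\<Delta> l) g0 = g" using full[OF lC lC g] by blast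
  obtain r where r: "r \<in> carrier R" "\<And>y. y \<in> carrier (\<Delta> l) \<Longrightarrow> f0 y = scal A (\<Delta> l) r y"
    using src.End_scalar[OF l f0(1)] by blast
  have "f0 (g0 y) = g0 (f0 y)" if y: "y \<in> carrier (\<Delta> l)" for y
    using r(2)[OF y] r(2)[OF Hom_closed[OF g0(1) y]] scal_Hom[OF src.RA lL lL g0(1) r(1) y] by simp
  then have "compose (carrier (\<Delta> l)) f0 g0 = compose (carrier (\<Delta> l)) g0 f0" by (auto simp: compose_def fun_eq_iff)
  then show ?thesis
    using arr_comp[OF lC lC lC g0(1) f0(1) x] arr_comp[OF lC lC lC f0(1) g0(1) x] f0(2) g0(2) by simp
qed

text \<open>
  The endomorphism ring of \<open>\<Delta>'(\<gamma>) \<otimes> U\<close>, being that of \<open>\<Delta>(l)\<close>, is commutative; this is what forces \<open>U\<close>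
  to be invertible.
\<close>

lemma standard_image_Pic:
  assumes conn: "connected_ring R" and l: "l \<in> \<Lambda>" and \<gamma>: "\<gamma> \<in> \<Gamma>" and E: "idem_matrix R n E"
    and i: "isomorphic A' (fobj \<Phi> (\<Delta> l)) (Fix A' (\<Delta>' \<gamma>) n E)"
  shows "\<exists>U\<in>Pic R. isomorphic A' (fobj \<Phi> (\<Delta> l)) (tensor R A' (\<Delta>' \<gamma>) U)"
proof -
  let ?Z = "fobj \<Phi> (\<Delta> l)" and ?F = "Fix A' (\<Delta>' \<gamma>) n E" and ?U = "Fix (self_algebra R) (self_algebra R) n E"
  have lC: "\<Delta> l \<in> \<C>" by (rule std_in_\<C>[OF l])
  have lg: "left_module A' (\<Delta>' \<gamma>)" by (rule tgt.std_module[OF \<gamma>])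
  have lZ: "left_module A' ?Z" by (rule \<D>_module[OF obj[OF lC]])
  have lF: "left_module A' ?F" by (rule left_module_Fix[OF tgt.RA lg E])
  interpret Z: left_module A' ?Z by (rule lZ)
  interpret F: left_module A' ?F by (rule lF)
  obtain e where e: "e \<in> Iso A' ?Z ?F" using i by (auto simp: isomorphic_def)
  obtain d where d: "d \<in> Iso A' ?F ?Z" "\<forall>x\<in>carrier ?Z. d (e x) = x" "\<forall>y\<in>carrier ?F. e (d y) = y"
    using Iso_inverse_ex[OF lZ e] by blast
  have dF: "d y \<in> carrier ?Z" if "y \<in> carrier ?F" for y by (rule Hom_closed[OF IsoD(1)[OF d(1)] that])
  have comm: "f (g x) = g (f x)" if f: "f \<in> Hom A' ?F ?F" and g: "g \<in> Hom A' ?F ?F" and x: "x \<in> carrier ?F" for f g x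
  proof -
    let ?t = "\<lambda>f. compose (carrier ?Z) d (compose (carrier ?Z) f e)"
    have tH: "?t f \<in> Hom A' ?Z ?Z" if "f \<in> Hom A' ?F ?F" for f
      by (rule Hom_compose[OF lZ Hom_compose[OF lZ IsoD(1)[OF e] that] IsoD(1)[OF d(1)]])
    have t: "?t f (d y) = d (f y)" if "y \<in> carrier ?F" for f y
      using dF[OF that] bspec[OF d(3) that] by simp
    have "d (f (g x)) = d (g (f x))"
      using standard_End_commute[OF l tH[OF f] tH[OF g] dF[OF x]]
      unfolding t[OF x] t[OF Hom_closed[OF f x]] t[OF Hom_closed[OF g x]] .
    then show ?thesis
      by (rule inj_onD[OF IsoD(2)[OF d(1)] _ Hom_closed[OF f Hom_closed[OF g x]] Hom_closed[OF g Hom_closed[OF f x]]])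
  qed
  have nz: "carrier ?F \<noteq> {\<zero>\<^bsub>?F\<^esub>}"
  proof
    assume z: "carrier ?F = {\<zero>\<^bsub>?F\<^esub>}"
    have "carrier ?Z = d ` carrier ?F" using IsoD(3)[OF d(1)] by simp
    also have "\<dots> = {\<zero>\<^bsub>?Z\<^esub>}" unfolding z using Hom_zero[OF lF lZ IsoD(1)[OF d(1)]] by simp
    finally show False using zero_reflect[OF lC] src.std_nonzero[OF conn l] by blast
  qed
  have U: "?U \<in> Pic R"
  proof (rule rank_one_Pic[where A=A' and M="\<Delta>' \<gamma>", OF tgt.RA lg E conn _ _ nz])
    show "r = \<zero>\<^bsub>R\<^esub>" if "r \<in> carrier R" "\<And>x. x \<in> carrier (\<Delta>' \<gamma>) \<Longrightarrow> scal A' (\<Delta>' \<gamma>) r x = \<zero>\<^bsub>\<Delta>' \<gamma>\<^esub>" for r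
      by (rule tgt.scalar_faithful[OF \<gamma> that])
    show "f (g x) = g (f x)" if "f \<in> Hom A' ?F ?F" "g \<in> Hom A' ?F ?F" "x \<in> carrier ?F" for f g x by (rule comm[OF that])
  qed
  have "isomorphic A' ?F (tensor R A' (\<Delta>' \<gamma>) ?U)"
  proof -
    obtain U where "U \<in> R_proj R" "isomorphic A' ?F (tensor R A' (\<Delta>' \<gamma>) U)" "U = ?U" "left_module A' (tensor R A' (\<Delta>' \<gamma>) U)"
      by (rule tensor_of_matrix[OF tgt.RA lg E])
    then show ?thesis by blast
  qed
  then show ?thesis using U isomorphic_trans[OF lZ i] by blast
qed

lemma standard_bijection:
  assumes conn: "connected_ring R"
  shows "\<exists>\<phi> U. bij_betw \<phi> \<Lambda> \<Gamma> \<and>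
    (\<forall>l\<in>\<Lambda>. U l \<in> Pic R \<and> isomorphic A' (fobj \<Phi> (\<Delta> l)) (tensor R A' (\<Delta>' (\<phi> l)) (U l)))"
proof -
  interpret inv: filtered_equivalence R A' \<Gamma> \<Delta>' A \<Lambda> \<Delta> \<Psi> \<Phi> by (rule inverse)
  have "\<forall>l. \<exists>\<gamma> n E. l \<in> \<Lambda> \<longrightarrow> \<gamma> \<in> \<Gamma> \<and> idem_matrix R n E \<and> isomorphic A' (fobj \<Phi> (\<Delta> l)) (Fix A' (\<Delta>' \<gamma>) n E)"
    using standard_image[OF conn] by blast
  then obtain \<phi> n E where \<phi>: "\<And>l. l \<in> \<Lambda> \<Longrightarrow> \<phi> l \<in> \<Gamma>" "\<And>l. l \<in> \<Lambda> \<Longrightarrow> idem_matrix R (n l) (E l)"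
    "\<And>l. l \<in> \<Lambda> \<Longrightarrow> isomorphic A' (fobj \<Phi> (\<Delta> l)) (Fix A' (\<Delta>' (\<phi> l)) (n l) (E l))" by metis
  have "\<forall>\<gamma>. \<exists>l n E. \<gamma> \<in> \<Gamma> \<longrightarrow> l \<in> \<Lambda> \<and> idem_matrix R n E \<and> isomorphic A (fobj \<Psi> (\<Delta>' \<gamma>)) (Fix A (\<Delta> l) n E)"
    using inv.standard_image[OF conn] by blast
  then obtain \<psi> n' E' where \<psi>: "\<And>g. g \<in> \<Gamma> \<Longrightarrow> \<psi> g \<in> \<Lambda>" "\<And>g. g \<in> \<Gamma> \<Longrightarrow> idem_matrix R (n' g) (E' g)"
    "\<And>g. g \<in> \<Gamma> \<Longrightarrow> isomorphic A (fobj \<Psi> (\<Delta>' g)) (Fix A (\<Delta> (\<psi> g)) (n' g) (E' g))" by metis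
  have b: "bij_betw \<phi> \<Lambda> \<Gamma>"
  proof (rule bij_betw_byWitness[where f'=\<psi>])
    show "\<forall>l\<in>\<Lambda>. \<psi> (\<phi> l) = l"
    proof
      fix l assume l: "l \<in> \<Lambda>"
      show "\<psi> (\<phi> l) = l" by (rule standard_round_trip[OF conn l \<phi>(1)[OF l] \<psi>(1)[OF \<phi>(1)[OF l]] \<phi>(2,3)[OF l] \<psi>(2,3)[OF \<phi>(1)[OF l]]])
    qed
    show "\<forall>g\<in>\<Gamma>. \<phi> (\<psi> g) = g"
    proof
      fix g assume g: "g \<in> \<Gamma>"
      show "\<phi> (\<psi> g) = g" by (rule inv.standard_round_trip[OF conn g \<psi>(1)[OF g] \<phi>(1)[OF \<psi>(1)[OF g]] \<psi>(2,3)[OF g] \<phi>(2,3)[OF \<psi>(1)[OF g]]])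
    qed
  qed (use \<phi>(1) \<psi>(1) in auto)
  have "\<forall>l. \<exists>U. l \<in> \<Lambda> \<longrightarrow> U \<in> Pic R \<and> isomorphic A' (fobj \<Phi> (\<Delta> l)) (tensor R A' (\<Delta>' (\<phi> l)) U)"
    using standard_image_Pic[OF conn _ \<phi>] by blast
  then obtain U where "\<forall>l. l \<in> \<Lambda> \<longrightarrow> U l \<in> Pic R \<and> isomorphic A' (fobj \<Phi> (\<Delta> l)) (tensor R A' (\<Delta>' (\<phi> l)) (U l))" by metis
  then show ?thesis using b by blast
qed

end

theorem mainTheorem1:
  fixes R :: "'r ring"
    and A :: "('r, 'a) module" and A' :: "('r, 'b) module"
    and \<Lambda> :: "('l::order) set" and \<Gamma> :: "('g::order) set"
    and \<Delta> :: "'l \<Rightarrow> ('a, 'm) module" and \<Delta>' :: "'g \<Rightarrow> ('b, 'n) module"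
    and \<Phi> :: "('a, 'm, 'b, 'n) mod_functor"
  assumes "module_universe TYPE('a) TYPE('m)" and "module_universe TYPE('b) TYPE('n)"
    and "cring R" and "noetherian_ring R"
    and "split_quasi_hereditary R A \<Lambda> \<Delta>"
    and "split_quasi_hereditary R A' \<Gamma> \<Delta>'"
    and "exact_equivalence A (Filt A (Delta_tilde R A \<Lambda> \<Delta>))
           A' (Filt A' (Delta_tilde R A' \<Gamma> \<Delta>')) \<Phi>"
  shows "\<exists>F. category_equivalence A (fg_modules A) A' (fg_modules A') F \<and>
           naturally_isomorphic A (Filt A (Delta_tilde R A \<Lambda> \<Delta>)) A' (functor_comp F incl) (functor_comp incl \<Phi>) \<and>
           (connected_ring R \<longrightarrow> highest_weight_equivalence R A \<Lambda> \<Delta> A' \<Gamma> \<Delta>' F)"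
proof -
  obtain \<Psi> where "quasi_inverse A (Filt A (Delta_tilde R A \<Lambda> \<Delta>)) A' (Filt A' (Delta_tilde R A' \<Gamma> \<Delta>')) \<Phi> \<Psi>"
    "exact_functor A (Filt A (Delta_tilde R A \<Lambda> \<Delta>)) A' \<Phi>" "exact_functor A' (Filt A' (Delta_tilde R A' \<Gamma> \<Delta>')) A \<Psi>"
    using assms(7) unfolding exact_equivalence_def by blast
  then interpret filtered_equivalence R A \<Lambda> \<Delta> A' \<Gamma> \<Delta>' \<Phi> \<Psi>
    by (intro filtered_equivalence.intro filtered_equivalence_axioms.intro quasi_hereditary.intro assms)
  obtain F where F: "category_equivalence A (fg_modules A :: ('a, 'm) module set) A' (fg_modules A') F"
    and nat: "naturally_isomorphic A \<C> A' (functor_comp F incl) (functor_comp incl \<Phi>)"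
    using extension by blast
  have "highest_weight_equivalence R A \<Lambda> \<Delta> A' \<Gamma> \<Delta>' F" if conn: "connected_ring R"
  proof -
    obtain \<phi> U where b: "bij_betw \<phi> \<Lambda> \<Gamma>" and U: "\<And>l. l \<in> \<Lambda> \<Longrightarrow> U l \<in> Pic R"
      "\<And>l. l \<in> \<Lambda> \<Longrightarrow> isomorphic A' (fobj \<Phi> (\<Delta> l)) (tensor R A' (\<Delta>' (\<phi> l)) (U l))"
      using standard_bijection[OF conn] by blast
    have Ff: "is_functor A (fg_modules A :: ('a, 'm) module set) A' (fg_modules A') F"
      using F unfolding category_equivalence_def quasi_inverse_def by blast
    obtain \<eta> where \<eta>: "\<forall>M\<in>\<C>. \<eta> M \<in> Iso A' (fobj F M) (fobj \<Phi> M)"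
      using nat unfolding naturally_isomorphic_def functor_comp_def incl_def by auto
    have "isomorphic A' (fobj F (\<Delta> l)) (tensor R A' (\<Delta>' (\<phi> l)) (U l))" if l: "l \<in> \<Lambda>" for l
    proof (rule isomorphic_trans[OF _ _ U(2)[OF l]])
      show "left_module A' (fobj F (\<Delta> l))" by (rule fg_modulesD(1)[OF is_functorD(1)[OF Ff src.std_fg[OF l]]])
      show "isomorphic A' (fobj F (\<Delta> l)) (fobj \<Phi> (\<Delta> l))" using \<eta> std_in_\<C>[OF l] by (auto simp: isomorphic_def)
    qed
    then show ?thesis unfolding highest_weight_equivalence_def using F b U(1) by blast
  qed
  then show ?thesis using F nat by blast
qed

end
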